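(* Let $(A,B)$ be a pair of real random variables and let $\alpha>0$. Suppose that (1) $A\ge 0$ a.s. and the conditional law of $\log A$ given $A>0$ is non-arithmetic; (2) $\mathbb{E}A^{\alpha}=1$ and $\rho:=\mathbb{E}[A^{\alpha}\log A]<\infty$; (3) the function $L(x):=x^{\alpha}\mathbb{P}(B>x)$ is slowly varying, $\mathbb{E}B_+^{\alpha}=\infty$, and $\mathbb{E}B_-^{\alpha-\varepsilon}<\infty$ for all $\varepsilon\in(0,\alpha)$. Suppose further that there exists $\beta>0$ such that $$\limsup_{h\to0^+}\sup_{a\in\mathbb{R}}h^{-\beta}\,\mathbb{P}(a<\log A\le a+h)<\infty$$ and $\mathbb{E}A^{\gamma}<\infty$ for some $\gamma>\alpha+\alpha^2/\beta$. Let $Z$ be a random variable with law $\mathbb{P}(Z\in\cdot)=\mathbb{E}[A^{\alpha}\mathbf{1}_{\{\log A\in\cdot\}}]$ and assume that the law of $Z$ is strongly non-lattice. Let $R$ be the (unique in law) solution of $R\stackrel{d}{=}AR+B$ with $R$ and $(A,B)$ independent. Then, as $x\to\infty$, $$x^{\alpha}\,\mathbb{P}(R>x)=\frac{\widetilde L(x)}{\rho}+\frac{\mathbb{E}\big[(AR+B)_+^{\alpha}-(AR)_+^{\alpha}-B_+^{\alpha}\big]}{\alpha\rho}+O(L(x))+o(1),$$ where $\widetilde L(x)=\int_0^x\frac{L(t)}{t}\,dt$.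
   Context: $a_+=\max\{a,0\}$, $a_-=\max\{-a,0\}$. A measurable $L:(0,\infty)\to(0,\infty)$ is slowly varying if $L(\lambda x)/L(x)\to1$ as $x\to\infty$ for every $\lambda>0$. A law on $\mathbb{R}$ is arithmetic if it is supported in $d\mathbb{Z}$ for some $d>0$, and non-arithmetic otherwise. The law of $Z$ is strongly non-lattice if its characteristic function $f_Z$ satisfies $\limsup_{|t|\to\infty}|f_Z(t)|<1$. Conventions: $\log0=-\infty$, $0^\alpha\log0=0$. In the expectation in the claim, $R$ is independent of $(A,B)$. The assumptions guarantee that the solution $R$ exists and is unique in law. *)

theory Defs
  imports "HOL-Probability.Probability" "HOL-Library.Landau_Symbols"
begin

definition slowly_varying :: "(real \<Rightarrow> real) \<Rightarrow> bool" where
  "slowly_varying L \<longleftrightarrow>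
     L \<in> borel_measurable (restrict_space borel {0<..}) \<and>
     (\<forall>x>0. L x > 0) \<and>
     (\<forall>c>0. ((\<lambda>x. L (c * x) / L x) \<longlongrightarrow> 1) at_top)"

definition arithmetic_law :: "real measure \<Rightarrow> bool" where
  "arithmetic_law \<mu> \<longleftrightarrow> (\<exists>d>0. AE x in \<mu>. \<exists>k::int. x = d * of_int k)"

definition strongly_non_lattice :: "real measure \<Rightarrow> bool" where
  "strongly_non_lattice \<mu> \<longleftrightarrow> Limsup at_infinity (\<lambda>t::real. ereal (cmod (char \<mu> t))) < 1"

text \<open>The conditional law of \<open>log A\<close> given \<open>A > 0\<close>: the normalised restriction of the
  probability to the event \<open>A > 0\<close> is \<^const>\<open>uniform_measure\<close>.\<close>

definition cond_log_law :: "'a measure \<Rightarrow> ('a \<Rightarrow> real) \<Rightarrow> real measure" where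
  "cond_log_law M A =
     distr (uniform_measure M {\<omega> \<in> space M. A \<omega> > 0}) borel (\<lambda>\<omega>. ln (A \<omega>))"

text \<open>A solution of \<open>R = A R + B\<close> in law with \<open>R\<close> independent of the pair \<open>(A, B)\<close>.
  Independence is that of the generated sigma-algebras, because \<open>indep_var\<close> needs both variables
  to have the same value type. All three variables live on the same probability space \<open>M\<close>; \<open>A\<close> and \<open>B\<close> may be dependent.\<close>

definition perpetuity_solution ::
    "'a measure \<Rightarrow> ('a \<Rightarrow> real) \<Rightarrow> ('a \<Rightarrow> real) \<Rightarrow> ('a \<Rightarrow> real) \<Rightarrow> bool" where
  "perpetuity_solution M A B R \<longleftrightarrow>
     R \<in> borel_measurable M \<and>
     prob_space.indep_set M
       (sets (vimage_algebra (space M) R borel))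
       (sets (vimage_algebra (space M) (\<lambda>\<omega>. (A \<omega>, B \<omega>)) (borel \<Otimes>\<^sub>M borel))) \<and>
     distr M borel R = distr M borel (\<lambda>\<omega>. A \<omega> * R \<omega> + B \<omega>)"

end

theory Submission
  imports Defs "HOL-Complex_Analysis.Complex_Analysis" "HOL-Real_Asymp.Real_Asymp"
begin

text \<open>
  In the scale \<open>x = exp z\<close> put \<open>r(z) = exp (\<alpha> z) P(R > exp z)\<close>. Tilting by \<open>exp (\<alpha> z)\<close> turns
  \<open>R = A R + B\<close> into the renewal equation \<open>r = \<mu> * r + \<psi>\<close>, where \<open>\<mu>\<close> is the law of \<open>Z\<close> and
  \<open>\<psi>(z) = exp (\<alpha> z) (P(A R + B > exp z) - P(A R > exp z))\<close>, so that \<open>r = H * \<psi>\<close> for the renewal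
  measure \<open>H\<close> of \<open>\<mu>\<close>. Split \<open>\<psi>\<close> into \<open>L(exp z)\<close> and the increment
  \<open>exp (\<alpha> z) E[1{A R + B > exp z} - 1{A R > exp z} - 1{B > exp z}]\<close>.

  Since \<open>\<mu>\<close> is strongly non-lattice with exponential moments on both sides, the discounted mass
  \<open>exp (\<alpha> s) \<integral> exp (- \<alpha> y) 1{y > s} dH(y)\<close> approaches its Lebesgue counterpart at an exponential
  rate: for the smoothed version, the convolution of \<open>H\<close> with a ramp, this follows by Fourier
  inversion and a shift of the contour across the pole at \<open>0\<close>, and monotonicity undoes the
  smoothing. Conditioning on \<open>B\<close>, the convolution of \<open>H\<close> with \<open>L(exp z)\<close> is
  \<open>E[min(B\<^sub>+, x)\<^sup>\<alpha>] / (\<alpha> \<rho>)\<close>, that is \<open>\<integral>\<^sub>0\<^sup>x L(t)/t dt / \<rho>\<close>, up to a multiple of the expectation of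
  \<open>B\<^sub>+\<^sup>\<alpha> exp (- r \<bar>ln x - ln B\<bar>)\<close>, which is \<open>O(L(x)) + o(1)\<close> by a Potter bound.

  Outside a window \<open>[-K, K)\<close> the increment is bounded by \<open>exp (- \<epsilon> \<bar>z\<bar>)\<close> plus \<open>exp (\<alpha> z)\<close> times the
  probability that \<open>z\<close> lies in an exponentially thin band around \<open>ln B\<close>; its renewal convolution is
  \<open>O(exp (- c K) + L(x)) + o(1)\<close>. On the window, \<open>H\<close> is exponentially close to Lebesgue measure over \<open>\<rho>\<close>,
  and letting \<open>K\<close> grow gives the constant term, because the integral of the increment over the
  line is \<open>E[(A R + B)\<^sub>+\<^sup>\<alpha> - (A R)\<^sub>+\<^sup>\<alpha> - B\<^sub>+\<^sup>\<alpha>] / \<alpha>\<close>.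
\<close>

section \<open>Fourier inversion of ramps\<close>

text \<open>The transform \<open>1 / (1 - mgf s)\<close> of the renewal measure is bounded on
  vertical lines near the axis but does not decay there, since |\<open>mgf\<close>| stays bounded.
  Inversion therefore needs a kernel with integrable transform; the ramp contributes
  \<open>1 / (\<alpha> + s)^2\<close>, and its exponentially weighted differences give back the
  discounted mass. The pole at 0 is cancelled rather than crossed: the transform
  \<open>- 1 / (\<rho> * s)\<close> of Lebesgue measure over \<rho> on the half-line has the same
  singular part, so the difference extends to a strip, and the line Re s = -r or Re s = r is taken
  according to the sign of x.

  The second obstacle is that the law of B may have atoms, so the part of the increment living near
  ln B is not small pointwise. It becomes small after convolution only: a band of width of order
  B^(-\<delta>) has renewal mass of order at most B^(-\<delta>) + exp (-r |x - ln B|). The first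
  term lowers the moment of B below order \<alpha>, where it is finite; the second is the same
  discrepancy as in the main term and produces O(L(x)) + o(1).\<close>

lemma Fubini_product_bound:
  fixes f :: "'a \<Rightarrow> 'b \<Rightarrow> 'c::{banach, second_countable_topology}"
  assumes "sigma_finite_measure M1" "sigma_finite_measure M2"
    and f: "(\<lambda>(x, y). f x y) \<in> borel_measurable (M1 \<Otimes>\<^sub>M M2)"
    and g: "integrable M1 g" and h: "integrable M2 h"
    and bound: "\<And>x y. norm (f x y) \<le> g x * (h y :: real)"
  shows "integrable (M1 \<Otimes>\<^sub>M M2) (\<lambda>(x, y). f x y)"
    and "(\<integral>y. (\<integral>x. f x y \<partial>M1) \<partial>M2) = (\<integral>x. (\<integral>y. f x y \<partial>M2) \<partial>M1)"
proof -
  interpret pair_sigma_finite M1 M2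
    using assms by (simp add: pair_sigma_finite_def)
  have gh: "integrable (M1 \<Otimes>\<^sub>M M2) (\<lambda>(x, y). g x * h y)"
  proof (rule Fubini_integrable)
    show "(\<lambda>(x, y). g x * h y) \<in> borel_measurable (M1 \<Otimes>\<^sub>M M2)"
      using g h by measurable
    show "integrable M1 (\<lambda>x. \<integral>y. norm (case (x, y) of (x, y) \<Rightarrow> g x * h y) \<partial>M2)"
      using integrable_norm[OF g] by (simp add: abs_mult)
    show "AE x in M1. integrable M2 (\<lambda>y. case (x, y) of (x, y) \<Rightarrow> g x * h y)"
      using h by simp
  qed
  show I: "integrable (M1 \<Otimes>\<^sub>M M2) (\<lambda>(x, y). f x y)"
    by (rule Bochner_Integration.integrable_bound[OF gh f])
       (auto intro!: order_trans[OF bound])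
  show "(\<integral>y. (\<integral>x. f x y \<partial>M1) \<partial>M2) = (\<integral>x. (\<integral>y. f x y \<partial>M2) \<partial>M1)"
    using Fubini_integral[OF I] .
qed

lemma integrable_inverse_quadratic:
  assumes "b > (0::real)"
  shows "integrable lborel (\<lambda>t::real. 1 / (b\<^sup>2 + t\<^sup>2))"
proof -
  have "integrable lborel (\<lambda>t::real. inverse (1 + t\<^sup>2))"
    using integrable_inverse_1_plus_square
    by (simp add: set_integrable_def interval_lebesgue_integrable_def)
  then have "integrable lborel (\<lambda>t::real. inverse (1 + (0 + (1/b) * t)\<^sup>2))"
    using assms by (intro lborel_integrable_real_affine) auto
  then have "integrable lborel (\<lambda>t::real. (1 / b\<^sup>2) * inverse (1 + (0 + (1/b) * t)\<^sup>2))"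
    by (rule integrable_mult_right)
  moreover have "(1 / b\<^sup>2) * inverse (1 + (0 + (1/b) * t)\<^sup>2) = 1 / (b\<^sup>2 + t\<^sup>2)" for t
    using assms by (simp add: field_simps power2_eq_square add_nonneg_eq_0_iff)
  ultimately show ?thesis by simp
qed

text \<open>Up to the factor b^2 this is the density of the Gamma law with shape 2 and rate b. Being
  continuous at 0, it has a transform that decays quadratically and hence is integrable.\<close>

definition ramp :: "real \<Rightarrow> real \<Rightarrow> real" where
  "ramp b w = max w 0 * exp (- (b * w))"

lemma ramp_nonneg: "ramp b w \<ge> 0"
  by (simp add: ramp_def)

lemma ramp_measurable [measurable]: "ramp b \<in> borel_measurable borel"
  unfolding ramp_def[abs_def] by measurable

lemma continuous_ramp: "continuous_on UNIV (ramp b)"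
  unfolding ramp_def[abs_def] by (intro continuous_intros)

lemma ramp_le:
  assumes "b > 0" shows "ramp b w \<le> 1 / b"
proof (cases "w > 0")
  case True
  have "b * w \<le> exp (b * w)"
    using exp_ge_add_one_self[of "b * w"] by linarith
  then have "b * w * exp (- (b * w)) \<le> 1"
    by (simp add: exp_minus field_simps)
  then show ?thesis
    using True assms by (simp add: ramp_def field_simps)
qed (use assms in \<open>auto simp: ramp_def\<close>)

lemma integrable_ramp:
  assumes "b > 0" shows "integrable lborel (ramp b)"
proof -
  interpret prob_space "density lborel (erlang_density 1 b)"
    by (rule prob_space_erlang_density[OF assms])
  have "(\<integral>\<^sup>+x. ennreal (erlang_density 1 b x) \<partial>lborel) = 1"
    using emeasure_space_1 by (simp add: emeasure_density)
  then have "integrable lborel (erlang_density 1 b)"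
    using assms by (intro integrableI_nonneg) auto
  then have "integrable lborel (\<lambda>x. erlang_density 1 b x * (1 / b\<^sup>2))"
    by (rule integrable_mult_left)
  moreover have "erlang_density 1 b x * (1 / b\<^sup>2) = ramp b x" for x
    using assms by (auto simp: erlang_density_def ramp_def power2_eq_square max_def)
  ultimately show ?thesis by simp
qed

text \<open>With s = b + i t the integrand is w exp (-s w) on the half-line, and its primitive
  \<open>F\<close> vanishes at infinity; only the boundary value -1/s^2 at 0 contributes.\<close>

lemma ramp_fourier:
  assumes "b > 0"
  shows "(\<integral>w. iexp (- (t * w)) * ramp b w \<partial>lborel) = 1 / (b + \<i> * t)\<^sup>2"
proof -
  define s where "s = complex_of_real b + \<i> * t"
  have s0: "s \<noteq> 0" using assms by (auto simp: s_def complex_eq_iff)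
  define F where "F w = - (w / s + 1 / s\<^sup>2) * exp (- (s * w))" for w :: complex
  define f where "f w = w * exp (- (s * w))" for w :: complex
  have DF: "(F has_field_derivative f w) (at w)" for w
    unfolding F_def f_def
    by (rule derivative_eq_intros refl | use s0 in \<open>simp add: field_simps power2_eq_square\<close>)+
  have int: "integrable lborel (\<lambda>w. iexp (- (t * w)) * complex_of_real (ramp b w))"
    using integrable_ramp[OF assms]
    by (rule Bochner_Integration.integrable_bound) (auto simp: norm_mult ramp_nonneg)
  have eq: "indicator (einterval 0 \<infinity>) w *\<^sub>R f (complex_of_real w) = iexp (- (t * w)) * ramp b w" for w
    by (auto simp: f_def s_def ramp_def einterval_def indicator_def algebra_simps max_def
        exp_add[symmetric] exp_of_real[symmetric] simp flip: exp_add)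
  have "(LBINT w=0..\<infinity>. f (complex_of_real w)) = 0 - (- (1 / s\<^sup>2))"
  proof (rule interval_integral_FTC_integrable)
    show "((\<lambda>w. F (complex_of_real w)) has_vector_derivative f (complex_of_real x)) (at x)" for x
      using DF[of x] by (rule has_vector_derivative_real_field)
    show "isCont (\<lambda>w. f (complex_of_real w)) x" for x
      unfolding f_def by (intro continuous_intros)
    show "set_integrable lborel (einterval 0 \<infinity>) (\<lambda>w. f (complex_of_real w))"
      unfolding set_integrable_def eq by (rule int)
    have "isCont (\<lambda>w::real. F (complex_of_real w)) 0"
      using has_vector_derivative_real_field[OF DF] by (rule has_vector_derivative_continuous)
    then have "((\<lambda>w::real. F (complex_of_real w)) \<longlongrightarrow> F (complex_of_real 0)) (at_right 0)"
      by (simp add: isCont_def filterlim_at_split)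
    then show "(((\<lambda>w. F (complex_of_real w)) \<circ> real_of_ereal) \<longlongrightarrow> - (1 / s\<^sup>2)) (at_right 0)"
      by (simp add: F_def zero_ereal_def ereal_tendsto_simps1(2))
    have "((\<lambda>w::real. (w / norm s + 1 / norm s ^ 2) * exp (- (b * w))) \<longlongrightarrow> 0) at_top"
      using assms s0 by real_asymp
    then have "((\<lambda>w::real. F (complex_of_real w)) \<longlongrightarrow> 0) at_top"
    proof (rule Lim_null_comparison[rotated])
      show "\<forall>\<^sub>F x in at_top. norm (F (complex_of_real x)) \<le> (x / norm s + 1 / norm s ^ 2) * exp (- (b * x))"
        using eventually_ge_at_top[of 0]
      proof eventually_elim
        case (elim x)
        have "norm (F (complex_of_real x)) = norm (x / s + 1 / s\<^sup>2) * exp (- (b * x))"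
          by (simp add: F_def norm_mult s_def norm_minus_commute del: minus_add_distrib)
        also have "norm (x / s + 1 / s\<^sup>2) \<le> x / norm s + 1 / norm s ^ 2"
          using elim by (intro order_trans[OF norm_triangle_ineq]) (simp add: norm_divide norm_power)
        finally show ?case by (simp add: mult_right_mono)
      qed
    qed
    then show "(((\<lambda>w. F (complex_of_real w)) \<circ> real_of_ereal) \<longlongrightarrow> 0) (at_left \<infinity>)"
      by (simp add: ereal_tendsto_simps1)
  qed auto
  then have "(\<integral>w. indicator (einterval 0 \<infinity>) w *\<^sub>R f (complex_of_real w) \<partial>lborel) = 1 / s\<^sup>2"
    by (simp add: interval_lebesgue_integral_def set_lebesgue_integral_def)
  then show ?thesis
    unfolding eq s_def .
qed

section \<open>Fourier inversion of the ramp by Gaussian regularisation\<close>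

definition gauss :: "real \<Rightarrow> real \<Rightarrow> real" where
  "gauss \<sigma> t = exp (- ((\<sigma> * t)\<^sup>2) / 2)"

lemma gauss_measurable [measurable]: "gauss \<sigma> \<in> borel_measurable borel"
  unfolding gauss_def[abs_def] by measurable

lemma gauss_bounds: "0 \<le> gauss \<sigma> t" "gauss \<sigma> t \<le> 1"
  by (auto simp: gauss_def)

text \<open>The characteristic function of the standard normal law is again Gaussian; rescaling the
  variable by \<sigma> turns that identity into this one.\<close>

lemma gaussian_fourier:
  assumes "\<sigma> > 0"
  shows "(\<integral>t. iexp (t * d) * gauss \<sigma> t \<partial>lborel) = 2 * pi / \<sigma> * std_normal_density (d / \<sigma>)"
proof -
  have "char std_normal_distribution (d / \<sigma>) = (\<integral>x. std_normal_density x *\<^sub>R iexp (d / \<sigma> * x) \<partial>lborel)"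
    unfolding char_def by (subst integral_density) (auto simp: normal_density_nonneg)
  also have "\<dots> = \<sigma> *\<^sub>R (\<integral>t. std_normal_density (0 + \<sigma> * t) *\<^sub>R iexp (d / \<sigma> * (0 + \<sigma> * t)) \<partial>lborel)"
    using assms by (subst lborel_integral_real_affine[where c=\<sigma> and t=0]) auto
  also have "(\<lambda>t. std_normal_density (0 + \<sigma> * t) *\<^sub>R iexp (d / \<sigma> * (0 + \<sigma> * t)))
      = (\<lambda>t. (1 / sqrt (2 * pi)) * (iexp (t * d) * gauss \<sigma> t))"
    using assms by (auto simp: gauss_def std_normal_density_def scaleR_conv_of_real mult_ac fun_eq_iff)
  finally have "exp (- (d / \<sigma>)\<^sup>2 / 2) = \<sigma> / sqrt (2 * pi) * (\<integral>t. iexp (t * d) * gauss \<sigma> t \<partial>lborel)"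
    by (simp add: char_std_normal_distribution scaleR_conv_of_real)
  then have "(\<integral>t. iexp (t * d) * gauss \<sigma> t \<partial>lborel) = complex_of_real (sqrt (2 * pi) / \<sigma> * exp (- (d / \<sigma>)\<^sup>2 / 2))"
    using assms by (simp add: field_simps)
  also have "sqrt (2 * pi) / \<sigma> * exp (- (d / \<sigma>)\<^sup>2 / 2) = 2 * pi / \<sigma> * std_normal_density (d / \<sigma>)"
    using assms by (simp add: std_normal_density_def field_simps flip: real_sqrt_mult)
  finally show ?thesis by simp
qed

lemma integrable_gaussian:
  assumes "\<sigma> > 0"
  shows "integrable lborel (\<lambda>t::real. gauss \<sigma> t)"
proof -
  have "integrable lborel (\<lambda>t::real. sqrt (2 * pi) * std_normal_density (0 + \<sigma> * t))"
    using assms by (intro integrable_mult_right lborel_integrable_real_affine) auto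
  then show ?thesis by (simp add: std_normal_density_def gauss_def)
qed

text \<open>Writing the transform as an integral over v and exchanging the order needs joint
  integrability in t and v, which only the Gaussian cutoff in t provides. Its price is that the ramp
  is recovered averaged against a normal law of standard deviation \<sigma>.\<close>

lemma smoothed_ramp_inversion:
  assumes b: "b > 0" and \<sigma>: "\<sigma> > 0"
  shows "(\<integral>t. iexp (t * w) / (b + \<i> * t)\<^sup>2 * gauss \<sigma> t \<partial>lborel)
    = 2 * pi * (\<integral>u. std_normal_density u * ramp b (w + \<sigma> * u) \<partial>lborel)"
proof -
  have "(\<integral>t. iexp (t * w) / (b + \<i> * t)\<^sup>2 * gauss \<sigma> t \<partial>lborel)
      = (\<integral>t. (\<integral>v. iexp (t * (w - v)) * gauss \<sigma> t * ramp b v \<partial>lborel) \<partial>lborel)"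
  proof (rule Bochner_Integration.integral_cong[OF refl])
    fix t
    have *: "iexp (t * (w - v)) * gauss \<sigma> t * ramp b v =
      (iexp (t * w) * gauss \<sigma> t) * (iexp (- (t * v)) * ramp b v)" for v
      by (simp add: algebra_simps flip: exp_add)
    show "iexp (t * w) / (b + \<i> * t)\<^sup>2 * gauss \<sigma> t =
        (\<integral>v. iexp (t * (w - v)) * gauss \<sigma> t * ramp b v \<partial>lborel)"
      unfolding * integral_mult_right_zero ramp_fourier[OF b] by simp
  qed
  also have "\<dots> = (\<integral>v. (\<integral>t. iexp (t * (w - v)) * gauss \<sigma> t * ramp b v \<partial>lborel) \<partial>lborel)"
    by (rule Fubini_product_bound(2)[where g="ramp b" and h="\<lambda>t. gauss \<sigma> t"])
       (auto simp: norm_mult ramp_nonneg gauss_bounds sigma_finite_lborel integrable_ramp b integrable_gaussian \<sigma>)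
  also have "\<dots> = (\<integral>v. complex_of_real (2 * pi / \<sigma> * (std_normal_density ((w - v) / \<sigma>) * ramp b v)) \<partial>lborel)"
    unfolding integral_mult_left_zero gaussian_fourier[OF \<sigma>] by (simp add: mult_ac)
  also have "\<dots> = complex_of_real (2 * pi / \<sigma> * (\<integral>v. std_normal_density ((w - v) / \<sigma>) * ramp b v \<partial>lborel))"
    by (simp only: integral_complex_of_real integral_mult_right_zero)
  also have "(\<integral>v. std_normal_density ((w - v) / \<sigma>) * ramp b v \<partial>lborel)
    = \<bar>\<sigma>\<bar> *\<^sub>R (\<integral>u. std_normal_density ((w - (w + \<sigma> * u)) / \<sigma>) * ramp b (w + \<sigma> * u) \<partial>lborel)"
    using \<sigma> by (intro lborel_integral_real_affine) auto
  also have "(\<lambda>u. std_normal_density ((w - (w + \<sigma> * u)) / \<sigma>) * ramp b (w + \<sigma> * u))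
    = (\<lambda>u. std_normal_density u * ramp b (w + \<sigma> * u))"
    using \<sigma> by (simp add: std_normal_density_def)
  finally show ?thesis using \<sigma> by (simp del: of_real_mult of_real_divide)
qed

lemma norm_ramp_transform:
  assumes "b > 0"
  shows "norm (1 / (complex_of_real b + \<i> * of_real t)\<^sup>2) = 1 / (b\<^sup>2 + t\<^sup>2)"
  by (simp add: norm_divide norm_power cmod_power2)

text \<open>Let \<sigma> tend to 0 in the smoothed identity. The frequency side is dominated by 1 /
  (b^2 + t^2); on the other side the ramp is bounded by 1 / b and continuous at w.\<close>

lemma ramp_inversion:
  assumes b: "b > 0"
  shows "(\<integral>t. iexp (t * w) / (b + \<i> * t)\<^sup>2 \<partial>lborel) = 2 * pi * ramp b w"
proof -
  define \<sigma> where "\<sigma> j = 1 / real (Suc j)" for j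
  have \<sigma>: "\<sigma> j > 0" for j by (simp add: \<sigma>_def)
  have \<sigma>0: "\<sigma> \<longlonglongrightarrow> 0" unfolding \<sigma>_def by real_asymp
  have bt: "b + \<i> * complex_of_real t \<noteq> 0" for t using b by (auto simp: complex_eq_iff)
  have L: "(\<lambda>j. \<integral>t. iexp (t * w) / (b + \<i> * t)\<^sup>2 * gauss (\<sigma> j) t \<partial>lborel)
    \<longlonglongrightarrow> (\<integral>t. iexp (t * w) / (b + \<i> * t)\<^sup>2 \<partial>lborel)"
  proof (rule integral_dominated_convergence[OF _ _ integrable_inverse_quadratic[OF b]])
    show "AE t in lborel. (\<lambda>j. iexp (t * w) / (b + \<i> * t)\<^sup>2 * gauss (\<sigma> j) t) \<longlonglongrightarrow> iexp (t * w) / (b + \<i> * t)\<^sup>2"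
    proof (rule AE_I2)
      fix t
      have "(\<lambda>j. gauss (\<sigma> j) t) \<longlonglongrightarrow> gauss 0 t"
        unfolding gauss_def by (intro tendsto_intros \<sigma>0) auto
      then have "(\<lambda>j. complex_of_real (gauss (\<sigma> j) t)) \<longlonglongrightarrow> complex_of_real 1"
        by (intro tendsto_of_real) (simp add: gauss_def)
      from tendsto_mult_left[OF this, of "iexp (t * w) / (b + \<i> * t)\<^sup>2"]
      show "(\<lambda>j. iexp (t * w) / (b + \<i> * t)\<^sup>2 * gauss (\<sigma> j) t) \<longlonglongrightarrow> iexp (t * w) / (b + \<i> * t)\<^sup>2"
        by simp
    qed
    show "AE t in lborel. norm (iexp (t * w) / (b + \<i> * t)\<^sup>2 * gauss (\<sigma> j) t) \<le> 1 / (b\<^sup>2 + t\<^sup>2)" for j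
    proof (rule AE_I2)
      fix t
      have "norm (iexp (t * w) / (b + \<i> * t)\<^sup>2 * gauss (\<sigma> j) t)
        = norm (1 / (b + \<i> * t)\<^sup>2) * gauss (\<sigma> j) t"
        by (simp add: norm_mult norm_divide gauss_bounds)
      also have "\<dots> = 1 / (b\<^sup>2 + t\<^sup>2) * gauss (\<sigma> j) t"
        using norm_ramp_transform[OF b] by simp
      also have "\<dots> \<le> 1 / (b\<^sup>2 + t\<^sup>2)"
        by (intro mult_left_le gauss_bounds) auto
      finally show "norm (iexp (t * w) / (b + \<i> * t)\<^sup>2 * gauss (\<sigma> j) t) \<le> 1 / (b\<^sup>2 + t\<^sup>2)" .
    qed
  qed auto
  have R: "(\<lambda>j. \<integral>u. std_normal_density u * ramp b (w + \<sigma> j * u) \<partial>lborel)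
    \<longlonglongrightarrow> (\<integral>u. std_normal_density u * ramp b w \<partial>lborel)"
  proof (rule integral_dominated_convergence[where w="\<lambda>u. std_normal_density u * (1 / b)"])
    show "integrable lborel (\<lambda>u. std_normal_density u * (1 / b))"
      by (intro integrable_mult_left) auto
    show "AE u in lborel. (\<lambda>j. std_normal_density u * ramp b (w + \<sigma> j * u)) \<longlonglongrightarrow> std_normal_density u * ramp b w"
    proof (rule AE_I2)
      fix u
      have "(\<lambda>j. w + \<sigma> j * u) \<longlonglongrightarrow> w + 0 * u"
        by (intro tendsto_intros \<sigma>0)
      then have "(\<lambda>j. ramp b (w + \<sigma> j * u)) \<longlonglongrightarrow> ramp b (w + 0 * u)"
        using continuous_ramp by (intro isCont_tendsto_compose[of _ "ramp b"]) (auto simp: continuous_on_eq_continuous_at)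
      then show "(\<lambda>j. std_normal_density u * ramp b (w + \<sigma> j * u)) \<longlonglongrightarrow> std_normal_density u * ramp b w"
        by (intro tendsto_intros) auto
    qed
    show "AE u in lborel. norm (std_normal_density u * ramp b (w + \<sigma> j * u)) \<le> std_normal_density u * (1 / b)" for j
      using ramp_le[OF b] by (auto simp: abs_mult ramp_nonneg simp del: times_divide_eq_right intro!: mult_left_mono)
  qed auto
  have "(\<lambda>j. complex_of_real (2 * pi * (\<integral>u. std_normal_density u * ramp b (w + \<sigma> j * u) \<partial>lborel)))
    \<longlonglongrightarrow> (\<integral>t. iexp (t * w) / (b + \<i> * t)\<^sup>2 \<partial>lborel)"
    using L unfolding smoothed_ramp_inversion[OF b \<sigma>] by simp
  moreover have "(\<lambda>j. complex_of_real (2 * pi * (\<integral>u. std_normal_density u * ramp b (w + \<sigma> j * u) \<partial>lborel)))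
    \<longlonglongrightarrow> complex_of_real (2 * pi * (\<integral>u. std_normal_density u * ramp b w \<partial>lborel))"
    by (intro tendsto_intros R)
  moreover have "(\<integral>u. std_normal_density u * ramp b w \<partial>lborel) = ramp b w"
    by simp
  ultimately show ?thesis
    by (metis (no_types, lifting) LIMSEQ_unique)
qed

text \<open>The strip is convex, so f has a primitive F there and the truncated integrals over both
  lines are differences of values of F. What remains are two horizontal segments at height n and -n,
  which the decay of f bounds by O(1 / n^2).\<close>

lemma integral_vertical_shift:
  fixes f :: "complex \<Rightarrow> complex"
  assumes r: "0 < r" "r < r'"
    and holo: "f holomorphic_on {s. \<bar>Re s\<bar> < r'}"
    and b: "b > 0"
    and bound: "\<And>s. \<bar>Re s\<bar> \<le> r \<Longrightarrow> norm (f s) \<le> C / (b\<^sup>2 + (Im s)\<^sup>2)"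
  shows "(\<integral>t. f (Complex (-r) t) \<partial>lborel) = (\<integral>t. f (Complex r t) \<partial>lborel)"
proof -
  define S where "S = {s. \<bar>Re s\<bar> < r'}"
  have S: "convex S" "open S"
  proof -
    have *: "S = {s. Re s < r'} \<inter> {s. Re s > - r'}" by (auto simp: S_def)
    show "convex S" unfolding * by (intro convex_Int convex_halfspace_Re_lt convex_halfspace_Re_gt)
    show "open S" unfolding * by (intro open_Int open_halfspace_Re_lt open_halfspace_Re_gt)
  qed
  obtain F where F: "\<And>x. x \<in> S \<Longrightarrow> (F has_field_derivative f x) (at x within S)"
    using holomorphic_convex_primitive'[OF S] holo unfolding S_def by blast
  have cont: "continuous_on {s. \<bar>Re s\<bar> < r'} f"
    by (rule holomorphic_on_imp_continuous_on[OF holo])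
  have Cpos: "C \<ge> 0"
  proof -
    have "0 \<le> norm (f 0)" by simp
    also have "\<dots> \<le> C / (b\<^sup>2 + (Im 0)\<^sup>2)" using r by (intro bound) auto
    finally show ?thesis using b by (simp add: zero_le_divide_iff)
  qed
  have meas: "(\<lambda>t. f (Complex c t)) \<in> borel_measurable borel" if "\<bar>c\<bar> \<le> r" for c
    using that r
    by (intro borel_measurable_continuous_onI continuous_on_compose2[OF cont] continuous_intros)
       (auto simp: Complex_eq intro!: continuous_intros)
  have int: "integrable lborel (\<lambda>t. f (Complex c t))" if "\<bar>c\<bar> \<le> r" for c
  proof (rule Bochner_Integration.integrable_bound)
    show "integrable lborel (\<lambda>t. C * (1 / (b\<^sup>2 + t\<^sup>2)))"
      by (intro integrable_mult_right integrable_inverse_quadratic b)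
    show "AE t in lborel. norm (f (Complex c t)) \<le> norm (C * (1 / (b\<^sup>2 + t\<^sup>2)))"
    proof (rule AE_I2)
      fix t show "norm (f (Complex c t)) \<le> norm (C * (1 / (b\<^sup>2 + t\<^sup>2)))"
        using bound[of "Complex c t"] that Cpos by simp
    qed
  qed (use meas[OF that] in simp)
  define I where "I c n = (\<integral>t. indicator {- real n..real n} t *\<^sub>R (\<i> * f (Complex c t)) \<partial>lborel)" for c n
  have FTC: "I c n = F (Complex c n) - F (Complex c (- real n))" if "\<bar>c\<bar> \<le> r" for c n
    unfolding I_def
  proof (rule integral_FTC_atLeastAtMost)
    fix t :: real
    have "(F has_field_derivative f (Complex c t)) (at (Complex c t))"
      using F[of "Complex c t"] at_within_open[of "Complex c t" S] S(2) that r unfolding S_def by auto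
    then have D: "(F has_field_derivative f (Complex c t)) (at (Complex c t) within Complex c ` {- real n..real n})"
      by (rule has_field_derivative_at_within)
    have "((\<lambda>t. of_real c + \<i> * of_real t) has_vector_derivative \<i>) (at t within {- real n..real n})"
      by (auto intro!: derivative_eq_intros simp: has_vector_derivative_def scaleR_conv_of_real)
    then have "(Complex c has_vector_derivative \<i>) (at t within {- real n..real n})"
      by (simp add: Complex_eq[abs_def])
    from field_vector_diff_chain_within[OF this D]
    show "((\<lambda>t. F (Complex c t)) has_vector_derivative (\<i> * f (Complex c t))) (at t within {- real n..real n})"
      by (simp add: o_def)
  next
    show "continuous_on {- real n..real n} (\<lambda>t. \<i> * f (Complex c t))"
      using that r
      by (intro continuous_intros continuous_on_compose2[OF cont])
         (auto simp: Complex_eq intro!: continuous_intros)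
  qed auto
  have lim: "(\<lambda>n. I c n) \<longlonglongrightarrow> (\<integral>t. \<i> * f (Complex c t) \<partial>lborel)" if "\<bar>c\<bar> \<le> r" for c
    unfolding I_def
  proof (rule integral_dominated_convergence[where w="\<lambda>t. norm (f (Complex c t))"])
    show "AE t in lborel. (\<lambda>n. indicator {- real n..real n} t *\<^sub>R (\<i> * f (Complex c t))) \<longlonglongrightarrow> \<i> * f (Complex c t)"
    proof (rule AE_I2, rule tendsto_eventually)
      fix t :: real
      obtain N where "\<bar>t\<bar> \<le> real N" using real_arch_simple by blast
      then show "\<forall>\<^sub>F n in sequentially. indicator {- real n..real n} t *\<^sub>R (\<i> * f (Complex c t)) = \<i> * f (Complex c t)"
        by (intro eventually_sequentiallyI[of N])
           (auto simp: indicator_def dest!: of_nat_mono[where 'a=real])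
    qed
  qed (use int[OF that] meas[OF that] in \<open>auto simp: norm_mult split: split_indicator\<close>)
  have seg: "norm (F (Complex r y) - F (Complex (-r) y)) \<le> 2 * r * C / (b\<^sup>2 + y\<^sup>2)" for y
  proof -
    have "norm (F (Complex r y) - F (Complex (-r) y)) \<le> C / (b\<^sup>2 + y\<^sup>2) * norm (Complex r y - Complex (-r) y)"
    proof (rule field_differentiable_bound)
      let ?T = "{s. Im s = y} \<inter> {s. Re s \<le> r} \<inter> {s. Re s \<ge> - r}"
      show "convex ?T" by (intro convex_Int convex_halfspace_Re_le convex_halfspace_Re_ge) (auto simp: convex_def algebra_simps simp flip: distrib_right)
      show "(F has_field_derivative f z) (at z within ?T)" if "z \<in> ?T" for z
        using that r by (intro has_field_derivative_subset[OF F]) (auto simp: S_def)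
      show "norm (f z) \<le> C / (b\<^sup>2 + y\<^sup>2)" if "z \<in> ?T" for z
        using bound[of z] that by auto
    qed (use r in auto)
    also have "Complex r y - Complex (-r) y = of_real (2 * r)" by (simp add: complex_eq_iff)
    finally show ?thesis using r by (simp add: norm_of_real mult_ac)
  qed
  have "(\<lambda>n. I r n - I (-r) n) \<longlonglongrightarrow> 0"
  proof (rule Lim_null_comparison)
    show "(\<lambda>n. 4 * r * C / (b\<^sup>2 + (real n)\<^sup>2)) \<longlonglongrightarrow> 0" using b by real_asymp
    show "\<forall>\<^sub>F n in sequentially. norm (I r n - I (-r) n) \<le> 4 * r * C / (b\<^sup>2 + (real n)\<^sup>2)"
    proof (rule always_eventually, rule allI)
      fix n
      have "norm (I r n - I (-r) n) = norm ((F (Complex r n) - F (Complex (-r) n)) - (F (Complex r (-n)) - F (Complex (-r) (-n))))"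
        using r by (simp add: FTC algebra_simps)
      also have "\<dots> \<le> 2 * r * C / (b\<^sup>2 + (real n)\<^sup>2) + 2 * r * C / (b\<^sup>2 + (- real n)\<^sup>2)"
        by (intro order_trans[OF norm_triangle_ineq4] add_mono seg)
      finally show "norm (I r n - I (-r) n) \<le> 4 * r * C / (b\<^sup>2 + (real n)\<^sup>2)" by (simp add: mult_ac)
    qed
  qed
  moreover have "(\<lambda>n. I r n - I (-r) n) \<longlonglongrightarrow> (\<integral>t. \<i> * f (Complex r t) \<partial>lborel) - (\<integral>t. \<i> * f (Complex (-r) t) \<partial>lborel)"
    using r by (intro tendsto_diff lim) auto
  ultimately have "(\<integral>t. \<i> * f (Complex r t) \<partial>lborel) - (\<integral>t. \<i> * f (Complex (-r) t) \<partial>lborel) = 0"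
    using LIMSEQ_unique by blast
  then show ?thesis by simp
qed

text \<open>On the line Re s = c the inversion yields the ramp of rate \<alpha> + c, and the factor
  exp (c w) tilts it back to rate \<alpha>. The value is thus the same on every line right of
  -\<alpha>, so the line can be chosen where the measure has an exponential moment.\<close>

lemma ramp_inversion_shifted:
  assumes "\<alpha> + c > 0"
  shows "(\<integral>t. exp (Complex c t * of_real w) / (\<alpha> + Complex c t)\<^sup>2 \<partial>lborel) = 2 * pi * ramp \<alpha> w"
proof -
  have "(\<integral>t. exp (Complex c t * of_real w) / (\<alpha> + Complex c t)\<^sup>2 \<partial>lborel)
    = (\<integral>t. exp (c * w) * (iexp (t * w) / (of_real (\<alpha> + c) + \<i> * t)\<^sup>2) \<partial>lborel)"
    by (rule Bochner_Integration.integral_cong)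
       (auto simp: Complex_eq algebra_simps exp_add exp_of_real[symmetric])
  also have "\<dots> = exp (c * w) * (2 * pi * ramp (\<alpha> + c) w)"
    unfolding integral_mult_right_zero ramp_inversion[OF assms] by simp
  also have "exp (c * w) * (2 * pi * ramp (\<alpha> + c) w) = 2 * pi * ramp \<alpha> w"
    by (simp add: ramp_def algebra_simps flip: exp_add)
  finally show ?thesis by (simp flip: of_real_mult)
qed

lemma norm_exp_Complex: "norm (exp (Complex c t * of_real w)) = exp (c * w)"
  by simp

text \<open>Integrate the shifted inversion formula in y. Fubini applies because the modulus of the
  integrand is the product of exp (c (y - x)) and an integrable function of t. It is used twice on
  the same line, for the renewal measure and for its Lebesgue limit, so that the two can be
  subtracted under one integral.\<close>

lemma ramp_convolution_inversion:
  fixes \<nu> :: "real measure"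
  assumes "sigma_finite_measure \<nu>" and [measurable_cong]: "sets \<nu> = sets borel"
    and c: "\<alpha> + c > 0" and int: "integrable \<nu> (\<lambda>y. exp (c * y))"
  shows "integrable \<nu> (\<lambda>y. ramp \<alpha> (y - x))"
    and "2 * pi * (\<integral>y. ramp \<alpha> (y - x) \<partial>\<nu>) =
      (\<integral>t. exp (- (Complex c t * of_real x)) * (\<integral>y. exp (Complex c t * of_real y) \<partial>\<nu>) / (\<alpha> + Complex c t)\<^sup>2 \<partial>lborel)"
proof -
  define g where "g y t = exp (Complex c t * of_real (y - x)) / (\<alpha> + Complex c t)\<^sup>2" for y t
  have [measurable]: "(\<lambda>t. Complex c t) \<in> borel_measurable borel"
    by (auto simp: Complex_eq)
  have gn: "norm (g y t) = exp (c * (y - x)) * (1 / ((\<alpha> + c)\<^sup>2 + t\<^sup>2))" for y t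
    unfolding g_def norm_divide norm_exp_Complex by (simp add: norm_power cmod_power2)
  have "(\<integral>t. (\<integral>y. g y t \<partial>\<nu>) \<partial>lborel) = (\<integral>y. (\<integral>t. g y t \<partial>lborel) \<partial>\<nu>)"
  proof (rule Fubini_product_bound(2)[where g="\<lambda>y. exp (c * (y - x))" and h="\<lambda>t. 1 / ((\<alpha> + c)\<^sup>2 + t\<^sup>2)"])
    show "(\<lambda>(y, t). g y t) \<in> borel_measurable (\<nu> \<Otimes>\<^sub>M lborel)"
      unfolding g_def by measurable
    have "integrable \<nu> (\<lambda>y. exp (- (c * x)) * exp (c * y))" using int by simp
    then show "integrable \<nu> (\<lambda>y. exp (c * (y - x)))"
      by (simp add: algebra_simps flip: exp_add)
  qed (use assms gn in \<open>auto simp: sigma_finite_lborel integrable_inverse_quadratic\<close>)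
  also have "(\<lambda>y. \<integral>t. g y t \<partial>lborel) = (\<lambda>y. complex_of_real (2 * pi * ramp \<alpha> (y - x)))"
    unfolding g_def ramp_inversion_shifted[OF c] by simp
  also have "(\<integral>y. complex_of_real (2 * pi * ramp \<alpha> (y - x)) \<partial>\<nu>) = 2 * pi * (\<integral>y. ramp \<alpha> (y - x) \<partial>\<nu>)"
    by (simp only: integral_complex_of_real integral_mult_right_zero)
  finally have "2 * pi * (\<integral>y. ramp \<alpha> (y - x) \<partial>\<nu>) = (\<integral>t. (\<integral>y. g y t \<partial>\<nu>) \<partial>lborel)" ..
  also have "\<dots> = (\<integral>t. exp (- (Complex c t * of_real x)) * (\<integral>y. exp (Complex c t * of_real y) \<partial>\<nu>) / (\<alpha> + Complex c t)\<^sup>2 \<partial>lborel)"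
  proof (rule Bochner_Integration.integral_cong[OF refl])
    fix t
    have "g y t = exp (- (Complex c t * of_real x)) * exp (Complex c t * of_real y) / (\<alpha> + Complex c t)\<^sup>2" for y
      by (simp add: g_def algebra_simps flip: exp_add)
    then show "(\<integral>y. g y t \<partial>\<nu>) = exp (- (Complex c t * of_real x)) * (\<integral>y. exp (Complex c t * of_real y) \<partial>\<nu>) / (\<alpha> + Complex c t)\<^sup>2"
      by simp
  qed
  finally show "2 * pi * (\<integral>y. ramp \<alpha> (y - x) \<partial>\<nu>) =
      (\<integral>t. exp (- (Complex c t * of_real x)) * (\<integral>y. exp (Complex c t * of_real y) \<partial>\<nu>) / (\<alpha> + Complex c t)\<^sup>2 \<partial>lborel)" .
  show "integrable \<nu> (\<lambda>y. ramp \<alpha> (y - x))"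
  proof (rule Bochner_Integration.integrable_bound)
    show "integrable \<nu> (\<lambda>y. 1 / (\<alpha> + c) * exp (- (c * x)) * exp (c * y))" using int by simp
    show "AE y in \<nu>. norm (ramp \<alpha> (y - x)) \<le> norm (1 / (\<alpha> + c) * exp (- (c * x)) * exp (c * y))"
    proof (rule AE_I2)
      fix y
      have "ramp \<alpha> (y - x) = exp (c * (y - x)) * ramp (\<alpha> + c) (y - x)"
        by (simp add: ramp_def algebra_simps flip: exp_add)
      also have "\<dots> \<le> exp (c * (y - x)) * (1 / (\<alpha> + c))"
        by (intro mult_left_mono ramp_le c) auto
      also have "\<dots> = 1 / (\<alpha> + c) * exp (- (c * x)) * exp (c * y)"
        by (simp add: algebra_simps flip: exp_add)
      finally show "norm (ramp \<alpha> (y - x)) \<le> norm (1 / (\<alpha> + c) * exp (- (c * x)) * exp (c * y))"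
        using ramp_nonneg[of \<alpha> "y - x"] c by simp
    qed
  qed simp
qed

section \<open>Renewal measures\<close>

text \<open>A decomposition of a measure into two summands is often known only through nonnegative
  integrals; splitting into positive and negative, real and imaginary parts extends it to complex
  integrands. This is how the renewal equation reaches Fourier transforms.\<close>

lemma integral_add_measure:
  fixes f :: "'a \<Rightarrow> complex"
  assumes sets: "sets M1 = sets M" "sets M2 = sets M"
    and add: "\<And>g :: 'a \<Rightarrow> ennreal. g \<in> borel_measurable M \<Longrightarrow> (\<integral>\<^sup>+x. g x \<partial>M) = (\<integral>\<^sup>+x. g x \<partial>M1) + (\<integral>\<^sup>+x. g x \<partial>M2)"
    and f: "integrable M f"
  shows "integrable M1 f" "integrable M2 f" "(\<integral>x. f x \<partial>M) = (\<integral>x. f x \<partial>M1) + (\<integral>x. f x \<partial>M2)"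
proof -
  have m: "borel_measurable M1 = borel_measurable M" "borel_measurable M2 = borel_measurable M"
    using sets by (auto intro!: measurable_cong_sets)
  have le: "(\<integral>\<^sup>+x. g x \<partial>M1) \<le> (\<integral>\<^sup>+x. g x \<partial>M)" "(\<integral>\<^sup>+x. g x \<partial>M2) \<le> (\<integral>\<^sup>+x. g x \<partial>M)"
    if "g \<in> borel_measurable M" for g :: "'a \<Rightarrow> ennreal"
    using add[OF that] by auto
  have I: "integrable M1 f" "integrable M2 f" if "integrable M f" for f :: "'a \<Rightarrow> 'b::{banach, second_countable_topology}"
    using that le[of "\<lambda>x. ennreal (norm (f x))"] unfolding integrable_iff_bounded
    by (auto simp: m intro: le_less_trans)
  show "integrable M1 f" "integrable M2 f" by (intro I f)+
  have R: "(\<integral>x. g x \<partial>M) = (\<integral>x. g x \<partial>M1) + (\<integral>x. g x \<partial>M2)" if g: "integrable M g" for g :: "'a \<Rightarrow> real"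
  proof -
    have gm: "(\<lambda>x. ennreal (g x)) \<in> borel_measurable M" "(\<lambda>x. ennreal (- g x)) \<in> borel_measurable M"
      using g by auto
    have e: "enn2real (\<integral>\<^sup>+x. h x \<partial>M) = enn2real (\<integral>\<^sup>+x. h x \<partial>M1) + enn2real (\<integral>\<^sup>+x. h x \<partial>M2)"
      if "h \<in> borel_measurable M" "(\<integral>\<^sup>+x. h x \<partial>M) < \<infinity>" for h :: "'a \<Rightarrow> ennreal"
      using le[OF that(1)] that by (subst add) (auto intro!: enn2real_plus simp: less_top[symmetric] top_unique)
    have fin: "(\<integral>\<^sup>+x. ennreal (g x) \<partial>M) < \<infinity>" "(\<integral>\<^sup>+x. ennreal (- g x) \<partial>M) < \<infinity>"
      using g by (auto simp: real_integrable_def less_top)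
    show ?thesis
      using e[OF gm(1) fin(1)] e[OF gm(2) fin(2)] I[OF g] g
      by (simp add: real_lebesgue_integral_def)
  qed
  have "Re (\<integral>x. f x \<partial>M) = Re ((\<integral>x. f x \<partial>M1) + (\<integral>x. f x \<partial>M2))"
    using R[OF integrable_Re[OF f]] I[OF f] f by simp
  moreover have "Im (\<integral>x. f x \<partial>M) = Im ((\<integral>x. f x \<partial>M1) + (\<integral>x. f x \<partial>M2))"
    using R[OF integrable_Im[OF f]] I[OF f] f by simp
  ultimately show "(\<integral>x. f x \<partial>M) = (\<integral>x. f x \<partial>M1) + (\<integral>x. f x \<partial>M2)"
    by (rule complex_eqI)
qed

primrec conv_power :: "real measure \<Rightarrow> nat \<Rightarrow> real measure" where
  "conv_power \<mu> 0 = return borel 0"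
| "conv_power \<mu> (Suc n) = convolution \<mu> (conv_power \<mu> n)"

text \<open>The expected occupation measure of the random walk with step law \<mu> started at 0: the
  term n = 0 is the unit mass at 0. It is built directly on Borel sets because the total mass is
  infinite for a probability law \<mu>.\<close>

definition renewal_measure :: "real measure \<Rightarrow> real measure" where
  "renewal_measure \<mu> = measure_of UNIV (sets borel) (\<lambda>E. \<Sum>n. emeasure (conv_power \<mu> n) E)"

lemma sets_conv_power [measurable_cong, simp]: "sets (conv_power \<mu> n) = sets borel"
  by (cases n) auto

lemma space_conv_power [simp]: "space (conv_power \<mu> n) = UNIV"
  by (cases n) auto

lemma sets_renewal_measure [measurable_cong, simp]: "sets (renewal_measure \<mu>) = sets borel"
  unfolding renewal_measure_def using sets.sigma_sets_eq[of "borel :: real measure"] by simp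

lemma space_renewal_measure [simp]: "space (renewal_measure \<mu>) = UNIV"
  using sets_eq_imp_space_eq[OF sets_renewal_measure] by simp

lemma emeasure_renewal_measure:
  assumes "E \<in> sets borel"
  shows "emeasure (renewal_measure \<mu>) E = (\<Sum>n. emeasure (conv_power \<mu> n) E)"
  unfolding renewal_measure_def
proof (rule emeasure_measure_of_sigma[OF _ _ _ assms])
  show "sigma_algebra UNIV (sets (borel :: real measure))"
    using sets.sigma_algebra_axioms[of "borel :: real measure"] by simp
  show "positive (sets borel) (\<lambda>E. \<Sum>n. emeasure (conv_power \<mu> n) E)"
    by (simp add: positive_def)
  show "countably_additive (sets borel) (\<lambda>E. \<Sum>n. emeasure (conv_power \<mu> n) E)"
  proof (rule countably_additiveI)
    fix A :: "nat \<Rightarrow> real set" assume A: "range A \<subseteq> sets borel" "disjoint_family A"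
    have "(\<Sum>n. emeasure (conv_power \<mu> n) (\<Union>i. A i)) = (\<Sum>n. \<Sum>i. emeasure (conv_power \<mu> n) (A i))"
      using A by (intro suminf_cong suminf_emeasure[symmetric]) auto
    also have "\<dots> = (\<integral>\<^sup>+n. \<integral>\<^sup>+i. emeasure (conv_power \<mu> n) (A i) \<partial>count_space UNIV \<partial>count_space UNIV)"
      by (simp add: nn_integral_count_space_nat)
    also have "\<dots> = (\<integral>\<^sup>+i. \<integral>\<^sup>+n. emeasure (conv_power \<mu> n) (A i) \<partial>count_space UNIV \<partial>count_space UNIV)"
      by (rule pair_sigma_finite.Fubini')
         (auto simp: pair_sigma_finite_def pair_measure_countable intro!: sigma_finite_measure_count_space_countable)
    finally show "(\<Sum>i. \<Sum>n. emeasure (conv_power \<mu> n) (A i)) = (\<Sum>n. emeasure (conv_power \<mu> n) (\<Union>i. A i))"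
      by (simp add: nn_integral_count_space_nat)
  qed
qed

lemma nn_integral_renewal_measure:
  assumes f: "f \<in> borel_measurable borel"
  shows "(\<integral>\<^sup>+y. f y \<partial>renewal_measure \<mu>) = (\<Sum>n. \<integral>\<^sup>+y. f y \<partial>conv_power \<mu> n)"
  using f
proof (induct rule: borel_measurable_induct)
  case (cong f g)
  then show ?case by (simp add: nn_integral_cong[of _ f g] cong: nn_integral_cong)
next
  case (set A)
  then show ?case by (simp add: emeasure_renewal_measure)
next
  case (mult u c)
  then show ?case by (simp add: nn_integral_cmult)
next
  case (add u v)
  then show ?case by (simp add: nn_integral_add suminf_add)
next
  case (seq U)
  have "(\<integral>\<^sup>+y. (SUP i. U i y) \<partial>renewal_measure \<mu>) = (SUP i. \<integral>\<^sup>+y. U i y \<partial>renewal_measure \<mu>)"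
    using seq by (intro nn_integral_monotone_convergence_SUP) auto
  also have "\<dots> = (SUP i. \<Sum>n. \<integral>\<^sup>+y. U i y \<partial>conv_power \<mu> n)"
    using seq by simp
  also have "\<dots> = (\<Sum>n. SUP i. \<integral>\<^sup>+y. U i y \<partial>conv_power \<mu> n)"
    using seq by (intro ennreal_suminf_SUP_eq[symmetric]) (auto simp: incseq_def le_fun_def intro!: nn_integral_mono)
  also have "\<dots> = (\<Sum>n. \<integral>\<^sup>+y. (SUP i. U i y) \<partial>conv_power \<mu> n)"
    using seq by (intro suminf_cong nn_integral_monotone_convergence_SUP[symmetric]) auto
  finally show ?case by (simp add: image_comp)
qed

lemma suminf_ennreal_Suc: "(\<Sum>n. a n) = a 0 + (\<Sum>n. a (Suc n) :: ennreal)"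
proof -
  have "(\<lambda>n. a (Suc n)) sums (\<Sum>n. a (Suc n))" by (simp add: summable_sums)
  then have "a sums ((\<Sum>n. a (Suc n)) + a 0)" by (rule sums_Suc)
  then show ?thesis by (simp add: sums_iff add.commute)
qed

locale step_law = prob_space \<mu> for \<mu> :: "real measure" +
  assumes sets_\<mu> [measurable_cong, simp]: "sets \<mu> = sets borel"
begin

lemma space_\<mu> [simp]: "space \<mu> = UNIV"
  using sets_eq_imp_space_eq[OF sets_\<mu>] by simp

abbreviation "H \<equiv> renewal_measure \<mu>"

lemma finite_conv_power: "finite_measure (conv_power \<mu> n)"
proof (induct n)
  case 0
  show ?case by (simp add: prob_space.finite_measure prob_space_return)
next
  case (Suc n)
  then show ?case using finite_measure_axioms by (auto intro: convolution_finite)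
qed

text \<open>Condition on the first step: H is the unit mass at 0 plus the convolution of \<mu> with
  H.\<close>

lemma nn_integral_renewal:
  assumes [measurable]: "f \<in> borel_measurable borel"
  shows "(\<integral>\<^sup>+y. f y \<partial>H) = f 0 + (\<integral>\<^sup>+z. \<integral>\<^sup>+y. f (z + y) \<partial>H \<partial>\<mu>)"
proof -
  have "(\<integral>\<^sup>+y. f y \<partial>H) = f 0 + (\<Sum>n. \<integral>\<^sup>+y. f y \<partial>convolution \<mu> (conv_power \<mu> n))"
    by (subst nn_integral_renewal_measure, simp, subst suminf_ennreal_Suc) (simp add: nn_integral_return)
  also have "(\<Sum>n. \<integral>\<^sup>+y. f y \<partial>convolution \<mu> (conv_power \<mu> n)) = (\<Sum>n. \<integral>\<^sup>+z. \<integral>\<^sup>+y. f (z + y) \<partial>conv_power \<mu> n \<partial>\<mu>)"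
    by (intro suminf_cong nn_integral_convolution finite_conv_power finite_measure_axioms) auto
  also have "\<dots> = (\<integral>\<^sup>+z. (\<Sum>n. \<integral>\<^sup>+y. f (z + y) \<partial>conv_power \<mu> n) \<partial>\<mu>)"
  proof (rule nn_integral_suminf[symmetric])
    fix n
    interpret cp: finite_measure "conv_power \<mu> n" by (rule finite_conv_power)
    show "(\<lambda>z. \<integral>\<^sup>+y. f (z + y) \<partial>conv_power \<mu> n) \<in> borel_measurable \<mu>"
      by measurable
  qed
  also have "\<dots> = (\<integral>\<^sup>+z. \<integral>\<^sup>+y. f (z + y) \<partial>H \<partial>\<mu>)"
    by (simp add: nn_integral_renewal_measure)
  finally show ?thesis .
qed

lemma nn_integral_exp_conv_power:
  "(\<integral>\<^sup>+y. ennreal (exp (c * y)) \<partial>conv_power \<mu> n) = (\<integral>\<^sup>+y. ennreal (exp (c * y)) \<partial>\<mu>) ^ n"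
proof (induct n)
  case 0
  show ?case by (simp add: nn_integral_return)
next
  case (Suc n)
  have "(\<integral>\<^sup>+y. ennreal (exp (c * y)) \<partial>conv_power \<mu> (Suc n)) = (\<integral>\<^sup>+z. \<integral>\<^sup>+y. ennreal (exp (c * (z + y))) \<partial>conv_power \<mu> n \<partial>\<mu>)"
    by (simp add: nn_integral_convolution finite_conv_power finite_measure_axioms)
  also have "\<dots> = (\<integral>\<^sup>+z. ennreal (exp (c * z)) * (\<integral>\<^sup>+y. ennreal (exp (c * y)) \<partial>conv_power \<mu> n) \<partial>\<mu>)"
    by (subst nn_integral_cmult[symmetric]) (auto simp: algebra_simps exp_add ennreal_mult)
  also have "\<dots> = (\<integral>\<^sup>+y. ennreal (exp (c * y)) \<partial>\<mu>) ^ Suc n"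
    by (simp add: Suc nn_integral_multc)
  finally show ?case .
qed

text \<open>The exponential moment of the n-th convolution power is the n-th power of that of \<mu>,
  so the sum over n is a convergent geometric series.\<close>

lemma nn_integral_exp_renewal_finite:
  assumes int: "integrable \<mu> (\<lambda>z. exp (c * z))" and lt: "(\<integral>z. exp (c * z) \<partial>\<mu>) < 1"
  shows "integrable H (\<lambda>y. exp (c * y))"
proof -
  define q where "q = (\<integral>z. exp (c * z) \<partial>\<mu>)"
  have q: "0 \<le> q" "q < 1" using lt by (auto simp: q_def integral_nonneg_AE)
  have "(\<integral>\<^sup>+y. ennreal (exp (c * y)) \<partial>H) = (\<Sum>n. ennreal (q ^ n))"
  proof -
    have "(\<integral>\<^sup>+z. ennreal (exp (c * z)) \<partial>\<mu>) = ennreal q"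
      unfolding q_def by (rule nn_integral_eq_integral[OF int]) simp
    then have "(\<integral>\<^sup>+y. ennreal (exp (c * y)) \<partial>conv_power \<mu> n) = ennreal (q ^ n)" for n
      using q by (simp only: nn_integral_exp_conv_power ennreal_power)
    then show ?thesis by (subst nn_integral_renewal_measure) auto
  qed
  also have "\<dots> = ennreal (\<Sum>n. q ^ n)"
    using q by (intro suminf_ennreal2 summable_geometric) auto
  also have "\<dots> < \<infinity>" by simp
  finally show ?thesis by (intro integrableI_nonneg) auto
qed

text \<open>An exponential is bounded away from 0 on compact intervals, so one finite exponential
  moment makes every such interval have finite mass.\<close>

lemma sigma_finite_renewal:
  assumes "integrable H (\<lambda>y. exp (c * y))"
  shows "sigma_finite_measure H"
proof
  have "emeasure H {- real n..real n} < \<infinity>" for n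
  proof -
    have "emeasure H {- real n..real n} = (\<integral>\<^sup>+y. indicator {- real n..real n} y \<partial>H)" by simp
    also have "\<dots> \<le> (\<integral>\<^sup>+y. ennreal (exp (\<bar>c\<bar> * real n)) * ennreal (exp (c * y)) \<partial>H)"
    proof (rule nn_integral_mono)
      fix y
      have "1 \<le> exp (\<bar>c\<bar> * real n + c * y)" if "- real n \<le> y" "y \<le> real n"
      proof -
        have "\<bar>c * y\<bar> \<le> \<bar>c\<bar> * real n" using that by (simp add: abs_mult mult_left_mono)
        then show ?thesis by simp
      qed
      then show "indicator {- real n..real n} y \<le> ennreal (exp (\<bar>c\<bar> * real n)) * ennreal (exp (c * y))"
        by (auto simp: indicator_def exp_add simp flip: ennreal_mult)
    qed
    also have "\<dots> < \<infinity>"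
      using assms by (subst nn_integral_cmult) (auto simp: nn_integral_eq_integral ennreal_mult_less_top)
    finally show ?thesis .
  qed
  moreover have "(\<Union>n. {- real n..real n}) = UNIV"
  proof (auto)
    fix x :: real
    obtain n where "\<bar>x\<bar> \<le> real n" using real_arch_simple by blast
    then show "\<exists>n. - real n \<le> x \<and> x \<le> real n" by (intro exI[of _ n]) auto
  qed
  ultimately show "\<exists>A. countable A \<and> A \<subseteq> sets H \<and> \<Union>A = space H \<and> (\<forall>a\<in>A. emeasure H a \<noteq> \<infinity>)"
    by (intro exI[of _ "range (\<lambda>n. {- real n..real n})"]) (auto simp: less_top)
qed

text \<open>The nonnegative equation says that H is the unit mass at 0 plus the image of the product
  of \<mu> and H under addition; additivity of integrals carries this over to complex f. Joint
  integrability is recorded as well because later exchanges of integrals rely on it.\<close>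

lemma renewal_equation:
  fixes f :: "real \<Rightarrow> complex"
  assumes "sigma_finite_measure H" and f: "integrable H f"
  shows "integrable (\<mu> \<Otimes>\<^sub>M H) (\<lambda>(z, y). f (z + y))"
    and "(\<integral>y. f y \<partial>H) = f 0 + (\<integral>z. (\<integral>y. f (z + y) \<partial>H) \<partial>\<mu>)"
proof -
  interpret H: sigma_finite_measure H by fact
  interpret P: pair_sigma_finite \<mu> H ..
  have fm: "f \<in> borel_measurable borel" using f by (auto dest: borel_measurable_integrable)
  note [measurable] = fm
  let ?M2 = "distr (\<mu> \<Otimes>\<^sub>M H) borel (\<lambda>(z, y). z + y)"
  have add: "(\<integral>\<^sup>+x. g x \<partial>H) = (\<integral>\<^sup>+x. g x \<partial>return borel 0) + (\<integral>\<^sup>+x. g x \<partial>?M2)"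
    if "g \<in> borel_measurable H" for g :: "real \<Rightarrow> ennreal"
  proof -
    have [measurable]: "g \<in> borel_measurable borel" using that by simp
    have "(\<integral>\<^sup>+x. g x \<partial>?M2) = (\<integral>\<^sup>+p. g (fst p + snd p) \<partial>(\<mu> \<Otimes>\<^sub>M H))"
      by (subst nn_integral_distr) (auto simp: case_prod_beta)
    also have "\<dots> = (\<integral>\<^sup>+z. \<integral>\<^sup>+y. g (z + y) \<partial>H \<partial>\<mu>)"
      by (subst H.nn_integral_fst[symmetric]) auto
    finally have "(\<integral>\<^sup>+x. g x \<partial>?M2) = (\<integral>\<^sup>+z. \<integral>\<^sup>+y. g (z + y) \<partial>H \<partial>\<mu>)" .
    moreover have "(\<integral>\<^sup>+x. g x \<partial>return borel 0) = g 0" by (simp add: nn_integral_return)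
    moreover have "(\<integral>\<^sup>+x. g x \<partial>H) = g 0 + (\<integral>\<^sup>+z. \<integral>\<^sup>+y. g (z + y) \<partial>H \<partial>\<mu>)"
      by (rule nn_integral_renewal) simp
    ultimately show ?thesis by simp
  qed
  have sets: "sets (return borel 0) = sets H" "sets ?M2 = sets H" by simp_all
  have I2: "integrable ?M2 f"
    by (rule integral_add_measure(2)[OF sets _ f]) (rule add)
  have eq: "(\<integral>x. f x \<partial>H) = (\<integral>x. f x \<partial>return borel 0) + (\<integral>x. f x \<partial>?M2)"
    by (rule integral_add_measure(3)[OF sets _ f]) (rule add)
  show I: "integrable (\<mu> \<Otimes>\<^sub>M H) (\<lambda>(z, y). f (z + y))"
    using integrable_distr[OF _ I2] by (simp add: case_prod_beta')
  have "(\<integral>x. f x \<partial>?M2) = (\<integral>p. f (fst p + snd p) \<partial>(\<mu> \<Otimes>\<^sub>M H))"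
    by (subst integral_distr) (simp_all add: case_prod_beta')
  also have "\<dots> = (\<integral>z. (\<integral>y. f (z + y) \<partial>H) \<partial>\<mu>)"
    using P.integral_fst[OF I] by (simp add: case_prod_beta')
  finally show "(\<integral>y. f y \<partial>H) = f 0 + (\<integral>z. (\<integral>y. f (z + y) \<partial>H) \<partial>\<mu>)"
    unfolding eq by (simp add: integral_return fm)
qed

end

section \<open>Random walks with a strongly non-lattice step\<close>

lemma norm_exp_minus_1_le: "norm (exp z - 1) \<le> norm z * exp (norm z)" for z :: complex
proof -
  have "norm (exp z - exp 0) \<le> exp (norm z) * norm (z - 0)"
  proof (rule field_differentiable_bound[of "cball 0 (norm z)"])
    fix w :: complex assume "w \<in> cball 0 (norm z)"
    then show "norm (exp w) \<le> exp (norm z)"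
      using norm_exp[of w] by (auto intro: order_trans)
    show "(exp has_field_derivative exp w) (at w within cball 0 (norm z))"
      by (rule DERIV_subset[OF DERIV_exp]) auto
  qed auto
  then show ?thesis by (simp add: mult.commute)
qed

text \<open>Squaring 1 + x/2 <= exp (x/2) produces the surplus x^2/4. The strictness is what later
  forces Z = 0 almost surely in the equality cases of convexity arguments.\<close>

lemma exp_gt_linear: "x \<noteq> 0 \<Longrightarrow> exp (x::real) > 1 + x"
proof (cases "1 + x / 2 > 0")
  case True
  assume "x \<noteq> 0"
  then have "0 < x\<^sup>2" by simp
  moreover have "(1 + x / 2)\<^sup>2 = 1 + x + x\<^sup>2 / 4" by (simp add: power2_eq_square field_simps)
  ultimately have "1 + x < (1 + x / 2)\<^sup>2" by linarith
  also have "\<dots> \<le> (exp (x / 2))\<^sup>2" using True exp_ge_add_one_self[of "x / 2"] by (intro power_mono) auto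
  also have "\<dots> = exp x" by (simp add: power2_eq_square flip: exp_add)
  finally show ?thesis .
next
  case False
  then have "1 + x < 0" by simp
  then show ?thesis using exp_gt_zero[of x] by linarith
qed

text \<open>The law \<open>\<mu>\<close> plays the role of the law of \<open>Z\<close>; its exponential moments of order \<open>-\<alpha>\<close> and
  \<open>\<theta>\<close> correspond to \<open>P(A > 0) \<le> 1\<close> and \<open>E A\<^sup>\<gamma> < \<infinity>\<close> with \<open>\<theta> = \<gamma> - \<alpha>\<close>.\<close>

locale tilted_walk = step_law \<mu> for \<mu> :: "real measure" +
  fixes \<alpha> \<theta> :: real
  assumes \<alpha>_pos: "\<alpha> > 0" and \<theta>_pos: "\<theta> > 0"
    and int_neg: "integrable \<mu> (\<lambda>z. exp (- \<alpha> * z))"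
    and neg_le_1: "(\<integral>z. exp (- \<alpha> * z) \<partial>\<mu>) \<le> 1"
    and int_pos: "integrable \<mu> (\<lambda>z. exp (\<theta> * z))"
    and snl: "strongly_non_lattice \<mu>"
begin

lemma prob_UNIV [simp]: "measure \<mu> UNIV = 1"
  using prob_space by simp

lemma exp_between: "- \<alpha> \<le> c \<Longrightarrow> c \<le> \<theta> \<Longrightarrow> exp (c * z) \<le> exp (- \<alpha> * z) + exp (\<theta> * z)"
proof (cases "z \<ge> 0")
  case True
  assume "c \<le> \<theta>"
  then have "exp (c * z) \<le> exp (\<theta> * z)" using True by (simp add: mult_right_mono)
  then show ?thesis by (simp add: add_increasing)
next
  case False
  assume "- \<alpha> \<le> c"
  then have "c * z \<le> - \<alpha> * z" using False by (intro mult_right_mono_neg) auto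
  then have "exp (c * z) \<le> exp (- \<alpha> * z)" by simp
  then show ?thesis by (simp add: add_increasing2)
qed

lemma integrable_exp:
  assumes "- \<alpha> \<le> c" "c \<le> \<theta>" shows "integrable \<mu> (\<lambda>z. exp (c * z))"
  by (rule Bochner_Integration.integrable_bound[OF Bochner_Integration.integrable_add[OF int_neg int_pos]])
     (use exp_between[OF assms] in auto)

definition mgf :: "complex \<Rightarrow> complex" where
  "mgf s = (\<integral>z. exp (s * of_real z) \<partial>\<mu>)"

lemma integrable_cexp:
  assumes "- \<alpha> \<le> Re s" "Re s \<le> \<theta>" shows "integrable \<mu> (\<lambda>z. exp (s * of_real z))"
  by (rule Bochner_Integration.integrable_bound[OF integrable_exp[OF assms]]) auto

text \<open>Differentiation under the integral sign: along any sequence of increments tending to 0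
  the difference quotients are dominated by exponentials whose orders still lie in the
  strip.\<close>

lemma mgf_holomorphic: "mgf holomorphic_on {s. - \<alpha> < Re s \<and> Re s < \<theta>}"
    and mgf_has_derivative: "- \<alpha> < Re s \<Longrightarrow> Re s < \<theta> \<Longrightarrow> (mgf has_field_derivative (\<integral>z. of_real z * exp (s * of_real z) \<partial>\<mu>)) (at s)"
proof -
  show D: "(mgf has_field_derivative (\<integral>z. of_real z * exp (s * of_real z) \<partial>\<mu>)) (at s)" if s: "- \<alpha> < Re s" "Re s < \<theta>" for s
  proof -
    \<comment> \<open>There is room for 2 d on both sides of Re s: one d absorbs the increment h,
      the other absorbs the factor |z| that the difference quotient produces.\<close>
    define d where "d = min (\<theta> - Re s) (Re s + \<alpha>) / 2"
    have d: "d > 0" "- \<alpha> \<le> Re s - 2 * d" "Re s + 2 * d \<le> \<theta>" "Re s - d \<ge> - \<alpha>" "Re s + d \<le> \<theta>"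
      using s by (auto simp: d_def min_def field_simps)
    show ?thesis
      unfolding DERIV_def
    proof (subst tendsto_at_iff_sequentially, intro allI impI)
      fix X :: "nat \<Rightarrow> complex" assume X0: "\<forall>i. X i \<in> UNIV - {0}" and X: "X \<longlonglongrightarrow> 0"
      from X d(1) have "\<forall>\<^sub>F n in sequentially. norm (X n) < d"
        by (intro order_tendstoD(2)[of "\<lambda>n. norm (X n)" 0]) (auto intro: tendsto_norm_zero)
      then obtain N where N: "\<And>n. n \<ge> N \<Longrightarrow> norm (X n) < d"
        by (auto simp: eventually_sequentially)
      define w where "w z = (1 / d) * (exp ((Re s + 2 * d) * z) + exp ((Re s - 2 * d) * z))" for z
      define q where "q h z = (exp (h * of_real z) - 1) / h * exp (s * of_real z)" for h :: complex and z :: real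
      have qb: "norm (q h z) \<le> w z" if h: "h \<noteq> 0" "norm h < d" for h z
      proof -
        have "norm ((exp (h * of_real z) - 1) / h) \<le> norm (h * of_real z) * exp (norm (h * of_real z)) / norm h"
          unfolding norm_divide by (intro divide_right_mono norm_exp_minus_1_le) auto
        also have "\<dots> = \<bar>z\<bar> * exp (norm h * \<bar>z\<bar>)" using h by (simp add: norm_mult)
        also have "\<dots> \<le> \<bar>z\<bar> * exp (d * \<bar>z\<bar>)" using h by (intro mult_left_mono) (auto intro: mult_right_mono)
        also have "\<dots> \<le> (1 / d) * exp (d * \<bar>z\<bar>) * exp (d * \<bar>z\<bar>)"
        proof -
          have "d * \<bar>z\<bar> \<le> exp (d * \<bar>z\<bar>)" using exp_ge_add_one_self[of "d * \<bar>z\<bar>"] by linarith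
          then have "\<bar>z\<bar> \<le> (1 / d) * exp (d * \<bar>z\<bar>)" using d by (simp add: field_simps)
          then show ?thesis by (rule mult_right_mono) auto
        qed
        also have "\<dots> = (1 / d) * exp (2 * d * \<bar>z\<bar>)" by (simp flip: exp_add)
        finally have "norm (q h z) \<le> (1 / d) * exp (2 * d * \<bar>z\<bar>) * exp (Re s * z)"
          unfolding q_def norm_mult using d(1) by (intro mult_mono) auto
        also have "\<dots> = (1 / d) * exp (2 * d * \<bar>z\<bar> + Re s * z)" by (simp add: exp_add)
        also have "\<dots> \<le> w z"
          unfolding w_def using d
          by (intro mult_left_mono; cases "z \<ge> 0") (auto simp: algebra_simps add_increasing add_increasing2)
        finally show ?thesis .
      qed
      have "(\<lambda>n. \<integral>z. q (X (n + N)) z \<partial>\<mu>) \<longlonglongrightarrow> (\<integral>z. of_real z * exp (s * of_real z) \<partial>\<mu>)"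
      proof (rule integral_dominated_convergence[where w=w])
        show "integrable \<mu> w" unfolding w_def
          using d by (intro integrable_mult_right Bochner_Integration.integrable_add integrable_exp) auto
        show "AE z in \<mu>. norm (q (X (n + N)) z) \<le> w z" for n
          using qb[of "X (n + N)"] N[of "n + N"] X0 by auto
        show "AE z in \<mu>. (\<lambda>n. q (X (n + N)) z) \<longlonglongrightarrow> of_real z * exp (s * of_real z)"
        proof (rule AE_I2)
          fix z :: real
          have "((\<lambda>h. exp (h * complex_of_real z)) has_field_derivative of_real z) (at 0)"
            by (auto intro!: derivative_eq_intros)
          then have "((\<lambda>h. (exp (h * complex_of_real z) - 1) / h) \<longlongrightarrow> of_real z) (at 0)"
            by (simp add: DERIV_def)
          then have "((\<lambda>h. (exp (h * complex_of_real z) - 1) / h) \<circ> X) \<longlonglongrightarrow> of_real z"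
            using X X0 by (simp add: tendsto_at_iff_sequentially)
          then have "(\<lambda>n. (exp (X n * complex_of_real z) - 1) / X n) \<longlonglongrightarrow> of_real z"
            by (simp add: o_def)
          then have "(\<lambda>n. (exp (X (n + N) * complex_of_real z) - 1) / X (n + N)) \<longlonglongrightarrow> of_real z"
            by (rule LIMSEQ_ignore_initial_segment)
          then show "(\<lambda>n. q (X (n + N)) z) \<longlonglongrightarrow> of_real z * exp (s * of_real z)"
            unfolding q_def by (rule tendsto_mult_right)
        qed
      qed (auto simp: q_def)
      moreover have "(\<integral>z. q (X (n + N)) z \<partial>\<mu>) = (mgf (s + X (n + N)) - mgf s) / X (n + N)" for n
      proof -
        let ?h = "X (n + N)"
        have "\<bar>Re ?h\<bar> < d" using N[of "n + N"] abs_Re_le_cmod[of ?h] by linarith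
        then have "- \<alpha> \<le> Re (s + ?h)" "Re (s + ?h) \<le> \<theta>" using d by auto
        note i = integrable_cexp[OF this] integrable_cexp[of s]
        have "(\<integral>z. q ?h z \<partial>\<mu>) = (\<integral>z. (exp ((s + ?h) * of_real z) - exp (s * of_real z)) / ?h \<partial>\<mu>)"
          by (intro Bochner_Integration.integral_cong refl) (simp add: q_def algebra_simps exp_add diff_divide_distrib)
        also have "\<dots> = (mgf (s + ?h) - mgf s) / ?h"
          unfolding mgf_def using i s by simp
        finally show ?thesis .
      qed
      ultimately have "(\<lambda>n. (mgf (s + X (n + N)) - mgf s) / X (n + N)) \<longlonglongrightarrow> (\<integral>z. of_real z * exp (s * of_real z) \<partial>\<mu>)"
        by simp
      then show "((\<lambda>h. (mgf (s + h) - mgf s) / h) \<circ> X) \<longlonglongrightarrow> (\<integral>z. of_real z * exp (s * of_real z) \<partial>\<mu>)"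
        unfolding o_def by (rule LIMSEQ_offset)
    qed
  qed
  have "open {s. - \<alpha> < Re s \<and> Re s < \<theta>}"
    using open_Int[OF open_halfspace_Re_gt[of "- \<alpha>"] open_halfspace_Re_lt[of \<theta>]] by (simp add: Int_def)
  then show "mgf holomorphic_on {s. - \<alpha> < Re s \<and> Re s < \<theta>}"
    using D by (auto simp: holomorphic_on_open)
qed

lemma mgf_0: "mgf 0 = 1"
  by (simp add: mgf_def prob_space)

lemma integrable_id: "integrable \<mu> (\<lambda>z. z)"
proof (rule Bochner_Integration.integrable_bound)
  let ?d = "min \<alpha> \<theta>"
  show "integrable \<mu> (\<lambda>z. (1 / ?d) * (exp (- \<alpha> * z) + exp (\<theta> * z)))"
    using int_neg int_pos by (intro integrable_mult_right Bochner_Integration.integrable_add)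
  show "AE z in \<mu>. norm z \<le> norm ((1 / ?d) * (exp (- \<alpha> * z) + exp (\<theta> * z)))"
  proof (rule AE_I2)
    fix z :: real
    have d: "?d > 0" using \<alpha>_pos \<theta>_pos by simp
    have "?d * \<bar>z\<bar> \<le> exp (- \<alpha> * z) + exp (\<theta> * z)"
    proof (cases "z \<ge> 0")
      case True
      then have "?d * \<bar>z\<bar> \<le> \<theta> * z" by (auto intro: mult_right_mono)
      also have "\<dots> \<le> exp (\<theta> * z)" using exp_ge_add_one_self[of "\<theta> * z"] by linarith
      finally show ?thesis by (simp add: add_increasing)
    next
      case False
      then have "?d * \<bar>z\<bar> \<le> \<alpha> * \<bar>z\<bar>" by (auto intro: mult_right_mono)
      also have "\<dots> \<le> exp (- \<alpha> * z)" using False exp_ge_add_one_self[of "- \<alpha> * z"] by simp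
      finally show ?thesis by (simp add: add_increasing2)
    qed
    then show "norm z \<le> norm ((1 / ?d) * (exp (- \<alpha> * z) + exp (\<theta> * z)))"
      using d by (simp add: field_simps)
  qed
qed auto

definition drift :: real where "drift = (\<integral>z. z \<partial>\<mu>)"

lemma snl_bound: obtains b T where "b < 1" "T > 0" "\<And>t. \<bar>t\<bar> \<ge> T \<Longrightarrow> norm (mgf (\<i> * of_real t)) \<le> b"
proof -
  have "Limsup at_infinity (\<lambda>t::real. ereal (cmod (char \<mu> t))) < 1"
    using snl by (simp add: strongly_non_lattice_def)
  then obtain b where b: "Limsup at_infinity (\<lambda>t::real. ereal (cmod (char \<mu> t))) < ereal b" "ereal b < 1"
    using ereal_dense2 by blast
  then have "\<forall>\<^sub>F t in at_infinity. ereal (cmod (char \<mu> t)) < ereal b"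
    by (auto dest: Limsup_lessD)
  then obtain T where T: "\<And>t. T \<le> norm t \<Longrightarrow> cmod (char \<mu> t) < b"
    by (auto simp: eventually_at_infinity)
  have "mgf (\<i> * of_real t) = char \<mu> t" for t
    by (simp add: mgf_def char_def mult_ac)
  with T b show ?thesis by (intro that[of b "max T 1"]) (auto intro: less_imp_le)
qed

text \<open>If the value were 1 at some t other than 0, then cos (t Z) = 1 almost surely, so the
  characteristic function would equal 1 at all multiples of t. These go to infinity, where strong
  non-lattice keeps the modulus below some b < 1.\<close>

lemma mgf_imaginary_ne_1:
  assumes "t \<noteq> 0" shows "mgf (\<i> * of_real t) \<noteq> 1"
proof
  assume eq: "mgf (\<i> * of_real t) = 1"
  have "integrable \<mu> (\<lambda>z. exp (\<i> * of_real t * of_real z))"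
    using \<alpha>_pos \<theta>_pos by (intro integrable_cexp) auto
  then have "(\<integral>z. cos (t * z) \<partial>\<mu>) = Re (mgf (\<i> * of_real t))"
    unfolding mgf_def by (subst integral_Re[symmetric]) (auto simp: Re_exp)
  moreover have ic: "integrable \<mu> (\<lambda>z. cos (t * z))"
    by (rule integrable_const_bound[of _ 1]) auto
  ultimately have "(\<integral>z. 1 - cos (t * z) \<partial>\<mu>) = 0"
    using eq by simp
  then have ae: "AE z in \<mu>. 1 - cos (t * z) = 0"
    using ic by (subst (asm) integral_nonneg_eq_0_iff_AE) auto
  have one: "mgf (\<i> * of_real (real n * t)) = 1" for n :: nat
  proof -
    have "mgf (\<i> * of_real (real n * t)) = (\<integral>z. 1 \<partial>\<mu>)"
      unfolding mgf_def
    proof (rule integral_cong_AE)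
      show "AE z in \<mu>. exp (\<i> * of_real (real n * t) * of_real z) = 1"
        using ae
      proof eventually_elim
        case (elim z)
        then have "exp (\<i> * of_real (t * z)) = 1"
          using sin_cos_squared_add[of "t * z"] by (simp add: complex_eq_iff Re_exp Im_exp)
        then have "exp (of_nat n * (\<i> * of_real (t * z))) = 1"
          by (simp add: exp_of_nat_mult)
        then show ?case by (simp add: mult_ac)
      qed
    qed auto
    then show ?thesis by (simp add: prob_space)
  qed
  obtain b T where b: "b < 1" "\<And>t. \<bar>t\<bar> \<ge> T \<Longrightarrow> norm (mgf (\<i> * of_real t)) \<le> b"
    using snl_bound by blast
  obtain n :: nat where "T / \<bar>t\<bar> \<le> real n" using real_arch_simple by blast
  then have "\<bar>real n * t\<bar> \<ge> T" using assms by (simp add: abs_mult field_simps)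
  from b(2)[OF this] b(1) show False unfolding one by simp
qed

lemma not_AE_0: "\<not> (AE z in \<mu>. z = 0)"
proof
  assume ae: "AE z in \<mu>. z = 0"
  have "mgf (\<i> * of_real 1) = (\<integral>z. 1 \<partial>\<mu>)"
    unfolding mgf_def by (rule integral_cong_AE) (use ae in \<open>auto elim: eventually_mono\<close>)
  then show False using mgf_imaginary_ne_1[of 1] by (simp add: prob_space)
qed

text \<open>Integrating exp (-\<alpha> z) >= 1 - \<alpha> z against a moment of at most 1 gives a
  nonnegative drift. Equality would make Z vanish almost surely, contrary to strong
  non-lattice.\<close>

lemma drift_pos: "drift > 0"
proof -
  define g where "g z = exp (- \<alpha> * z) - 1 + \<alpha> * z" for z
  have g0: "g z \<ge> 0" for z using exp_ge_add_one_self[of "- \<alpha> * z"] by (simp add: g_def)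
  have gi: "integrable \<mu> g" unfolding g_def using int_neg integrable_id by auto
  have "(\<integral>z. g z \<partial>\<mu>) \<noteq> 0"
  proof
    assume "(\<integral>z. g z \<partial>\<mu>) = 0"
    then have "AE z in \<mu>. g z = 0"
      using integral_nonneg_eq_0_iff_AE[OF gi] g0 by auto
    then have "AE z in \<mu>. z = 0"
    proof eventually_elim
      case (elim z)
      then show ?case using exp_gt_linear[of "- \<alpha> * z"] \<alpha>_pos by (cases "z = 0") (auto simp: g_def)
    qed
    then show False using not_AE_0 by simp
  qed
  moreover have "(\<integral>z. g z \<partial>\<mu>) \<ge> 0" using g0 by simp
  ultimately have "(\<integral>z. g z \<partial>\<mu>) > 0" by simp
  moreover have "(\<integral>z. g z \<partial>\<mu>) = (\<integral>z. exp (- \<alpha> * z) \<partial>\<mu>) - 1 + \<alpha> * drift"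
    unfolding g_def drift_def using int_neg integrable_id by (simp add: prob_space)
  ultimately have "\<alpha> * drift > 0" using neg_le_1 by linarith
  then show ?thesis using \<alpha>_pos by (simp add: zero_less_mult_iff)
qed

text \<open>Strict convexity of the moment in c between -\<alpha>, where it is at most 1, and 0,
  where it is 1. This makes the exponential moments of H finite for orders in (-\<alpha>, 0), the
  only region where its transform is available directly.\<close>

lemma mgf_neg_less_1:
  assumes c: "- \<alpha> < c" "c < 0" shows "(\<integral>z. exp (c * z) \<partial>\<mu>) < 1"
proof -
  define l where "l = - c / \<alpha>"
  have l: "0 < l" "l < 1" using c \<alpha>_pos by (auto simp: l_def field_simps)
  have cl: "c = - \<alpha> * l" using \<alpha>_pos by (simp add: l_def)
  define g where "g z = (1 - l) + l * exp (- \<alpha> * z) - exp (c * z)" for z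
  text \<open>Weighted AM-GM, via \<open>exp x \<ge> 1 + x\<close> after factoring out \<open>exp (c z)\<close>.\<close>
  have key: "g z = exp (c * z) * ((1 - l) * (exp (- c * z) - 1 - (- c * z)) + l * (exp ((- \<alpha> - c) * z) - 1 - (- \<alpha> - c) * z))" for z
  proof -
    have "(1 - l) * (X - 1 - (- c * z)) + l * (Y - 1 - (- \<alpha> - c) * z) = (1 - l) * X + l * Y - 1" for X Y
      unfolding cl by algebra
    then have "exp (c * z) * ((1 - l) * (exp (- c * z) - 1 - (- c * z)) + l * (exp ((- \<alpha> - c) * z) - 1 - (- \<alpha> - c) * z))
      = exp (c * z) * ((1 - l) * exp (- c * z) + l * exp ((- \<alpha> - c) * z) - 1)"
      by simp
    also have "\<dots> = (1 - l) * (exp (c * z) * exp (- c * z)) + l * (exp (c * z) * exp ((- \<alpha> - c) * z)) - exp (c * z)"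
      by (simp only: algebra_simps)
    also have "exp (c * z) * exp (- c * z) = 1" by (simp flip: exp_add)
    also have "exp (c * z) * exp ((- \<alpha> - c) * z) = exp (- \<alpha> * z)" by (simp add: algebra_simps flip: exp_add)
    finally show ?thesis by (simp add: g_def)
  qed
  have gpos: "g z > 0" if "z \<noteq> 0" for z
  proof -
    have "exp (- c * z) - 1 - (- c * z) > 0" using exp_gt_linear[of "- c * z"] c that by simp
    moreover have "exp ((- \<alpha> - c) * z) - 1 - (- \<alpha> - c) * z \<ge> 0"
      using exp_ge_add_one_self[of "(- \<alpha> - c) * z"] by linarith
    ultimately show ?thesis
      unfolding key using l by (intro mult_pos_pos add_pos_nonneg mult_nonneg_nonneg) auto
  qed
  have g0: "g z \<ge> 0" for z using gpos[of z] by (cases "z = 0") (auto simp: g_def)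
  have ic: "integrable \<mu> (\<lambda>z. exp (c * z))" using c \<theta>_pos by (intro integrable_exp) auto
  have gi: "integrable \<mu> g" unfolding g_def using int_neg ic by auto
  have "(\<integral>z. g z \<partial>\<mu>) \<noteq> 0"
  proof
    assume "(\<integral>z. g z \<partial>\<mu>) = 0"
    then have "AE z in \<mu>. g z = 0"
      using integral_nonneg_eq_0_iff_AE[OF gi] g0 by auto
    then have "AE z in \<mu>. z = 0"
      by eventually_elim (use gpos in force)
    then show False using not_AE_0 by simp
  qed
  moreover have "(\<integral>z. g z \<partial>\<mu>) \<ge> 0" using g0 by simp
  ultimately have "(\<integral>z. g z \<partial>\<mu>) > 0" by simp
  moreover have "(\<integral>z. g z \<partial>\<mu>) = (1 - l) + l * (\<integral>z. exp (- \<alpha> * z) \<partial>\<mu>) - (\<integral>z. exp (c * z) \<partial>\<mu>)"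
    unfolding g_def using int_neg ic by (simp add: prob_space)
  moreover have "l * (\<integral>z. exp (- \<alpha> * z) \<partial>\<mu>) \<le> l * 1" using neg_le_1 l by (intro mult_left_mono) auto
  ultimately show ?thesis by linarith
qed

lemma integrable_H:
  assumes c: "- \<alpha> < c" "c < 0" shows "integrable H (\<lambda>y. exp (c * y))"
  by (rule nn_integral_exp_renewal_finite) (use assms \<theta>_pos mgf_neg_less_1 in \<open>auto intro!: integrable_exp\<close>)

sublocale H: sigma_finite_measure H
  using sigma_finite_renewal[OF integrable_H[of "- \<alpha> / 2"]] \<alpha>_pos by simp

text \<open>For an exponential the convolution factorises, so the renewal equation reads X = 1 +
  \<open>mgf s\<close> X. The resulting identity X (1 - \<open>mgf s\<close>) = 1 also shows that
  the denominator is not 0.\<close>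

lemma transform_H:
  assumes s: "- \<alpha> < Re s" "Re s < 0"
  shows "(\<integral>y. exp (s * of_real y) \<partial>H) = 1 / (1 - mgf s)"
proof -
  have int: "integrable H (\<lambda>y. exp (s * of_real y))"
    by (rule Bochner_Integration.integrable_bound[OF integrable_H[OF s]]) auto
  have "(\<integral>y. exp (s * of_real y) \<partial>H) = 1 + (\<integral>z. (\<integral>y. exp (s * of_real (z + y)) \<partial>H) \<partial>\<mu>)"
    using renewal_equation(2)[OF H.sigma_finite_measure_axioms int] by simp
  also have "(\<lambda>z. \<integral>y. exp (s * of_real (z + y)) \<partial>H) = (\<lambda>z. exp (s * of_real z) * (\<integral>y. exp (s * of_real y) \<partial>H))"
    by (simp add: algebra_simps exp_add)
  also have "(\<integral>z. exp (s * of_real z) * (\<integral>y. exp (s * of_real y) \<partial>H) \<partial>\<mu>) = mgf s * (\<integral>y. exp (s * of_real y) \<partial>H)"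
    by (simp add: mgf_def)
  finally have *: "(\<integral>y. exp (s * of_real y) \<partial>H) * (1 - mgf s) = 1" by (simp add: algebra_simps)
  then have "1 - mgf s \<noteq> 0" by auto
  with * show ?thesis by (simp add: field_simps)
qed

end

section \<open>Exponential rate in the renewal theorem\<close>

lemma has_integral_exp_half_line:
  assumes s: "Re s < 0"
  shows "integrable lborel (\<lambda>y. indicator {0..} y *\<^sub>R exp (s * of_real y))"
    and "(\<integral>y. indicator {0..} y *\<^sub>R exp (s * of_real y) \<partial>lborel) = - (1 / s)"
proof -
  have s0: "s \<noteq> 0" using s by auto
  have "(\<integral>\<^sup>+y. ennreal (exp (Re s * y)) * indicator {0..} y \<partial>lborel) = ennreal (0 - (1 / Re s) * exp (Re s * 0))"
  proof (rule nn_integral_FTC_atLeast)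
    show "((\<lambda>y. (1 / Re s) * exp (Re s * y)) \<longlongrightarrow> 0) at_top" using s by real_asymp
  qed (use s in \<open>auto intro!: derivative_eq_intros\<close>)
  moreover have "ennreal (norm (indicator {0..} y *\<^sub>R exp (s * of_real y))) = ennreal (exp (Re s * y)) * indicator {0..} y" for y :: real
    by (auto simp: indicator_def)
  ultimately have fin: "(\<integral>\<^sup>+y. ennreal (norm (indicator {0..} y *\<^sub>R exp (s * of_real y))) \<partial>lborel) < \<infinity>"
    by simp
  show int: "integrable lborel (\<lambda>y. indicator {0..} y *\<^sub>R exp (s * of_real y))"
    by (rule integrableI_bounded[OF _ fin]) auto
  have int': "integrable lborel (\<lambda>y. indicator (einterval 0 \<infinity>) y *\<^sub>R exp (s * of_real y))"
  proof (rule Bochner_Integration.integrable_bound[OF int])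
    show "AE y in lborel. norm (indicator (einterval 0 \<infinity>) y *\<^sub>R exp (s * of_real y)) \<le> norm (indicator {0..} y *\<^sub>R exp (s * of_real y))"
      by (auto simp: indicator_def einterval_def)
  qed auto
  have "(LBINT y=0..\<infinity>. exp (s * of_real y)) = 0 - 1 / s"
  proof (rule interval_integral_FTC_integrable)
    have D: "((\<lambda>w. exp (s * w) / s) has_field_derivative exp (s * w)) (at w)" for w
      using s0 by (auto intro!: derivative_eq_intros)
    show "((\<lambda>y. exp (s * of_real y) / s) has_vector_derivative exp (s * of_real x)) (at x)" for x
      by (rule has_vector_derivative_real_field[OF D])
    have "isCont (\<lambda>w::real. exp (s * of_real w) / s) 0"
      by (intro continuous_intros) (use s0 in auto)
    then have "((\<lambda>w::real. exp (s * of_real w) / s) \<longlongrightarrow> 1 / s) (at_right 0)"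
      by (simp add: isCont_def filterlim_at_split)
    then show "(((\<lambda>y. exp (s * of_real y) / s) \<circ> real_of_ereal) \<longlongrightarrow> 1 / s) (at_right 0)"
      by (simp add: zero_ereal_def ereal_tendsto_simps1(2))
    have "((\<lambda>y. exp (Re s * y) / norm s) \<longlongrightarrow> 0) at_top" using s s0 by real_asymp
    then have "((\<lambda>y::real. exp (s * of_real y) / s) \<longlongrightarrow> 0) at_top"
      by (rule Lim_null_comparison[rotated]) (auto simp: norm_divide)
    then show "(((\<lambda>y. exp (s * of_real y) / s) \<circ> real_of_ereal) \<longlongrightarrow> 0) (at_left \<infinity>)"
      by (simp add: ereal_tendsto_simps1)
    show "set_integrable lborel (einterval 0 \<infinity>) (\<lambda>y. exp (s * of_real y))"
      unfolding set_integrable_def by (rule int')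
  qed auto
  then have "(\<integral>y. indicator (einterval 0 \<infinity>) y *\<^sub>R exp (s * of_real y) \<partial>lborel) = - (1 / s)"
    by (simp add: interval_lebesgue_integral_def set_lebesgue_integral_def)
  also have "(\<integral>y. indicator (einterval 0 \<infinity>) y *\<^sub>R exp (s * of_real y) \<partial>lborel) = (\<integral>y. indicator {0..} y *\<^sub>R exp (s * of_real y) \<partial>lborel)"
  proof (rule integral_cong_AE)
    show "AE y in lborel. indicator (einterval 0 \<infinity>) y *\<^sub>R exp (s * of_real y) = indicator {0..} y *\<^sub>R exp (s * of_real y)"
      using AE_lborel_singleton[of 0] by eventually_elim (auto simp: indicator_def einterval_def)
  qed auto
  finally show "(\<integral>y. indicator {0..} y *\<^sub>R exp (s * of_real y) \<partial>lborel) = - (1 / s)" .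
qed

text \<open>This is the Lebesgue counterpart of the renewal convolution of the ramp. For x >= 0 the
  whole ramp is seen and the value is the constant 1/\<alpha>^2; for x < 0 only the part beyond -x
  is.\<close>

lemma ramp_integral_half_line:
  assumes a: "\<alpha> > 0"
  shows "(\<integral>\<^sup>+y. ennreal (ramp \<alpha> (y - x)) * indicator {0..} y \<partial>lborel)
    = ennreal ((\<alpha> * max 0 (- x) + 1) / \<alpha>\<^sup>2 * exp (- \<alpha> * max 0 (- x)))"
proof -
  define F where "F y = - ((\<alpha> * (y - x) + 1) / \<alpha>\<^sup>2 * exp (- \<alpha> * (y - x)))" for y
  let ?m = "max 0 x"
  have "(\<integral>\<^sup>+y. ennreal (ramp \<alpha> (y - x)) * indicator {0..} y \<partial>lborel)
      = (\<integral>\<^sup>+y. ennreal ((y - x) * exp (- \<alpha> * (y - x))) * indicator {?m..} y \<partial>lborel)"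
    by (intro nn_integral_cong) (auto simp: ramp_def indicator_def max_def)
  also have "\<dots> = ennreal (0 - F ?m)"
  proof (rule nn_integral_FTC_atLeast)
    show "(F has_real_derivative (y - x) * exp (- \<alpha> * (y - x))) (at y)" for y
      unfolding F_def using a
      by (auto intro!: derivative_eq_intros simp: field_simps power2_eq_square)
    show "(F \<longlongrightarrow> 0) at_top" unfolding F_def using a by real_asymp
  qed auto
  also have "0 - F ?m = (\<alpha> * max 0 (- x) + 1) / \<alpha>\<^sup>2 * exp (- \<alpha> * max 0 (- x))"
    by (auto simp: F_def max_def)
  finally show ?thesis .
qed

context tilted_walk begin

text \<open>The difference quotient of \<open>mgf\<close> at 0 with the removable singularity filled
  in. Thus 1 - \<open>mgf s\<close> = - s \<open>mgf1 s\<close>, and the zeros of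
  \<open>mgf1\<close> are the remaining obstructions to continuing the transform of H.\<close>

definition mgf1 :: "complex \<Rightarrow> complex" where
  "mgf1 s = (if s = 0 then deriv mgf 0 else (mgf s - mgf 0) / (s - 0))"

lemma mgf1_holomorphic: "mgf1 holomorphic_on {s. - \<alpha> < Re s \<and> Re s < \<theta>}"
proof -
  have "open {s. - \<alpha> < Re s \<and> Re s < \<theta>}"
    using open_Int[OF open_halfspace_Re_gt[of "- \<alpha>"] open_halfspace_Re_lt[of \<theta>]] by (simp add: Int_def)
  from pole_lemma_open[OF mgf_holomorphic this, of 0] show ?thesis
    by (simp add: mgf1_def[abs_def])
qed

lemma mgf1_0: "mgf1 0 = drift"
proof -
  have "(mgf has_field_derivative (\<integral>z. of_real z * exp (0 * of_real z) \<partial>\<mu>)) (at 0)"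
    using \<alpha>_pos \<theta>_pos by (intro mgf_has_derivative) auto
  then show ?thesis by (simp add: mgf1_def DERIV_imp_deriv drift_def)
qed

text \<open>Strong non-lattice speaks about the imaginary axis only. A Lipschitz bound in the real
  part, uniform in the imaginary part, carries it into a strip.\<close>

lemma mgf_strip_close:
  assumes d: "d > 0" "2 * d \<le> \<alpha>" "2 * d \<le> \<theta>"
  obtains C where "C > 0" "\<And>c t. \<bar>c\<bar> \<le> d \<Longrightarrow> norm (mgf (Complex c t) - mgf (\<i> * of_real t)) \<le> C * \<bar>c\<bar>"
proof
  define g where "g z = (1 / d) * (exp ((2 * d) * z) + exp ((- 2 * d) * z))" for z
  have gi: "integrable \<mu> g"
    unfolding g_def using d by (intro integrable_mult_right Bochner_Integration.integrable_add integrable_exp) auto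
  have gb: "norm (exp (of_real c * of_real z) - 1 :: complex) \<le> \<bar>c\<bar> * g z" if "\<bar>c\<bar> \<le> d" for c z
  proof -
    have "norm (exp (of_real c * of_real z) - 1 :: complex) \<le> norm (of_real c * of_real z :: complex) * exp (norm (of_real c * of_real z :: complex))"
      by (rule norm_exp_minus_1_le)
    also have "\<dots> = \<bar>c\<bar> * (\<bar>z\<bar> * exp (\<bar>c\<bar> * \<bar>z\<bar>))" by (simp add: norm_mult)
    also have "\<dots> \<le> \<bar>c\<bar> * (((1 / d) * exp (d * \<bar>z\<bar>)) * exp (d * \<bar>z\<bar>))"
    proof -
      have "d * \<bar>z\<bar> \<le> exp (d * \<bar>z\<bar>)" using exp_ge_add_one_self[of "d * \<bar>z\<bar>"] by linarith
      then have "\<bar>z\<bar> \<le> (1 / d) * exp (d * \<bar>z\<bar>)" using d by (simp add: field_simps)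
      moreover have "exp (\<bar>c\<bar> * \<bar>z\<bar>) \<le> exp (d * \<bar>z\<bar>)" using that by (simp add: mult_right_mono)
      ultimately show ?thesis using d by (intro mult_left_mono mult_mono) auto
    qed
    also have "((1 / d) * exp (d * \<bar>z\<bar>)) * exp (d * \<bar>z\<bar>) = (1 / d) * exp (2 * d * \<bar>z\<bar>)" by (simp flip: exp_add)
    also have "\<bar>c\<bar> * \<dots> \<le> \<bar>c\<bar> * g z"
      unfolding g_def using d by (intro mult_left_mono; cases "z \<ge> 0") (auto simp: add_increasing add_increasing2)
    finally show ?thesis .
  qed
  have gn: "g z \<ge> 0" for z using d by (simp add: g_def)
  show "(\<integral>z. g z \<partial>\<mu>) + 1 > 0" using integral_nonneg_AE[of g \<mu>] gn by (simp add: add_nonneg_pos)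
  show "norm (mgf (Complex c t) - mgf (\<i> * of_real t)) \<le> ((\<integral>z. g z \<partial>\<mu>) + 1) * \<bar>c\<bar>" if c: "\<bar>c\<bar> \<le> d" for c t
  proof -
    have i: "integrable \<mu> (\<lambda>z. exp (Complex c t * of_real z))" "integrable \<mu> (\<lambda>z. exp ((\<i> * of_real t) * of_real z))"
      using d c \<alpha>_pos \<theta>_pos by (auto intro!: integrable_cexp)
    have "norm (mgf (Complex c t) - mgf (\<i> * of_real t)) = norm (\<integral>z. exp (Complex c t * of_real z) - exp ((\<i> * of_real t) * of_real z) \<partial>\<mu>)"
      unfolding mgf_def using i by simp
    also have "\<dots> \<le> (\<integral>z. norm (exp (Complex c t * of_real z) - exp ((\<i> * of_real t) * of_real z)) \<partial>\<mu>)"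
      by (rule integral_norm_bound)
    also have "\<dots> \<le> (\<integral>z. \<bar>c\<bar> * g z \<partial>\<mu>)"
    proof (rule integral_mono)
      fix z
      have "exp (Complex c t * of_real z) - exp ((\<i> * of_real t) * of_real z) = exp ((\<i> * of_real t) * of_real z) * (exp (of_real c * of_real z) - 1)"
        by (simp add: Complex_eq algebra_simps exp_add)
      then show "norm (exp (Complex c t * of_real z) - exp ((\<i> * of_real t) * of_real z)) \<le> \<bar>c\<bar> * g z"
        using gb[OF c, of z] by (simp add: norm_mult)
    qed (use i gi in auto)
    also have "\<dots> \<le> ((\<integral>z. g z \<partial>\<mu>) + 1) * \<bar>c\<bar>" by (simp add: algebra_simps)
    finally show ?thesis .
  qed
qed

text \<open>Far from the real axis |\<open>mgf\<close>| stays below 1, which excludes zeros of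
  \<open>mgf1\<close>. In the remaining compact rectangle the zeros form a compact set that misses
  the imaginary axis: at 0 the value is the positive drift, elsewhere \<open>mgf\<close> is not 1.
  Hence they keep a positive distance from the axis.\<close>

lemma strip:
  obtains r b T where "r > 0" "r < \<alpha>" "r < \<theta>" "b < 1" "T > 0"
    "\<And>s. \<bar>Re s\<bar> \<le> r \<Longrightarrow> \<bar>Im s\<bar> \<ge> T \<Longrightarrow> norm (mgf s) \<le> b"
    "\<And>s. \<bar>Re s\<bar> \<le> r \<Longrightarrow> mgf1 s \<noteq> 0"
proof -
  obtain b T where bT: "b < 1" "T > 0" "\<And>t. \<bar>t\<bar> \<ge> T \<Longrightarrow> norm (mgf (\<i> * of_real t)) \<le> b"
    using snl_bound by blast
  define d where "d = min \<alpha> \<theta> / 4"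
  have d: "d > 0" "2 * d \<le> \<alpha>" "2 * d \<le> \<theta>" "d < \<alpha>" "d < \<theta>" using \<alpha>_pos \<theta>_pos by (auto simp: d_def)
  obtain C where C: "C > 0" "\<And>c t. \<bar>c\<bar> \<le> d \<Longrightarrow> norm (mgf (Complex c t) - mgf (\<i> * of_real t)) \<le> C * \<bar>c\<bar>"
    using mgf_strip_close[OF d(1-3)] by blast
  \<comment> \<open>Within this distance the Lipschitz bound changes |\<open>mgf\<close>| by at most
    (1 - b) / 2, so it moves no further than halfway from b to 1.\<close>
  define r1 where "r1 = min d ((1 - b) / (2 * C))"
  have r1: "r1 > 0" "r1 \<le> d" using d bT C by (auto simp: r1_def)
  have far: "norm (mgf s) \<le> (1 + b) / 2" if "\<bar>Re s\<bar> \<le> r1" "\<bar>Im s\<bar> \<ge> T" for s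
  proof -
    have "norm (mgf s) \<le> norm (mgf (\<i> * of_real (Im s))) + norm (mgf (Complex (Re s) (Im s)) - mgf (\<i> * of_real (Im s)))"
      using norm_triangle_sub[of "mgf s"] by simp
    also have "\<dots> \<le> b + C * \<bar>Re s\<bar>" using bT(3)[OF that(2)] C(2)[of "Re s" "Im s"] that r1 by auto
    also have "C * \<bar>Re s\<bar> \<le> C * ((1 - b) / (2 * C))" using that C by (intro mult_left_mono) (auto simp: r1_def)
    also have "\<dots> = (1 - b) / 2" using C by simp
    finally show ?thesis by (simp add: field_simps)
  qed
  define B where "B = {s. \<bar>Re s\<bar> \<le> r1 \<and> \<bar>Im s\<bar> \<le> T}"
  have B: "B = cbox (Complex (- r1) (- T)) (Complex r1 T)"
    by (auto simp: B_def in_cbox_complex_iff)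
  have cont: "continuous_on B mgf1"
    by (rule continuous_on_subset[OF holomorphic_on_imp_continuous_on[OF mgf1_holomorphic]])
       (use r1 d in \<open>auto simp: B_def\<close>)
  define Zs where "Zs = {s \<in> B. mgf1 s = 0}"
  have compZ: "compact Zs"
  proof -
    have "closed Zs" unfolding Zs_def
      by (rule continuous_closed_preimage_constant[OF cont]) (unfold B, rule closed_cbox)
    moreover have "bounded Zs" by (rule bounded_subset[of B]) (auto simp: Zs_def B)
    ultimately show ?thesis by (simp add: compact_eq_bounded_closed)
  qed
  have Re0: "Re s \<noteq> 0" if "mgf1 s = 0" for s
  proof
    assume "Re s = 0"
    then have s: "s = \<i> * of_real (Im s)" by (simp add: complex_eq_iff)
    show False
    proof (cases "s = 0")
      case True then show False using that mgf1_0 drift_pos by simp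
    next
      case False
      then have "mgf s = 1" using that by (simp add: mgf1_def mgf_0)
      moreover have "Im s \<noteq> 0" using False s by (metis mult_zero_right of_real_0)
      ultimately show False using mgf_imaginary_ne_1[of "Im s"] s by simp
    qed
  qed
  obtain r2 where r2: "r2 > 0" "\<And>s. s \<in> Zs \<Longrightarrow> \<bar>Re s\<bar> > r2"
  proof (cases "Zs = {}")
    case True then show ?thesis using that[of 1] by auto
  next
    case False
    have "continuous_on Zs (\<lambda>s. \<bar>Re s\<bar>)" by (intro continuous_intros)
    from continuous_attains_inf[OF compZ False this] obtain s0 where s0: "s0 \<in> Zs" "\<And>s. s \<in> Zs \<Longrightarrow> \<bar>Re s0\<bar> \<le> \<bar>Re s\<bar>"
      by blast
    have "\<bar>Re s0\<bar> > 0" using Re0[of s0] s0 by (auto simp: Zs_def)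
    then show ?thesis using s0 by (intro that[of "\<bar>Re s0\<bar> / 2"]) force+
  qed
  show ?thesis
  proof (rule that[of "min r1 r2" "(1 + b) / 2" T])
    show "mgf1 s \<noteq> 0" if "\<bar>Re s\<bar> \<le> min r1 r2" for s
    proof (cases "\<bar>Im s\<bar> \<le> T")
      case True
      then show ?thesis using r2(2)[of s] that by (auto simp: Zs_def B_def)
    next
      case False
      then have "norm (mgf s) \<le> (1 + b) / 2" using that by (intro far) auto
      then have "mgf s \<noteq> 1" using bT by auto
      moreover have "s \<noteq> 0" using False bT by auto
      ultimately show ?thesis by (simp add: mgf1_def mgf_0)
    qed
  qed (use far r1 r2 d bT in auto)
qed

text \<open>With m = 1 / \<open>mgf1\<close>, the transform of H is -m(s)/s and m(0) =
  1/\<open>drift\<close>. Adding 1/(\<open>drift\<close> s) therefore gives minus the difference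
  quotient of m at 0, which is holomorphic. Boundedness comes from compactness near the real axis
  and from |\<open>mgf\<close>| <= b < 1 away from it.\<close>

lemma regularised_transform:
  obtains r r' C G where "r > 0" "r < r'" "r < \<alpha>" "r' < \<alpha>"
    "G holomorphic_on {s. \<bar>Re s\<bar> < r'}"
    "\<And>s. \<bar>Re s\<bar> \<le> r \<Longrightarrow> norm (G s) \<le> C"
    "\<And>s. \<bar>Re s\<bar> \<le> r \<Longrightarrow> s \<noteq> 0 \<Longrightarrow> G s = 1 / (1 - mgf s) + 1 / (complex_of_real drift * s)"
proof -
  obtain r' b T where r': "r' > 0" "r' < \<alpha>" "r' < \<theta>" and b: "b < 1" "T > 0"
    "\<And>s. \<bar>Re s\<bar> \<le> r' \<Longrightarrow> \<bar>Im s\<bar> \<ge> T \<Longrightarrow> norm (mgf s) \<le> b"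
    and nz: "\<And>s. \<bar>Re s\<bar> \<le> r' \<Longrightarrow> mgf1 s \<noteq> 0"
    using strip by metis
  define W where "W = {s. \<bar>Re s\<bar> < r'}"
  have Wo: "open W"
  proof -
    have *: "W = {s. Re s < r'} \<inter> {s. Re s > - r'}" by (auto simp: W_def)
    show "open W" unfolding * by (intro open_Int open_halfspace_Re_lt open_halfspace_Re_gt)
  qed
  define m where "m s = 1 / mgf1 s" for s
  have mh: "m holomorphic_on W"
    unfolding m_def
    by (intro holomorphic_intros holomorphic_on_subset[OF mgf1_holomorphic])
       (use nz r' in \<open>auto simp: W_def\<close>)
  define G where "G s = - (if s = 0 then deriv m 0 else (m s - m 0) / (s - 0))" for s
  have Gh: "G holomorphic_on W"
    unfolding G_def by (intro holomorphic_intros pole_lemma_open[OF mh Wo])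
  have Ge: "G s = 1 / (1 - mgf s) + 1 / (complex_of_real drift * s)" if "\<bar>Re s\<bar> \<le> r'" "s \<noteq> 0" for s
  proof -
    have "mgf1 s \<noteq> 0" using nz that by simp
    then have ne: "mgf s \<noteq> 1" using that by (simp add: mgf1_def mgf_0)
    have m: "m s = s / (mgf s - 1)" using that by (simp add: m_def mgf1_def mgf_0)
    have "G s = - (s / (mgf s - 1)) / s + (1 / drift) / s"
      using that by (simp add: G_def m) (simp add: m_def mgf1_0 diff_divide_distrib)
    also have "- (s / (mgf s - 1)) / s = 1 / (1 - mgf s)"
      using that ne by (simp add: field_simps)
    finally show ?thesis by simp
  qed
  \<comment> \<open>The closed strip must lie inside the open one, so that G is continuous on the
    compact rectangle that bounds it.\<close>
  define r where "r = r' / 2"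
  have r: "r > 0" "r < r'" "r < \<alpha>" using r' by (auto simp: r_def)
  have "bounded (G ` cbox (Complex (- r) (- T)) (Complex r T))"
    by (intro compact_imp_bounded compact_continuous_image continuous_on_subset[OF holomorphic_on_imp_continuous_on[OF Gh]] compact_cbox)
       (use r in \<open>auto simp: in_cbox_complex_iff W_def\<close>)
  then obtain C1 where C1: "\<And>s. s \<in> cbox (Complex (- r) (- T)) (Complex r T) \<Longrightarrow> norm (G s) \<le> C1"
    by (auto simp: bounded_iff)
  define C where "C = max C1 (1 / (1 - b) + 1 / (drift * T))"
  have "norm (G s) \<le> C" if s: "\<bar>Re s\<bar> \<le> r" for s
    proof (cases "\<bar>Im s\<bar> \<le> T")
      case True
      then have "norm (G s) \<le> C1" using s by (intro C1) (auto simp: in_cbox_complex_iff)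
      then show ?thesis by (simp add: C_def)
    next
      case False
      then have s0: "s \<noteq> 0" using b by auto
      have "norm (mgf s) \<le> b" using False s r by (intro b(3)) auto
      then have "norm (1 - mgf s) \<ge> 1 - b" using norm_triangle_ineq2[of 1 "mgf s"] by simp
      then have "norm (1 / (1 - mgf s)) \<le> 1 / (1 - b)"
        using b by (auto simp: norm_divide intro!: frac_le)
      moreover have "norm (1 / (complex_of_real drift * s)) \<le> 1 / (drift * T)"
      proof -
        have "norm s \<ge> T" using False abs_Im_le_cmod[of s] by linarith
        then show ?thesis using drift_pos b by (auto simp: norm_divide norm_mult intro!: frac_le mult_left_mono)
      qed
      moreover have "norm (G s) \<le> norm (1 / (1 - mgf s)) + norm (1 / (complex_of_real drift * s))"
        using Ge[of s] s r s0 norm_triangle_ineq[of "1 / (1 - mgf s)" "1 / (complex_of_real drift * s)"] by simp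
      ultimately have "norm (G s) \<le> 1 / (1 - b) + 1 / (drift * T)" by linarith
      then show ?thesis by (simp add: C_def)
    qed
  moreover have "G s = 1 / (1 - mgf s) + 1 / (complex_of_real drift * s)" if "\<bar>Re s\<bar> \<le> r" "s \<noteq> 0" for s
    using that r by (intro Ge) auto
  ultimately show ?thesis
    using that[OF r(1) r(2) r(3) r'(2) Gh[unfolded W_def]] by blast
qed

definition "ramp_renewal x = (\<integral>y. ramp \<alpha> (y - x) \<partial>H)"

text \<open>The convolution of the ramp with Lebesgue measure on the half-line [0, \<infinity>)
  divided by the drift.\<close>

definition "ramp_limit x = (\<alpha> * max 0 (- x) + 1) / \<alpha>\<^sup>2 * exp (- \<alpha> * max 0 (- x)) / drift"

text \<open>On the line Re s = -r the difference is an inversion integral with the bounded function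
  G. The factor exp (-s x) contributes exp (r x) in modulus there, which decays for x <= 0; for x >=
  0 the line is first moved to Re s = r, where the modulus is exp (-r x).\<close>

lemma ramp_renewal_rate:
  obtains r C where "r > 0" "r < \<alpha>" "C > 0" "\<And>x. \<bar>ramp_renewal x - ramp_limit x\<bar> \<le> C * exp (- r * \<bar>x\<bar>)"
    "\<And>x. integrable H (\<lambda>y. ramp \<alpha> (y - x))"
proof -
  obtain r r' C G where r: "r > 0" "r < r'" "r < \<alpha>" "r' < \<alpha>"
    and Gh: "G holomorphic_on {s. \<bar>Re s\<bar> < r'}"
    and GC: "\<And>s. \<bar>Re s\<bar> \<le> r \<Longrightarrow> norm (G s) \<le> C"
    and Ge: "\<And>s. \<bar>Re s\<bar> \<le> r \<Longrightarrow> s \<noteq> 0 \<Longrightarrow> G s = 1 / (1 - mgf s) + 1 / (complex_of_real drift * s)"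
    using regularised_transform by metis
  have C0: "C \<ge> 0" using GC[of 0] r norm_ge_zero[of "G 0"] by (simp del: norm_ge_zero)
  \<comment> \<open>The candidate limit of H. Its transform -1/(\<open>drift\<close> s) for Re s < 0
    is exactly the singular part of the transform of H.\<close>
  define U where "U = density lborel (\<lambda>y::real. ennreal (indicator {0..} y / drift))"
  have dp: "indicator {0..} y / drift \<ge> 0" for y :: real using drift_pos by simp
  have setsU: "sets U = sets borel" by (simp add: U_def)
  have sfU: "sigma_finite_measure U"
    unfolding U_def by (subst sigma_finite_measure.sigma_finite_iff_density_finite[OF sigma_finite_lborel]) auto
  have intU_iff: "integrable U f \<longleftrightarrow> integrable lborel (\<lambda>y. (indicator {0..} y / drift) *\<^sub>R f y)"
    and intU: "(\<integral>y. f y \<partial>U) = (\<integral>y. (indicator {0..} y / drift) *\<^sub>R f y \<partial>lborel)"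
    if "f \<in> borel_measurable borel" for f :: "real \<Rightarrow> 'c::{banach, second_countable_topology}"
    unfolding U_def using that drift_pos by (auto simp: integrable_density integral_density)
  have expU: "(\<integral>y. exp (s * of_real y) \<partial>U) = - (1 / (complex_of_real drift * s))" if "Re s < 0" for s :: complex
  proof -
    have "(\<integral>y. exp (s * of_real y) \<partial>U) = (\<integral>y. (1 / drift) *\<^sub>R (indicator {0..} y *\<^sub>R exp (s * of_real y)) \<partial>lborel)"
      by (subst intU) auto
    also have "\<dots> = (1 / drift) *\<^sub>R - (1 / s)"
      by (subst integral_scaleR_right) (simp add: has_integral_exp_half_line(2)[OF that])
    finally show ?thesis by (simp add: scaleR_conv_of_real)
  qed
  have intexpU: "integrable U (\<lambda>y. exp (c * y))" if "c < 0" for c :: real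
  proof -
    have "integrable lborel (\<lambda>y. norm (indicator {0..} y *\<^sub>R exp (complex_of_real c * of_real y)))"
      using that by (intro integrable_norm has_integral_exp_half_line(1)) auto
    then have "integrable lborel (\<lambda>y. (1 / drift) * (indicator {0..} y * exp (c * y)))"
      by (intro integrable_mult_right) simp
    then show ?thesis by (subst intU_iff) (auto simp: mult_ac)
  qed
  have rampU: "(\<integral>y. ramp \<alpha> (y - x) \<partial>U) = ramp_limit x" for x
  proof -
    have "(\<integral>y. ramp \<alpha> (y - x) \<partial>U) = (1 / drift) * (\<integral>y. ramp \<alpha> (y - x) * indicator {0..} y \<partial>lborel)"
      by (subst intU) (auto simp: mult_ac simp flip: integral_mult_right_zero)
    also have "(\<integral>y. ramp \<alpha> (y - x) * indicator {0..} y \<partial>lborel) = enn2real (\<integral>\<^sup>+y. ennreal (ramp \<alpha> (y - x)) * indicator {0..} y \<partial>lborel)"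
      by (subst integral_eq_nn_integral) (auto simp: ramp_nonneg ennreal_mult ennreal_indicator)
    also have "\<dots> = (\<alpha> * max 0 (- x) + 1) / \<alpha>\<^sup>2 * exp (- \<alpha> * max 0 (- x))"
      using \<alpha>_pos by (subst ramp_integral_half_line[OF \<alpha>_pos]) (simp add: add_nonneg_nonneg)
    finally show ?thesis by (simp add: ramp_limit_def)
  qed
  have c: "- \<alpha> < - r" "- r < 0" "\<alpha> + - r > 0" using r by auto
  define f where "f x s = exp (- (s * of_real x)) * G s / (\<alpha> + s)\<^sup>2" for x :: real and s :: complex
  define J where "J = (\<integral>t. 1 / ((\<alpha> - r)\<^sup>2 + t\<^sup>2) \<partial>lborel)"
  have Ji: "integrable lborel (\<lambda>t. 1 / ((\<alpha> - r)\<^sup>2 + t\<^sup>2))" using r by (intro integrable_inverse_quadratic) auto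
  have J0: "J \<ge> 0" unfolding J_def by simp
  have fb: "norm (f x s) \<le> exp (- (Re s * x)) * C * (1 / ((\<alpha> - r)\<^sup>2 + (Im s)\<^sup>2))" if s: "\<bar>Re s\<bar> \<le> r" for x s
  proof -
    have "norm (1 / (\<alpha> + s)\<^sup>2) = 1 / ((\<alpha> + Re s)\<^sup>2 + (Im s)\<^sup>2)"
      by (simp add: norm_divide norm_power cmod_power2)
    also have "\<dots> \<le> 1 / ((\<alpha> - r)\<^sup>2 + (Im s)\<^sup>2)"
      using s r by (intro divide_left_mono add_right_mono power_mono mult_pos_pos add_pos_nonneg) auto
    finally have "norm (1 / (\<alpha> + s)\<^sup>2) \<le> 1 / ((\<alpha> - r)\<^sup>2 + (Im s)\<^sup>2)" .
    then have "norm (exp (- (s * of_real x))) * norm (G s) * norm (1 / (\<alpha> + s)\<^sup>2) \<le> exp (- (Re s * x)) * C * (1 / ((\<alpha> - r)\<^sup>2 + (Im s)\<^sup>2))"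
      using GC[OF s] C0 by (intro mult_mono) auto
    then show ?thesis by (simp add: f_def norm_mult norm_divide)
  qed
  have fh: "f x holomorphic_on {s. \<bar>Re s\<bar> < r'}" for x
  proof -
    have "complex_of_real \<alpha> + s \<noteq> 0" if "\<bar>Re s\<bar> < r'" for s
    proof
      assume "complex_of_real \<alpha> + s = 0"
      then have "Re (complex_of_real \<alpha> + s) = 0" by (simp only: zero_complex.sel)
      then show False using that r by simp
    qed
    then show ?thesis unfolding f_def by (intro holomorphic_intros Gh) auto
  qed
  have fm: "(\<lambda>t. f x (Complex c t)) \<in> borel_measurable borel" if "\<bar>c\<bar> \<le> r" for x c
    using that r
    by (intro borel_measurable_continuous_onI continuous_on_compose2[OF holomorphic_on_imp_continuous_on[OF fh[of x]]] continuous_intros)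
       (auto simp: Complex_eq intro!: continuous_intros)
  have fi: "norm (\<integral>t. f x (Complex c t) \<partial>lborel) \<le> exp (- (c * x)) * C * J" if cr: "\<bar>c\<bar> \<le> r" for x c
  proof -
    have b: "norm (f x (Complex c t)) \<le> exp (- (c * x)) * C * (1 / ((\<alpha> - r)\<^sup>2 + t\<^sup>2))" for t
      using fb[of "Complex c t" x] cr by simp
    have g: "integrable lborel (\<lambda>t. exp (- (c * x)) * C * (1 / ((\<alpha> - r)\<^sup>2 + t\<^sup>2)))"
      by (intro integrable_mult_right Ji)
    have fI: "integrable lborel (\<lambda>t. f x (Complex c t))"
      by (rule Bochner_Integration.integrable_bound[OF g])
         (use fm[OF cr] b C0 in \<open>auto intro!: AE_I2 order_trans[OF b]\<close>)
    have "norm (\<integral>t. f x (Complex c t) \<partial>lborel) \<le> (\<integral>t. norm (f x (Complex c t)) \<partial>lborel)"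
      by (rule integral_norm_bound)
    also have "\<dots> \<le> (\<integral>t. exp (- (c * x)) * C * (1 / ((\<alpha> - r)\<^sup>2 + t\<^sup>2)) \<partial>lborel)"
      by (rule integral_mono[OF integrable_norm[OF fI] g b])
    also have "\<dots> = exp (- (c * x)) * C * J" by (simp only: integral_mult_right_zero J_def)
    finally show ?thesis .
  qed
  have shift: "(\<integral>t. f x (Complex (- r) t) \<partial>lborel) = (\<integral>t. f x (Complex r t) \<partial>lborel)" for x
  proof (rule integral_vertical_shift[OF r(1,2) fh])
    show "\<alpha> - r > 0" using r by simp
    show "norm (f x s) \<le> exp (r * \<bar>x\<bar>) * C / ((\<alpha> - r)\<^sup>2 + (Im s)\<^sup>2)" if "\<bar>Re s\<bar> \<le> r" for s
    proof -
      have "\<bar>Re s * x\<bar> \<le> r * \<bar>x\<bar>" using that by (simp add: abs_mult mult_right_mono)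
      then have "- (Re s * x) \<le> r * \<bar>x\<bar>" by linarith
      then have "exp (- (Re s * x)) * C * (1 / ((\<alpha> - r)\<^sup>2 + (Im s)\<^sup>2)) \<le> exp (r * \<bar>x\<bar>) * C * (1 / ((\<alpha> - r)\<^sup>2 + (Im s)\<^sup>2))"
        using C0 by (intro mult_right_mono) auto
      with fb[OF that, of x] show ?thesis by simp
    qed
  qed
  have intH: "integrable H (\<lambda>y. exp (- r * y))" by (rule integrable_H) (use c in auto)
  note RH = ramp_convolution_inversion[OF H.sigma_finite_measure_axioms sets_renewal_measure c(3) intH]
  note RU = ramp_convolution_inversion[OF sfU setsU c(3) intexpU[OF c(2)]]
  have main: "2 * pi * (ramp_renewal x - ramp_limit x) = (\<integral>t. f x (Complex (- r) t) \<partial>lborel)" for x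
  proof -
    define h where "h t = exp (- (Complex (- r) t * of_real x)) / (\<alpha> + Complex (- r) t)\<^sup>2" for t
    have "Complex (- r) t \<noteq> 0" for t using r by (simp add: complex_eq_iff)
    then have Gt: "G (Complex (- r) t) = 1 / (1 - mgf (Complex (- r) t)) + 1 / (complex_of_real drift * Complex (- r) t)" for t
      using r by (intro Ge) auto
    have H': "2 * pi * ramp_renewal x = (\<integral>t. exp (- (Complex (- r) t * of_real x)) * (1 / (1 - mgf (Complex (- r) t))) / (\<alpha> + Complex (- r) t)\<^sup>2 \<partial>lborel)"
      unfolding ramp_renewal_def RH(2) using c by (subst transform_H) auto
    have U': "2 * pi * ramp_limit x = (\<integral>t. exp (- (Complex (- r) t * of_real x)) * (- (1 / (complex_of_real drift * Complex (- r) t))) / (\<alpha> + Complex (- r) t)\<^sup>2 \<partial>lborel)"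
      unfolding rampU[symmetric] RU(2) using c by (subst expU) auto
    define k where "k t = exp (- (Complex (- r) t * of_real x)) * (- (1 / (complex_of_real drift * Complex (- r) t))) / (\<alpha> + Complex (- r) t)\<^sup>2" for t
    have [measurable]: "(\<lambda>t. Complex (- r) t) \<in> borel_measurable borel" by (auto simp: Complex_eq)
    have fI: "integrable lborel (\<lambda>t. f x (Complex (- r) t))"
      using fb[of "Complex (- r) _" x] r C0
      by (intro Bochner_Integration.integrable_bound[OF integrable_mult_right[OF Ji, of "exp (r * x) * C"]])
         (auto simp: fm)
    have kI: "integrable lborel k"
    proof (rule Bochner_Integration.integrable_bound[OF integrable_mult_right[OF Ji, of "exp (r * x) / (drift * r)"]])
      show "k \<in> borel_measurable lborel" unfolding k_def by simp
      show "AE t in lborel. norm (k t) \<le> norm (exp (r * x) / (drift * r) * (1 / ((\<alpha> - r)\<^sup>2 + t\<^sup>2)))"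
      proof (rule AE_I2)
        fix t
        have "norm (1 / (\<alpha> + Complex (- r) t)\<^sup>2) = 1 / ((\<alpha> - r)\<^sup>2 + t\<^sup>2)"
          by (simp add: norm_divide norm_power cmod_power2)
        moreover have "norm (1 / (complex_of_real drift * Complex (- r) t)) \<le> 1 / (drift * r)"
          using abs_Re_le_cmod[of "Complex (- r) t"] r drift_pos
          by (auto simp: norm_divide norm_mult intro!: frac_le mult_left_mono)
        ultimately have "exp (r * x) * norm (1 / (complex_of_real drift * Complex (- r) t)) * norm (1 / (\<alpha> + Complex (- r) t)\<^sup>2)
          \<le> exp (r * x) * (1 / (drift * r)) * (1 / ((\<alpha> - r)\<^sup>2 + t\<^sup>2))"
          using r drift_pos by (intro mult_mono) auto
        moreover have "norm (k t) = exp (r * x) * norm (1 / (complex_of_real drift * Complex (- r) t)) * norm (1 / (\<alpha> + Complex (- r) t)\<^sup>2)"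
          by (simp add: k_def norm_mult norm_divide)
        ultimately show "norm (k t) \<le> norm (exp (r * x) / (drift * r) * (1 / ((\<alpha> - r)\<^sup>2 + t\<^sup>2)))"
          using r drift_pos by simp
      qed
    qed
    \<comment> \<open>By the formula for G, the integrand belonging to H is \<open>f\<close> plus
      the integrand \<open>k\<close> belonging to U; integrating leaves only \<open>f\<close> for
      the difference.\<close>
    have e: "exp (- (Complex (- r) t * of_real x)) * (1 / (1 - mgf (Complex (- r) t))) / (\<alpha> + Complex (- r) t)\<^sup>2
        = f x (Complex (- r) t) + k t" for t
      unfolding f_def k_def Gt by (simp add: algebra_simps add_divide_distrib diff_divide_distrib)
    have "2 * pi * ramp_renewal x = (\<integral>t. f x (Complex (- r) t) \<partial>lborel) + 2 * pi * ramp_limit x"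
      unfolding H' e U' k_def[symmetric] using fI kI by simp
    then show ?thesis by (simp add: algebra_simps)
  qed
  have bound: "2 * pi * \<bar>ramp_renewal x - ramp_limit x\<bar> \<le> exp (- r * \<bar>x\<bar>) * (C * J)" for x
  proof -
    have "2 * pi * \<bar>ramp_renewal x - ramp_limit x\<bar> = norm (complex_of_real (2 * pi * (ramp_renewal x - ramp_limit x)))"
      by (simp only: norm_of_real abs_mult) simp
    also have "\<dots> = norm (\<integral>t. f x (Complex (- r) t) \<partial>lborel)" using main by simp
    also have "\<dots> \<le> exp (- r * \<bar>x\<bar>) * (C * J)"
    proof (cases "x \<ge> 0")
      case True
      then show ?thesis using fi[of r x] r unfolding shift by (simp add: mult_ac)
    next
      case False
      then show ?thesis using fi[of "- r" x] r by (simp add: mult_ac)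
    qed
    finally show ?thesis .
  qed
  show ?thesis
  proof (rule that[of r "C * J / (2 * pi) + 1"])
    show "\<bar>ramp_renewal x - ramp_limit x\<bar> \<le> (C * J / (2 * pi) + 1) * exp (- r * \<bar>x\<bar>)" for x
    proof -
      have "\<bar>ramp_renewal x - ramp_limit x\<bar> \<le> exp (- r * \<bar>x\<bar>) * (C * J) / (2 * pi)"
        using bound[of x] by (simp add: field_simps)
      also have "\<dots> \<le> (C * J / (2 * pi) + 1) * exp (- r * \<bar>x\<bar>)" by (simp add: algebra_simps)
      finally show ?thesis .
    qed
    show "C * J / (2 * pi) + 1 > 0" using C0 J0 by (simp add: add_nonneg_pos)
  qed (use r RH(1) in auto)
qed

end

section \<open>From ramps back to discounted masses of half-lines\<close>

lemma nn_integral_exp_abs: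
  assumes e: "\<epsilon> > (0::real)"
  shows "(\<integral>\<^sup>+s. ennreal (exp (- \<epsilon> * \<bar>x - s\<bar>)) \<partial>lborel) = ennreal (2 / \<epsilon>)"
proof -
  have half: "(\<integral>\<^sup>+s. ennreal (exp (- \<epsilon> * s)) * indicator {0..} s \<partial>lborel) = ennreal (1 / \<epsilon>)"
  proof -
    have "(\<integral>\<^sup>+s. ennreal (exp (- \<epsilon> * s)) * indicator {0..} s \<partial>lborel) = ennreal (0 - (- (1 / \<epsilon>) * exp (- \<epsilon> * 0)))"
    proof (rule nn_integral_FTC_atLeast)
      show "((\<lambda>s. - (1 / \<epsilon>) * exp (- \<epsilon> * s)) \<longlongrightarrow> 0) at_top" using e by real_asymp
    qed (use e in \<open>auto intro!: derivative_eq_intros\<close>)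
    then show ?thesis by simp
  qed
  have r: "(\<integral>\<^sup>+s. ennreal (exp (- \<epsilon> * \<bar>x - s\<bar>)) * indicator {x..} s \<partial>lborel) = ennreal (1 / \<epsilon>)"
  proof (subst nn_integral_real_affine[where c=1 and t=x])
    have "(\<integral>\<^sup>+s. ennreal (exp (- \<epsilon> * \<bar>x - (x + 1 * s)\<bar>)) * indicator {x..} (x + 1 * s) \<partial>lborel)
       = (\<integral>\<^sup>+s. ennreal (exp (- \<epsilon> * s)) * indicator {0..} s \<partial>lborel)"
      by (intro nn_integral_cong) (auto simp: indicator_def)
    then show "ennreal \<bar>1\<bar> * (\<integral>\<^sup>+s. ennreal (exp (- \<epsilon> * \<bar>x - (x + 1 * s)\<bar>)) * indicator {x..} (x + 1 * s) \<partial>lborel) = ennreal (1 / \<epsilon>)"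
      using half by simp
  qed auto
  have l: "(\<integral>\<^sup>+s. ennreal (exp (- \<epsilon> * \<bar>x - s\<bar>)) * indicator {..x} s \<partial>lborel) = ennreal (1 / \<epsilon>)"
  proof (subst nn_integral_real_affine[where c="-1" and t=x])
    have "(\<integral>\<^sup>+s. ennreal (exp (- \<epsilon> * \<bar>x - (x + -1 * s)\<bar>)) * indicator {..x} (x + -1 * s) \<partial>lborel)
       = (\<integral>\<^sup>+s. ennreal (exp (- \<epsilon> * s)) * indicator {0..} s \<partial>lborel)"
      by (intro nn_integral_cong) (auto simp: indicator_def)
    then show "ennreal \<bar>-1\<bar> * (\<integral>\<^sup>+s. ennreal (exp (- \<epsilon> * \<bar>x - (x + -1 * s)\<bar>)) * indicator {..x} (x + -1 * s) \<partial>lborel) = ennreal (1 / \<epsilon>)"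
      using half by simp
  qed auto
  have "(\<integral>\<^sup>+s. ennreal (exp (- \<epsilon> * \<bar>x - s\<bar>)) \<partial>lborel)
    = (\<integral>\<^sup>+s. ennreal (exp (- \<epsilon> * \<bar>x - s\<bar>)) * indicator {x..} s + ennreal (exp (- \<epsilon> * \<bar>x - s\<bar>)) * indicator {..x} s \<partial>lborel)"
  proof (rule nn_integral_cong_AE)
    show "AE s in lborel. ennreal (exp (- \<epsilon> * \<bar>x - s\<bar>)) = ennreal (exp (- \<epsilon> * \<bar>x - s\<bar>)) * indicator {x..} s + ennreal (exp (- \<epsilon> * \<bar>x - s\<bar>)) * indicator {..x} s"
      using AE_lborel_singleton[of x] by eventually_elim (auto simp: indicator_def)
  qed
  also have "\<dots> = (\<integral>\<^sup>+s. ennreal (exp (- \<epsilon> * \<bar>x - s\<bar>)) * indicator {x..} s \<partial>lborel)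
    + (\<integral>\<^sup>+s. ennreal (exp (- \<epsilon> * \<bar>x - s\<bar>)) * indicator {..x} s \<partial>lborel)"
    by (rule nn_integral_add) auto
  also have "\<dots> = ennreal (1 / \<epsilon>) + ennreal (1 / \<epsilon>)" unfolding l r ..
  also have "\<dots> = ennreal (2 / \<epsilon>)" using e by (simp flip: ennreal_plus)
  finally show ?thesis .
qed

lemma exp_le_linear: 
  assumes "0 \<le> h" "h \<le> L" shows "exp h - 1 \<le> exp L * (h::real)"
proof -
  have "1 - h \<le> exp (- h)" using exp_ge_add_one_self[of "- h"] by simp
  then have "exp h * (1 - h) \<le> exp h * exp (- h)" by (intro mult_left_mono) auto
  then have "exp h - 1 \<le> exp h * h" by (simp add: algebra_simps flip: exp_add)
  also have "\<dots> \<le> exp L * h" using assms by (intro mult_right_mono) auto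
  finally show ?thesis .
qed

lemma exp_abs_shift:
  fixes r a b d :: real
  assumes "r \<ge> 0" "\<bar>a - b\<bar> \<le> d" shows "exp (- r * \<bar>a\<bar>) \<le> exp (r * d) * exp (- r * \<bar>b\<bar>)"
proof -
  have "r * \<bar>b\<bar> \<le> r * (d + \<bar>a\<bar>)" using assms by (intro mult_left_mono) auto
  then show ?thesis by (simp add: algebra_simps flip: exp_add)
qed

context tilted_walk begin

definition "tail_mass s = (\<integral>y. exp (- \<alpha> * y) * indicator {s<..} y \<partial>H)"

definition "discounted_renewal s = exp (\<alpha> * s) * tail_mass s"

text \<open>The value of the same functional for Lebesgue measure on [0, \<infinity>) divided by the
  drift; it is constant for s >= 0.\<close>

definition "discounted_limit s = exp (- \<alpha> * max 0 (- s)) / (\<alpha> * drift)"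

lemma integrable_tail_mass: "integrable H (\<lambda>y. exp (- \<alpha> * y) * indicator {s<..} y)"
proof (rule Bochner_Integration.integrable_bound)
  show "integrable H (\<lambda>y. exp (- (\<alpha> / 2) * s) * exp (- (\<alpha> / 2) * y))"
    using \<alpha>_pos by (intro integrable_mult_right integrable_H) auto
  show "AE y in H. norm (exp (- \<alpha> * y) * indicator {s<..} y) \<le> norm (exp (- (\<alpha> / 2) * s) * exp (- (\<alpha> / 2) * y))"
  proof (rule AE_I2)
    fix y
    have "exp (- \<alpha> * y) \<le> exp (- (\<alpha> / 2) * s) * exp (- (\<alpha> / 2) * y)" if "s < y"
    proof -
      have "\<alpha> / 2 * s \<le> \<alpha> / 2 * y" using that \<alpha>_pos by (intro mult_left_mono) auto
      then show ?thesis by (simp flip: exp_add)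
    qed
    then show "norm (exp (- \<alpha> * y) * indicator {s<..} y) \<le> norm (exp (- (\<alpha> / 2) * s) * exp (- (\<alpha> / 2) * y))"
      by (auto simp: indicator_def abs_mult)
  qed
qed auto

lemma ramp_shift: "exp (- \<alpha> * x) * ramp \<alpha> (y - x) = exp (- \<alpha> * y) * max (y - x) 0"
  by (simp add: ramp_def algebra_simps flip: exp_add)

text \<open>The function exp (-\<alpha> x) \<open>ramp_renewal x\<close> is the integral of exp
  (-\<alpha> y) (y - x)_+ over H, hence convex in x with slope -\<open>tail_mass\<close>. Convexity
  puts the tail mass between the difference quotients on either side.\<close>

lemma discounted_renewal_le:
  assumes int: "\<And>x. integrable H (\<lambda>y. ramp \<alpha> (y - x))" and h: "h > 0"
  shows "h * discounted_renewal s \<le> exp (\<alpha> * h) * ramp_renewal (s - h) - ramp_renewal s"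
    and "ramp_renewal s - exp (- \<alpha> * h) * ramp_renewal (s + h) \<le> h * discounted_renewal s"
proof -
  define Q where "Q x = exp (- \<alpha> * x) * ramp_renewal x" for x
  have Qi: "integrable H (\<lambda>y. exp (- \<alpha> * y) * max (y - x) 0)" for x
    using integrable_mult_right[OF int[of x], of "exp (- \<alpha> * x)"] by (simp only: ramp_shift)
  have Q: "Q x = (\<integral>y. exp (- \<alpha> * y) * max (y - x) 0 \<partial>H)" for x
    by (simp only: Q_def ramp_renewal_def ramp_shift flip: integral_mult_right_zero)
  have Qe: "exp (\<alpha> * s) * Q u = exp (\<alpha> * (s - u)) * ramp_renewal u" for u
  proof -
    have "exp (\<alpha> * s) * exp (- \<alpha> * u) = exp (\<alpha> * (s - u))" by (simp add: algebra_simps flip: exp_add)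
    then show ?thesis unfolding Q_def mult.assoc[symmetric] by simp
  qed
  have "h * tail_mass s = (\<integral>y. h * (exp (- \<alpha> * y) * indicator {s<..} y) \<partial>H)"
    by (simp add: tail_mass_def)
  also have "\<dots> \<le> (\<integral>y. exp (- \<alpha> * y) * max (y - (s - h)) 0 - exp (- \<alpha> * y) * max (y - s) 0 \<partial>H)"
  proof (rule integral_mono)
    show "h * (exp (- \<alpha> * y) * indicator {s<..} y) \<le> exp (- \<alpha> * y) * max (y - (s - h)) 0 - exp (- \<alpha> * y) * max (y - s) 0" for y
    proof -
      have "h * indicator {s<..} y \<le> max (y - (s - h)) 0 - max (y - s) 0" using h by (auto simp: indicator_def)
      then have "exp (- \<alpha> * y) * (h * indicator {s<..} y) \<le> exp (- \<alpha> * y) * (max (y - (s - h)) 0 - max (y - s) 0)"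
        by (intro mult_left_mono) auto
      then show ?thesis by (simp add: algebra_simps)
    qed
  qed (use Qi integrable_tail_mass in auto)
  also have "\<dots> = Q (s - h) - Q s" unfolding Q using Qi by simp
  finally have "h * tail_mass s \<le> Q (s - h) - Q s" .
  then have "exp (\<alpha> * s) * (h * tail_mass s) \<le> exp (\<alpha> * s) * (Q (s - h) - Q s)" by (intro mult_left_mono) auto
  then show "h * discounted_renewal s \<le> exp (\<alpha> * h) * ramp_renewal (s - h) - ramp_renewal s"
    unfolding right_diff_distrib[of _ "Q _" "Q _"] Qe by (simp add: discounted_renewal_def mult_ac)
  have "Q s - Q (s + h) = (\<integral>y. exp (- \<alpha> * y) * max (y - s) 0 - exp (- \<alpha> * y) * max (y - (s + h)) 0 \<partial>H)"
    unfolding Q using Qi by simp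
  also have "\<dots> \<le> (\<integral>y. h * (exp (- \<alpha> * y) * indicator {s<..} y) \<partial>H)"
  proof (rule integral_mono)
    show "exp (- \<alpha> * y) * max (y - s) 0 - exp (- \<alpha> * y) * max (y - (s + h)) 0 \<le> h * (exp (- \<alpha> * y) * indicator {s<..} y)" for y
    proof -
      have "max (y - s) 0 - max (y - (s + h)) 0 \<le> h * indicator {s<..} y" using h by (auto simp: indicator_def)
      then have "exp (- \<alpha> * y) * (max (y - s) 0 - max (y - (s + h)) 0) \<le> exp (- \<alpha> * y) * (h * indicator {s<..} y)"
        by (intro mult_left_mono) auto
      then show ?thesis by (simp add: algebra_simps)
    qed
  qed (use Qi integrable_tail_mass in auto)
  also have "\<dots> = h * tail_mass s" by (simp add: tail_mass_def)
  finally have "Q s - Q (s + h) \<le> h * tail_mass s" .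
  then have "exp (\<alpha> * s) * (Q s - Q (s + h)) \<le> exp (\<alpha> * s) * (h * tail_mass s)" by (intro mult_left_mono) auto
  then show "ramp_renewal s - exp (- \<alpha> * h) * ramp_renewal (s + h) \<le> h * discounted_renewal s"
    unfolding right_diff_distrib[of _ "Q _" "Q _"] Qe by (simp add: discounted_renewal_def mult_ac)
qed

text \<open>The same differences for the explicit limit, compared with h times its discounted mass.
  The factors exp (\<alpha> h) and exp (-\<alpha> h) are 1 + O(h) for bounded h and so cost no more
  than the step size. The cases record on which side of 0 the two arguments lie.\<close>

lemma limit_le:
  assumes h: "h > 0"
  shows "exp (\<alpha> * h) * ramp_limit (s - h) - ramp_limit s \<le> h * exp (\<alpha> * h) * discounted_limit s"
    and "h * exp (- \<alpha> * h) * discounted_limit s \<le> ramp_limit s - exp (- \<alpha> * h) * ramp_limit (s + h)"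
proof -
  define D where "D = \<alpha>\<^sup>2 * drift"
  have D: "D > 0" using \<alpha>_pos drift_pos by (simp add: D_def)
  define p where "p x = (\<alpha> * max 0 (- x) + 1) * exp (- \<alpha> * max 0 (- x))" for x
  have rl: "ramp_limit x = p x / D" for x
    using \<alpha>_pos drift_pos by (simp add: ramp_limit_def p_def D_def field_simps)
  have dl: "discounted_limit x = \<alpha> * exp (- \<alpha> * max 0 (- x)) / D" for x
    using \<alpha>_pos drift_pos by (simp add: discounted_limit_def D_def field_simps power2_eq_square)
  have e1: "exp u - 1 \<le> u * exp u" for u :: real
  proof -
    have "exp u * (1 - u) \<le> exp u * exp (- u)" using exp_ge_add_one_self[of "- u"] by (intro mult_left_mono) auto
    then show ?thesis by (simp add: algebra_simps flip: exp_add)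
  qed
  have "exp (\<alpha> * h) * p (s - h) - p s \<le> h * exp (\<alpha> * h) * (\<alpha> * exp (- \<alpha> * max 0 (- s)))"
  proof -
    consider "s \<ge> h" | "s \<le> 0" | "0 < s" "s < h" by linarith
    then show ?thesis
    proof cases
      case 1
      then show ?thesis using h e1[of "\<alpha> * h"] by (simp add: p_def mult_ac)
    next
      case 2
      have "exp (\<alpha> * h) * p (s - h) - p s = \<alpha> * h * exp (\<alpha> * s)"
        using 2 h by (simp add: p_def algebra_simps flip: exp_add)
      also have "\<dots> \<le> (\<alpha> * h * exp (\<alpha> * s)) * exp (\<alpha> * h)"
        using h \<alpha>_pos mult_left_mono[of 1 "exp (\<alpha> * h)" "\<alpha> * h * exp (\<alpha> * s)"] by simp
      finally show ?thesis using 2 by (simp add: mult_ac)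
    next
      case 3
      have "exp (\<alpha> * h) * p (s - h) - p s = \<alpha> * (h - s) * exp (\<alpha> * s) + (exp (\<alpha> * s) - 1)"
        using 3 by (simp add: p_def algebra_simps flip: exp_add)
      also have "\<dots> \<le> \<alpha> * (h - s) * exp (\<alpha> * s) + \<alpha> * s * exp (\<alpha> * s)"
        using e1[of "\<alpha> * s"] by simp
      also have "\<dots> = \<alpha> * h * exp (\<alpha> * s)" by (simp add: algebra_simps)
      also have "\<dots> \<le> \<alpha> * h * exp (\<alpha> * h)" using 3 \<alpha>_pos by (intro mult_left_mono) auto
      finally show ?thesis using 3 by (simp add: mult_ac)
    qed
  qed
  from divide_right_mono[OF this, of D] D
  show "exp (\<alpha> * h) * ramp_limit (s - h) - ramp_limit s \<le> h * exp (\<alpha> * h) * discounted_limit s"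
    by (simp add: rl dl diff_divide_distrib)
  have "h * exp (- \<alpha> * h) * (\<alpha> * exp (- \<alpha> * max 0 (- s))) \<le> p s - exp (- \<alpha> * h) * p (s + h)"
  proof -
    consider "s \<ge> 0" | "s + h \<le> 0" | "s < 0" "s + h > 0" by linarith
    then show ?thesis
    proof cases
      case 1
      have "\<alpha> * h * exp (- \<alpha> * h) \<le> 1 - exp (- \<alpha> * h)" using e1[of "- \<alpha> * h"] by simp
      then show ?thesis using 1 h by (simp add: p_def mult_ac)
    next
      case 2
      have "p s - exp (- \<alpha> * h) * p (s + h) = \<alpha> * h * exp (\<alpha> * s)"
        using 2 h by (simp add: p_def algebra_simps flip: exp_add)
      moreover have "(\<alpha> * h * exp (\<alpha> * s)) * exp (- \<alpha> * h) \<le> \<alpha> * h * exp (\<alpha> * s)"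
        using h \<alpha>_pos mult_left_mono[of "exp (- \<alpha> * h)" 1 "\<alpha> * h * exp (\<alpha> * s)"] by simp
      ultimately show ?thesis using 2 h by (simp add: mult_ac)
    next
      case 3
      define u where "u = - s"
      have u: "0 < u" "u < h" using 3 by (auto simp: u_def)
      have "\<alpha> * (h - u) * exp (- \<alpha> * h) \<le> \<alpha> * (h - u) * exp (- \<alpha> * (h - u))"
        using u \<alpha>_pos by (intro mult_left_mono) auto
      also have "\<dots> \<le> 1 - exp (- \<alpha> * (h - u))" using e1[of "- \<alpha> * (h - u)"] by simp
      finally have 1: "\<alpha> * (h - u) * exp (- \<alpha> * h) \<le> 1 - exp (- \<alpha> * (h - u))" .
      have 2: "\<alpha> * u * exp (- \<alpha> * h) \<le> \<alpha> * u" using u \<alpha>_pos mult_left_mono[of "exp (- \<alpha> * h)" 1 "\<alpha> * u"] by simp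
      have "\<alpha> * h * exp (- \<alpha> * h) \<le> \<alpha> * u + 1 - exp (- \<alpha> * (h - u))"
        using 1 2 by (simp add: algebra_simps)
      then have "exp (- \<alpha> * u) * (\<alpha> * h * exp (- \<alpha> * h)) \<le> exp (- \<alpha> * u) * (\<alpha> * u + 1 - exp (- \<alpha> * (h - u)))"
        by (intro mult_left_mono) auto
      also have "\<dots> = (\<alpha> * u + 1) * exp (- \<alpha> * u) - exp (- \<alpha> * h)"
        by (simp add: algebra_simps flip: exp_add)
      finally show ?thesis using 3 by (simp add: p_def u_def mult_ac)
    qed
  qed
  from divide_right_mono[OF this, of D] D
  show "h * exp (- \<alpha> * h) * discounted_limit s \<le> ramp_limit s - exp (- \<alpha> * h) * ramp_limit (s + h)"
    by (simp add: rl dl diff_divide_distrib)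
qed

lemma discounted_limit_bounds: "0 \<le> discounted_limit s" "discounted_limit s \<le> 1 / (\<alpha> * drift)"
  using \<alpha>_pos drift_pos by (auto simp: discounted_limit_def divide_right_mono)

text \<open>Unsmoothing: \<^const>\<open>discounted_renewal\<close> is a difference quotient of \<^const>\<open>ramp_renewal\<close> up to
  monotonicity, and the step \<open>h = exp (- r \<bar>s\<bar> / 2)\<close> balances both errors.\<close>

lemma discounted_renewal_rate:
  obtains r C where "r > 0" "r < \<alpha>" "C > 0"
    "\<And>s. \<bar>discounted_renewal s - discounted_limit s\<bar> \<le> C * exp (- r * \<bar>s\<bar>)"
proof -
  obtain r C where r: "r > 0" "r < \<alpha>" and C: "C > 0"
    and rate: "\<And>x. \<bar>ramp_renewal x - ramp_limit x\<bar> \<le> C * exp (- r * \<bar>x\<bar>)"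
    and int: "\<And>x. integrable H (\<lambda>y. ramp \<alpha> (y - x))"
    using ramp_renewal_rate by metis
  define C1 where "C1 = exp \<alpha> * (C * exp r) + C"
  define C2 where "C2 = exp \<alpha> / drift + C1"
  have C1: "C1 > 0" using C by (simp add: C1_def add_pos_pos)
  have C2: "C2 > 0" using C1 drift_pos by (simp add: C2_def add_pos_pos)
  have bound: "\<bar>discounted_renewal s - discounted_limit s\<bar> \<le> C2 * exp (- (r / 2) * \<bar>s\<bar>)" for s
  proof -
    define h where "h = exp (- (r / 2) * \<bar>s\<bar>)"
    have h: "h > 0" "h \<le> 1" using r by (auto simp: h_def)
    have hh: "exp (- r * \<bar>s\<bar>) = h * h" by (simp add: h_def flip: exp_add)
    have ah: "0 \<le> \<alpha> * h" "\<alpha> * h \<le> \<alpha>" using h \<alpha>_pos mult_left_mono[of h 1 \<alpha>] by auto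
    have sh: "C * exp (- r * \<bar>s + t\<bar>) \<le> C * exp r * (h * h)" if "\<bar>t\<bar> \<le> 1" for t
      using exp_abs_shift[of r "s + t" s 1] that r C hh by (simp add: mult_left_mono)
    have eh: "exp (\<alpha> * h) \<le> exp \<alpha>" "exp (- \<alpha> * h) \<le> exp \<alpha>" using ah by auto
    have k0: "discounted_limit s \<ge> 0" "discounted_limit s \<le> 1 / (\<alpha> * drift)" by (rule discounted_limit_bounds)+
    have lin: "exp (\<alpha> * h) - 1 \<le> exp \<alpha> * (\<alpha> * h)" by (rule exp_le_linear[OF ah])
    have lin2: "1 - exp (- \<alpha> * h) \<le> exp \<alpha> * (\<alpha> * h)"
    proof -
      have "1 - exp (- \<alpha> * h) \<le> \<alpha> * h" using exp_ge_add_one_self[of "- \<alpha> * h"] by simp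
      also have "\<dots> \<le> exp \<alpha> * (\<alpha> * h)" using ah \<alpha>_pos mult_right_mono[of 1 "exp \<alpha>" "\<alpha> * h"] by simp
      finally show ?thesis .
    qed
    have kk: "(exp \<alpha> * (\<alpha> * h)) * discounted_limit s \<le> exp \<alpha> / drift * h"
    proof -
      have "(exp \<alpha> * (\<alpha> * h)) * discounted_limit s \<le> (exp \<alpha> * (\<alpha> * h)) * (1 / (\<alpha> * drift))"
        using k0 ah by (intro mult_left_mono) auto
      also have "\<dots> = exp \<alpha> / drift * h" using \<alpha>_pos by simp
      finally show ?thesis .
    qed
    have E1: "exp (\<alpha> * h) * \<bar>ramp_renewal (s - h) - ramp_limit (s - h)\<bar> \<le> exp \<alpha> * (C * exp r * (h * h))"
      using rate[of "s - h"] sh[of "- h"] h eh by (intro mult_mono) auto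
    have E2: "exp (- \<alpha> * h) * \<bar>ramp_renewal (s + h) - ramp_limit (s + h)\<bar> \<le> exp \<alpha> * (C * exp r * (h * h))"
      using rate[of "s + h"] sh[of h] h eh by (intro mult_mono) auto
    have E0: "\<bar>ramp_renewal s - ramp_limit s\<bar> \<le> C * (h * h)"
      using rate[of s] hh by simp
    have "h * discounted_renewal s \<le> exp (\<alpha> * h) * ramp_renewal (s - h) - ramp_renewal s"
      by (rule discounted_renewal_le(1)[OF int h(1)])
    also have "\<dots> \<le> (exp (\<alpha> * h) * ramp_limit (s - h) - ramp_limit s)
      + exp (\<alpha> * h) * \<bar>ramp_renewal (s - h) - ramp_limit (s - h)\<bar> + \<bar>ramp_renewal s - ramp_limit s\<bar>"
    proof -
      have "exp (\<alpha> * h) * (ramp_renewal (s - h) - ramp_limit (s - h)) \<le> exp (\<alpha> * h) * \<bar>ramp_renewal (s - h) - ramp_limit (s - h)\<bar>"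
        by (intro mult_left_mono) auto
      then show ?thesis by (simp add: algebra_simps)
    qed
    also have "\<dots> \<le> h * exp (\<alpha> * h) * discounted_limit s + C1 * (h * h)"
      using limit_le(1)[OF h(1), of s] E1 E0 by (simp add: C1_def algebra_simps)
    finally have "h * discounted_renewal s \<le> h * (exp (\<alpha> * h) * discounted_limit s + C1 * h)"
      by (simp add: algebra_simps)
    then have "discounted_renewal s \<le> exp (\<alpha> * h) * discounted_limit s + C1 * h"
      using h by simp
    moreover have "(exp (\<alpha> * h) - 1) * discounted_limit s \<le> exp \<alpha> / drift * h"
      using mult_right_mono[OF lin k0(1)] kk by linarith
    ultimately have up: "discounted_renewal s - discounted_limit s \<le> C2 * h"
      by (simp add: C2_def algebra_simps)
    have "h * exp (- \<alpha> * h) * discounted_limit s - C1 * (h * h)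
      \<le> (ramp_limit s - exp (- \<alpha> * h) * ramp_limit (s + h))
       - exp (- \<alpha> * h) * \<bar>ramp_renewal (s + h) - ramp_limit (s + h)\<bar> - \<bar>ramp_renewal s - ramp_limit s\<bar>"
      using limit_le(2)[OF h(1), of s] E2 E0 by (simp add: C1_def algebra_simps)
    also have "\<dots> \<le> ramp_renewal s - exp (- \<alpha> * h) * ramp_renewal (s + h)"
    proof -
      have "exp (- \<alpha> * h) * (ramp_renewal (s + h) - ramp_limit (s + h)) \<le> exp (- \<alpha> * h) * \<bar>ramp_renewal (s + h) - ramp_limit (s + h)\<bar>"
        by (intro mult_left_mono) auto
      then show ?thesis by (simp add: algebra_simps)
    qed
    also have "\<dots> \<le> h * discounted_renewal s"
      by (rule discounted_renewal_le(2)[OF int h(1)])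
    finally have "h * (exp (- \<alpha> * h) * discounted_limit s - C1 * h) \<le> h * discounted_renewal s"
      by (simp add: algebra_simps)
    then have "exp (- \<alpha> * h) * discounted_limit s - C1 * h \<le> discounted_renewal s"
      using h by simp
    moreover have "(1 - exp (- \<alpha> * h)) * discounted_limit s \<le> exp \<alpha> / drift * h"
      using mult_right_mono[OF lin2 k0(1)] kk by linarith
    ultimately have "discounted_limit s - discounted_renewal s \<le> C2 * h"
      by (simp add: C2_def algebra_simps)
    with up show ?thesis unfolding h_def by linarith
  qed
  show ?thesis
    using that[of "r / 2" C2] r C2 bound by auto
qed

section \<open>Local size of the renewal measure\<close>

lemma finite_H_Ioc: "emeasure H {a<..b} < \<infinity>"
proof -
  have "emeasure H {a<..b} = (\<integral>\<^sup>+y. indicator {a<..b} y \<partial>H)" by simp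
  also have "\<dots> \<le> (\<integral>\<^sup>+y. ennreal (exp (\<alpha> * b) * (exp (- \<alpha> * y) * indicator {a<..} y)) \<partial>H)"
    using \<alpha>_pos by (intro nn_integral_mono) (auto simp: indicator_def simp flip: exp_add)
  also have "\<dots> < \<infinity>"
    using integrable_mult_right[OF integrable_tail_mass[of a], of "exp (\<alpha> * b)"]
    by (subst nn_integral_eq_integral) (auto simp: less_top)
  finally show ?thesis .
qed

text \<open>On the interval the weight exp (\<alpha> (b - y)) is at least 1, so the mass is
  dominated by a difference of two discounted tails.\<close>

lemma measure_H_Ioc_le:
  assumes "a \<le> b"
  shows "measure H {a<..b} \<le> exp (\<alpha> * (b - a)) * discounted_renewal a - discounted_renewal b"
proof -
  have "measure H {a<..b} = (\<integral>y. indicator {a<..b} y \<partial>H)" by simp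
  also have "\<dots> \<le> (\<integral>y. exp (\<alpha> * b) * (exp (- \<alpha> * y) * indicator {a<..} y - exp (- \<alpha> * y) * indicator {b<..} y) \<partial>H)"
  proof (rule integral_mono)
    show "integrable H (indicat_real {a<..b})" using finite_H_Ioc[of a b] by simp
    show "indicat_real {a<..b} y \<le> exp (\<alpha> * b) * (exp (- \<alpha> * y) * indicator {a<..} y - exp (- \<alpha> * y) * indicator {b<..} y)" for y
      using \<alpha>_pos assms by (auto simp: indicator_def simp flip: exp_add)
  qed (intro integrable_mult_right Bochner_Integration.integrable_diff integrable_tail_mass)
  also have "\<dots> = exp (\<alpha> * b) * (tail_mass a - tail_mass b)"
    using integrable_tail_mass by (simp add: tail_mass_def)
  also have "\<dots> = exp (\<alpha> * (b - a)) * discounted_renewal a - discounted_renewal b"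
    by (simp add: discounted_renewal_def algebra_simps flip: exp_add mult.assoc)
  finally show ?thesis .
qed

lemma discounted_limit_mono: "a \<le> b \<Longrightarrow> discounted_limit a \<le> discounted_limit b"
  using \<alpha>_pos drift_pos unfolding discounted_limit_def
  by (intro divide_right_mono) (auto simp: mult_le_cancel_left)

text \<open>The Lebesgue part is Lipschitz in the interval length and the convergence rate supplies
  the rest; no density of H is available. The cap 3 on the length covers the bands around ln B,
  whose length is three times a number in (0, 1].\<close>

lemma measure_H_Ioc_bound:
  assumes r: "r > 0" and C: "C > 0" and rate: "\<And>s. \<bar>discounted_renewal s - discounted_limit s\<bar> \<le> C * exp (- r * \<bar>s\<bar>)"
  obtains C' where "C' > 0" "\<And>a b. a \<le> b \<Longrightarrow> b \<le> a + 3 \<Longrightarrow> measure H {a<..b} \<le> C' * ((b - a) + exp (- r * \<bar>a\<bar>))"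
proof -
  define c1 where "c1 = exp (\<alpha> * 3) / drift"
  define c2 where "c2 = exp (\<alpha> * 3) * C + C * exp (r * 3)"
  have c: "c1 > 0" "c2 > 0" using C drift_pos by (auto simp: c1_def c2_def add_pos_pos)
  have "measure H {a<..b} \<le> (c1 + c2) * ((b - a) + exp (- r * \<bar>a\<bar>))" if ab: "a \<le> b" "b \<le> a + 3" for a b
  proof -
    have e: "1 \<le> exp (\<alpha> * (b - a))" "exp (\<alpha> * (b - a)) \<le> exp (\<alpha> * 3)" using ab \<alpha>_pos by auto
    have lin: "exp (\<alpha> * (b - a)) - 1 \<le> exp (\<alpha> * 3) * (\<alpha> * (b - a))"
      using ab \<alpha>_pos by (intro exp_le_linear) auto
    have "measure H {a<..b} \<le> exp (\<alpha> * (b - a)) * discounted_renewal a - discounted_renewal b"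
      by (rule measure_H_Ioc_le[OF ab(1)])
    also have "\<dots> \<le> exp (\<alpha> * (b - a)) * (discounted_limit a + C * exp (- r * \<bar>a\<bar>)) - (discounted_limit b - C * exp (- r * \<bar>b\<bar>))"
    proof -
      have "discounted_renewal a \<le> discounted_limit a + C * exp (- r * \<bar>a\<bar>)" using rate[of a] by linarith
      moreover have "discounted_limit b - C * exp (- r * \<bar>b\<bar>) \<le> discounted_renewal b" using rate[of b] by linarith
      ultimately show ?thesis by (intro diff_mono mult_left_mono) auto
    qed
    also have "\<dots> \<le> (exp (\<alpha> * (b - a)) - 1) * discounted_limit a + exp (\<alpha> * (b - a)) * (C * exp (- r * \<bar>a\<bar>)) + C * exp (- r * \<bar>b\<bar>)"
      using discounted_limit_mono[OF ab(1)] by (simp add: algebra_simps)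
    also have "\<dots> \<le> c1 * (b - a) + exp (\<alpha> * 3) * (C * exp (- r * \<bar>a\<bar>)) + C * (exp (r * 3) * exp (- r * \<bar>a\<bar>))"
    proof (intro add_mono)
      have "(exp (\<alpha> * (b - a)) - 1) * discounted_limit a \<le> (exp (\<alpha> * 3) * (\<alpha> * (b - a))) * (1 / (\<alpha> * drift))"
        using lin e discounted_limit_bounds[of a] ab \<alpha>_pos by (intro mult_mono) auto
      also have "\<dots> = c1 * (b - a)" using \<alpha>_pos by (simp add: c1_def)
      finally show "(exp (\<alpha> * (b - a)) - 1) * discounted_limit a \<le> c1 * (b - a)" .
      show "exp (\<alpha> * (b - a)) * (C * exp (- r * \<bar>a\<bar>)) \<le> exp (\<alpha> * 3) * (C * exp (- r * \<bar>a\<bar>))"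
        using e C by (intro mult_right_mono) auto
      show "C * exp (- r * \<bar>b\<bar>) \<le> C * (exp (r * 3) * exp (- r * \<bar>a\<bar>))"
        using C r ab by (intro mult_left_mono exp_abs_shift) auto
    qed
    also have "\<dots> = c1 * (b - a) + c2 * exp (- r * \<bar>a\<bar>)" by (simp add: c2_def algebra_simps)
    also have "\<dots> \<le> (c1 + c2) * ((b - a) + exp (- r * \<bar>a\<bar>))"
    proof -
      have "0 \<le> c2 * (b - a)" "0 \<le> c1 * exp (- r * \<bar>a\<bar>)" using c ab by auto
      then show ?thesis by (simp add: algebra_simps)
    qed
    finally show ?thesis .
  qed
  then show ?thesis using that[of "c1 + c2"] c by simp
qed

text \<open>Each point y is spread over the unit interval to its left. After exchanging the
  integrals, the unit intervals have uniformly bounded renewal mass and an ordinary Lebesgue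
  integral remains.\<close>

lemma nn_integral_exp_abs_H:
  assumes e: "\<epsilon> > 0"
  obtains C where "C > 0" "\<And>x. (\<integral>\<^sup>+y. ennreal (exp (- \<epsilon> * \<bar>x - y\<bar>)) \<partial>H) \<le> ennreal C"
proof -
  obtain r C where r: "r > 0" and C: "C > 0" and rate: "\<And>s. \<bar>discounted_renewal s - discounted_limit s\<bar> \<le> C * exp (- r * \<bar>s\<bar>)"
    using discounted_renewal_rate by metis
  obtain C' where C': "C' > 0" "\<And>a b. a \<le> b \<Longrightarrow> b \<le> a + 3 \<Longrightarrow> measure H {a<..b} \<le> C' * ((b - a) + exp (- r * \<bar>a\<bar>))"
    using measure_H_Ioc_bound[OF r C rate] by metis
  have unit: "emeasure H {s<..s + 1} \<le> ennreal (C' * 2)" for s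
  proof -
    have "measure H {s<..s + 1} \<le> C' * (1 + exp (- r * \<bar>s\<bar>))" using C'(2)[of s "s + 1"] by simp
    also have "\<dots> \<le> C' * 2" using C' r by (intro mult_left_mono) auto
    finally show ?thesis using finite_H_Ioc[of s "s + 1"] by (subst emeasure_eq_ennreal_measure) (auto intro: ennreal_leI)
  qed
  have "(\<integral>\<^sup>+y. ennreal (exp (- \<epsilon> * \<bar>x - y\<bar>)) \<partial>H) \<le> ennreal (exp \<epsilon> * (C' * 2) * (2 / \<epsilon>))" for x
  proof -
    have "(\<integral>\<^sup>+y. ennreal (exp (- \<epsilon> * \<bar>x - y\<bar>)) \<partial>H)
      \<le> (\<integral>\<^sup>+y. (\<integral>\<^sup>+s. ennreal (exp \<epsilon>) * (ennreal (exp (- \<epsilon> * \<bar>x - s\<bar>)) * (if s < y \<and> y \<le> s + 1 then 1 else 0)) \<partial>lborel) \<partial>H)"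
    proof (rule nn_integral_mono)
      fix y
      have "ennreal (exp (- \<epsilon> * \<bar>x - y\<bar>)) = (\<integral>\<^sup>+s. ennreal (exp (- \<epsilon> * \<bar>x - y\<bar>)) * indicator {y - 1..<y} s \<partial>lborel)"
        by (subst nn_integral_cmult) auto
      also have "\<dots> \<le> (\<integral>\<^sup>+s. ennreal (exp \<epsilon>) * (ennreal (exp (- \<epsilon> * \<bar>x - s\<bar>)) * (if s < y \<and> y \<le> s + 1 then 1 else 0)) \<partial>lborel)"
      proof (rule nn_integral_mono)
        fix s
        show "ennreal (exp (- \<epsilon> * \<bar>x - y\<bar>)) * indicator {y - 1..<y} s \<le> ennreal (exp \<epsilon>) * (ennreal (exp (- \<epsilon> * \<bar>x - s\<bar>)) * (if s < y \<and> y \<le> s + 1 then 1 else 0))"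
          using exp_abs_shift[of \<epsilon> "x - y" "x - s" 1] e
          by (auto simp: indicator_def simp flip: ennreal_mult intro!: ennreal_leI)
      qed
      finally show "ennreal (exp (- \<epsilon> * \<bar>x - y\<bar>)) \<le> (\<integral>\<^sup>+s. ennreal (exp \<epsilon>) * (ennreal (exp (- \<epsilon> * \<bar>x - s\<bar>)) * (if s < y \<and> y \<le> s + 1 then 1 else 0)) \<partial>lborel)" .
    qed
    also have "\<dots> = (\<integral>\<^sup>+s. (\<integral>\<^sup>+y. ennreal (exp \<epsilon>) * (ennreal (exp (- \<epsilon> * \<bar>x - s\<bar>)) * (if s < y \<and> y \<le> s + 1 then 1 else 0)) \<partial>H) \<partial>lborel)"
    proof (rule pair_sigma_finite.Fubini')
      show "pair_sigma_finite lborel H" by (simp add: pair_sigma_finite_def sigma_finite_lborel H.sigma_finite_measure_axioms)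
      show "(\<lambda>(s, y). ennreal (exp \<epsilon>) * (ennreal (exp (- \<epsilon> * \<bar>x - s\<bar>)) * (if s < y \<and> y \<le> s + 1 then 1 else 0))) \<in> borel_measurable (lborel \<Otimes>\<^sub>M H)"
        by measurable
    qed
    also have "\<dots> = (\<integral>\<^sup>+s. (ennreal (exp \<epsilon>) * ennreal (exp (- \<epsilon> * \<bar>x - s\<bar>))) * emeasure H {s<..s + 1} \<partial>lborel)"
    proof (intro nn_integral_cong)
      fix s
      have "(\<integral>\<^sup>+y. ennreal (exp \<epsilon>) * (ennreal (exp (- \<epsilon> * \<bar>x - s\<bar>)) * (if s < y \<and> y \<le> s + 1 then 1 else 0)) \<partial>H)
        = (\<integral>\<^sup>+y. (ennreal (exp \<epsilon>) * ennreal (exp (- \<epsilon> * \<bar>x - s\<bar>))) * indicator {s<..s + 1} y \<partial>H)"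
        by (intro nn_integral_cong) (auto simp: indicator_def)
      then show "(\<integral>\<^sup>+y. ennreal (exp \<epsilon>) * (ennreal (exp (- \<epsilon> * \<bar>x - s\<bar>)) * (if s < y \<and> y \<le> s + 1 then 1 else 0)) \<partial>H)
        = (ennreal (exp \<epsilon>) * ennreal (exp (- \<epsilon> * \<bar>x - s\<bar>))) * emeasure H {s<..s + 1}"
        by (simp add: nn_integral_cmult)
    qed
    also have "\<dots> \<le> (\<integral>\<^sup>+s. ennreal (exp \<epsilon> * (C' * 2)) * ennreal (exp (- \<epsilon> * \<bar>x - s\<bar>)) \<partial>lborel)"
    proof (rule nn_integral_mono)
      fix s
      have "(ennreal (exp \<epsilon>) * ennreal (exp (- \<epsilon> * \<bar>x - s\<bar>))) * emeasure H {s<..s + 1} \<le> (ennreal (exp \<epsilon>) * ennreal (exp (- \<epsilon> * \<bar>x - s\<bar>))) * ennreal (C' * 2)"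
        by (intro mult_left_mono unit) auto
      then show "(ennreal (exp \<epsilon>) * ennreal (exp (- \<epsilon> * \<bar>x - s\<bar>))) * emeasure H {s<..s + 1} \<le> ennreal (exp \<epsilon> * (C' * 2)) * ennreal (exp (- \<epsilon> * \<bar>x - s\<bar>))"
        using C' by (simp add: mult_ac flip: ennreal_mult)
    qed
    also have "\<dots> = ennreal (exp \<epsilon> * (C' * 2) * (2 / \<epsilon>))"
    proof -
      have "(\<integral>\<^sup>+s. ennreal (exp \<epsilon> * (C' * 2)) * ennreal (exp (- \<epsilon> * \<bar>x - s\<bar>)) \<partial>lborel)
        = ennreal (exp \<epsilon> * (C' * 2)) * ennreal (2 / \<epsilon>)"
        unfolding nn_integral_exp_abs[OF e, symmetric, of x] by (rule nn_integral_cmult) auto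
      then show ?thesis using C' e by (simp only: ennreal_mult) (simp flip: ennreal_mult)
    qed
    finally show ?thesis .
  qed
  then show ?thesis using that[of "exp \<epsilon> * (C' * 2) * (2 / \<epsilon>)"] C' e by simp
qed

end

section \<open>Moments of perpetuities\<close>

text \<open>Dividing by x + y reduces the claim to u <= u^k for u in [0, 1], applied to the two
  proportions.\<close>

lemma powr_add_le_add_powr:
  assumes "0 \<le> x" "0 \<le> y" "0 < k" "k \<le> 1" shows "(x + y) powr k \<le> x powr k + y powr (k::real)"
proof (cases "x + y = 0")
  case True
  then show ?thesis using assms by simp
next
  case False
  then have s: "x + y > 0" using assms by linarith
  have "u / (x + y) \<le> (u / (x + y)) powr k" if "0 \<le> u" "u \<le> x + y" for u
  proof (cases "u = 0")
    case False
    then have "(u / (x + y)) powr 1 \<le> (u / (x + y)) powr k"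
      using that s assms by (intro powr_mono') auto
    then show ?thesis using False that s by simp
  qed simp
  from add_mono[OF this[of x] this[of y]] have "1 \<le> (x / (x + y)) powr k + (y / (x + y)) powr k"
    using assms s by (simp flip: add_divide_distrib)
  also have "\<dots> = (x powr k + y powr k) / (x + y) powr k"
    using assms s by (simp add: powr_divide add_divide_distrib)
  finally show ?thesis using s by (simp add: field_simps)
qed

text \<open>The factor c may be as close to 1 as desired, which will keep c E|A|^k below 1; only D
  suffers. With (1 + e)^k = c, the first term absorbs everything when |y| <= e |x|, and the second
  does otherwise.\<close>

lemma powr_add_le_weighted:
  assumes c: "1 < (c::real)" and k: "0 < k"
  obtains D where "D > 0" "\<And>x y. \<bar>x + y\<bar> powr k \<le> c * \<bar>x\<bar> powr k + D * \<bar>y\<bar> powr k"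
proof -
  define e where "e = c powr (1 / k) - 1"
  have e: "e > 0" using c k by (simp add: e_def powr_def)
  have ce: "(1 + e) powr k = c" using c k by (simp add: e_def powr_powr)
  define D where "D = (1 + 1 / e) powr k"
  have "1 + 1 / e > 0" using e by (simp add: add_pos_pos)
  then have D: "D > 0" unfolding D_def by simp
  have "\<bar>x + y\<bar> powr k \<le> c * \<bar>x\<bar> powr k + D * \<bar>y\<bar> powr k" for x y
  proof (cases "\<bar>y\<bar> \<le> e * \<bar>x\<bar>")
    case True
    have "\<bar>x + y\<bar> \<le> (1 + e) * \<bar>x\<bar>" using True abs_triangle_ineq[of x y] by (simp add: algebra_simps)
    then have "\<bar>x + y\<bar> powr k \<le> ((1 + e) * \<bar>x\<bar>) powr k" using k by (intro powr_mono2) auto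
    also have "\<dots> = c * \<bar>x\<bar> powr k" using e by (simp add: powr_mult ce)
    finally show ?thesis using D by (simp add: add_increasing2)
  next
    case False
    then have "\<bar>x\<bar> \<le> \<bar>y\<bar> / e" using e by (simp add: field_simps)
    then have "\<bar>x + y\<bar> \<le> (1 + 1 / e) * \<bar>y\<bar>" using abs_triangle_ineq[of x y] by (simp add: algebra_simps)
    then have "\<bar>x + y\<bar> powr k \<le> ((1 + 1 / e) * \<bar>y\<bar>) powr k" using k by (intro powr_mono2) auto
    also have "\<dots> = D * \<bar>y\<bar> powr k" using e by (simp add: powr_mult D_def)
    finally show ?thesis using c by (simp add: add_increasing)
  qed
  then show ?thesis using that D by blast
qed

section \<open>Independence and moments of R below order \<alpha>\<close>

locale perpetuity = prob_space M for M :: "'a measure" +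
  fixes A B R :: "'a \<Rightarrow> real"
  assumes A_meas [measurable]: "A \<in> borel_measurable M" and B_meas [measurable]: "B \<in> borel_measurable M"
    and solution: "perpetuity_solution M A B R"
begin

lemma R_meas [measurable]: "R \<in> borel_measurable M"
  using solution by (simp add: perpetuity_solution_def)

text \<open>Independence of the generated sigma-algebras is the product formula on measurable
  rectangles, and these determine the joint law. The pair (A, B) stays together since its components
  may be dependent.\<close>

lemma joint_law:
  "distr M (borel \<Otimes>\<^sub>M (borel \<Otimes>\<^sub>M borel)) (\<lambda>\<omega>. (R \<omega>, A \<omega>, B \<omega>))
    = distr M borel R \<Otimes>\<^sub>M distr M (borel \<Otimes>\<^sub>M borel) (\<lambda>\<omega>. (A \<omega>, B \<omega>))"
proof -
  interpret PR: prob_space "distr M borel R" by (rule prob_space_distr) simp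
  interpret PAB: prob_space "distr M (borel \<Otimes>\<^sub>M borel) (\<lambda>\<omega>. (A \<omega>, B \<omega>))" by (rule prob_space_distr) simp
  have ind: "indep_set (sets (vimage_algebra (space M) R borel))
       (sets (vimage_algebra (space M) (\<lambda>\<omega>. (A \<omega>, B \<omega>)) (borel \<Otimes>\<^sub>M borel)))"
    using solution by (simp add: perpetuity_solution_def)
  have "distr M borel R \<Otimes>\<^sub>M distr M (borel \<Otimes>\<^sub>M borel) (\<lambda>\<omega>. (A \<omega>, B \<omega>)) =
    distr M (borel \<Otimes>\<^sub>M (borel \<Otimes>\<^sub>M borel)) (\<lambda>\<omega>. (R \<omega>, A \<omega>, B \<omega>))"
  proof (rule pair_measure_eqI)
    show "sigma_finite_measure (distr M borel R)" ..
    show "sigma_finite_measure (distr M (borel \<Otimes>\<^sub>M borel) (\<lambda>\<omega>. (A \<omega>, B \<omega>)))" ..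
    show "sets (distr M borel R \<Otimes>\<^sub>M distr M (borel \<Otimes>\<^sub>M borel) (\<lambda>\<omega>. (A \<omega>, B \<omega>))) =
      sets (distr M (borel \<Otimes>\<^sub>M (borel \<Otimes>\<^sub>M borel)) (\<lambda>\<omega>. (R \<omega>, A \<omega>, B \<omega>)))"
      by (simp cong: sets_pair_measure_cong)
    fix E F
    assume "E \<in> sets (distr M borel R)" and "F \<in> sets (distr M (borel \<Otimes>\<^sub>M borel) (\<lambda>\<omega>. (A \<omega>, B \<omega>)))"
    then have E: "E \<in> sets borel" and F: "F \<in> sets (borel \<Otimes>\<^sub>M borel)" by auto
    let ?E = "R -` E \<inter> space M" and ?F = "(\<lambda>\<omega>. (A \<omega>, B \<omega>)) -` F \<inter> space M"
    have ms: "?E \<in> sets M" "?F \<in> sets M"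
      using E F by (auto intro!: measurable_sets[OF _ E] measurable_sets[OF _ F])
    have "prob (?E \<inter> ?F) = prob ?E * prob ?F"
      using E F by (intro indep_setD[OF ind] in_vimage_algebra)
    then have "emeasure M (?E \<inter> ?F) = emeasure M ?E * emeasure M ?F"
      by (simp add: emeasure_eq_measure ennreal_mult)
    moreover have "(\<lambda>\<omega>. (R \<omega>, A \<omega>, B \<omega>)) -` (E \<times> F) \<inter> space M = ?E \<inter> ?F" by auto
    ultimately show "emeasure (distr M borel R) E * emeasure (distr M (borel \<Otimes>\<^sub>M borel) (\<lambda>\<omega>. (A \<omega>, B \<omega>))) F
      = emeasure (distr M (borel \<Otimes>\<^sub>M (borel \<Otimes>\<^sub>M borel)) (\<lambda>\<omega>. (R \<omega>, A \<omega>, B \<omega>))) (E \<times> F)"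
      using E F by (simp add: emeasure_distr pair_measureI)
  qed
  then show ?thesis ..
qed

lemma indep_nn_integral:
  assumes h: "h \<in> borel_measurable (borel \<Otimes>\<^sub>M (borel \<Otimes>\<^sub>M borel))"
  shows "(\<integral>\<^sup>+\<omega>. h (R \<omega>, A \<omega>, B \<omega>) \<partial>M) = (\<integral>\<^sup>+\<omega>'. \<integral>\<^sup>+\<omega>. h (R \<omega>', A \<omega>, B \<omega>) \<partial>M \<partial>M)"
proof -
  note [measurable] = h
  interpret PAB: prob_space "distr M (borel \<Otimes>\<^sub>M borel) (\<lambda>\<omega>. (A \<omega>, B \<omega>))" by (rule prob_space_distr) simp
  have "(\<integral>\<^sup>+\<omega>. h (R \<omega>, A \<omega>, B \<omega>) \<partial>M) = (\<integral>\<^sup>+p. h p \<partial>distr M (borel \<Otimes>\<^sub>M (borel \<Otimes>\<^sub>M borel)) (\<lambda>\<omega>. (R \<omega>, A \<omega>, B \<omega>)))"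
    by (subst nn_integral_distr) auto
  also have "\<dots> = (\<integral>\<^sup>+r. \<integral>\<^sup>+p. h (r, p) \<partial>distr M (borel \<Otimes>\<^sub>M borel) (\<lambda>\<omega>. (A \<omega>, B \<omega>)) \<partial>distr M borel R)"
    unfolding joint_law by (subst PAB.nn_integral_fst[symmetric]) (auto cong: measurable_cong_sets)
  also have "\<dots> = (\<integral>\<^sup>+\<omega>'. \<integral>\<^sup>+\<omega>. h (R \<omega>', A \<omega>, B \<omega>) \<partial>M \<partial>M)"
    by (simp add: nn_integral_distr)
  finally show ?thesis .
qed

lemma fixpoint_nn_integral:
  assumes [measurable]: "g \<in> borel_measurable borel"
  shows "(\<integral>\<^sup>+\<omega>. g (R \<omega>) \<partial>M) = (\<integral>\<^sup>+\<omega>'. \<integral>\<^sup>+\<omega>. g (A \<omega> * R \<omega>' + B \<omega>) \<partial>M \<partial>M)"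
proof -
  have "(\<integral>\<^sup>+\<omega>. g (R \<omega>) \<partial>M) = (\<integral>\<^sup>+r. g r \<partial>distr M borel R)" by (simp add: nn_integral_distr)
  also have "\<dots> = (\<integral>\<^sup>+\<omega>. g (A \<omega> * R \<omega> + B \<omega>) \<partial>M)"
    using solution by (simp add: perpetuity_solution_def nn_integral_distr)
  also have "\<dots> = (\<integral>\<^sup>+\<omega>'. \<integral>\<^sup>+\<omega>. g (A \<omega> * R \<omega>' + B \<omega>) \<partial>M \<partial>M)"
    using indep_nn_integral[of "\<lambda>(r, a, b). g (a * r + b)"] by simp
  finally show ?thesis .
qed

text \<open>Truncated Lyapunov function \<open>min (\<bar>r\<bar>\<^sup>\<kappa>) n\<close>, pushed through the multiplicative part of the
  recursion \<open>N\<close> times; \<open>c\<close> absorbs the cross terms of \<open>\<bar>x + y\<bar>\<^sup>\<kappa>\<close>.\<close>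

primrec lyap :: "real \<Rightarrow> real \<Rightarrow> nat \<Rightarrow> nat \<Rightarrow> real \<Rightarrow> ennreal" where
  "lyap c k n 0 r = ennreal (min (\<bar>r\<bar> powr k) (real n))"
| "lyap c k n (Suc j) r = ennreal c * (\<integral>\<^sup>+\<omega>. lyap c k n j (A \<omega> * r) \<partial>M)"

lemma lyap_measurable [measurable]: "lyap c k n j \<in> borel_measurable borel"
proof (induct j)
  case (Suc j)
  note [measurable] = Suc
  show ?case by (subst lyap.simps(2)[abs_def]) measurable
qed simp

context
  fixes c k D m :: real
  assumes c: "c \<ge> 1" and k: "k > 0" and D: "D \<ge> 0"
    and conv: "\<And>x y. \<bar>x + y\<bar> powr k \<le> c * \<bar>x\<bar> powr k + D * \<bar>y\<bar> powr k"
    and m: "(\<integral>\<^sup>+\<omega>. ennreal (\<bar>A \<omega>\<bar> powr k) \<partial>M) = ennreal m" "m \<ge> 0"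
begin

text \<open>By induction on j: perturbing r by b perturbs A r by A b, whose k-th absolute moment is
  m |b|^k. So the contribution of b gains a factor c m per step, while the factor c in front of the
  main term is the one built into the next level.\<close>

lemma lyap_add: "lyap c k n j (r + b) \<le> ennreal c * lyap c k n j r + ennreal (D * (c * m) ^ j * \<bar>b\<bar> powr k)"
proof (induct j arbitrary: r b)
  case 0
  have "min (\<bar>r + b\<bar> powr k) (real n) \<le> min (c * \<bar>r\<bar> powr k + D * \<bar>b\<bar> powr k) (real n)"
    by (intro min.mono conv) auto
  also have "min (c * \<bar>r\<bar> powr k + D * \<bar>b\<bar> powr k) (real n) \<le> c * min (\<bar>r\<bar> powr k) (real n) + D * \<bar>b\<bar> powr k"
  proof (cases "\<bar>r\<bar> powr k \<le> real n")
    case False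
    have "real n \<le> c * real n" using c mult_right_mono[of 1 c "real n"] by simp
    then have "real n \<le> c * real n + D * \<bar>b\<bar> powr k" using D by (simp add: add_increasing2)
    then show ?thesis using False by (simp add: min_def)
  qed simp
  finally have "lyap c k n 0 (r + b) \<le> ennreal (c * min (\<bar>r\<bar> powr k) (real n) + D * \<bar>b\<bar> powr k)"
    by (simp add: ennreal_leI)
  also have "\<dots> = ennreal c * lyap c k n 0 r + ennreal (D * (c * m) ^ 0 * \<bar>b\<bar> powr k)"
    using c D by (simp add: ennreal_mult)
  finally show ?case .
next
  case (Suc j)
  have "lyap c k n (Suc j) (r + b) = ennreal c * (\<integral>\<^sup>+\<omega>. lyap c k n j (A \<omega> * r + A \<omega> * b) \<partial>M)"
    by (simp add: distrib_left)
  also have "\<dots> \<le> ennreal c * (\<integral>\<^sup>+\<omega>. ennreal c * lyap c k n j (A \<omega> * r) + ennreal (D * (c * m) ^ j * \<bar>A \<omega> * b\<bar> powr k) \<partial>M)"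
    by (intro mult_left_mono nn_integral_mono Suc) auto
  also have "(\<integral>\<^sup>+\<omega>. ennreal c * lyap c k n j (A \<omega> * r) + ennreal (D * (c * m) ^ j * \<bar>A \<omega> * b\<bar> powr k) \<partial>M)
    = ennreal c * (\<integral>\<^sup>+\<omega>. lyap c k n j (A \<omega> * r) \<partial>M) + ennreal (D * (c * m) ^ j * \<bar>b\<bar> powr k) * ennreal m"
  proof (subst nn_integral_add)
    have "(\<integral>\<^sup>+\<omega>. ennreal (D * (c * m) ^ j * \<bar>A \<omega> * b\<bar> powr k) \<partial>M) = (\<integral>\<^sup>+\<omega>. ennreal (D * (c * m) ^ j * \<bar>b\<bar> powr k) * ennreal (\<bar>A \<omega>\<bar> powr k) \<partial>M)"
      using c D m by (intro nn_integral_cong) (simp add: abs_mult powr_mult mult_ac flip: ennreal_mult)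
    also have "\<dots> = ennreal (D * (c * m) ^ j * \<bar>b\<bar> powr k) * ennreal m"
      by (subst nn_integral_cmult) (auto simp: m)
    finally show "(\<integral>\<^sup>+\<omega>. ennreal c * lyap c k n j (A \<omega> * r) \<partial>M) + (\<integral>\<^sup>+\<omega>. ennreal (D * (c * m) ^ j * \<bar>A \<omega> * b\<bar> powr k) \<partial>M)
      = ennreal c * (\<integral>\<^sup>+\<omega>. lyap c k n j (A \<omega> * r) \<partial>M) + ennreal (D * (c * m) ^ j * \<bar>b\<bar> powr k) * ennreal m"
      by (simp add: nn_integral_cmult)
  qed auto
  also have "ennreal c * (ennreal c * (\<integral>\<^sup>+\<omega>. lyap c k n j (A \<omega> * r) \<partial>M) + ennreal (D * (c * m) ^ j * \<bar>b\<bar> powr k) * ennreal m)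
    = ennreal c * lyap c k n (Suc j) r + ennreal (D * (c * m) ^ Suc j * \<bar>b\<bar> powr k)"
    using c D m by (simp add: distrib_left mult_ac flip: ennreal_mult)
  finally show ?case .
qed

text \<open>Ignoring the truncation gives geometric decay in j, but no control in r until a moment
  of R is known. The complementary bound \<open>lyap_le_const\<close> is uniform in r but grows when
  c > 1.\<close>

lemma lyap_le: "lyap c k n j r \<le> ennreal ((c * m) ^ j * \<bar>r\<bar> powr k)"
proof (induct j arbitrary: r)
  case (Suc j)
  have "lyap c k n (Suc j) r \<le> ennreal c * (\<integral>\<^sup>+\<omega>. ennreal ((c * m) ^ j * \<bar>A \<omega> * r\<bar> powr k) \<partial>M)"
    unfolding lyap.simps by (intro mult_left_mono nn_integral_mono Suc) auto
  also have "(\<integral>\<^sup>+\<omega>. ennreal ((c * m) ^ j * \<bar>A \<omega> * r\<bar> powr k) \<partial>M) = (\<integral>\<^sup>+\<omega>. ennreal ((c * m) ^ j * \<bar>r\<bar> powr k) * ennreal (\<bar>A \<omega>\<bar> powr k) \<partial>M)"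
    using c m by (intro nn_integral_cong) (simp add: abs_mult powr_mult mult_ac flip: ennreal_mult)
  also have "\<dots> = ennreal ((c * m) ^ j * \<bar>r\<bar> powr k) * ennreal m"
    by (subst nn_integral_cmult) (auto simp: m)
  finally show ?case using c m by (simp add: mult_ac flip: ennreal_mult)
qed simp

lemma lyap_le_const: "lyap c k n j r \<le> ennreal (c ^ j * real n)"
proof (induct j arbitrary: r)
  case (Suc j)
  have "lyap c k n (Suc j) r \<le> ennreal c * (\<integral>\<^sup>+\<omega>. ennreal (c ^ j * real n) \<partial>M)"
    unfolding lyap.simps by (intro mult_left_mono nn_integral_mono Suc) auto
  then show ?case using c by (simp add: emeasure_space_1 mult_ac flip: ennreal_mult)
qed simp

text \<open>Each use of the fixed-point equation trades level j for level j + 1 at the cost of D (c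
  m)^j E|B|^k. The geometric series bounds the total cost independently of j and of the truncation
  n.\<close>

lemma moment_iterate:
  assumes b: "(\<integral>\<^sup>+\<omega>. ennreal (\<bar>B \<omega>\<bar> powr k) \<partial>M) = ennreal b" "b \<ge> 0" and cm: "c * m < 1"
  shows "(\<integral>\<^sup>+\<omega>. lyap c k n 0 (R \<omega>) \<partial>M) \<le> (\<integral>\<^sup>+\<omega>. lyap c k n j (R \<omega>) \<partial>M) + ennreal (D * b / (1 - c * m))"
proof -
  have cm0: "c * m \<ge> 0" using c m by simp
  have "(\<integral>\<^sup>+\<omega>. lyap c k n 0 (R \<omega>) \<partial>M) \<le> (\<integral>\<^sup>+\<omega>. lyap c k n j (R \<omega>) \<partial>M) + ennreal (D * b * (\<Sum>i<j. (c * m) ^ i))"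
  proof (induct j)
    case (Suc j)
    have "(\<integral>\<^sup>+\<omega>. lyap c k n j (R \<omega>) \<partial>M) = (\<integral>\<^sup>+\<omega>'. \<integral>\<^sup>+\<omega>. lyap c k n j (A \<omega> * R \<omega>' + B \<omega>) \<partial>M \<partial>M)"
      by (rule fixpoint_nn_integral) simp
    also have "\<dots> \<le> (\<integral>\<^sup>+\<omega>'. \<integral>\<^sup>+\<omega>. ennreal c * lyap c k n j (A \<omega> * R \<omega>') + ennreal (D * (c * m) ^ j * \<bar>B \<omega>\<bar> powr k) \<partial>M \<partial>M)"
      by (intro nn_integral_mono lyap_add)
    also have "\<dots> = (\<integral>\<^sup>+\<omega>'. lyap c k n (Suc j) (R \<omega>') + ennreal (D * (c * m) ^ j * b) \<partial>M)"
    proof (rule nn_integral_cong)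
      fix \<omega>'
      have "(\<integral>\<^sup>+\<omega>. ennreal (D * (c * m) ^ j * \<bar>B \<omega>\<bar> powr k) \<partial>M) = (\<integral>\<^sup>+\<omega>. ennreal (D * (c * m) ^ j) * ennreal (\<bar>B \<omega>\<bar> powr k) \<partial>M)"
        using D cm0 by (intro nn_integral_cong) (simp flip: ennreal_mult)
      also have "\<dots> = ennreal (D * (c * m) ^ j * b)"
        using D cm0 b by (subst nn_integral_cmult) (auto simp flip: ennreal_mult)
      finally have "(\<integral>\<^sup>+\<omega>. ennreal (D * (c * m) ^ j * \<bar>B \<omega>\<bar> powr k) \<partial>M) = ennreal (D * (c * m) ^ j * b)" .
      then show "(\<integral>\<^sup>+\<omega>. ennreal c * lyap c k n j (A \<omega> * R \<omega>') + ennreal (D * (c * m) ^ j * \<bar>B \<omega>\<bar> powr k) \<partial>M)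
        = lyap c k n (Suc j) (R \<omega>') + ennreal (D * (c * m) ^ j * b)"
        by (subst nn_integral_add) (auto simp: nn_integral_cmult)
    qed
    also have "\<dots> = (\<integral>\<^sup>+\<omega>'. lyap c k n (Suc j) (R \<omega>') \<partial>M) + ennreal (D * (c * m) ^ j * b)"
      by (subst nn_integral_add) (auto simp: emeasure_space_1 simp del: lyap.simps)
    finally have "(\<integral>\<^sup>+\<omega>. lyap c k n j (R \<omega>) \<partial>M) \<le> (\<integral>\<^sup>+\<omega>'. lyap c k n (Suc j) (R \<omega>') \<partial>M) + ennreal (D * (c * m) ^ j * b)" .
    from add_right_mono[OF this, of "ennreal (D * b * (\<Sum>i<j. (c * m) ^ i))"]
    have "(\<integral>\<^sup>+\<omega>. lyap c k n 0 (R \<omega>) \<partial>M) \<le> (\<integral>\<^sup>+\<omega>'. lyap c k n (Suc j) (R \<omega>') \<partial>M) + ennreal (D * (c * m) ^ j * b) + ennreal (D * b * (\<Sum>i<j. (c * m) ^ i))"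
      by (rule order_trans[OF Suc])
    also have "\<dots> = (\<integral>\<^sup>+\<omega>'. lyap c k n (Suc j) (R \<omega>') \<partial>M) + ennreal (D * b * (\<Sum>i<Suc j. (c * m) ^ i))"
      using D b cm0 by (simp add: add.assoc sum_nonneg distrib_left mult_ac add.commute del: lyap.simps flip: ennreal_plus)
    finally show ?case .
  qed simp
  also have "\<dots> \<le> (\<integral>\<^sup>+\<omega>. lyap c k n j (R \<omega>) \<partial>M) + ennreal (D * b / (1 - c * m))"
  proof (intro add_left_mono ennreal_leI)
    have "(\<Sum>i<j. (c * m) ^ i) = (1 - (c * m) ^ j) / (1 - c * m)" using cm by (subst sum_gp_strict) auto
    also have "\<dots> \<le> 1 / (1 - c * m)" using cm cm0 by (intro divide_right_mono) auto
    finally have "D * b * (\<Sum>i<j. (c * m) ^ i) \<le> D * b * (1 / (1 - c * m))" using D b by (intro mult_left_mono) auto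
    then show "D * b * (\<Sum>i<j. (c * m) ^ i) \<le> D * b / (1 - c * m)" by simp
  qed
  finally show ?thesis .
qed

lemma moment_finite_if:
  assumes b: "(\<integral>\<^sup>+\<omega>. ennreal (\<bar>B \<omega>\<bar> powr k) \<partial>M) < \<infinity>" and cm: "c * m < 1"
    and lim: "\<And>n. (\<lambda>j. \<integral>\<^sup>+\<omega>. lyap c k n j (R \<omega>) \<partial>M) \<longlonglongrightarrow> 0"
  shows "(\<integral>\<^sup>+\<omega>. ennreal (\<bar>R \<omega>\<bar> powr k) \<partial>M) < \<infinity>"
proof -
  obtain b' where b': "(\<integral>\<^sup>+\<omega>. ennreal (\<bar>B \<omega>\<bar> powr k) \<partial>M) = ennreal b'" "b' \<ge> 0"
    using b by (cases "\<integral>\<^sup>+\<omega>. ennreal (\<bar>B \<omega>\<bar> powr k) \<partial>M") auto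
  have le: "(\<integral>\<^sup>+\<omega>. lyap c k n 0 (R \<omega>) \<partial>M) \<le> ennreal (D * b' / (1 - c * m))" for n
  proof (rule LIMSEQ_le_const)
    have "(\<lambda>j. (\<integral>\<^sup>+\<omega>. lyap c k n j (R \<omega>) \<partial>M) + ennreal (D * b' / (1 - c * m))) \<longlonglongrightarrow> 0 + ennreal (D * b' / (1 - c * m))"
      by (intro tendsto_add lim tendsto_const)
    then show "(\<lambda>j. (\<integral>\<^sup>+\<omega>. lyap c k n j (R \<omega>) \<partial>M) + ennreal (D * b' / (1 - c * m))) \<longlonglongrightarrow> ennreal (D * b' / (1 - c * m))"
      by simp
    show "\<exists>N. \<forall>j\<ge>N. (\<integral>\<^sup>+\<omega>. lyap c k n 0 (R \<omega>) \<partial>M) \<le> (\<integral>\<^sup>+\<omega>. lyap c k n j (R \<omega>) \<partial>M) + ennreal (D * b' / (1 - c * m))"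
      using moment_iterate[OF b' cm] by blast
  qed
  have "(\<integral>\<^sup>+\<omega>. ennreal (\<bar>R \<omega>\<bar> powr k) \<partial>M) = (\<integral>\<^sup>+\<omega>. (SUP n. lyap c k n 0 (R \<omega>)) \<partial>M)"
  proof (rule nn_integral_cong)
    fix \<omega>
    obtain n where n: "\<bar>R \<omega>\<bar> powr k \<le> real n" using real_arch_simple by blast
    show "ennreal (\<bar>R \<omega>\<bar> powr k) = (SUP n. lyap c k n 0 (R \<omega>))"
    proof (rule antisym)
      have "ennreal (\<bar>R \<omega>\<bar> powr k) = lyap c k n 0 (R \<omega>)"
        using n by (simp add: min_def)
      also have "\<dots> \<le> (SUP n. lyap c k n 0 (R \<omega>))" by (rule SUP_upper) simp
      finally show "ennreal (\<bar>R \<omega>\<bar> powr k) \<le> (SUP n. lyap c k n 0 (R \<omega>))" .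
      show "(SUP n. lyap c k n 0 (R \<omega>)) \<le> ennreal (\<bar>R \<omega>\<bar> powr k)" by (rule SUP_least) (simp add: ennreal_leI)
    qed
  qed
  also have "\<dots> = (SUP n. \<integral>\<^sup>+\<omega>. lyap c k n 0 (R \<omega>) \<partial>M)"
    by (rule nn_integral_monotone_convergence_SUP)
       (auto simp: incseq_def le_fun_def intro!: ennreal_leI)
  also have "\<dots> \<le> ennreal (D * b' / (1 - c * m))" by (rule SUP_least) (rule le)
  also have "\<dots> < \<infinity>" by simp
  finally show ?thesis .
qed

end

text \<open>For k <= 1 subadditivity permits c = 1, so the truncated functions are bounded by n for
  all j and dominated convergence needs no moment of R beforehand.\<close>

lemma moment_small:
  assumes k: "0 < k" "k \<le> 1" and m: "(\<integral>\<^sup>+\<omega>. ennreal (\<bar>A \<omega>\<bar> powr k) \<partial>M) < 1"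
    and b: "(\<integral>\<^sup>+\<omega>. ennreal (\<bar>B \<omega>\<bar> powr k) \<partial>M) < \<infinity>"
  shows "(\<integral>\<^sup>+\<omega>. ennreal (\<bar>R \<omega>\<bar> powr k) \<partial>M) < \<infinity>"
proof -
  obtain m' where m': "(\<integral>\<^sup>+\<omega>. ennreal (\<bar>A \<omega>\<bar> powr k) \<partial>M) = ennreal m'" "m' \<ge> 0" "m' < 1"
    using m by (cases "\<integral>\<^sup>+\<omega>. ennreal (\<bar>A \<omega>\<bar> powr k) \<partial>M") (auto simp: ennreal_less_iff simp flip: ennreal_1)
  have conv: "\<bar>x + y\<bar> powr k \<le> 1 * \<bar>x\<bar> powr k + 1 * \<bar>y\<bar> powr k" for x y
  proof -
    have "\<bar>x + y\<bar> powr k \<le> (\<bar>x\<bar> + \<bar>y\<bar>) powr k" using k by (intro powr_mono2 abs_triangle_ineq) auto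
    also have "\<dots> \<le> \<bar>x\<bar> powr k + \<bar>y\<bar> powr k" using k by (intro powr_add_le_add_powr) auto
    finally show ?thesis by simp
  qed
  note ctx = order_refl[of "1::real"] k(1) zero_le_one conv m'(1,2)
  show ?thesis
  proof (rule moment_finite_if[OF ctx b])
    fix n
    have "(\<lambda>j. \<integral>\<^sup>+\<omega>. lyap 1 k n j (R \<omega>) \<partial>M) \<longlonglongrightarrow> (\<integral>\<^sup>+\<omega>. 0 \<partial>M)"
    proof (rule nn_integral_dominated_convergence[where w="\<lambda>_. ennreal (real n)"])
      show "AE \<omega> in M. lyap 1 k n j (R \<omega>) \<le> ennreal (real n)" for j
        using lyap_le_const[OF ctx, of n j] by simp
      show "AE \<omega> in M. (\<lambda>j. lyap 1 k n j (R \<omega>)) \<longlonglongrightarrow> 0"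
      proof (rule AE_I2)
        fix \<omega>
        have "(\<lambda>j. ennreal ((1 * m') ^ j * \<bar>R \<omega>\<bar> powr k)) \<longlonglongrightarrow> ennreal (0 * \<bar>R \<omega>\<bar> powr k)"
          using m' by (intro tendsto_intros LIMSEQ_realpow_zero) auto
        then have lim: "(\<lambda>j. ennreal ((1 * m') ^ j * \<bar>R \<omega>\<bar> powr k)) \<longlonglongrightarrow> 0" by simp
        show "(\<lambda>j. lyap 1 k n j (R \<omega>)) \<longlonglongrightarrow> 0"
          by (rule tendsto_sandwich[where f="\<lambda>_. 0" and h="\<lambda>j. ennreal ((1 * m') ^ j * \<bar>R \<omega>\<bar> powr k)"])
             (use lyap_le[OF ctx, of n] lim in \<open>auto intro!: always_eventually\<close>)
      qed
    qed (auto simp: emeasure_space_1)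
    then show "(\<lambda>j. \<integral>\<^sup>+\<omega>. lyap 1 k n j (R \<omega>) \<partial>M) \<longlonglongrightarrow> 0" by simp
  qed (use m' in auto)
qed

text \<open>For k > 1 a factor c > 1 is unavoidable, and the truncated functions are no longer
  bounded uniformly in j. Interpolating between the two bounds with weight t = k1 / k leaves |R|^k1,
  already known to be integrable, and a geometric rate.\<close>

lemma moment_bootstrap:
  assumes k: "0 < k1" "k1 \<le> k" and m: "(\<integral>\<^sup>+\<omega>. ennreal (\<bar>A \<omega>\<bar> powr k) \<partial>M) < 1"
    and b: "(\<integral>\<^sup>+\<omega>. ennreal (\<bar>B \<omega>\<bar> powr k) \<partial>M) < \<infinity>"
    and R1: "(\<integral>\<^sup>+\<omega>. ennreal (\<bar>R \<omega>\<bar> powr k1) \<partial>M) < \<infinity>"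
  shows "(\<integral>\<^sup>+\<omega>. ennreal (\<bar>R \<omega>\<bar> powr k) \<partial>M) < \<infinity>"
proof -
  obtain m' where m': "(\<integral>\<^sup>+\<omega>. ennreal (\<bar>A \<omega>\<bar> powr k) \<partial>M) = ennreal m'" "m' \<ge> 0" "m' < 1"
    using m by (cases "\<integral>\<^sup>+\<omega>. ennreal (\<bar>A \<omega>\<bar> powr k) \<partial>M") (auto simp: ennreal_less_iff simp flip: ennreal_1)
  define t where "t = k1 / k"
  have t: "0 < t" "t \<le> 1" "k * t = k1" using k by (auto simp: t_def)
  have mt: "m' powr t < 1" using m' t by (cases "m' = 0") (auto simp: powr_def mult_pos_neg)
  \<comment> \<open>Chosen so that c > 1 and c (m')^t < 1 hold together; for x < 1 the number 2 / (1
    + x) has both properties.\<close>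
  define c where "c = 2 / (1 + m' powr t)"
  have c1: "c > 1" using mt m' by (simp add: c_def field_simps add_pos_nonneg)
  have cmt: "c * m' powr t < 1" using mt by (simp add: c_def field_simps add_pos_nonneg)
  have "m' \<le> m' powr t"
  proof (cases "m' = 0")
    case False
    then have "m' powr 1 \<le> m' powr t" using m' t by (intro powr_mono') auto
    then show ?thesis using m' False by simp
  qed simp
  then have cm: "c * m' < 1" using cmt c1 mult_left_mono[of m' "m' powr t" c] by linarith
  obtain D where D: "D > 0" "\<And>x y. \<bar>x + y\<bar> powr k \<le> c * \<bar>x\<bar> powr k + D * \<bar>y\<bar> powr k"
    using powr_add_le_weighted[OF c1, of k] k by auto
  have k0: "0 < k" using k by simp
  note ctx = less_imp_le[OF c1] k0 less_imp_le[OF D(1)] D(2) m'(1,2)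
  \<comment> \<open>The interpolated rate: c^(1 - t) from the constant bound times (c m')^t from the
    decaying one. It equals c (m')^t, hence is below 1.\<close>
  define q where "q = c powr (1 - t) * (c * m') powr t"
  have q: "0 \<le> q" "q < 1"
  proof -
    have "q = c * m' powr t"
      using c1 m' by (simp add: q_def powr_mult flip: powr_add mult.assoc)
    then show "0 \<le> q" "q < 1" using cmt c1 by auto
  qed
  show ?thesis
  proof (rule moment_finite_if[OF ctx b cm])
    fix n
    have bound: "lyap c k n j r \<le> ennreal (q ^ j * real n powr (1 - t)) * ennreal (\<bar>r\<bar> powr k1)" for j r
    proof -
      let ?x = "c ^ j * real n" and ?y = "(c * m') ^ j * \<bar>r\<bar> powr k"
      have xy: "?x \<ge> 0" "?y \<ge> 0" using c1 m' by auto
      have "lyap c k n j r \<le> min (ennreal ?x) (ennreal ?y)"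
        using lyap_le[OF ctx] lyap_le_const[OF ctx] by simp
      also have "\<dots> = ennreal (min ?x ?y)" using xy by (simp add: min_def ennreal_le_iff)
      \<comment> \<open>The minimum of two nonnegative numbers is at most their geometric mean with
        weights 1 - t and t.\<close>
      also have "min ?x ?y \<le> ?x powr (1 - t) * ?y powr t"
      proof (cases "min ?x ?y = 0")
        case False
        then have p: "min ?x ?y > 0" using xy by linarith
        have "min ?x ?y = min ?x ?y powr (1 - t) * min ?x ?y powr t" using p by (simp flip: powr_add)
        also have "\<dots> \<le> ?x powr (1 - t) * ?y powr t" using p t by (intro mult_mono powr_mono2) auto
        finally show ?thesis .
      qed simp
      also have "?x powr (1 - t) * ?y powr t = q ^ j * real n powr (1 - t) * \<bar>r\<bar> powr k1"
      proof -
        have "(u ^ j) powr w = (u powr w) ^ j" if "u \<ge> 0" for u w :: real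
          using that by (induct j) (auto simp: powr_mult)
        then have "(c ^ j) powr (1 - t) = (c powr (1 - t)) ^ j" "((c * m') ^ j) powr t = ((c * m') powr t) ^ j"
          using c1 m' by auto
        then show ?thesis
          using c1 m' t by (simp add: powr_mult powr_powr q_def power_mult_distrib mult_ac)
      qed
      finally show ?thesis using q by (simp add: ennreal_leI flip: ennreal_mult)
    qed
    obtain K where K: "(\<integral>\<^sup>+\<omega>. ennreal (\<bar>R \<omega>\<bar> powr k1) \<partial>M) = ennreal K" "K \<ge> 0"
      using R1 by (cases "\<integral>\<^sup>+\<omega>. ennreal (\<bar>R \<omega>\<bar> powr k1) \<partial>M") auto
    have le: "(\<integral>\<^sup>+\<omega>. lyap c k n j (R \<omega>) \<partial>M) \<le> ennreal (q ^ j * real n powr (1 - t) * K)" for j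
    proof -
      have "(\<integral>\<^sup>+\<omega>. lyap c k n j (R \<omega>) \<partial>M) \<le> (\<integral>\<^sup>+\<omega>. ennreal (q ^ j * real n powr (1 - t)) * ennreal (\<bar>R \<omega>\<bar> powr k1) \<partial>M)"
        by (intro nn_integral_mono bound)
      also have "\<dots> = ennreal (q ^ j * real n powr (1 - t) * K)"
        using q K by (subst nn_integral_cmult) (auto simp flip: ennreal_mult)
      finally show ?thesis .
    qed
    have "(\<lambda>j. ennreal (q ^ j * real n powr (1 - t) * K)) \<longlonglongrightarrow> ennreal (0 * real n powr (1 - t) * K)"
      using q by (intro tendsto_intros LIMSEQ_realpow_zero) auto
    then have lim: "(\<lambda>j. ennreal (q ^ j * real n powr (1 - t) * K)) \<longlonglongrightarrow> 0" by simp
    show "(\<lambda>j. \<integral>\<^sup>+\<omega>. lyap c k n j (R \<omega>) \<partial>M) \<longlonglongrightarrow> 0"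
      by (rule tendsto_sandwich[where f="\<lambda>_. 0" and h="\<lambda>j. ennreal (q ^ j * real n powr (1 - t) * K)"])
         (use le lim in \<open>auto intro!: always_eventually\<close>)
  qed
qed

lemma moment_finite:
  assumes \<alpha>: "\<alpha> > 0"
    and m: "\<And>k. 0 < k \<Longrightarrow> k < \<alpha> \<Longrightarrow> (\<integral>\<^sup>+\<omega>. ennreal (\<bar>A \<omega>\<bar> powr k) \<partial>M) < 1"
    and b: "\<And>k. 0 < k \<Longrightarrow> k < \<alpha> \<Longrightarrow> (\<integral>\<^sup>+\<omega>. ennreal (\<bar>B \<omega>\<bar> powr k) \<partial>M) < \<infinity>"
    and k: "0 < k" "k < \<alpha>"
  shows "(\<integral>\<^sup>+\<omega>. ennreal (\<bar>R \<omega>\<bar> powr k) \<partial>M) < \<infinity>"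
proof -
  have k1: "0 < min k 1" "min k 1 \<le> 1" "min k 1 < \<alpha>" "min k 1 \<le> k" using k by auto
  have "(\<integral>\<^sup>+\<omega>. ennreal (\<bar>R \<omega>\<bar> powr min k 1) \<partial>M) < \<infinity>"
    by (intro moment_small k1 m b)
  then show ?thesis by (intro moment_bootstrap[OF k1(1) k1(4)] m b k)
qed

end

section \<open>Slowly varying tails\<close>

locale slow_tail = prob_space M for M :: "'a measure" +
  fixes B :: "'a \<Rightarrow> real" and \<alpha> :: real
  assumes B_meas [measurable]: "B \<in> borel_measurable M" and \<alpha>_pos: "\<alpha> > 0"
    and sv: "slowly_varying (\<lambda>x. x powr \<alpha> * measure M {\<omega> \<in> space M. B \<omega> > x})"
begin

text \<open>\<open>L\<close> in logarithmic scale.\<close>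

definition B_tail :: "real \<Rightarrow> real" where
  "B_tail z = exp (\<alpha> * z) * prob {\<omega> \<in> space M. B \<omega> > exp z}"

lemma B_tail_eq: "x > 0 \<Longrightarrow> x powr \<alpha> * prob {\<omega> \<in> space M. B \<omega> > x} = B_tail (ln x)"
  by (simp add: B_tail_def powr_def)

lemma tail_antimono:
  assumes "z \<le> w" shows "prob {\<omega> \<in> space M. B \<omega> > exp w} \<le> prob {\<omega> \<in> space M. B \<omega> > exp z}"
proof (rule finite_measure_mono)
  have "exp z \<le> exp w" using assms by simp
  from le_less_trans[OF this] show "{\<omega> \<in> space M. B \<omega> > exp w} \<subseteq> {\<omega> \<in> space M. B \<omega> > exp z}"
    by blast
qed simp

lemma B_tail_measurable [measurable]: "B_tail \<in> borel_measurable borel"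
proof -
  have "mono (\<lambda>z. - prob {\<omega> \<in> space M. B \<omega> > exp z})"
    by (rule monoI) (simp add: tail_antimono)
  then have "(\<lambda>z. - prob {\<omega> \<in> space M. B \<omega> > exp z}) \<in> borel_measurable borel"
    by (rule borel_measurable_mono)
  then have "(\<lambda>z. - (- prob {\<omega> \<in> space M. B \<omega> > exp z})) \<in> borel_measurable borel"
    by (rule borel_measurable_uminus)
  then show ?thesis unfolding B_tail_def by simp
qed

lemma B_tail_pos: "B_tail z > 0"
proof -
  have "exp z powr \<alpha> * prob {\<omega> \<in> space M. B \<omega> > exp z} > 0"
    using sv by (auto simp: slowly_varying_def)
  then show ?thesis using B_tail_eq[of "exp z"] by simp
qed

lemma B_tail_le_exp: "B_tail z \<le> exp (\<alpha> * z)"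
  by (simp add: B_tail_def mult_left_le)

text \<open>The probability can only decrease as z grows, so a step forward of length at most 1
  gains no more than the growth of exp (\<alpha> z).\<close>

lemma B_tail_forward:
  assumes "z \<le> w" "w \<le> z + 1" shows "B_tail w \<le> exp \<alpha> * B_tail z"
proof -
  have "prob {\<omega> \<in> space M. B \<omega> > exp w} \<le> prob {\<omega> \<in> space M. B \<omega> > exp z}"
    by (rule tail_antimono) (rule assms)
  moreover have "exp (\<alpha> * w) \<le> exp \<alpha> * exp (\<alpha> * z)"
    using assms \<alpha>_pos mult_left_mono[of w "z + 1" \<alpha>] by (simp add: algebra_simps flip: exp_add)
  ultimately have "B_tail w \<le> (exp \<alpha> * exp (\<alpha> * z)) * prob {\<omega> \<in> space M. B \<omega> > exp z}"
    unfolding B_tail_def by (intro mult_mono) auto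
  then show ?thesis by (simp add: B_tail_def mult_ac)
qed

lemma B_tail_step:
  assumes "\<epsilon> > 0"
  obtains z0 where "\<And>z. z \<ge> z0 \<Longrightarrow> B_tail (z + 1) \<le> exp \<epsilon> * B_tail z" "\<And>z. z \<ge> z0 \<Longrightarrow> B_tail z \<le> exp \<epsilon> * B_tail (z + 1)"
proof -
  let ?L = "\<lambda>x. x powr \<alpha> * prob {\<omega> \<in> space M. B \<omega> > x}"
  have "\<forall>c>0. ((\<lambda>x. ?L (c * x) / ?L x) \<longlongrightarrow> 1) at_top"
    using sv by (simp add: slowly_varying_def)
  then have "((\<lambda>x. ?L (exp 1 * x) / ?L x) \<longlongrightarrow> 1) at_top"
    by (rule allE[of _ "exp 1"]) simp
  then have "((\<lambda>z. ?L (exp 1 * exp z) / ?L (exp z)) \<longlongrightarrow> 1) at_top"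
    by (rule filterlim_compose[OF _ exp_at_top])
  then have lim: "((\<lambda>z. B_tail (z + 1) / B_tail z) \<longlongrightarrow> 1) at_top"
  proof -
    have "exp 1 * exp z = exp (z + 1)" for z :: real by (simp add: exp_add)
    then have "?L (exp z) = B_tail z" "?L (exp 1 * exp z) = B_tail (z + 1)" for z
      using B_tail_eq[of "exp z"] B_tail_eq[of "exp (z + 1)"] by simp_all
    with \<open>((\<lambda>z. ?L (exp 1 * exp z) / ?L (exp z)) \<longlongrightarrow> 1) at_top\<close> show ?thesis by simp
  qed
  have e: "exp (- \<epsilon>) < 1" "1 < exp \<epsilon>" using assms by auto
  have "\<forall>\<^sub>F z in at_top. exp (- \<epsilon>) < B_tail (z + 1) / B_tail z \<and> B_tail (z + 1) / B_tail z < exp \<epsilon>"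
    using order_tendstoD[OF lim] e by (auto intro: eventually_conj)
  then obtain z0 where z0: "\<And>z. z \<ge> z0 \<Longrightarrow> exp (- \<epsilon>) < B_tail (z + 1) / B_tail z \<and> B_tail (z + 1) / B_tail z < exp \<epsilon>"
    by (auto simp: eventually_at_top_linorder)
  show ?thesis
  proof (rule that)
    fix z assume "z \<ge> z0"
    from z0[OF this] B_tail_pos[of z] show "B_tail (z + 1) \<le> exp \<epsilon> * B_tail z" "B_tail z \<le> exp \<epsilon> * B_tail (z + 1)"
      by (simp_all add: field_simps exp_minus)
  qed
qed

text \<open>Slow variation is used for the single factor e and iterated over integer steps in the
  logarithm; fractional remainders are handled by monotonicity of the tail. No uniform convergence
  in the scaling factor is required.\<close>

lemma potter:
  assumes e: "\<epsilon> > 0"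
  obtains C z0 where "C > 0" "\<And>z w. z \<ge> z0 \<Longrightarrow> w \<ge> z0 \<Longrightarrow> B_tail z \<le> C * B_tail w * exp (\<epsilon> * \<bar>z - w\<bar>)"
proof -
  obtain z0 where z0: "\<And>z. z \<ge> z0 \<Longrightarrow> B_tail (z + 1) \<le> exp \<epsilon> * B_tail z" "\<And>z. z \<ge> z0 \<Longrightarrow> B_tail z \<le> exp \<epsilon> * B_tail (z + 1)"
    using B_tail_step[OF e] by metis
  have up: "B_tail (z + real k) \<le> exp (\<epsilon> * real k) * B_tail z" if "z \<ge> z0" for z k
  proof (induct k)
    case (Suc k)
    have "B_tail (z + real (Suc k)) \<le> exp \<epsilon> * B_tail (z + real k)" using z0(1)[of "z + real k"] that by (simp add: add_ac)
    also have "\<dots> \<le> exp \<epsilon> * (exp (\<epsilon> * real k) * B_tail z)" using Suc by (intro mult_left_mono) auto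
    finally show ?case by (simp add: algebra_simps exp_add)
  qed simp
  have down: "B_tail z \<le> exp (\<epsilon> * real k) * B_tail (z + real k)" if "z \<ge> z0" for z k
  proof (induct k)
    case (Suc k)
    have "B_tail (z + real k) \<le> exp \<epsilon> * B_tail (z + real (Suc k))" using z0(2)[of "z + real k"] that by (simp add: add_ac)
    then have "exp (\<epsilon> * real k) * B_tail (z + real k) \<le> exp (\<epsilon> * real k) * (exp \<epsilon> * B_tail (z + real (Suc k)))" by (intro mult_left_mono) auto
    from order_trans[OF Suc this] show ?case by (simp add: algebra_simps exp_add)
  qed simp
  define C where "C = exp \<alpha> * exp \<epsilon>"
  have C: "C > 0" "exp \<alpha> \<le> C" using e by (auto simp: C_def)
  have both: "B_tail w \<le> C * B_tail z * exp (\<epsilon> * (w - z)) \<and> B_tail z \<le> C * B_tail w * exp (\<epsilon> * (w - z))" if zw: "z \<ge> z0" "z \<le> w" for z w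
  proof -
    define k where "k = nat \<lfloor>w - z\<rfloor>"
    have k: "z + real k \<le> w" "w \<le> z + real k + 1" using zw by (auto simp: k_def) linarith+
    have ek: "exp (\<epsilon> * real k) \<le> exp (\<epsilon> * (w - z))" using k e by (auto intro: mult_left_mono)
    have "B_tail w \<le> exp \<alpha> * B_tail (z + real k)" using k by (intro B_tail_forward) auto
    also have "\<dots> \<le> exp \<alpha> * (exp (\<epsilon> * real k) * B_tail z)" by (intro mult_left_mono up zw) auto
    also have "\<dots> \<le> C * (exp (\<epsilon> * (w - z)) * B_tail z)" using ek B_tail_pos[of z] C by (intro mult_mono) auto
    finally have 1: "B_tail w \<le> C * B_tail z * exp (\<epsilon> * (w - z))" by (simp add: mult_ac)
    \<comment> \<open>Here k + 1 steps are taken, so that the end point lies in [w, w + 1] and the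
      one-sided forward bound from w applies.\<close>
    have "B_tail z \<le> exp (\<epsilon> * real (Suc k)) * B_tail (z + real (Suc k))" by (rule down) (rule zw)
    also have "\<dots> \<le> exp (\<epsilon> * real (Suc k)) * (exp \<alpha> * B_tail w)" using k by (intro mult_left_mono B_tail_forward) auto
    also have "exp (\<epsilon> * real (Suc k)) = exp \<epsilon> * exp (\<epsilon> * real k)" by (simp add: algebra_simps exp_add)
    also have "(exp \<epsilon> * exp (\<epsilon> * real k)) * (exp \<alpha> * B_tail w) \<le> (exp \<epsilon> * exp (\<epsilon> * (w - z))) * (exp \<alpha> * B_tail w)"
      using ek B_tail_pos[of w] by (intro mult_right_mono mult_left_mono) auto
    finally have 2: "B_tail z \<le> C * B_tail w * exp (\<epsilon> * (w - z))" by (simp add: C_def mult_ac)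
    from 1 2 show ?thesis ..
  qed
  show ?thesis
  proof (rule that[OF C(1)])
    fix z w assume "z \<ge> z0" "w \<ge> z0"
    then show "B_tail z \<le> C * B_tail w * exp (\<epsilon> * \<bar>z - w\<bar>)"
      using both[of z w] both[of w z] by (cases "z \<le> w") auto
  qed
qed

text \<open>The Potter bound with exponent r/2 spends half of the decay exp (-r |x - z|) and leaves
  an integrable half. Below z0 the trivial bound exp (\<alpha> z) is integrable by itself and yields
  the term exp (-r x).\<close>

lemma nn_integral_B_tail_window:
  assumes r: "r > 0"
  obtains C z0 where "C > 0" "\<And>x. x \<ge> z0 \<Longrightarrow> (\<integral>\<^sup>+z. ennreal (B_tail z * exp (- r * \<bar>x - z\<bar>)) \<partial>lborel) \<le> ennreal (C * (B_tail x + exp (- r * x)))"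
proof -
  obtain C z0 where C: "C > 0" and P: "\<And>z w. z \<ge> z0 \<Longrightarrow> w \<ge> z0 \<Longrightarrow> B_tail z \<le> C * B_tail w * exp ((r / 2) * \<bar>z - w\<bar>)"
    using potter[of "r / 2"] r by auto
  define K where "K = exp ((\<alpha> + r) * z0) * (2 / (\<alpha> + r))"
  have K: "K > 0" using \<alpha>_pos r by (simp add: K_def)
  have "(\<integral>\<^sup>+z. ennreal (B_tail z * exp (- r * \<bar>x - z\<bar>)) \<partial>lborel) \<le> ennreal ((C * (2 / (r / 2)) + K) * (B_tail x + exp (- r * x)))" if x: "x \<ge> z0" for x
  proof -
    have "(\<integral>\<^sup>+z. ennreal (B_tail z * exp (- r * \<bar>x - z\<bar>)) \<partial>lborel)
      \<le> (\<integral>\<^sup>+z. ennreal (C * B_tail x) * ennreal (exp (- (r / 2) * \<bar>x - z\<bar>)) + ennreal (exp (- r * x) * exp ((\<alpha> + r) * z0)) * ennreal (exp (- (\<alpha> + r) * \<bar>z0 - z\<bar>)) \<partial>lborel)"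
    proof (rule nn_integral_mono)
      fix z
      have "B_tail z * exp (- r * \<bar>x - z\<bar>) \<le> C * B_tail x * exp (- (r / 2) * \<bar>x - z\<bar>) + exp (- r * x) * exp ((\<alpha> + r) * z0) * exp (- (\<alpha> + r) * \<bar>z0 - z\<bar>)"
      proof (cases "z \<ge> z0")
        case True
        have "B_tail z * exp (- r * \<bar>x - z\<bar>) \<le> (C * B_tail x * exp ((r / 2) * \<bar>z - x\<bar>)) * exp (- r * \<bar>x - z\<bar>)"
          by (intro mult_right_mono P True x) auto
        also have "\<dots> = C * B_tail x * exp (- (r / 2) * \<bar>x - z\<bar>)"
          by (simp add: abs_minus_commute field_simps flip: exp_add)
        finally show ?thesis by (simp add: add_increasing2)
      next
        case False
        have "B_tail z * exp (- r * \<bar>x - z\<bar>) \<le> exp (\<alpha> * z) * exp (- r * \<bar>x - z\<bar>)"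
          by (intro mult_right_mono B_tail_le_exp) auto
        also have "\<dots> = exp (- r * x) * exp ((\<alpha> + r) * z0) * exp (- (\<alpha> + r) * \<bar>z0 - z\<bar>)"
          using False x by (simp add: algebra_simps flip: exp_add)
        finally show ?thesis using C B_tail_pos[of x] by (simp add: add_increasing)
      qed
      then show "ennreal (B_tail z * exp (- r * \<bar>x - z\<bar>)) \<le> ennreal (C * B_tail x) * ennreal (exp (- (r / 2) * \<bar>x - z\<bar>)) + ennreal (exp (- r * x) * exp ((\<alpha> + r) * z0)) * ennreal (exp (- (\<alpha> + r) * \<bar>z0 - z\<bar>))"
        using C B_tail_pos[of x] by (simp add: ennreal_leI flip: ennreal_mult ennreal_plus)
    qed
    also have "\<dots> = ennreal (C * B_tail x) * ennreal (2 / (r / 2)) + ennreal (exp (- r * x) * exp ((\<alpha> + r) * z0)) * ennreal (2 / (\<alpha> + r))"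
    proof -
      have e: "r / 2 > 0" "\<alpha> + r > 0" using r \<alpha>_pos by auto
      show ?thesis
        unfolding nn_integral_exp_abs[OF e(1), of x, symmetric] nn_integral_exp_abs[OF e(2), of z0, symmetric]
        by (subst nn_integral_add) (simp_all add: nn_integral_cmult)
    qed
    also have "\<dots> = ennreal (C * B_tail x * (2 / (r / 2)) + exp (- r * x) * exp ((\<alpha> + r) * z0) * (2 / (\<alpha> + r)))"
      using C B_tail_pos[of x] r \<alpha>_pos by (simp flip: ennreal_mult ennreal_plus)
    also have "\<dots> \<le> ennreal ((C * (2 / (r / 2)) + K) * (B_tail x + exp (- r * x)))"
    proof (rule ennreal_leI)
      have "0 \<le> C * (2 / (r / 2)) * exp (- r * x)" "0 \<le> K * B_tail x" using C r K B_tail_pos[of x] by auto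
      moreover have "exp (- r * x) * exp ((\<alpha> + r) * z0) * (2 / (\<alpha> + r)) = K * exp (- r * x)" by (simp add: K_def)
      moreover have "(C * (2 / (r / 2)) + K) * (B_tail x + exp (- r * x)) = C * B_tail x * (2 / (r / 2)) + K * exp (- r * x) + C * (2 / (r / 2)) * exp (- r * x) + K * B_tail x"
        by (simp add: algebra_simps)
      ultimately show "C * B_tail x * (2 / (r / 2)) + exp (- r * x) * exp ((\<alpha> + r) * z0) * (2 / (\<alpha> + r)) \<le> (C * (2 / (r / 2)) + K) * (B_tail x + exp (- r * x))"
        by linarith
    qed
    finally show ?thesis .
  qed
  then show ?thesis using that[of "C * (2 / (r / 2)) + K" z0] C K r by (simp add: add_pos_pos)
qed

text \<open>The error functional common to the main term and the increment, with x in logarithmic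
  scale. The indicator removes B <= 0, where \<open>ln\<close> has no meaning for the
  estimate.\<close>

definition window :: "real \<Rightarrow> real \<Rightarrow> ennreal" where
  "window r x = (\<integral>\<^sup>+\<omega>. ennreal (B \<omega> powr \<alpha> * exp (- r * \<bar>x - ln (B \<omega>)\<bar>)) * indicator {0<..} (B \<omega>) \<partial>M)"

text \<open>The mass sitting at ln B is spread over the unit interval to its left, where the weights
  change by at most exp (\<alpha> + r). Exchanging the integrals then replaces B by its tail
  function.\<close>

lemma window_le:
  assumes r: "r > 0"
  shows "window r x \<le> ennreal (exp (\<alpha> + r)) * (\<integral>\<^sup>+z. ennreal (B_tail z * exp (- r * \<bar>x - z\<bar>)) \<partial>lborel)"
proof -
  let ?g = "\<lambda>z \<omega>. ennreal (exp (\<alpha> + r)) * (ennreal (exp (\<alpha> * z) * exp (- r * \<bar>x - z\<bar>)) * (if B \<omega> > exp z then 1 else 0))"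
  have "window r x \<le> (\<integral>\<^sup>+\<omega>. \<integral>\<^sup>+z. ?g z \<omega> \<partial>lborel \<partial>M)"
    unfolding window_def
  proof (rule nn_integral_mono)
    fix \<omega>
    show "ennreal (B \<omega> powr \<alpha> * exp (- r * \<bar>x - ln (B \<omega>)\<bar>)) * indicator {0<..} (B \<omega>) \<le> (\<integral>\<^sup>+z. ?g z \<omega> \<partial>lborel)"
    proof (cases "B \<omega> > 0")
      case True
      define b where "b = ln (B \<omega>)"
      have B: "B \<omega> = exp b" using True by (simp add: b_def)
      have "ennreal (B \<omega> powr \<alpha> * exp (- r * \<bar>x - ln (B \<omega>)\<bar>)) = (\<integral>\<^sup>+z. ennreal (exp (\<alpha> * b) * exp (- r * \<bar>x - b\<bar>)) * indicator {b - 1..<b} z \<partial>lborel)"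
        using True by (subst nn_integral_cmult) (auto simp: b_def powr_def)
      also have "\<dots> \<le> (\<integral>\<^sup>+z. ?g z \<omega> \<partial>lborel)"
      proof (rule nn_integral_mono)
        fix z
        have "exp (\<alpha> * b) * exp (- r * \<bar>x - b\<bar>) \<le> exp (\<alpha> + r) * (exp (\<alpha> * z) * exp (- r * \<bar>x - z\<bar>))" if "b - 1 \<le> z" "z < b"
        proof -
          have "exp (\<alpha> * b) \<le> exp \<alpha> * exp (\<alpha> * z)"
            using that \<alpha>_pos mult_left_mono[of b "z + 1" \<alpha>] by (simp add: algebra_simps flip: exp_add)
          moreover have "exp (- r * \<bar>x - b\<bar>) \<le> exp (r * 1) * exp (- r * \<bar>x - z\<bar>)"
            using that r by (intro exp_abs_shift) auto
          ultimately have "exp (\<alpha> * b) * exp (- r * \<bar>x - b\<bar>) \<le> (exp \<alpha> * exp (\<alpha> * z)) * (exp (r * 1) * exp (- r * \<bar>x - z\<bar>))"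
            by (intro mult_mono) auto
          then show ?thesis by (simp add: exp_add mult_ac)
        qed
        then show "ennreal (exp (\<alpha> * b) * exp (- r * \<bar>x - b\<bar>)) * indicator {b - 1..<b} z \<le> ?g z \<omega>"
          by (auto simp: indicator_def B ennreal_leI simp flip: ennreal_mult)
      qed
      finally show ?thesis using True by simp
    qed simp
  qed
  also have "\<dots> = (\<integral>\<^sup>+z. \<integral>\<^sup>+\<omega>. ?g z \<omega> \<partial>M \<partial>lborel)"
    by (rule pair_sigma_finite.Fubini'[symmetric])
       (auto simp: pair_sigma_finite_def sigma_finite_lborel sigma_finite_measure_axioms)
  also have "\<dots> = (\<integral>\<^sup>+z. ennreal (exp (\<alpha> + r)) * ennreal (B_tail z * exp (- r * \<bar>x - z\<bar>)) \<partial>lborel)"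
  proof (rule nn_integral_cong)
    fix z
    have "(\<integral>\<^sup>+\<omega>. ?g z \<omega> \<partial>M) = (\<integral>\<^sup>+\<omega>. ennreal (exp (\<alpha> + r)) * ennreal (exp (\<alpha> * z) * exp (- r * \<bar>x - z\<bar>)) * indicator {\<omega> \<in> space M. B \<omega> > exp z} \<omega> \<partial>M)"
      by (intro nn_integral_cong) (auto simp: indicator_def mult_ac)
    also have "\<dots> = ennreal (exp (\<alpha> + r)) * ennreal (exp (\<alpha> * z) * exp (- r * \<bar>x - z\<bar>)) * ennreal (prob {\<omega> \<in> space M. B \<omega> > exp z})"
      by (subst nn_integral_cmult) (auto simp: emeasure_eq_measure)
    finally show "(\<integral>\<^sup>+\<omega>. ?g z \<omega> \<partial>M) = ennreal (exp (\<alpha> + r)) * ennreal (B_tail z * exp (- r * \<bar>x - z\<bar>))"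
      by (simp add: B_tail_def mult_ac flip: ennreal_mult)
  qed
  also have "\<dots> = ennreal (exp (\<alpha> + r)) * (\<integral>\<^sup>+z. ennreal (B_tail z * exp (- r * \<bar>x - z\<bar>)) \<partial>lborel)"
    by (rule nn_integral_cmult) auto
  finally show ?thesis .
qed

lemma window_bound:
  assumes r: "r > 0"
  obtains C z0 where "C > 0" "\<And>x. x \<ge> z0 \<Longrightarrow> window r x \<le> ennreal (C * (B_tail x + exp (- r * x)))"
proof -
  obtain C z0 where C: "C > 0" "\<And>x. x \<ge> z0 \<Longrightarrow> (\<integral>\<^sup>+z. ennreal (B_tail z * exp (- r * \<bar>x - z\<bar>)) \<partial>lborel) \<le> ennreal (C * (B_tail x + exp (- r * x)))"
    using nn_integral_B_tail_window[OF r] by metis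
  have "window r x \<le> ennreal (exp (\<alpha> + r) * C * (B_tail x + exp (- r * x)))" if "x \<ge> z0" for x
  proof -
    have "window r x \<le> ennreal (exp (\<alpha> + r)) * ennreal (C * (B_tail x + exp (- r * x)))"
      by (rule order_trans[OF window_le[OF r]]) (intro mult_left_mono C that, simp)
    then show ?thesis using C B_tail_pos[of x] by (simp add: mult.assoc add_pos_pos less_imp_le flip: ennreal_mult)
  qed
  then show ?thesis using that[of "exp (\<alpha> + r) * C" z0] C by simp
qed

text \<open>With r = \<alpha> - k the window at a single point already dominates the moment: for B >
  1, B^k = B^\<alpha> exp (-r ln B), and moving the centre from 0 to z0 costs a constant
  factor.\<close>

lemma moment_pos_finite:
  assumes k: "0 < k" "k < \<alpha>"
  shows "(\<integral>\<^sup>+\<omega>. ennreal (max (B \<omega>) 0 powr k) \<partial>M) < \<infinity>"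
proof -
  define r where "r = \<alpha> - k"
  have r: "r > 0" using k by (simp add: r_def)
  obtain C z0 where C: "C > 0" "\<And>x. x \<ge> z0 \<Longrightarrow> window r x \<le> ennreal (C * (B_tail x + exp (- r * x)))"
    using window_bound[OF r] by metis
  have "(\<integral>\<^sup>+\<omega>. ennreal (max (B \<omega>) 0 powr k) \<partial>M) \<le> (\<integral>\<^sup>+\<omega>. ennreal (exp (r * \<bar>z0\<bar>)) * (ennreal (B \<omega> powr \<alpha> * exp (- r * \<bar>z0 - ln (B \<omega>)\<bar>)) * indicator {0<..} (B \<omega>)) + 1 \<partial>M)"
  proof (rule nn_integral_mono)
    fix \<omega>
    show "ennreal (max (B \<omega>) 0 powr k) \<le> ennreal (exp (r * \<bar>z0\<bar>)) * (ennreal (B \<omega> powr \<alpha> * exp (- r * \<bar>z0 - ln (B \<omega>)\<bar>)) * indicator {0<..} (B \<omega>)) + 1"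
    proof (cases "B \<omega> \<le> 1")
      case True
      then have "max (B \<omega>) 0 powr k \<le> 1 powr k" using k by (intro powr_mono2) auto
      then have "ennreal (max (B \<omega>) 0 powr k) \<le> 1" by (simp add: ennreal_leI flip: ennreal_1)
      then show ?thesis by (rule add_increasing[rotated]) simp
    next
      case False
      define b where "b = ln (B \<omega>)"
      have B: "B \<omega> = exp b" "b > 0" using False by (auto simp: b_def)
      have "exp (k * b) = exp (\<alpha> * b) * exp (- r * \<bar>0 - b\<bar>)"
        using B by (simp add: r_def algebra_simps flip: exp_add)
      also have "\<dots> \<le> exp (\<alpha> * b) * (exp (r * \<bar>z0\<bar>) * exp (- r * \<bar>z0 - b\<bar>))"
        using r by (intro mult_left_mono exp_abs_shift) auto
      finally have "max (B \<omega>) 0 powr k \<le> exp (r * \<bar>z0\<bar>) * (B \<omega> powr \<alpha> * exp (- r * \<bar>z0 - ln (B \<omega>)\<bar>))"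
        using B by (simp add: powr_def mult_ac)
      then have "ennreal (max (B \<omega>) 0 powr k) \<le> ennreal (exp (r * \<bar>z0\<bar>)) * (ennreal (B \<omega> powr \<alpha> * exp (- r * \<bar>z0 - ln (B \<omega>)\<bar>)) * indicator {0<..} (B \<omega>))"
        using False by (simp add: ennreal_leI flip: ennreal_mult)
      then show ?thesis by (rule add_increasing2[rotated]) simp
    qed
  qed
  also have "\<dots> = ennreal (exp (r * \<bar>z0\<bar>)) * window r z0 + 1"
    by (subst nn_integral_add) (auto simp: nn_integral_cmult window_def emeasure_space_1)
  also have "\<dots> < \<infinity>"
    using C(2)[of z0] by (auto simp: ennreal_mult_less_top intro: le_less_trans)
  finally show ?thesis .
qed

end

section \<open>The increment of the tail\<close>

lemma abs_ln_le:
  fixes x :: real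
  assumes "\<bar>x\<bar> \<le> 1 / 2" shows "\<bar>ln (1 + x)\<bar> \<le> 2 * \<bar>x\<bar>"
proof -
  have "\<bar>ln (1 + x) - x\<bar> \<le> 2 * x\<^sup>2" by (rule abs_ln_one_plus_x_minus_x_bound[OF assms])
  moreover have "2 * x\<^sup>2 \<le> \<bar>x\<bar>"
    using mult_right_mono[OF assms, of "\<bar>x\<bar>"] by (simp add: power2_eq_square flip: abs_mult)
  ultimately show ?thesis by linarith
qed

lemma eventually_at_left_gt:
  fixes f :: "real \<Rightarrow> real"
  assumes "isCont f a" "f a > c" shows "\<forall>\<^sub>F k in at_left a. f k > c"
proof -
  have "(f \<longlongrightarrow> f a) (at_left a)" using assms(1) by (simp add: isCont_def filterlim_at_split)
  then show ?thesis using assms(2) by (rule order_tendstoD)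
qed

text \<open>Where the increment \<open>1{q + b > t} - 1{q > t} - 1{b > t}\<close> can be nonzero: either both
  \<open>q\<close> and \<open>b\<close> are large, or \<open>q\<close> is close to \<open>t\<close>, or \<open>b\<close> is.\<close>

lemma increment_cases:
  fixes q b z \<delta> :: real
  assumes \<delta>: "0 < \<delta>" "\<delta> < 1" and z: "exp z \<ge> 2"
  shows "\<bar>of_bool (q + b > exp z) - of_bool (q > exp z) - of_bool (b > exp z)\<bar>
    \<le> (2 * (of_bool (\<bar>b\<bar> > exp ((1 - \<delta>) * z) / 4 \<and> \<bar>q\<bar> > exp z / 4)
      + of_bool (\<bar>b\<bar> > exp z / 4 \<and> \<bar>q\<bar> > exp ((1 - \<delta>) * z) / 4)
      + of_bool (\<bar>q - exp z\<bar> \<le> exp ((1 - \<delta>) * z))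
      + of_bool (b > 1 \<and> \<bar>z - ln b\<bar> \<le> b powr (- \<delta>))) :: real)"
proof -
  define t where "t = exp z"
  define u where "u = exp ((1 - \<delta>) * z)"
  have t: "t \<ge> 2" using z by (simp add: t_def)
  have z0: "z \<ge> 0" using z by (smt (verit) exp_le_one_iff)
  have u: "u = t * exp (- \<delta> * z)" by (simp add: u_def t_def algebra_simps flip: exp_add)
  have e1: "exp (- \<delta> * z) \<le> 1" using \<delta> z0 by simp
  have ut: "0 < u" "u \<le> t" using t e1 by (auto simp: u mult_left_le)
  have "of_bool (q + b > t) - of_bool (q > t) - of_bool (b > t) = (0::real)"
    if n1: "\<not> (\<bar>b\<bar> > u / 4 \<and> \<bar>q\<bar> > t / 4)" and n2: "\<not> (\<bar>b\<bar> > t / 4 \<and> \<bar>q\<bar> > u / 4)"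
      and n3: "\<not> \<bar>q - t\<bar> \<le> u" and n4: "\<not> (b > 1 \<and> \<bar>z - ln b\<bar> \<le> b powr (- \<delta>))"
  proof (cases "\<bar>q\<bar> > t / 4")
    case True
    \<comment> \<open>The distance of q from t exceeds u while |b| <= u/4, so adding b cannot move q
      across t; nor can b itself exceed t.\<close>
    then have b: "\<bar>b\<bar> \<le> u / 4" using n1 by auto
    then have "\<not> b > t" using ut by linarith
    moreover have "(q + b > t) \<longleftrightarrow> (q > t)" using n3 b ut by linarith
    ultimately show ?thesis by simp
  next
    case False
    then have q: "\<not> q > t" using t by linarith
    have "(q + b > t) \<longleftrightarrow> (b > t)"
    proof (rule ccontr)
      assume "\<not> ((q + b > t) \<longleftrightarrow> (b > t))"
      then have bt: "\<bar>b - t\<bar> \<le> \<bar>q\<bar>" by linarith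
      then have "\<bar>b\<bar> > t / 4" using False t by linarith
      then have "\<bar>q\<bar> \<le> u / 4" using n2 by auto
      with bt have bu: "\<bar>b - t\<bar> \<le> u / 4" by linarith
      define x where "x = b / t - 1"
      have x: "\<bar>x\<bar> \<le> exp (- \<delta> * z) / 4"
      proof -
        have "\<bar>x\<bar> = \<bar>b - t\<bar> / t" using t by (simp add: x_def diff_divide_distrib flip: abs_divide) (simp add: field_simps)
        also have "\<dots> \<le> (u / 4) / t" using bu t by (intro divide_right_mono) auto
        also have "\<dots> = exp (- \<delta> * z) / 4" using t by (simp add: u)
        finally show ?thesis .
      qed
      have b: "3 / 4 * t \<le> b" "b \<le> 5 / 4 * t" using bu ut by linarith+
      have b1: "b > 1" using b t by linarith
      have "ln b = z + ln (1 + x)" using b1 t by (simp add: x_def t_def ln_div)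
      then have "\<bar>z - ln b\<bar> = \<bar>ln (1 + x)\<bar>" by simp
      also have "\<dots> \<le> 2 * \<bar>x\<bar>" using x e1 by (intro abs_ln_le) linarith
      also have "\<dots> \<le> exp (- \<delta> * z) / 2" using x by linarith
      also have "\<dots> \<le> b powr (- \<delta>)"
      proof -
        have "exp (- \<delta> * z) = t powr (- \<delta>)" by (simp add: powr_def t_def)
        moreover have "(5 / 4 * t) powr (- \<delta>) \<le> b powr (- \<delta>)"
          using b b1 \<delta> by (intro powr_mono2') auto
        moreover have "(5 / 4 * t) powr (- \<delta>) = (5 / 4) powr (- \<delta>) * t powr (- \<delta>)"
          by (rule powr_mult; use t in simp)
        \<comment> \<open>The band is measured in terms of b, not of t. As b <= 5/4 t, passing from
          t to b costs a factor of at least 4/5, and the factor 1/2 gained above pays for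
          it.\<close>
        moreover have "(5 / 4 :: real) powr (- 1) \<le> (5 / 4) powr (- \<delta>)" using \<delta> by (intro powr_mono) auto
        moreover have "(5 / 4 :: real) powr (- 1) = 4 / 5" by (simp add: powr_minus)
        ultimately have "4 / 5 * exp (- \<delta> * z) \<le> b powr (- \<delta>)"
          using mult_right_mono[of "4/5" "(5 / 4) powr (- \<delta>)" "exp (- \<delta> * z)"] by simp
        then show ?thesis using exp_gt_zero[of "- \<delta> * z"] by linarith
      qed
      finally show False using n4 b1 by auto
    qed
    then show ?thesis using q by simp
  qed
  then show ?thesis unfolding t_def u_def by (auto simp: of_bool_def)
qed

text \<open>The law of Z enters only through the change-of-measure identity
  \<open>\<mu>_law\<close>, so all further work takes place on the space of A, B and R. The exponent
  \<theta> is the surplus \<gamma> - \<alpha> of the highest moment of A.\<close>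

locale perpetuity_tail =
  perpetuity M A B R + slow_tail M B \<alpha> + W: tilted_walk \<mu> \<alpha> \<theta>
  for M :: "'a measure" and A B R :: "'a \<Rightarrow> real" and \<alpha> :: real and \<mu> :: "real measure" and \<theta> :: real +
  fixes \<beta> Cb h0 :: real
  assumes A_nonneg: "AE \<omega> in M. A \<omega> \<ge> 0"
    and \<mu>_law: "\<And>h. h \<in> borel_measurable borel \<Longrightarrow>
      (\<integral>\<^sup>+z. h z \<partial>\<mu>) = (\<integral>\<^sup>+\<omega>. ennreal (A \<omega> powr \<alpha>) * indicator {0<..} (A \<omega>) * h (ln (A \<omega>)) \<partial>M)"
    and A_\<gamma>: "(\<integral>\<^sup>+\<omega>. ennreal (\<bar>A \<omega>\<bar> powr (\<alpha> + \<theta>)) \<partial>M) < \<infinity>"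
    and \<beta>: "\<beta> > 0" and h0: "h0 > 0" and Cb: "Cb > 0"
    and conc: "\<And>h a. 0 < h \<Longrightarrow> h < h0 \<Longrightarrow> prob {\<omega> \<in> space M. A \<omega> > 0 \<and> a < ln (A \<omega>) \<and> ln (A \<omega>) \<le> a + h} \<le> Cb * h powr \<beta>"
    and B_neg: "\<And>k. 0 < k \<Longrightarrow> k < \<alpha> \<Longrightarrow> (\<integral>\<^sup>+\<omega>. ennreal (max (- B \<omega>) 0 powr k) \<partial>M) < \<infinity>"
begin

text \<open>In tilted form this is the moment of exp ((k - \<alpha>) Z), whose order lies strictly
  between -\<alpha> and 0, where convexity makes it smaller than 1.\<close>

lemma A_moment:
  assumes k: "0 < k" "k < \<alpha>" shows "(\<integral>\<^sup>+\<omega>. ennreal (\<bar>A \<omega>\<bar> powr k) \<partial>M) < 1"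
proof -
  have c: "- \<alpha> < k - \<alpha>" "k - \<alpha> < 0" using k by auto
  have "(\<integral>\<^sup>+\<omega>. ennreal (\<bar>A \<omega>\<bar> powr k) \<partial>M)
    = (\<integral>\<^sup>+\<omega>. ennreal (A \<omega> powr \<alpha>) * indicator {0<..} (A \<omega>) * ennreal (exp ((k - \<alpha>) * ln (A \<omega>))) \<partial>M)"
  proof (rule nn_integral_cong_AE)
    show "AE \<omega> in M. ennreal (\<bar>A \<omega>\<bar> powr k) = ennreal (A \<omega> powr \<alpha>) * indicator {0<..} (A \<omega>) * ennreal (exp ((k - \<alpha>) * ln (A \<omega>)))"
      using A_nonneg
    proof eventually_elim
      case (elim \<omega>)
      show ?case
      proof (cases "A \<omega> = 0")
        case False
        then have "A \<omega> > 0" using elim by simp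
        then show ?thesis by (simp add: powr_def algebra_simps flip: ennreal_mult exp_add)
      qed simp
    qed
  qed
  also have "\<dots> = (\<integral>\<^sup>+z. ennreal (exp ((k - \<alpha>) * z)) \<partial>\<mu>)" by (subst \<mu>_law) auto
  also have "\<dots> = ennreal (\<integral>z. exp ((k - \<alpha>) * z) \<partial>\<mu>)"
    using c W.\<theta>_pos by (intro nn_integral_eq_integral W.integrable_exp) auto
  also have "\<dots> < 1" using W.mgf_neg_less_1[OF c] by (simp add: ennreal_less_iff flip: ennreal_1)
  finally show ?thesis .
qed

lemma B_moment:
  assumes k: "0 < k" "k < \<alpha>" shows "(\<integral>\<^sup>+\<omega>. ennreal (\<bar>B \<omega>\<bar> powr k) \<partial>M) < \<infinity>"
proof -
  have "(\<integral>\<^sup>+\<omega>. ennreal (\<bar>B \<omega>\<bar> powr k) \<partial>M) \<le> (\<integral>\<^sup>+\<omega>. ennreal (max (B \<omega>) 0 powr k) + ennreal (max (- B \<omega>) 0 powr k) \<partial>M)"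
  proof (rule nn_integral_mono)
    fix \<omega> show "ennreal (\<bar>B \<omega>\<bar> powr k) \<le> ennreal (max (B \<omega>) 0 powr k) + ennreal (max (- B \<omega>) 0 powr k)"
      by (cases "B \<omega> \<ge> 0") (auto simp: max_def)
  qed
  also have "\<dots> = (\<integral>\<^sup>+\<omega>. ennreal (max (B \<omega>) 0 powr k) \<partial>M) + (\<integral>\<^sup>+\<omega>. ennreal (max (- B \<omega>) 0 powr k) \<partial>M)"
    by (subst nn_integral_add) auto
  also have "\<dots> < \<infinity>" using moment_pos_finite[OF k] B_neg[OF k] by (simp add: ennreal_add_eq_top less_top)
  finally show ?thesis .
qed

lemma R_moment: "0 < k \<Longrightarrow> k < \<alpha> \<Longrightarrow> (\<integral>\<^sup>+\<omega>. ennreal (\<bar>R \<omega>\<bar> powr k) \<partial>M) < \<infinity>"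
  by (rule moment_finite[OF \<alpha>_pos A_moment B_moment])

lemma markov_tail:
  fixes X :: "'a \<Rightarrow> real"
  assumes [measurable]: "X \<in> borel_measurable M" and k: "k > 0" and fin: "(\<integral>\<^sup>+\<omega>. ennreal (\<bar>X \<omega>\<bar> powr k) \<partial>M) < \<infinity>"
  obtains C where "C > 0" "\<And>t. t > 0 \<Longrightarrow> prob {\<omega> \<in> space M. \<bar>X \<omega>\<bar> > t} \<le> C * t powr (- k)"
proof -
  obtain K where K: "(\<integral>\<^sup>+\<omega>. ennreal (\<bar>X \<omega>\<bar> powr k) \<partial>M) = ennreal K" "K \<ge> 0"
    using fin by (cases "\<integral>\<^sup>+\<omega>. ennreal (\<bar>X \<omega>\<bar> powr k) \<partial>M") auto
  have "prob {\<omega> \<in> space M. \<bar>X \<omega>\<bar> > t} \<le> (K + 1) * t powr (- k)" if t: "t > 0" for t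
  proof -
    have "ennreal (prob {\<omega> \<in> space M. \<bar>X \<omega>\<bar> > t}) = (\<integral>\<^sup>+\<omega>. indicator {\<omega> \<in> space M. \<bar>X \<omega>\<bar> > t} \<omega> \<partial>M)"
      by (simp add: emeasure_eq_measure)
    also have "\<dots> \<le> (\<integral>\<^sup>+\<omega>. ennreal (t powr (- k)) * ennreal (\<bar>X \<omega>\<bar> powr k) \<partial>M)"
    proof (rule nn_integral_mono)
      fix \<omega>
      have "1 \<le> t powr (- k) * \<bar>X \<omega>\<bar> powr k" if "\<bar>X \<omega>\<bar> > t"
      proof -
        have "t powr k \<le> \<bar>X \<omega>\<bar> powr k" using that t k by (intro powr_mono2) auto
        then show ?thesis using t by (simp add: powr_minus field_simps)
      qed
      then show "indicator {\<omega> \<in> space M. \<bar>X \<omega>\<bar> > t} \<omega> \<le> ennreal (t powr (- k)) * ennreal (\<bar>X \<omega>\<bar> powr k)"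
        by (auto simp: indicator_def simp flip: ennreal_mult)
    qed
    also have "\<dots> = ennreal (t powr (- k) * K)" using K by (subst nn_integral_cmult) (auto simp flip: ennreal_mult)
    finally have "prob {\<omega> \<in> space M. \<bar>X \<omega>\<bar> > t} \<le> t powr (- k) * K" using K by (simp add: ennreal_le_iff)
    also have "\<dots> \<le> (K + 1) * t powr (- k)" by (simp add: algebra_simps)
    finally show ?thesis .
  qed
  then show ?thesis using that[of "K + 1"] K by simp
qed

text \<open>A and B may be dependent, but R is independent of B. If A does not exceed a, a large
  product A R forces R to exceed q / a, and the probability factorises; otherwise the tail of A
  alone pays.\<close>

lemma joint_tail:
  assumes a: "a > 0"
  shows "prob {\<omega> \<in> space M. \<bar>B \<omega>\<bar> > b \<and> \<bar>A \<omega> * R \<omega>\<bar> > q}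
    \<le> prob {\<omega> \<in> space M. \<bar>B \<omega>\<bar> > b} * prob {\<omega> \<in> space M. \<bar>R \<omega>\<bar> > q / a} + prob {\<omega> \<in> space M. \<bar>A \<omega>\<bar> > a}"
proof -
  let ?X = "{\<omega> \<in> space M. \<bar>B \<omega>\<bar> > b \<and> \<bar>R \<omega>\<bar> > q / a}" and ?Y = "{\<omega> \<in> space M. \<bar>A \<omega>\<bar> > a}"
  have "prob {\<omega> \<in> space M. \<bar>B \<omega>\<bar> > b \<and> \<bar>A \<omega> * R \<omega>\<bar> > q} \<le> prob (?X \<union> ?Y)"
  proof (rule finite_measure_mono)
    show "{\<omega> \<in> space M. \<bar>B \<omega>\<bar> > b \<and> \<bar>A \<omega> * R \<omega>\<bar> > q} \<subseteq> ?X \<union> ?Y"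
    proof (rule subsetI)
      fix \<omega> assume \<omega>: "\<omega> \<in> {\<omega> \<in> space M. \<bar>B \<omega>\<bar> > b \<and> \<bar>A \<omega> * R \<omega>\<bar> > q}"
      have "\<bar>R \<omega>\<bar> > q / a" if "\<bar>A \<omega>\<bar> \<le> a"
      proof -
        have "q < \<bar>A \<omega>\<bar> * \<bar>R \<omega>\<bar>" using \<omega> by (simp add: abs_mult)
        also have "\<dots> \<le> a * \<bar>R \<omega>\<bar>" using that by (intro mult_right_mono) auto
        finally show ?thesis using a by (simp add: field_simps)
      qed
      with \<omega> show "\<omega> \<in> ?X \<union> ?Y" by auto
    qed
  qed simp
  also have "\<dots> \<le> prob ?X + prob ?Y" by (rule measure_Un_le) auto
  also have "prob ?X = prob {\<omega> \<in> space M. \<bar>B \<omega>\<bar> > b} * prob {\<omega> \<in> space M. \<bar>R \<omega>\<bar> > q / a}"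
  proof -
    let ?h = "\<lambda>(r, a', b'). (if \<bar>b'\<bar> > b \<and> \<bar>r\<bar> > q / a then 1 else 0) :: ennreal"
    have "ennreal (prob ?X) = (\<integral>\<^sup>+\<omega>. indicator ?X \<omega> \<partial>M)" by (simp add: emeasure_eq_measure)
    also have "\<dots> = (\<integral>\<^sup>+\<omega>. ?h (R \<omega>, A \<omega>, B \<omega>) \<partial>M)" by (intro nn_integral_cong) (auto simp: indicator_def)
    also have "\<dots> = (\<integral>\<^sup>+\<omega>'. \<integral>\<^sup>+\<omega>. ?h (R \<omega>', A \<omega>, B \<omega>) \<partial>M \<partial>M)" by (rule indep_nn_integral) measurable
    also have "\<dots> = (\<integral>\<^sup>+\<omega>'. indicator {\<omega> \<in> space M. \<bar>R \<omega>\<bar> > q / a} \<omega>' * ennreal (prob {\<omega> \<in> space M. \<bar>B \<omega>\<bar> > b}) \<partial>M)"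
    proof (rule nn_integral_cong)
      fix \<omega>' assume "\<omega>' \<in> space M"
      then have "(\<integral>\<^sup>+\<omega>. ?h (R \<omega>', A \<omega>, B \<omega>) \<partial>M) = (\<integral>\<^sup>+\<omega>. indicator {\<omega> \<in> space M. \<bar>R \<omega>\<bar> > q / a} \<omega>' * indicator {\<omega> \<in> space M. \<bar>B \<omega>\<bar> > b} \<omega> \<partial>M)"
        by (intro nn_integral_cong) (auto simp: indicator_def)
      also have "\<dots> = indicator {\<omega> \<in> space M. \<bar>R \<omega>\<bar> > q / a} \<omega>' * ennreal (prob {\<omega> \<in> space M. \<bar>B \<omega>\<bar> > b})"
        by (subst nn_integral_cmult) (auto simp: emeasure_eq_measure)
      finally show "(\<integral>\<^sup>+\<omega>. ?h (R \<omega>', A \<omega>, B \<omega>) \<partial>M) = indicator {\<omega> \<in> space M. \<bar>R \<omega>\<bar> > q / a} \<omega>' * ennreal (prob {\<omega> \<in> space M. \<bar>B \<omega>\<bar> > b})" .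
    qed
    also have "\<dots> = ennreal (prob {\<omega> \<in> space M. \<bar>B \<omega>\<bar> > b} * prob {\<omega> \<in> space M. \<bar>R \<omega>\<bar> > q / a})"
      by (subst nn_integral_multc) (auto simp: emeasure_eq_measure mult.commute simp flip: ennreal_mult)
    finally show ?thesis by (simp add: ennreal_inj)
  qed
  finally show ?thesis .
qed

lemma concentration_closed:
  assumes u: "0 < u" "4 * u < h0" "u \<le> 1 / 2" and t: "t > 0" and r: "r > 0"
  shows "prob {\<omega> \<in> space M. \<bar>A \<omega> * r - t\<bar> \<le> t * u} \<le> Cb * (4 * u) powr \<beta>"
proof -
  \<comment> \<open>In logarithmic scale the relative deviation x gives ln (1 + x) in [-2 u, u].
    Starting at -3 u makes the left inequality strict, as the half-open interval of the
    concentration bound demands.\<close>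
  define a where "a = ln (t / r) - 3 * u"
  have "prob {\<omega> \<in> space M. \<bar>A \<omega> * r - t\<bar> \<le> t * u} \<le> prob {\<omega> \<in> space M. A \<omega> > 0 \<and> a < ln (A \<omega>) \<and> ln (A \<omega>) \<le> a + 4 * u}"
  proof (rule finite_measure_mono)
    show "{\<omega> \<in> space M. \<bar>A \<omega> * r - t\<bar> \<le> t * u} \<subseteq> {\<omega> \<in> space M. A \<omega> > 0 \<and> a < ln (A \<omega>) \<and> ln (A \<omega>) \<le> a + 4 * u}"
    proof (rule subsetI)
      fix \<omega> assume \<omega>: "\<omega> \<in> {\<omega> \<in> space M. \<bar>A \<omega> * r - t\<bar> \<le> t * u}"
      define x where "x = A \<omega> * r / t - 1"
      have x: "\<bar>x\<bar> \<le> u"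
      proof -
        have "\<bar>x\<bar> = \<bar>A \<omega> * r - t\<bar> / t" using t by (simp add: x_def diff_divide_distrib flip: abs_divide) (simp add: field_simps)
        also have "\<dots> \<le> (t * u) / t" using \<omega> t by (intro divide_right_mono) auto
        finally show ?thesis using t by simp
      qed
      have A: "A \<omega> = t / r * (1 + x)" using t r by (simp add: x_def)
      have "1 + x > 0" using x u by linarith
      then have pos: "A \<omega> > 0" using A t r by simp
      have "ln (A \<omega>) = ln (t / r) + ln (1 + x)" unfolding A using t r \<open>1 + x > 0\<close> by (subst ln_mult_pos) auto
      moreover have "ln (1 + x) \<le> u" using ln_add_one_self_le_self2[of x] \<open>1 + x > 0\<close> x by linarith
      moreover have "\<bar>ln (1 + x)\<bar> \<le> 2 * \<bar>x\<bar>" using x u by (intro abs_ln_le) linarith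
      ultimately show "\<omega> \<in> {\<omega> \<in> space M. A \<omega> > 0 \<and> a < ln (A \<omega>) \<and> ln (A \<omega>) \<le> a + 4 * u}"
        using \<omega> pos x u by (auto simp: a_def)
    qed
  qed simp
  also have "\<dots> \<le> Cb * (4 * u) powr \<beta>" using u by (intro conc) auto
  finally show ?thesis .
qed

text \<open>For R > s the concentration of log A bounds the conditional probability given R, and
  P(|R| > s) is gained as a factor. For R <= s the product can be near t only if A is of order at
  least t / s, which its high moment makes rare; R^(\<alpha> + \<theta>) is reduced to the available
  moment R^k by R <= s.\<close>

lemma near_tail:
  assumes u: "0 < u" "4 * u < h0" "u \<le> 1 / 2" and t: "t > 0" and s: "s > 0"
    and k: "0 < k" "k \<le> \<alpha> + \<theta>"
    and KR: "(\<integral>\<^sup>+\<omega>. ennreal (\<bar>R \<omega>\<bar> powr k) \<partial>M) \<le> ennreal KR" "KR \<ge> 0"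
    and KA: "(\<integral>\<^sup>+\<omega>. ennreal (\<bar>A \<omega>\<bar> powr (\<alpha> + \<theta>)) \<partial>M) \<le> ennreal KA" "KA \<ge> 0"
  shows "prob {\<omega> \<in> space M. \<bar>A \<omega> * R \<omega> - t\<bar> \<le> t * u}
    \<le> Cb * (4 * u) powr \<beta> * prob {\<omega> \<in> space M. \<bar>R \<omega>\<bar> > s} + (2 / t) powr (\<alpha> + \<theta>) * s powr (\<alpha> + \<theta> - k) * KR * KA"
proof -
  define g where "g = \<alpha> + \<theta>"
  have g: "g > 0" "k \<le> g" using \<alpha>_pos W.\<theta>_pos k by (auto simp: g_def)
  let ?h1 = "\<lambda>(r, a, b::real). (if r > s \<and> \<bar>a * r - t\<bar> \<le> t * u then 1 else 0) :: ennreal"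
  let ?h2 = "\<lambda>(r, a, b::real). ennreal ((2 / t) powr g * s powr (g - k) * \<bar>r\<bar> powr k * \<bar>a\<bar> powr g) :: ennreal"
  have "ennreal (prob {\<omega> \<in> space M. \<bar>A \<omega> * R \<omega> - t\<bar> \<le> t * u}) = (\<integral>\<^sup>+\<omega>. indicator {\<omega> \<in> space M. \<bar>A \<omega> * R \<omega> - t\<bar> \<le> t * u} \<omega> \<partial>M)"
    by (simp add: emeasure_eq_measure)
  also have "\<dots> \<le> (\<integral>\<^sup>+\<omega>. ?h1 (R \<omega>, A \<omega>, B \<omega>) + ?h2 (R \<omega>, A \<omega>, B \<omega>) \<partial>M)"
  proof (rule nn_integral_mono_AE)
    show "AE \<omega> in M. indicator {\<omega> \<in> space M. \<bar>A \<omega> * R \<omega> - t\<bar> \<le> t * u} \<omega> \<le> ?h1 (R \<omega>, A \<omega>, B \<omega>) + ?h2 (R \<omega>, A \<omega>, B \<omega>)"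
      using A_nonneg
    proof eventually_elim
      case (elim \<omega>)
      have "1 \<le> (2 / t) powr g * s powr (g - k) * \<bar>R \<omega>\<bar> powr k * \<bar>A \<omega>\<bar> powr g"
        if n: "\<bar>A \<omega> * R \<omega> - t\<bar> \<le> t * u" and rs: "R \<omega> \<le> s"
      proof -
        have "t * u \<le> t * (1 / 2)" using u t by (intro mult_left_mono) auto
        then have AR: "A \<omega> * R \<omega> \<ge> t / 2" using n by linarith
        then have "A \<omega> * R \<omega> > 0" using t by linarith
        then have pos: "A \<omega> > 0" "R \<omega> > 0" using elim by (auto simp: zero_less_mult_iff)
        have "1 = 1 powr g" by simp
        also have "1 powr g \<le> (2 / t * (A \<omega> * R \<omega>)) powr g"
          using AR t g by (intro powr_mono2) (auto simp: field_simps)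
        also have "\<dots> = (2 / t) powr g * (R \<omega> powr (g - k) * R \<omega> powr k) * A \<omega> powr g"
        proof -
          have "(2 / t * (A \<omega> * R \<omega>)) powr g = (2 / t) powr g * (A \<omega> * R \<omega>) powr g"
            by (rule powr_mult; use t pos in simp)
          moreover have "(A \<omega> * R \<omega>) powr g = A \<omega> powr g * R \<omega> powr g"
            by (rule powr_mult; use pos in simp)
          moreover have "R \<omega> powr g = R \<omega> powr (g - k) * R \<omega> powr k"
            by (simp flip: powr_add)
          ultimately show ?thesis by simp
        qed
        also have "\<dots> \<le> (2 / t) powr g * (s powr (g - k) * R \<omega> powr k) * A \<omega> powr g"
          using pos rs g by (intro mult_right_mono mult_left_mono powr_mono2) auto
        finally show ?thesis using pos by (simp add: mult_ac)
      qed
      then show ?case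
        by (auto simp: indicator_def not_less intro: add_increasing2 add_increasing)
    qed
  qed
  also have "\<dots> = (\<integral>\<^sup>+\<omega>. ?h1 (R \<omega>, A \<omega>, B \<omega>) \<partial>M) + (\<integral>\<^sup>+\<omega>. ?h2 (R \<omega>, A \<omega>, B \<omega>) \<partial>M)"
    by (rule nn_integral_add) auto
  also have "(\<integral>\<^sup>+\<omega>. ?h1 (R \<omega>, A \<omega>, B \<omega>) \<partial>M) \<le> ennreal (Cb * (4 * u) powr \<beta> * prob {\<omega> \<in> space M. \<bar>R \<omega>\<bar> > s})"
  proof -
    have "(\<integral>\<^sup>+\<omega>. ?h1 (R \<omega>, A \<omega>, B \<omega>) \<partial>M) = (\<integral>\<^sup>+\<omega>'. \<integral>\<^sup>+\<omega>. ?h1 (R \<omega>', A \<omega>, B \<omega>) \<partial>M \<partial>M)"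
      by (rule indep_nn_integral) measurable
    also have "\<dots> \<le> (\<integral>\<^sup>+\<omega>'. ennreal (Cb * (4 * u) powr \<beta>) * indicator {\<omega> \<in> space M. \<bar>R \<omega>\<bar> > s} \<omega>' \<partial>M)"
    proof (rule nn_integral_mono)
      fix \<omega>' assume \<omega>': "\<omega>' \<in> space M"
      show "(\<integral>\<^sup>+\<omega>. ?h1 (R \<omega>', A \<omega>, B \<omega>) \<partial>M) \<le> ennreal (Cb * (4 * u) powr \<beta>) * indicator {\<omega> \<in> space M. \<bar>R \<omega>\<bar> > s} \<omega>'"
      proof (cases "R \<omega>' > s")
        case True
        have "(\<integral>\<^sup>+\<omega>. ?h1 (R \<omega>', A \<omega>, B \<omega>) \<partial>M) = (\<integral>\<^sup>+\<omega>. indicator {\<omega> \<in> space M. \<bar>A \<omega> * R \<omega>' - t\<bar> \<le> t * u} \<omega> \<partial>M)"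
          using True by (intro nn_integral_cong) (auto simp: indicator_def)
        also have "\<dots> = ennreal (prob {\<omega> \<in> space M. \<bar>A \<omega> * R \<omega>' - t\<bar> \<le> t * u})" by (simp add: emeasure_eq_measure)
        also have "\<dots> \<le> ennreal (Cb * (4 * u) powr \<beta>)"
          using True s by (intro ennreal_leI concentration_closed u t) auto
        finally show ?thesis using True \<omega>' s by simp
      qed simp
    qed
    also have "\<dots> = ennreal (Cb * (4 * u) powr \<beta> * prob {\<omega> \<in> space M. \<bar>R \<omega>\<bar> > s})"
      using Cb by (subst nn_integral_cmult) (auto simp: emeasure_eq_measure simp flip: ennreal_mult)
    finally show ?thesis .
  qed
  also have "(\<integral>\<^sup>+\<omega>. ?h2 (R \<omega>, A \<omega>, B \<omega>) \<partial>M) \<le> ennreal ((2 / t) powr g * s powr (g - k) * KR * KA)"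
  proof -
    have "(\<integral>\<^sup>+\<omega>. ?h2 (R \<omega>, A \<omega>, B \<omega>) \<partial>M) = (\<integral>\<^sup>+\<omega>'. \<integral>\<^sup>+\<omega>. ?h2 (R \<omega>', A \<omega>, B \<omega>) \<partial>M \<partial>M)"
      by (rule indep_nn_integral) measurable
    also have "\<dots> = (\<integral>\<^sup>+\<omega>'. \<integral>\<^sup>+\<omega>. ennreal ((2 / t) powr g * s powr (g - k)) * ennreal (\<bar>R \<omega>'\<bar> powr k) * ennreal (\<bar>A \<omega>\<bar> powr g) \<partial>M \<partial>M)"
      by (simp add: ennreal_mult)
    also have "\<dots> = ennreal ((2 / t) powr g * s powr (g - k)) * (\<integral>\<^sup>+\<omega>. ennreal (\<bar>R \<omega>\<bar> powr k) \<partial>M) * (\<integral>\<^sup>+\<omega>. ennreal (\<bar>A \<omega>\<bar> powr g) \<partial>M)"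
      by (simp add: nn_integral_cmult nn_integral_multc)
    also have "\<dots> \<le> ennreal ((2 / t) powr g * s powr (g - k)) * ennreal KR * ennreal KA"
      using KR KA by (intro mult_mono) (auto simp: g_def)
    finally show ?thesis using KR KA by (simp add: ennreal_mult)
  qed
  finally have "ennreal (prob {\<omega> \<in> space M. \<bar>A \<omega> * R \<omega> - t\<bar> \<le> t * u})
    \<le> ennreal (Cb * (4 * u) powr \<beta> * prob {\<omega> \<in> space M. \<bar>R \<omega>\<bar> > s}) + ennreal ((2 / t) powr g * s powr (g - k) * KR * KA)"
    by (simp add: add_mono)
  then show ?thesis
    using Cb KR KA by (simp add: g_def ennreal_le_iff flip: ennreal_plus)
qed

end

lemma exp_scale: "exp a powr b = exp (b * (a::real))"
  by (simp add: powr_def)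

context perpetuity_tail begin

definition incr :: "real \<Rightarrow> 'a \<Rightarrow> real" where
  "incr z \<omega> = of_bool (A \<omega> * R \<omega> + B \<omega> > exp z) - of_bool (A \<omega> * R \<omega> > exp z) - of_bool (B \<omega> > exp z)"

lemma incr_measurable [measurable]: "(\<lambda>(z, \<omega>). incr z \<omega>) \<in> borel_measurable (borel \<Otimes>\<^sub>M M)"
  unfolding incr_def of_bool_def by measurable

lemma incr_measurable' [measurable]: "incr z \<in> borel_measurable M"
  unfolding incr_def[abs_def] of_bool_def by measurable

lemma abs_incr_le: "\<bar>incr z \<omega>\<bar> \<le> 2"
  by (auto simp: incr_def)

lemma integrable_of_bool: "{\<omega> \<in> space M. P \<omega>} \<in> sets M \<Longrightarrow> integrable M (\<lambda>\<omega>. of_bool (P \<omega>) :: real)"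
  and integral_of_bool: "{\<omega> \<in> space M. P \<omega>} \<in> sets M \<Longrightarrow> (\<integral>\<omega>. of_bool (P \<omega>) \<partial>M) = prob {\<omega> \<in> space M. P \<omega>}"
proof -
  assume s: "{\<omega> \<in> space M. P \<omega>} \<in> sets M"
  have e: "of_bool (P \<omega>) = (indicator {\<omega> \<in> space M. P \<omega>} \<omega> :: real)" if "\<omega> \<in> space M" for \<omega>
    using that by (simp add: indicator_def)
  have i: "integrable M (indicator {\<omega> \<in> space M. P \<omega>} :: 'a \<Rightarrow> real)"
    using s by (simp add: emeasure_eq_measure)
  then show "integrable M (\<lambda>\<omega>. of_bool (P \<omega>) :: real)"
    by (subst Bochner_Integration.integrable_cong[OF refl e]) auto
  have "(\<integral>\<omega>. of_bool (P \<omega>) \<partial>M) = (\<integral>\<omega>. indicator {\<omega> \<in> space M. P \<omega>} \<omega> \<partial>M :: real)"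
    by (rule Bochner_Integration.integral_cong[OF refl e])
  also have "\<dots> = prob {\<omega> \<in> space M. P \<omega>}" using s by simp
  finally show "(\<integral>\<omega>. of_bool (P \<omega>) \<partial>M) = prob {\<omega> \<in> space M. P \<omega>}" .
qed

lemma integrable_incr: "integrable M (incr z)"
  by (rule integrable_const_bound[of _ 2]) (auto simp: abs_incr_le)

text \<open>Restricting to B > 1 keeps the half-width of the band at most 1 and its centre ln B
  positive.\<close>

definition near_B :: "real \<Rightarrow> real \<Rightarrow> real" where
  "near_B \<delta> z = prob {\<omega> \<in> space M. B \<omega> > 1 \<and> \<bar>z - ln (B \<omega>)\<bar> \<le> B \<omega> powr (- \<delta>)}"

text \<open>Every inequality says that a probability beats exp (-\<alpha> z) by a margin \<epsilon>.
  In order: B and R both large, with A cut at exp (\<eta> z); concentration of log A at scale exp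
  (-\<delta> z) with R > exp ((1 - \<eta>') z); the complementary case of smaller R and large A; and
  A > exp (\<eta> z) alone. The condition \<delta> < \<alpha> keeps the order \<alpha> - \<delta>/2
  of a later moment positive.\<close>

lemma exponents:
  obtains \<delta> \<eta> \<eta>' k \<epsilon> where
    "0 < \<delta>" "\<delta> < 1" "\<delta> < \<alpha>" "0 < \<eta>" "\<eta> < 1" "0 < \<eta>'" "\<eta>' < 1" "0 < k" "k < \<alpha>" "0 < \<epsilon>" "\<epsilon> \<le> \<alpha>"
    "k * (2 - \<delta> - \<eta>) \<ge> \<alpha> + \<epsilon>" "\<delta> * \<beta> + k * (1 - \<eta>') \<ge> \<alpha> + \<epsilon>"
    "k + \<eta>' * (\<alpha> + \<theta> - k) \<ge> \<alpha> + \<epsilon>" "(\<alpha> + \<theta>) * \<eta> \<ge> \<alpha> + \<epsilon>"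
proof -
  \<comment> \<open>The last inequality needs \<eta> above p, the first needs room below 1; the
    midpoint of p and 1 serves both.\<close>
  define p where "p = \<alpha> / (\<alpha> + \<theta>)"
  define \<eta> where "\<eta> = (p + 1) / 2"
  have "0 < p" "p < 1" using \<alpha>_pos W.\<theta>_pos by (auto simp: p_def)
  then have \<eta>: "0 < \<eta>" "\<eta> < 1" "\<alpha> / (\<alpha> + \<theta>) < \<eta>" by (auto simp: \<eta>_def simp flip: p_def)
  have g\<eta>: "(\<alpha> + \<theta>) * \<eta> > \<alpha>" using \<eta>(3) \<alpha>_pos W.\<theta>_pos by (simp add: divide_less_eq mult.commute)
  define \<delta> where "\<delta> = min ((1 - \<eta>) / 2) (\<alpha> / 2)"
  have \<delta>: "0 < \<delta>" "\<delta> < 1" "\<delta> < \<alpha>" "\<delta> < 1 - \<eta>" using \<eta> \<alpha>_pos by (auto simp: \<delta>_def min_def)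
  \<comment> \<open>Half of the threshold \<delta> \<beta> / \<alpha> at which the concentration
    gain \<delta> \<beta> would be used up by the loss \<alpha> \<eta>'.\<close>
  define \<eta>' where "\<eta>' = min (1 / 2) (\<delta> * \<beta> / (2 * \<alpha>))"
  have \<eta>': "0 < \<eta>'" "\<eta>' < 1" using \<delta> \<beta> \<alpha>_pos by (auto simp: \<eta>'_def)
  have ae: "\<alpha> * \<eta>' < \<delta> * \<beta>"
  proof -
    have "\<alpha> * \<eta>' \<le> \<alpha> * (\<delta> * \<beta> / (2 * \<alpha>))" using \<alpha>_pos by (intro mult_left_mono) (auto simp: \<eta>'_def)
    also have "\<dots> = \<delta> * \<beta> / 2" using \<alpha>_pos by simp
    finally show ?thesis using mult_pos_pos[OF \<delta>(1) \<beta>] by linarith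
  qed
  \<comment> \<open>At k = \<alpha> the three inequalities involving k hold strictly; R and B have
    moments of orders below \<alpha> only, so k is taken slightly smaller by continuity.\<close>
  have "\<forall>\<^sub>F k in at_left \<alpha>. k * (2 - \<delta> - \<eta>) > \<alpha>"
    by (rule eventually_at_left_gt) (use \<delta> \<alpha>_pos in \<open>auto intro!: continuous_intros\<close>)
  moreover have "\<forall>\<^sub>F k in at_left \<alpha>. \<delta> * \<beta> + k * (1 - \<eta>') > \<alpha>"
    by (rule eventually_at_left_gt) (use ae in \<open>auto intro!: continuous_intros simp: algebra_simps\<close>)
  moreover have "\<forall>\<^sub>F k in at_left \<alpha>. k + \<eta>' * (\<alpha> + \<theta> - k) > \<alpha>"
    by (rule eventually_at_left_gt) (use \<eta>' W.\<theta>_pos in \<open>auto intro!: continuous_intros\<close>)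
  moreover have "\<forall>\<^sub>F k in at_left \<alpha>. k > 0"
    by (rule eventually_at_left_gt) (use \<alpha>_pos in auto)
  moreover have "\<forall>\<^sub>F k in at_left \<alpha>. k < \<alpha>"
    by (simp add: eventually_at_filter)
  ultimately have "\<forall>\<^sub>F k in at_left \<alpha>. k * (2 - \<delta> - \<eta>) > \<alpha> \<and> \<delta> * \<beta> + k * (1 - \<eta>') > \<alpha> \<and> k + \<eta>' * (\<alpha> + \<theta> - k) > \<alpha> \<and> k > 0 \<and> k < \<alpha>"
    by eventually_elim simp
  then obtain k where k: "k * (2 - \<delta> - \<eta>) > \<alpha>" "\<delta> * \<beta> + k * (1 - \<eta>') > \<alpha>" "k + \<eta>' * (\<alpha> + \<theta> - k) > \<alpha>" "k > 0" "k < \<alpha>"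
    using eventually_happens'[OF trivial_limit_at_left_real] by blast
  define \<epsilon> where "\<epsilon> = Min {k * (2 - \<delta> - \<eta>) - \<alpha>, \<delta> * \<beta> + k * (1 - \<eta>') - \<alpha>, k + \<eta>' * (\<alpha> + \<theta> - k) - \<alpha>, (\<alpha> + \<theta>) * \<eta> - \<alpha>, \<alpha>}"
  have "\<epsilon> > 0" unfolding \<epsilon>_def using k g\<eta> \<alpha>_pos by (subst Min_gr_iff) auto
  moreover have "\<epsilon> \<le> k * (2 - \<delta> - \<eta>) - \<alpha>" "\<epsilon> \<le> \<delta> * \<beta> + k * (1 - \<eta>') - \<alpha>" "\<epsilon> \<le> k + \<eta>' * (\<alpha> + \<theta> - k) - \<alpha>" "\<epsilon> \<le> (\<alpha> + \<theta>) * \<eta> - \<alpha>" "\<epsilon> \<le> \<alpha>"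
    unfolding \<epsilon>_def by (auto intro!: Min_le)
  ultimately show ?thesis
    using that[OF \<delta>(1-3) \<eta>(1,2) \<eta>' k(4,5)] by simp
qed

text \<open>Of the four events that allow a nonzero increment, the first three have probability
  O(exp (-(\<alpha> + \<epsilon>) z)). The event that z is close to ln B has no such pointwise bound
  and is carried along as \<open>near_B\<close>.\<close>

lemma increment_bound:
  obtains C \<epsilon> \<delta> where "C > 0" "0 < \<epsilon>" "0 < \<delta>" "\<delta> < \<alpha>"
    "\<And>z. exp (\<alpha> * z) * (\<integral>\<omega>. \<bar>incr z \<omega>\<bar> \<partial>M) \<le> C * exp (- \<epsilon> * \<bar>z\<bar>) + 2 * exp (\<alpha> * z) * near_B \<delta> z"
proof -
  obtain \<delta> \<eta> \<eta>' k \<epsilon> where \<delta>: "0 < \<delta>" "\<delta> < 1" "\<delta> < \<alpha>" and \<eta>: "0 < \<eta>" "\<eta> < 1" and \<eta>': "0 < \<eta>'" "\<eta>' < 1"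
    and k: "0 < k" "k < \<alpha>" and \<epsilon>: "0 < \<epsilon>" "\<epsilon> \<le> \<alpha>"
    and e1: "k * (2 - \<delta> - \<eta>) \<ge> \<alpha> + \<epsilon>" and e2: "\<delta> * \<beta> + k * (1 - \<eta>') \<ge> \<alpha> + \<epsilon>"
    and e3: "k + \<eta>' * (\<alpha> + \<theta> - k) \<ge> \<alpha> + \<epsilon>" and e4: "(\<alpha> + \<theta>) * \<eta> \<ge> \<alpha> + \<epsilon>"
    using exponents by metis
  define g where "g = \<alpha> + \<theta>"
  have g: "g > 0" "k \<le> g" using \<alpha>_pos W.\<theta>_pos k by (auto simp: g_def)
  obtain CR where CR: "CR > 0" "\<And>t. t > 0 \<Longrightarrow> prob {\<omega> \<in> space M. \<bar>R \<omega>\<bar> > t} \<le> CR * t powr (- k)"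
    using markov_tail[OF R_meas k(1) R_moment[OF k]] by metis
  obtain CB where CB: "CB > 0" "\<And>t. t > 0 \<Longrightarrow> prob {\<omega> \<in> space M. \<bar>B \<omega>\<bar> > t} \<le> CB * t powr (- k)"
    using markov_tail[OF _ k(1) B_moment[OF k]] by (metis perpetuity_axioms perpetuity.B_meas)
  obtain CA where CA: "CA > 0" "\<And>t. t > 0 \<Longrightarrow> prob {\<omega> \<in> space M. \<bar>A \<omega>\<bar> > t} \<le> CA * t powr (- g)"
    using markov_tail[OF A_meas g(1)] A_\<gamma> unfolding g_def by metis
  obtain KR where KR: "(\<integral>\<^sup>+\<omega>. ennreal (\<bar>R \<omega>\<bar> powr k) \<partial>M) \<le> ennreal KR" "KR \<ge> 0"
    using R_moment[OF k] by (cases "\<integral>\<^sup>+\<omega>. ennreal (\<bar>R \<omega>\<bar> powr k) \<partial>M") auto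
  obtain KA where KA: "(\<integral>\<^sup>+\<omega>. ennreal (\<bar>A \<omega>\<bar> powr (\<alpha> + \<theta>)) \<partial>M) \<le> ennreal KA" "KA \<ge> 0"
    using A_\<gamma> by (cases "\<integral>\<^sup>+\<omega>. ennreal (\<bar>A \<omega>\<bar> powr (\<alpha> + \<theta>)) \<partial>M") auto
  have "((\<lambda>z. exp (- \<delta> * z)) \<longlongrightarrow> 0) at_top" using \<delta> by real_asymp
  then have "\<forall>\<^sub>F z in at_top. exp (- \<delta> * z) < min (1 / 2) (h0 / 4)"
    using h0 by (intro order_tendstoD(2)) auto
  then obtain z1 where z1: "\<And>z. z \<ge> z1 \<Longrightarrow> exp (- \<delta> * z) < min (1 / 2) (h0 / 4)"
    by (auto simp: eventually_at_top_linorder)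
  \<comment> \<open>Beyond \<open>ln 2\<close> the case analysis of the increment applies; beyond
    \<open>z1\<close> the relative width exp (-\<delta> z) is small enough for the concentration
    bound.\<close>
  define z0 where "z0 = max 1 (max (ln 2) z1)"
  define D12 where "D12 = CB * CR * 16 powr k + CA"
  define D3 where "D3 = Cb * 4 powr \<beta> * CR + 2 powr g * KR * KA"
  have D12: "D12 \<ge> 0" using CB CR CA by (simp add: D12_def)
  have D3: "D3 \<ge> 0" using Cb CR KR KA by (simp add: D3_def)
  have dec: "exp (- c * z) \<le> exp (- (\<alpha> + \<epsilon>) * z)" if "c \<ge> \<alpha> + \<epsilon>" "z \<ge> 0" for c z
    unfolding exp_le_cancel_iff using mult_right_mono[OF that] by (simp add: algebra_simps)
  have prod: "CB * (x / 4) powr (- k) * (CR * (y / 4) powr (- k)) = CB * CR * 16 powr k * (x * y) powr (- k)"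
    if "x > 0" "y > 0" for x y
  proof -
    have "(x / 4) powr (- k) * (y / 4) powr (- k) = (x / 4 * (y / 4)) powr (- k)"
      by (rule powr_mult[symmetric]; use that in simp)
    also have "x / 4 * (y / 4) = (x * y) / 16" by simp
    also have "((x * y) / 16) powr (- k) = 16 powr k * (x * y) powr (- k)"
      using that by (simp add: powr_divide powr_minus field_simps)
    finally show ?thesis by (simp add: mult_ac)
  qed
  have E1: "prob {\<omega> \<in> space M. \<bar>B \<omega>\<bar> > exp ((1 - \<delta>) * z) / 4 \<and> \<bar>A \<omega> * R \<omega>\<bar> > exp z / 4} \<le> D12 * exp (- (\<alpha> + \<epsilon>) * z)"
    and E2: "prob {\<omega> \<in> space M. \<bar>B \<omega>\<bar> > exp z / 4 \<and> \<bar>A \<omega> * R \<omega>\<bar> > exp ((1 - \<delta>) * z) / 4} \<le> D12 * exp (- (\<alpha> + \<epsilon>) * z)"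
    if z: "z \<ge> 0" for z
  proof -
    \<comment> \<open>Only the sum of the two exponents matters, so the cases in which B or A R is
      the larger one are treated at once.\<close>
    have gen: "prob {\<omega> \<in> space M. \<bar>B \<omega>\<bar> > exp p / 4 \<and> \<bar>A \<omega> * R \<omega>\<bar> > exp q / 4} \<le> D12 * exp (- (\<alpha> + \<epsilon>) * z)"
      if pq: "p + q = (2 - \<delta>) * z" for p q
    proof -
      have "prob {\<omega> \<in> space M. \<bar>B \<omega>\<bar> > exp p / 4 \<and> \<bar>A \<omega> * R \<omega>\<bar> > exp q / 4}
        \<le> prob {\<omega> \<in> space M. \<bar>B \<omega>\<bar> > exp p / 4} * prob {\<omega> \<in> space M. \<bar>R \<omega>\<bar> > exp q / 4 / exp (\<eta> * z)} + prob {\<omega> \<in> space M. \<bar>A \<omega>\<bar> > exp (\<eta> * z)}"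
        by (rule joint_tail) simp
      also have "exp q / 4 / exp (\<eta> * z) = exp (q - \<eta> * z) / 4" by (simp add: exp_diff)
      also have "prob {\<omega> \<in> space M. \<bar>B \<omega>\<bar> > exp p / 4} * prob {\<omega> \<in> space M. \<bar>R \<omega>\<bar> > exp (q - \<eta> * z) / 4} + prob {\<omega> \<in> space M. \<bar>A \<omega>\<bar> > exp (\<eta> * z)}
        \<le> CB * (exp p / 4) powr (- k) * (CR * (exp (q - \<eta> * z) / 4) powr (- k)) + CA * exp (\<eta> * z) powr (- g)"
        by (intro add_mono mult_mono CB(2) CR(2) CA(2)) (use CB(1) CR(1) in auto)
      also have "CB * (exp p / 4) powr (- k) * (CR * (exp (q - \<eta> * z) / 4) powr (- k)) = CB * CR * 16 powr k * exp (- (k * (2 - \<delta> - \<eta>)) * z)"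
      proof -
        have "exp p * exp (q - \<eta> * z) = exp ((2 - \<delta> - \<eta>) * z)"
          using pq by (simp add: algebra_simps flip: exp_add)
        then show ?thesis by (subst prod) (auto simp: exp_scale algebra_simps)
      qed
      also have "CA * exp (\<eta> * z) powr (- g) = CA * exp (- (g * \<eta>) * z)" by (simp add: exp_scale mult_ac)
      also have "CB * CR * 16 powr k * exp (- (k * (2 - \<delta> - \<eta>)) * z) + CA * exp (- (g * \<eta>) * z)
        \<le> CB * CR * 16 powr k * exp (- (\<alpha> + \<epsilon>) * z) + CA * exp (- (\<alpha> + \<epsilon>) * z)"
        using CB CR CA e1 e4 z by (intro add_mono mult_left_mono dec) (auto simp: g_def)
      finally show ?thesis by (simp add: D12_def algebra_simps)
    qed
    show "prob {\<omega> \<in> space M. \<bar>B \<omega>\<bar> > exp ((1 - \<delta>) * z) / 4 \<and> \<bar>A \<omega> * R \<omega>\<bar> > exp z / 4} \<le> D12 * exp (- (\<alpha> + \<epsilon>) * z)"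
      by (rule gen) (simp add: algebra_simps)
    show "prob {\<omega> \<in> space M. \<bar>B \<omega>\<bar> > exp z / 4 \<and> \<bar>A \<omega> * R \<omega>\<bar> > exp ((1 - \<delta>) * z) / 4} \<le> D12 * exp (- (\<alpha> + \<epsilon>) * z)"
      by (rule gen) (simp add: algebra_simps)
  qed
  have E3: "prob {\<omega> \<in> space M. \<bar>A \<omega> * R \<omega> - exp z\<bar> \<le> exp ((1 - \<delta>) * z)} \<le> D3 * exp (- (\<alpha> + \<epsilon>) * z)"
    if z: "z \<ge> z0" for z
  proof -
    have zz: "z \<ge> 0" "z \<ge> z1" using z by (auto simp: z0_def)
    define u where "u = exp (- \<delta> * z)"
    define s where "s = exp ((1 - \<eta>') * z)"
    have u: "0 < u" "4 * u < h0" "u \<le> 1 / 2" using z1[OF zz(2)] by (auto simp: u_def)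
    have eu: "exp ((1 - \<delta>) * z) = exp z * u" by (simp add: u_def algebra_simps flip: exp_add)
    have "prob {\<omega> \<in> space M. \<bar>A \<omega> * R \<omega> - exp z\<bar> \<le> exp z * u}
      \<le> Cb * (4 * u) powr \<beta> * prob {\<omega> \<in> space M. \<bar>R \<omega>\<bar> > s} + (2 / exp z) powr (\<alpha> + \<theta>) * s powr (\<alpha> + \<theta> - k) * KR * KA"
      by (rule near_tail[OF u _ _ k(1) _ KR KA]) (use g in \<open>auto simp: s_def g_def\<close>)
    also have "\<dots> \<le> Cb * (4 * u) powr \<beta> * (CR * s powr (- k)) + (2 / exp z) powr (\<alpha> + \<theta>) * s powr (\<alpha> + \<theta> - k) * KR * KA"
      using Cb CR by (intro add_right_mono mult_left_mono) (auto simp: s_def)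
    also have "Cb * (4 * u) powr \<beta> * (CR * s powr (- k)) = Cb * 4 powr \<beta> * CR * exp (- (\<delta> * \<beta> + k * (1 - \<eta>')) * z)"
    proof -
      have "(4 * u) powr \<beta> = 4 powr \<beta> * u powr \<beta>" by (rule powr_mult; use u in simp)
      moreover have "u powr \<beta> * s powr (- k) = exp (- (\<delta> * \<beta> + k * (1 - \<eta>')) * z)"
        by (simp add: u_def s_def exp_scale algebra_simps flip: exp_add)
      ultimately show ?thesis by simp
    qed
    also have "(2 / exp z) powr (\<alpha> + \<theta>) * s powr (\<alpha> + \<theta> - k) * KR * KA = 2 powr g * KR * KA * exp (- (k + \<eta>' * (\<alpha> + \<theta> - k)) * z)"
    proof -
      have "(2 / exp z) powr g = 2 powr g / exp z powr g" by (rule powr_divide; simp)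
      then have "(2 / exp z) powr g * s powr (g - k) = 2 powr g * (exp (- g * z) * exp ((g - k) * ((1 - \<eta>') * z)))"
        by (simp add: s_def exp_scale exp_minus field_simps)
      also have "exp (- g * z) * exp ((g - k) * ((1 - \<eta>') * z)) = exp (- (k + \<eta>' * (g - k)) * z)"
        by (simp add: algebra_simps flip: exp_add)
      finally show ?thesis by (simp add: g_def)
    qed
    also have "Cb * 4 powr \<beta> * CR * exp (- (\<delta> * \<beta> + k * (1 - \<eta>')) * z) + 2 powr g * KR * KA * exp (- (k + \<eta>' * (\<alpha> + \<theta> - k)) * z)
      \<le> Cb * 4 powr \<beta> * CR * exp (- (\<alpha> + \<epsilon>) * z) + 2 powr g * KR * KA * exp (- (\<alpha> + \<epsilon>) * z)"
      by (intro add_mono[OF mult_left_mono[OF dec[OF e2 zz(1)]] mult_left_mono[OF dec[OF e3 zz(1)]]])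
         (use Cb CR(1) KR KA in auto)
    finally show ?thesis unfolding eu by (simp add: D3_def algebra_simps)
  qed
  define C where "C = 2 * exp ((\<alpha> + \<epsilon>) * z0) + 2 * (D12 + D12 + D3)"
  have C: "C > 0" using D12 D3 by (simp add: C_def add_pos_nonneg)
  have main: "exp (\<alpha> * z) * (\<integral>\<omega>. \<bar>incr z \<omega>\<bar> \<partial>M) \<le> C * exp (- \<epsilon> * \<bar>z\<bar>) + 2 * exp (\<alpha> * z) * near_B \<delta> z" for z
  proof (cases "z \<ge> z0")
    case True
    then have zz: "z \<ge> 0" "exp z \<ge> 2" "\<bar>z\<bar> = z"
      using exp_ln[of 2] exp_le_cancel_iff[of "ln 2" z] by (auto simp: z0_def)
    have "(\<integral>\<omega>. \<bar>incr z \<omega>\<bar> \<partial>M) \<le> (\<integral>\<omega>. 2 * (of_bool (\<bar>B \<omega>\<bar> > exp ((1 - \<delta>) * z) / 4 \<and> \<bar>A \<omega> * R \<omega>\<bar> > exp z / 4)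
      + of_bool (\<bar>B \<omega>\<bar> > exp z / 4 \<and> \<bar>A \<omega> * R \<omega>\<bar> > exp ((1 - \<delta>) * z) / 4)
      + of_bool (\<bar>A \<omega> * R \<omega> - exp z\<bar> \<le> exp ((1 - \<delta>) * z))
      + of_bool (B \<omega> > 1 \<and> \<bar>z - ln (B \<omega>)\<bar> \<le> B \<omega> powr (- \<delta>))) \<partial>M)"
      unfolding incr_def
      by (intro integral_mono increment_cases \<delta> zz integrable_abs integrable_incr[unfolded incr_def]
          integrable_mult_right Bochner_Integration.integrable_add integrable_of_bool) measurable
    also have "\<dots> = 2 * (prob {\<omega> \<in> space M. \<bar>B \<omega>\<bar> > exp ((1 - \<delta>) * z) / 4 \<and> \<bar>A \<omega> * R \<omega>\<bar> > exp z / 4}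
      + prob {\<omega> \<in> space M. \<bar>B \<omega>\<bar> > exp z / 4 \<and> \<bar>A \<omega> * R \<omega>\<bar> > exp ((1 - \<delta>) * z) / 4}
      + prob {\<omega> \<in> space M. \<bar>A \<omega> * R \<omega> - exp z\<bar> \<le> exp ((1 - \<delta>) * z)} + near_B \<delta> z)"
      unfolding near_B_def
      by (simp only: integral_mult_right_zero integral_of_bool[symmetric] integrable_of_bool
          Bochner_Integration.integral_add Bochner_Integration.integrable_add)
         (simp add: integrable_of_bool integral_of_bool)
    also have "\<dots> \<le> 2 * (D12 * exp (- (\<alpha> + \<epsilon>) * z) + D12 * exp (- (\<alpha> + \<epsilon>) * z) + D3 * exp (- (\<alpha> + \<epsilon>) * z) + near_B \<delta> z)"
      using E1[OF zz(1)] E2[OF zz(1)] E3[OF True] by (intro mult_left_mono add_mono) auto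
    finally have "exp (\<alpha> * z) * (\<integral>\<omega>. \<bar>incr z \<omega>\<bar> \<partial>M) \<le> exp (\<alpha> * z) * (2 * (D12 * exp (- (\<alpha> + \<epsilon>) * z) + D12 * exp (- (\<alpha> + \<epsilon>) * z) + D3 * exp (- (\<alpha> + \<epsilon>) * z) + near_B \<delta> z))"
      by (intro mult_left_mono) auto
    also have "\<dots> = 2 * (D12 + D12 + D3) * (exp (\<alpha> * z) * exp (- (\<alpha> + \<epsilon>) * z)) + 2 * exp (\<alpha> * z) * near_B \<delta> z"
      by (simp add: algebra_simps)
    also have "exp (\<alpha> * z) * exp (- (\<alpha> + \<epsilon>) * z) = exp (- \<epsilon> * \<bar>z\<bar>)" using zz by (simp add: algebra_simps flip: exp_add)
    also have "2 * (D12 + D12 + D3) * exp (- \<epsilon> * \<bar>z\<bar>) \<le> C * exp (- \<epsilon> * \<bar>z\<bar>)"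
      by (intro mult_right_mono) (auto simp: C_def)
    finally show ?thesis by simp
  next
    case False
    have "(\<integral>\<omega>. \<bar>incr z \<omega>\<bar> \<partial>M) \<le> (\<integral>\<omega>. 2 \<partial>M)"
      by (intro integral_mono integrable_abs integrable_incr) (auto simp: abs_incr_le)
    then have "exp (\<alpha> * z) * (\<integral>\<omega>. \<bar>incr z \<omega>\<bar> \<partial>M) \<le> exp (\<alpha> * z) * 2"
      by (intro mult_left_mono) (auto simp: prob_space)
    \<comment> \<open>Here the increment is bounded by 2 and exp (\<alpha> z) supplies the decay.
      For negative z this uses \<epsilon> <= \<alpha>.\<close>
    also have "exp (\<alpha> * z) \<le> exp ((\<alpha> + \<epsilon>) * z0) * exp (- \<epsilon> * \<bar>z\<bar>)"
    proof -
      have z01: "z0 \<ge> 1" by (simp add: z0_def)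
      have "\<alpha> * z \<le> (\<alpha> + \<epsilon>) * z0 - \<epsilon> * \<bar>z\<bar>"
      proof (cases "z \<ge> 0")
        case True
        then have "(\<alpha> + \<epsilon>) * z \<le> (\<alpha> + \<epsilon>) * z0" using False \<alpha>_pos \<epsilon> by (intro mult_left_mono) auto
        then show ?thesis using True by (simp add: algebra_simps)
      next
        case False
        then have "\<epsilon> * \<bar>z\<bar> \<le> \<alpha> * \<bar>z\<bar>" using \<epsilon> by (intro mult_right_mono) auto
        moreover have "0 \<le> (\<alpha> + \<epsilon>) * z0" using z01 \<alpha>_pos \<epsilon> by simp
        moreover have "\<epsilon> * \<bar>z\<bar> = - (\<epsilon> * z)" "\<alpha> * \<bar>z\<bar> = - (\<alpha> * z)" using False by simp_all
        ultimately show ?thesis by linarith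
      qed
      then show ?thesis by (simp flip: exp_add)
    qed
    finally have "exp (\<alpha> * z) * (\<integral>\<omega>. \<bar>incr z \<omega>\<bar> \<partial>M) \<le> 2 * exp ((\<alpha> + \<epsilon>) * z0) * exp (- \<epsilon> * \<bar>z\<bar>)" by simp
    also have "\<dots> \<le> C * exp (- \<epsilon> * \<bar>z\<bar>)"
      using D12 D3 by (intro mult_right_mono) (auto simp: C_def)
    also have "\<dots> \<le> C * exp (- \<epsilon> * \<bar>z\<bar>) + 2 * exp (\<alpha> * z) * near_B \<delta> z"
      by (simp add: near_B_def)
    finally show ?thesis .
  qed
  show ?thesis by (rule that[OF C \<epsilon>(1) \<delta>(1) \<delta>(3) main])
qed

lemma near_B_measurable [measurable]: "near_B \<delta> \<in> borel_measurable borel"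
  unfolding near_B_def[abs_def] measure_def
proof -
  have "(\<lambda>z. emeasure M {\<omega> \<in> space M. 1 < B \<omega> \<and> \<bar>z - ln (B \<omega>)\<bar> \<le> B \<omega> powr - \<delta>}) =
    (\<lambda>z. \<integral>\<^sup>+\<omega>. (if 1 < B \<omega> \<and> \<bar>z - ln (B \<omega>)\<bar> \<le> B \<omega> powr - \<delta> then 1 else 0) \<partial>M)"
  proof
    fix z
    have "emeasure M {\<omega> \<in> space M. 1 < B \<omega> \<and> \<bar>z - ln (B \<omega>)\<bar> \<le> B \<omega> powr - \<delta>}
      = (\<integral>\<^sup>+\<omega>. indicator {\<omega> \<in> space M. 1 < B \<omega> \<and> \<bar>z - ln (B \<omega>)\<bar> \<le> B \<omega> powr - \<delta>} \<omega> \<partial>M)" by simp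
    also have "\<dots> = (\<integral>\<^sup>+\<omega>. (if 1 < B \<omega> \<and> \<bar>z - ln (B \<omega>)\<bar> \<le> B \<omega> powr - \<delta> then 1 else 0) \<partial>M)"
      by (intro nn_integral_cong) (auto simp: indicator_def)
    finally show "emeasure M {\<omega> \<in> space M. 1 < B \<omega> \<and> \<bar>z - ln (B \<omega>)\<bar> \<le> B \<omega> powr - \<delta>} = (\<integral>\<^sup>+\<omega>. (if 1 < B \<omega> \<and> \<bar>z - ln (B \<omega>)\<bar> \<le> B \<omega> powr - \<delta> then 1 else 0) \<partial>M)" .
  qed
  then have [measurable]: "(\<lambda>z. emeasure M {\<omega> \<in> space M. 1 < B \<omega> \<and> \<bar>z - ln (B \<omega>)\<bar> \<le> B \<omega> powr - \<delta>}) \<in> borel_measurable borel"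
    by simp
  show "(\<lambda>z. enn2real (emeasure M {\<omega> \<in> space M. 1 < B \<omega> \<and> \<bar>z - ln (B \<omega>)\<bar> \<le> B \<omega> powr - \<delta>})) \<in> borel_measurable borel"
    by measurable
qed

text \<open>For \<open>\<nu>\<close> we take both the renewal measure (\<open>\<kappa> = 1\<close>) and Lebesgue measure (\<open>\<kappa> = 0\<close>).\<close>

lemma near_B_convolution:
  fixes \<nu> :: "real measure"
  assumes sf: "sigma_finite_measure \<nu>" and [measurable_cong]: "sets \<nu> = sets borel"
    and r: "r > 0" and \<kappa>: "\<kappa> \<ge> 0" and C: "C \<ge> 0" and \<delta>: "0 < \<delta>" "\<delta> < \<alpha>" and K: "K \<ge> 2"
    and unit: "\<And>a b. a \<le> b \<Longrightarrow> b \<le> a + 3 \<Longrightarrow> emeasure \<nu> {a<..b} \<le> ennreal (C * ((b - a) + \<kappa> * exp (- r * \<bar>a\<bar>)))"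
  shows "(\<integral>\<^sup>+y. ennreal (2 * exp (\<alpha> * (x - y)) * near_B \<delta> (x - y)) * indicator (- {-K..<K}) (x - y) \<partial>\<nu>)
    \<le> ennreal (2 * exp \<alpha> * C) * (ennreal (3 * exp (- (\<delta> / 2) * (K - 1))) * (\<integral>\<^sup>+\<omega>. ennreal (max (B \<omega>) 0 powr (\<alpha> - \<delta> / 2)) \<partial>M)
      + ennreal (\<kappa> * exp (2 * r)) * window r x)"
proof -
  let ?G = "\<lambda>y \<omega>. ennreal (2 * exp (\<alpha> * (x - y))) * (if 1 < B \<omega> \<and> \<bar>x - y - ln (B \<omega>)\<bar> \<le> B \<omega> powr - \<delta> \<and> \<not> (-K \<le> x - y \<and> x - y < K) then 1 else 0)"
  have "(\<integral>\<^sup>+y. ennreal (2 * exp (\<alpha> * (x - y)) * near_B \<delta> (x - y)) * indicator (- {-K..<K}) (x - y) \<partial>\<nu>) = (\<integral>\<^sup>+y. \<integral>\<^sup>+\<omega>. ?G y \<omega> \<partial>M \<partial>\<nu>)"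
  proof (rule nn_integral_cong)
    fix y
    let ?E = "{\<omega> \<in> space M. 1 < B \<omega> \<and> \<bar>x - y - ln (B \<omega>)\<bar> \<le> B \<omega> powr - \<delta>}"
    have "(\<integral>\<^sup>+\<omega>. ?G y \<omega> \<partial>M) = (\<integral>\<^sup>+\<omega>. (ennreal (2 * exp (\<alpha> * (x - y))) * indicator (- {-K..<K}) (x - y)) * indicator ?E \<omega> \<partial>M)"
      by (intro nn_integral_cong) (auto simp: indicator_def)
    also have "\<dots> = (ennreal (2 * exp (\<alpha> * (x - y))) * indicator (- {-K..<K}) (x - y)) * ennreal (near_B \<delta> (x - y))"
      by (subst nn_integral_cmult) (auto simp: near_B_def emeasure_eq_measure)
    finally show "ennreal (2 * exp (\<alpha> * (x - y)) * near_B \<delta> (x - y)) * indicator (- {-K..<K}) (x - y) = (\<integral>\<^sup>+\<omega>. ?G y \<omega> \<partial>M)"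
      by (simp add: ennreal_mult near_B_def mult_ac)
  qed
  also have "\<dots> = (\<integral>\<^sup>+\<omega>. \<integral>\<^sup>+y. ?G y \<omega> \<partial>\<nu> \<partial>M)"
    by (rule pair_sigma_finite.Fubini')
       (auto simp: pair_sigma_finite_def sf sigma_finite_measure_axioms)
  also have "\<dots> \<le> (\<integral>\<^sup>+\<omega>. ennreal (2 * exp \<alpha> * C) * (ennreal (3 * exp (- (\<delta> / 2) * (K - 1))) * ennreal (max (B \<omega>) 0 powr (\<alpha> - \<delta> / 2))
      + ennreal (\<kappa> * exp (2 * r)) * (ennreal (B \<omega> powr \<alpha> * exp (- r * \<bar>x - ln (B \<omega>)\<bar>)) * indicator {0<..} (B \<omega>))) \<partial>M)"
  proof (rule nn_integral_mono)
    fix \<omega>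
    let ?rhs = "ennreal (2 * exp \<alpha> * C) * (ennreal (3 * exp (- (\<delta> / 2) * (K - 1))) * ennreal (max (B \<omega>) 0 powr (\<alpha> - \<delta> / 2))
      + ennreal (\<kappa> * exp (2 * r)) * (ennreal (B \<omega> powr \<alpha> * exp (- r * \<bar>x - ln (B \<omega>)\<bar>)) * indicator {0<..} (B \<omega>)))"
    show "(\<integral>\<^sup>+y. ?G y \<omega> \<partial>\<nu>) \<le> ?rhs"
    proof (cases "B \<omega> > 1 \<and> ln (B \<omega>) \<ge> K - 1")
      case False
      \<comment> \<open>The band has half-width at most 1. If 0 < ln B < K - 1, it lies inside the
        excluded window, so nothing is left to integrate.\<close>
      have "?G y \<omega> = 0" for y
      proof (cases "B \<omega> > 1")
        case True
        have "B \<omega> powr - \<delta> \<le> 1" using True \<delta> by (simp add: powr_def)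
        moreover have "ln (B \<omega>) > 0" "ln (B \<omega>) < K - 1" using True False by auto
        ultimately have "\<not> (\<bar>x - y - ln (B \<omega>)\<bar> \<le> B \<omega> powr - \<delta> \<and> \<not> (-K \<le> x - y \<and> x - y < K))"
          using K by linarith
        then show ?thesis by auto
      qed simp
      then show ?thesis by simp
    next
      case True
      define b where "b = ln (B \<omega>)"
      define w where "w = B \<omega> powr - \<delta>"
      have B: "B \<omega> = exp b" "b > 0" "b \<ge> K - 1" using True by (auto simp: b_def)
      have w: "0 < w" "w \<le> 1" "w = exp (- \<delta> * b)" using B \<delta> by (auto simp: w_def exp_scale)
      \<comment> \<open>The band in y is a closed interval; doubling w on the left encloses it in a
        half-open interval of length 3 w <= 3, to which the interval bound applies.\<close>
      have "(\<integral>\<^sup>+y. ?G y \<omega> \<partial>\<nu>) \<le> (\<integral>\<^sup>+y. ennreal (2 * exp (\<alpha> * (b + 1))) * indicator {x - b - 2 * w<..x - b + w} y \<partial>\<nu>)"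
      proof (rule nn_integral_mono)
        fix y
        have "\<alpha> * (x - y) \<le> \<alpha> * (b + 1)" if "\<bar>x - y - b\<bar> \<le> w"
        proof -
          have "x - y \<le> b + 1" using that w(2) by linarith
          then show ?thesis using \<alpha>_pos by (intro mult_left_mono) auto
        qed
        moreover have "y \<in> {x - b - 2 * w<..x - b + w}" if "\<bar>x - y - b\<bar> \<le> w"
          using that w(1) by auto
        ultimately show "?G y \<omega> \<le> ennreal (2 * exp (\<alpha> * (b + 1))) * indicator {x - b - 2 * w<..x - b + w} y"
          unfolding b_def[symmetric] w_def[symmetric] by (auto intro!: ennreal_leI)
      qed
      also have "\<dots> = ennreal (2 * exp (\<alpha> * (b + 1))) * emeasure \<nu> {x - b - 2 * w<..x - b + w}"
        by (subst nn_integral_cmult) auto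
      also have "\<dots> \<le> ennreal (2 * exp (\<alpha> * (b + 1))) * ennreal (C * (((x - b + w) - (x - b - 2 * w)) + \<kappa> * exp (- r * \<bar>x - b - 2 * w\<bar>)))"
        using w by (intro mult_left_mono unit) auto
      also have "\<dots> = ennreal (2 * exp (\<alpha> * (b + 1)) * (C * (3 * w + \<kappa> * exp (- r * \<bar>x - b - 2 * w\<bar>))))"
        using C \<kappa> w by (simp flip: ennreal_mult)
      also have "\<dots> \<le> ennreal (2 * exp \<alpha> * C * (3 * exp (- (\<delta> / 2) * (K - 1)) * exp ((\<alpha> - \<delta> / 2) * b) + \<kappa> * exp (2 * r) * (exp (\<alpha> * b) * exp (- r * \<bar>x - b\<bar>))))"
      proof (rule ennreal_leI)
        have "exp (- r * \<bar>x - b - 2 * w\<bar>) \<le> exp (r * 2) * exp (- r * \<bar>x - b\<bar>)"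
          using w r by (intro exp_abs_shift) auto
        then have 1: "\<kappa> * exp (- r * \<bar>x - b - 2 * w\<bar>) \<le> \<kappa> * (exp (r * 2) * exp (- r * \<bar>x - b\<bar>))" using \<kappa> by (intro mult_left_mono) auto
        \<comment> \<open>The width exp (-\<delta> b) is split evenly: one half becomes decay in K
          through b >= K - 1, the other lowers the moment of B from \<alpha> to \<alpha> -
          \<delta>/2.\<close>
        have 2: "w \<le> exp (- (\<delta> / 2) * (K - 1)) * exp (- (\<delta> / 2) * b)"
        proof -
          have "(\<delta> / 2) * (K - 1) \<le> (\<delta> / 2) * b" using B \<delta> by (intro mult_left_mono) auto
          then show ?thesis by (simp add: w(3) flip: exp_add)
        qed
        have "C * (3 * w + \<kappa> * exp (- r * \<bar>x - b - 2 * w\<bar>)) \<le> C * (3 * (exp (- (\<delta> / 2) * (K - 1)) * exp (- (\<delta> / 2) * b)) + \<kappa> * (exp (r * 2) * exp (- r * \<bar>x - b\<bar>)))"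
          by (rule mult_left_mono[OF add_mono[OF mult_left_mono[OF 2] 1] C]) simp
        then have "2 * exp (\<alpha> * (b + 1)) * (C * (3 * w + \<kappa> * exp (- r * \<bar>x - b - 2 * w\<bar>))) \<le> 2 * exp (\<alpha> * (b + 1)) * (C * (3 * (exp (- (\<delta> / 2) * (K - 1)) * exp (- (\<delta> / 2) * b)) + \<kappa> * (exp (r * 2) * exp (- r * \<bar>x - b\<bar>))))"
          by (rule mult_left_mono) auto
        also have ea: "exp (\<alpha> * (b + 1)) = exp \<alpha> * exp (\<alpha> * b)" by (simp add: algebra_simps exp_add)
        also have "2 * (exp \<alpha> * exp (\<alpha> * b)) * (C * (3 * (exp (- (\<delta> / 2) * (K - 1)) * exp (- (\<delta> / 2) * b)) + \<kappa> * (exp (r * 2) * exp (- r * \<bar>x - b\<bar>))))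
          = 2 * exp \<alpha> * C * (3 * exp (- (\<delta> / 2) * (K - 1)) * (exp (\<alpha> * b) * exp (- (\<delta> / 2) * b)) + \<kappa> * exp (2 * r) * (exp (\<alpha> * b) * exp (- r * \<bar>x - b\<bar>)))"
          by (simp add: algebra_simps)
        also have "exp (\<alpha> * b) * exp (- (\<delta> / 2) * b) = exp ((\<alpha> - \<delta> / 2) * b)" by (simp add: algebra_simps flip: exp_add)
        finally show "2 * exp (\<alpha> * (b + 1)) * (C * (3 * w + \<kappa> * exp (- r * \<bar>x - b - 2 * w\<bar>))) \<le> 2 * exp \<alpha> * C * (3 * exp (- (\<delta> / 2) * (K - 1)) * exp ((\<alpha> - \<delta> / 2) * b) + \<kappa> * exp (2 * r) * (exp (\<alpha> * b) * exp (- r * \<bar>x - b\<bar>)))"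
          unfolding ea .
      qed
      also have "\<dots> = ?rhs"
        using B C \<kappa> by (simp add: exp_scale max_def ennreal_mult ennreal_plus)
      finally show ?thesis .
    qed
  qed
  also have "\<dots> = ennreal (2 * exp \<alpha> * C) * (ennreal (3 * exp (- (\<delta> / 2) * (K - 1))) * (\<integral>\<^sup>+\<omega>. ennreal (max (B \<omega>) 0 powr (\<alpha> - \<delta> / 2)) \<partial>M)
      + ennreal (\<kappa> * exp (2 * r)) * window r x)"
    unfolding window_def by (simp add: nn_integral_cmult nn_integral_add)
  finally show ?thesis .
qed

end

section \<open>Renewal representation of the tail of the perpetuity\<close>

text \<open>Layer-cake formula in logarithmic scale; applied to A R + B, A R and B it turns the
  integrated increment into a difference of \<alpha>-th powers.\<close>

lemma nn_integral_exp_below: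
  assumes a: "a > (0::real)"
  shows "(\<integral>\<^sup>+z. ennreal (exp (a * z) * of_bool (v > exp z)) \<partial>lborel) = ennreal (max v 0 powr a / a)"
proof (cases "v > 0")
  case False
  then have "\<not> v > exp z" for z by (smt (verit) exp_gt_zero)
  then show ?thesis using False by (simp add: max_def)
next
  case True
  define w where "w = ln v"
  have v: "v = exp w" using True by (simp add: w_def)
  have "(\<integral>\<^sup>+z. ennreal (exp (a * z) * of_bool (v > exp z)) \<partial>lborel) = (\<integral>\<^sup>+s. ennreal (exp (a * (w + -1 * s)) * of_bool (v > exp (w + -1 * s))) \<partial>lborel)"
    by (subst nn_integral_real_affine[where c="-1" and t=w]) auto
  also have "\<dots> = (\<integral>\<^sup>+s. ennreal (exp (a * (w - s))) * indicator {0..} s \<partial>lborel)"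
    by (rule nn_integral_cong_AE) (use AE_lborel_singleton[of 0] in eventually_elim, auto simp: v indicator_def)
  also have "\<dots> = ennreal (0 - (- (1 / a) * exp (a * (w - 0))))"
  proof (rule nn_integral_FTC_atLeast)
    show "((\<lambda>s. - (1 / a) * exp (a * (w - s))) \<longlongrightarrow> 0) at_top" using a by real_asymp
  qed (use a in \<open>auto intro!: derivative_eq_intros\<close>)
  finally show ?thesis by (simp add: v exp_scale max_def)
qed

lemma
  assumes a: "a > (0::real)"
  shows integrable_exp_below: "integrable lborel (\<lambda>z. exp (a * z) * of_bool (v > exp z))"
    and integral_exp_below: "(\<integral>z. exp (a * z) * of_bool (v > exp z) \<partial>lborel) = max v 0 powr a / a"
proof -
  have [measurable]: "(\<lambda>z. exp (a * z) * of_bool (v > exp z)) \<in> borel_measurable borel"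
    unfolding of_bool_def by measurable
  show "integrable lborel (\<lambda>z. exp (a * z) * of_bool (v > exp z))"
    by (rule integrableI_nonneg) (auto simp: nn_integral_exp_below[OF a])
  show "(\<integral>z. exp (a * z) * of_bool (v > exp z) \<partial>lborel) = max v 0 powr a / a"
    using a by (subst integral_eq_nn_integral) (auto simp: nn_integral_exp_below[OF a])
qed

lemma powr_integral_below:
  assumes a: "a > (0::real)" and X: "X > 0"
  shows "(\<integral>\<^sup>+t. ennreal (t powr (a - 1)) * (if 0 < t \<and> t < X \<and> t < v then 1 else 0) \<partial>lborel)
    = ennreal (min (max v 0) X powr a / a)"
proof -
  define c where "c = min (max v 0) X"
  have c: "c \<ge> 0" using X by (simp add: c_def)
  have "(\<integral>\<^sup>+t. ennreal (t powr (a - 1)) * (if 0 < t \<and> t < X \<and> t < v then 1 else 0) \<partial>lborel)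
    = (\<integral>\<^sup>+t. ennreal (t powr (a - 1)) * indicator {0..c} t \<partial>lborel)"
  proof (rule nn_integral_cong_AE)
    show "AE t in lborel. ennreal (t powr (a - 1)) * (if 0 < t \<and> t < X \<and> t < v then 1 else 0) = ennreal (t powr (a - 1)) * indicator {0..c} t"
      using AE_lborel_singleton[of 0] AE_lborel_singleton[of c]
      by eventually_elim (auto simp: c_def indicator_def min_def max_def split: if_splits)
  qed
  also have "\<dots> = ennreal (c powr (a - 1 + 1) / (a - 1 + 1))"
    by (rule nn_integral_has_integral_lebesgue'[OF _ has_integral_powr_from_0]) (use a c in auto)
  finally show ?thesis by (simp add: c_def)
qed

context perpetuity_tail begin

abbreviation "HH \<equiv> renewal_measure \<mu>"

definition R_tail :: "real \<Rightarrow> real" where "R_tail z = exp (\<alpha> * z) * prob {\<omega> \<in> space M. R \<omega> > exp z}"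
definition AR_tail :: "real \<Rightarrow> real" where "AR_tail z = exp (\<alpha> * z) * prob {\<omega> \<in> space M. A \<omega> * R \<omega> > exp z}"
definition mean_incr :: "real \<Rightarrow> real" where "mean_incr z = exp (\<alpha> * z) * (\<integral>\<omega>. incr z \<omega> \<partial>M)"

lemma exp_tail_measurable:
  assumes [measurable]: "V \<in> borel_measurable M"
  shows "(\<lambda>z::real. prob {\<omega> \<in> space M. V \<omega> > exp z}) \<in> borel_measurable borel"
proof -
  have "mono (\<lambda>z::real. - prob {\<omega> \<in> space M. V \<omega> > exp z})"
  proof (rule monoI)
    fix z w :: real assume "z \<le> w"
    then have "exp z \<le> exp w" by simp
    from le_less_trans[OF this] have "prob {\<omega> \<in> space M. V \<omega> > exp w} \<le> prob {\<omega> \<in> space M. V \<omega> > exp z}"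
      by (intro finite_measure_mono) (blast, measurable)
    then show "- prob {\<omega> \<in> space M. V \<omega> > exp z} \<le> - prob {\<omega> \<in> space M. V \<omega> > exp w}" by simp
  qed
  then have "(\<lambda>z::real. - prob {\<omega> \<in> space M. V \<omega> > exp z}) \<in> borel_measurable borel"
    by (rule borel_measurable_mono)
  then have "(\<lambda>z::real. - (- prob {\<omega> \<in> space M. V \<omega> > exp z})) \<in> borel_measurable borel"
    by (rule borel_measurable_uminus)
  then show ?thesis by simp
qed

lemma R_tail_measurable [measurable]: "R_tail \<in> borel_measurable borel"
proof -
  have "(\<lambda>z. exp (\<alpha> * z)) \<in> borel_measurable borel" by measurable
  then show ?thesis unfolding R_tail_def[abs_def]
    by (rule borel_measurable_times[OF _ exp_tail_measurable[OF R_meas]])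
qed

lemma AR_tail_measurable [measurable]: "AR_tail \<in> borel_measurable borel"
proof -
  have "(\<lambda>z. exp (\<alpha> * z)) \<in> borel_measurable borel" "(\<lambda>\<omega>. A \<omega> * R \<omega>) \<in> borel_measurable M" by measurable
  from borel_measurable_times[OF this(1) exp_tail_measurable[OF this(2)]]
  show ?thesis unfolding AR_tail_def[abs_def] .
qed

lemma R_law: "prob {\<omega> \<in> space M. R \<omega> > t} = prob {\<omega> \<in> space M. A \<omega> * R \<omega> + B \<omega> > t}"
proof -
  have "prob {\<omega> \<in> space M. R \<omega> > t} = measure (distr M borel R) {t<..}"
    by (subst measure_distr) (auto intro!: arg_cong[where f=prob])
  also have "\<dots> = measure (distr M borel (\<lambda>\<omega>. A \<omega> * R \<omega> + B \<omega>)) {t<..}"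
    using solution by (simp add: perpetuity_solution_def)
  also have "\<dots> = prob {\<omega> \<in> space M. A \<omega> * R \<omega> + B \<omega> > t}"
    by (subst measure_distr) (auto intro!: arg_cong[where f=prob])
  finally show ?thesis .
qed

lemma mean_incr_eq: "mean_incr z = R_tail z - AR_tail z - B_tail z"
proof -
  have "(\<integral>\<omega>. incr z \<omega> \<partial>M) = prob {\<omega> \<in> space M. A \<omega> * R \<omega> + B \<omega> > exp z} - prob {\<omega> \<in> space M. A \<omega> * R \<omega> > exp z} - prob {\<omega> \<in> space M. B \<omega> > exp z}"
    unfolding incr_def by (simp add: integrable_of_bool integral_of_bool)
  then show ?thesis unfolding mean_incr_def R_tail_def AR_tail_def B_tail_def R_law by (simp only: right_diff_distrib)
qed

lemma mean_incr_measurable [measurable]: "mean_incr \<in> borel_measurable borel"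
proof -
  have "(\<lambda>z. R_tail z - AR_tail z - B_tail z) \<in> borel_measurable borel" by measurable
  then show ?thesis unfolding mean_incr_eq[abs_def] .
qed

text \<open>A crude bound from a moment of order \<alpha>/2. It suffices for convergence of all
  convolutions with H, which has exponential moments of orders in (-\<alpha>, 0), and \<alpha>/2 is
  one convenient choice.\<close>

lemma tail_le:
  assumes [measurable]: "V \<in> borel_measurable M" and m: "\<And>k. 0 < k \<Longrightarrow> k < \<alpha> \<Longrightarrow> (\<integral>\<^sup>+\<omega>. ennreal (\<bar>V \<omega>\<bar> powr k) \<partial>M) < \<infinity>"
  obtains C where "C > 0" "\<And>z. exp (\<alpha> * z) * prob {\<omega> \<in> space M. V \<omega> > exp z} \<le> C * exp (\<alpha> / 2 * z)"
proof -
  have k: "0 < \<alpha> / 2" "\<alpha> / 2 < \<alpha>" using \<alpha>_pos by auto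
  obtain C where C: "C > 0" "\<And>t. t > 0 \<Longrightarrow> prob {\<omega> \<in> space M. \<bar>V \<omega>\<bar> > t} \<le> C * t powr (- (\<alpha> / 2))"
    using markov_tail[OF assms(1) k(1) m[OF k]] by metis
  have "exp (\<alpha> * z) * prob {\<omega> \<in> space M. V \<omega> > exp z} \<le> C * exp (\<alpha> / 2 * z)" for z
  proof -
    have "prob {\<omega> \<in> space M. V \<omega> > exp z} \<le> prob {\<omega> \<in> space M. \<bar>V \<omega>\<bar> > exp z}"
      by (intro finite_measure_mono) auto
    also have "\<dots> \<le> C * exp z powr (- (\<alpha> / 2))" by (rule C) simp
    also have "exp z powr (- (\<alpha> / 2)) = exp (- (\<alpha> / 2) * z)" by (simp add: exp_scale)
    finally have "exp (\<alpha> * z) * prob {\<omega> \<in> space M. V \<omega> > exp z} \<le> exp (\<alpha> * z) * (C * exp (- (\<alpha> / 2) * z))"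
      by (intro mult_left_mono) auto
    also have "\<dots> = C * (exp (\<alpha> * z) * exp (- (\<alpha> / 2) * z))" by simp
    also have "exp (\<alpha> * z) * exp (- (\<alpha> / 2) * z) = exp (\<alpha> / 2 * z)" by (simp add: algebra_simps flip: exp_add)
    finally show ?thesis .
  qed
  then show ?thesis using that C by blast
qed

lemma integrable_HH:
  assumes [measurable]: "h \<in> borel_measurable borel" and b: "\<And>z. \<bar>h z\<bar> \<le> C * exp (\<alpha> / 2 * z)"
  shows "integrable HH (\<lambda>y. h (x - y))"
proof (rule Bochner_Integration.integrable_bound)
  show "integrable HH (\<lambda>y. C * exp (\<alpha> / 2 * x) * exp (- (\<alpha> / 2) * y))"
    using \<alpha>_pos by (intro integrable_mult_right W.integrable_H) auto
  show "AE y in HH. norm (h (x - y)) \<le> norm (C * exp (\<alpha> / 2 * x) * exp (- (\<alpha> / 2) * y))"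
  proof (rule AE_I2)
    fix y
    have "\<bar>h (x - y)\<bar> \<le> C * exp (\<alpha> / 2 * (x - y))" by (rule b)
    also have "\<dots> = C * exp (\<alpha> / 2 * x) * exp (- (\<alpha> / 2) * y)"
      by (simp add: algebra_simps diff_divide_distrib flip: exp_add)
    finally show "norm (h (x - y)) \<le> norm (C * exp (\<alpha> / 2 * x) * exp (- (\<alpha> / 2) * y))" by simp
  qed
qed simp

lemma integrable_R_tail: "integrable HH (\<lambda>y. R_tail (x - y))"
proof -
  obtain C where C: "C > 0" "\<And>z. exp (\<alpha> * z) * prob {\<omega> \<in> space M. R \<omega> > exp z} \<le> C * exp (\<alpha> / 2 * z)"
    using tail_le[OF R_meas R_moment] by metis
  show ?thesis by (rule integrable_HH[of _ C]) (use C in \<open>auto simp: R_tail_def\<close>)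
qed

lemma integrable_B_tail: "integrable HH (\<lambda>y. B_tail (x - y))"
proof -
  obtain C where C: "C > 0" "\<And>z. exp (\<alpha> * z) * prob {\<omega> \<in> space M. B \<omega> > exp z} \<le> C * exp (\<alpha> / 2 * z)"
    using tail_le[OF B_meas B_moment] by metis
  show ?thesis by (rule integrable_HH[of _ C]) (use C in \<open>auto simp: B_tail_def\<close>)
qed

text \<open>Exponential tilting turns the multiplicative step \<open>R \<mapsto> A R\<close> into convolution with \<open>\<mu>\<close>.\<close>

lemma AR_tail_convolution: "(\<integral>z. R_tail (x - z) \<partial>\<mu>) = AR_tail x"
proof -
  have "(\<integral>\<^sup>+z. ennreal (R_tail (x - z)) \<partial>\<mu>) = (\<integral>\<^sup>+\<omega>. ennreal (A \<omega> powr \<alpha>) * indicator {0<..} (A \<omega>) * ennreal (R_tail (x - ln (A \<omega>))) \<partial>M)"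
    by (rule \<mu>_law) simp
  also have "\<dots> = (\<integral>\<^sup>+\<omega>. ennreal (exp (\<alpha> * x)) * (\<integral>\<^sup>+\<omega>'. (if A \<omega> * R \<omega>' > exp x then 1 else 0) \<partial>M) \<partial>M)"
  proof (rule nn_integral_cong_AE)
    show "AE \<omega> in M. ennreal (A \<omega> powr \<alpha>) * indicator {0<..} (A \<omega>) * ennreal (R_tail (x - ln (A \<omega>))) = ennreal (exp (\<alpha> * x)) * (\<integral>\<^sup>+\<omega>'. (if A \<omega> * R \<omega>' > exp x then 1 else 0) \<partial>M)"
      using A_nonneg
    proof eventually_elim
      case (elim \<omega>)
      show ?case
      proof (cases "A \<omega> = 0")
        case True
        then show ?thesis by (simp add: not_less)
      next
        case False
        define a where "a = ln (A \<omega>)"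
        have a: "A \<omega> = exp a" using False elim by (simp add: a_def)
        have "(\<integral>\<^sup>+\<omega>'. (if A \<omega> * R \<omega>' > exp x then 1 else 0) \<partial>M) = (\<integral>\<^sup>+\<omega>'. indicator {\<omega>' \<in> space M. R \<omega>' > exp (x - a)} \<omega>' \<partial>M)"
          by (intro nn_integral_cong) (auto simp: a exp_diff indicator_def field_simps)
        also have "\<dots> = ennreal (prob {\<omega>' \<in> space M. R \<omega>' > exp (x - a)})" by (simp add: emeasure_eq_measure)
        finally have "ennreal (exp (\<alpha> * x)) * (\<integral>\<^sup>+\<omega>'. (if A \<omega> * R \<omega>' > exp x then 1 else 0) \<partial>M) = ennreal (exp (\<alpha> * x) * prob {\<omega>' \<in> space M. R \<omega>' > exp (x - a)})"
          by (simp add: ennreal_mult)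
        moreover have "exp (\<alpha> * x) * prob {\<omega>' \<in> space M. R \<omega>' > exp (x - a)} = A \<omega> powr \<alpha> * R_tail (x - ln (A \<omega>))"
          by (simp add: a exp_scale R_tail_def algebra_simps flip: exp_add)
        moreover have "R_tail (x - ln (A \<omega>)) \<ge> 0" by (simp add: R_tail_def)
        moreover have "A \<omega> > 0" by (simp add: a)
        ultimately show ?thesis by (simp add: ennreal_mult)
      qed
    qed
  qed
  also have "\<dots> = ennreal (exp (\<alpha> * x)) * (\<integral>\<^sup>+\<omega>. \<integral>\<^sup>+\<omega>'. (if A \<omega> * R \<omega>' > exp x then 1 else 0) \<partial>M \<partial>M)"
    by (rule nn_integral_cmult) measurable
  also have "(\<integral>\<^sup>+\<omega>. \<integral>\<^sup>+\<omega>'. (if A \<omega> * R \<omega>' > exp x then 1 else 0) \<partial>M \<partial>M) = (\<integral>\<^sup>+\<omega>'. \<integral>\<^sup>+\<omega>. (if A \<omega> * R \<omega>' > exp x then 1 else (0::ennreal)) \<partial>M \<partial>M)"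
    by (rule pair_sigma_finite.Fubini') (auto simp: pair_sigma_finite_def sigma_finite_measure_axioms)
  also have "\<dots> = (\<integral>\<^sup>+\<omega>. (if A \<omega> * R \<omega> > exp x then 1 else 0) \<partial>M)"
    using indep_nn_integral[of "\<lambda>(r, a, b). if a * r > exp x then 1 else 0"] by simp
  also have "\<dots> = (\<integral>\<^sup>+\<omega>. indicator {\<omega> \<in> space M. A \<omega> * R \<omega> > exp x} \<omega> \<partial>M)"
    by (intro nn_integral_cong) (auto simp: indicator_def)
  also have "\<dots> = ennreal (prob {\<omega> \<in> space M. A \<omega> * R \<omega> > exp x})" by (simp add: emeasure_eq_measure)
  finally have "(\<integral>\<^sup>+z. ennreal (R_tail (x - z)) \<partial>\<mu>) = ennreal (AR_tail x)"
    by (simp add: AR_tail_def ennreal_mult)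
  then show ?thesis
    by (subst integral_eq_nn_integral) (auto simp: R_tail_def AR_tail_def)
qed

text \<open>The renewal equation is read as an identity for H and integrated against the tail of R,
  whose convolution with \<mu> is the tail of A R. This solves the equation for the tail directly,
  without iteration or a uniqueness argument.\<close>

lemma R_tail_renewal:
  shows "integrable HH (\<lambda>y. AR_tail (x - y))" "R_tail x = (\<integral>y. R_tail (x - y) - AR_tail (x - y) \<partial>HH)"
proof -
  let ?f = "\<lambda>y. complex_of_real (R_tail (x - y))"
  have fi: "integrable HH ?f" using integrable_R_tail[of x] by simp
  interpret P: pair_sigma_finite \<mu> HH
    by (simp add: pair_sigma_finite_def W.sigma_finite_measure_axioms W.H.sigma_finite_measure_axioms)
  note RE = W.renewal_equation[OF W.H.sigma_finite_measure_axioms fi]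
  have inner: "(\<integral>z. ?f (z + y) \<partial>\<mu>) = complex_of_real (AR_tail (x - y))" for y
    using AR_tail_convolution[of "x - y"] by (simp add: algebra_simps)
  have "integrable HH (\<lambda>y. \<integral>z. ?f (z + y) \<partial>\<mu>)"
    using P.integrable_snd[OF RE(1)] .
  then have "integrable HH (\<lambda>y. complex_of_real (AR_tail (x - y)))" unfolding inner .
  then show qi: "integrable HH (\<lambda>y. AR_tail (x - y))" unfolding complex_of_real_integrable_eq .
  have "(\<integral>z. (\<integral>y. ?f (z + y) \<partial>HH) \<partial>\<mu>) = (\<integral>y. (\<integral>z. ?f (z + y) \<partial>\<mu>) \<partial>HH)"
    by (rule P.Fubini_integral[symmetric]) (rule RE(1))
  also have "\<dots> = complex_of_real (\<integral>y. AR_tail (x - y) \<partial>HH)" unfolding inner by simp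
  finally have "complex_of_real (\<integral>y. R_tail (x - y) \<partial>HH) = complex_of_real (R_tail x) + complex_of_real (\<integral>y. AR_tail (x - y) \<partial>HH)"
    using RE(2) by simp
  then have "(\<integral>y. R_tail (x - y) \<partial>HH) = R_tail x + (\<integral>y. AR_tail (x - y) \<partial>HH)"
    by (simp flip: of_real_add)
  then show "R_tail x = (\<integral>y. R_tail (x - y) - AR_tail (x - y) \<partial>HH)"
    using integrable_R_tail qi by simp
qed

lemma integrable_mean_incr_HH: "integrable HH (\<lambda>y. mean_incr (x - y))"
  unfolding mean_incr_eq by (intro Bochner_Integration.integrable_diff integrable_R_tail integrable_B_tail R_tail_renewal)

lemma R_tail_decomposition: "R_tail x = (\<integral>y. B_tail (x - y) \<partial>HH) + (\<integral>y. mean_incr (x - y) \<partial>HH)"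
proof -
  have "(\<integral>y. B_tail (x - y) \<partial>HH) + (\<integral>y. mean_incr (x - y) \<partial>HH) = (\<integral>y. B_tail (x - y) + mean_incr (x - y) \<partial>HH)"
    by (rule Bochner_Integration.integral_add[symmetric]) (rule integrable_B_tail integrable_mean_incr_HH)+
  then show ?thesis unfolding mean_incr_eq using R_tail_renewal(2)[of x] by simp
qed

section \<open>Convolution of the renewal measure with L\<close>

definition clipped_moment :: "real \<Rightarrow> real" where
  "clipped_moment x = (\<integral>\<omega>. min (max (B \<omega>) 0) (exp x) powr \<alpha> \<partial>M)"

lemma integrable_clipped: "integrable M (\<lambda>\<omega>. min (max (B \<omega>) 0) (exp x) powr \<alpha>)"
  by (rule integrable_const_bound[of _ "exp x powr \<alpha>"]) (use \<alpha>_pos in \<open>auto intro!: powr_mono2\<close>)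

lemma tail_mass_measurable [measurable]: "W.tail_mass \<in> borel_measurable borel"
proof -
  have "mono (\<lambda>s. - W.tail_mass s)"
    by (rule monoI) (auto simp: W.tail_mass_def indicator_def intro!: integral_mono W.integrable_tail_mass[unfolded indicator_def, simplified])
  then have "(\<lambda>s. - W.tail_mass s) \<in> borel_measurable borel" by (rule borel_measurable_mono)
  then have "(\<lambda>s. - (- W.tail_mass s)) \<in> borel_measurable borel" by (rule borel_measurable_uminus)
  then show ?thesis by simp
qed

lemma discounted_renewal_measurable [measurable]: "W.discounted_renewal \<in> borel_measurable borel"
  unfolding W.discounted_renewal_def[abs_def] by measurable

lemma discounted_renewal_nonneg: "W.discounted_renewal s \<ge> 0"
  by (simp add: W.discounted_renewal_def W.tail_mass_def)

text \<open>For fixed \<omega> with b = ln B the inner integral runs over y > x - b with weight exp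
  (\<alpha> (x - y)), which is exp (\<alpha> b) times the discounted mass at x - b. This is why
  discounted masses of half-lines are the right functional of H.\<close>

lemma B_tail_convolution_eq:
  shows "integrable M (\<lambda>\<omega>. if B \<omega> > 0 then B \<omega> powr \<alpha> * W.discounted_renewal (x - ln (B \<omega>)) else 0)"
    and "(\<integral>y. B_tail (x - y) \<partial>HH) = (\<integral>\<omega>. (if B \<omega> > 0 then B \<omega> powr \<alpha> * W.discounted_renewal (x - ln (B \<omega>)) else 0) \<partial>M)"
proof -
  let ?\<phi> = "\<lambda>\<omega>. if B \<omega> > 0 then B \<omega> powr \<alpha> * W.discounted_renewal (x - ln (B \<omega>)) else 0"
  have "ennreal (\<integral>y. B_tail (x - y) \<partial>HH) = (\<integral>\<^sup>+y. ennreal (B_tail (x - y)) \<partial>HH)"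
    by (rule nn_integral_eq_integral[symmetric, OF integrable_B_tail]) (simp add: B_tail_pos less_imp_le)
  also have "\<dots> = (\<integral>\<^sup>+y. \<integral>\<^sup>+\<omega>. ennreal (exp (\<alpha> * (x - y))) * (if B \<omega> > exp (x - y) then 1 else 0) \<partial>M \<partial>HH)"
  proof (rule nn_integral_cong)
    fix y
    have "(\<integral>\<^sup>+\<omega>. ennreal (exp (\<alpha> * (x - y))) * (if B \<omega> > exp (x - y) then 1 else 0) \<partial>M) = (\<integral>\<^sup>+\<omega>. ennreal (exp (\<alpha> * (x - y))) * indicator {\<omega> \<in> space M. B \<omega> > exp (x - y)} \<omega> \<partial>M)"
      by (intro nn_integral_cong) (auto simp: indicator_def)
    also have "\<dots> = ennreal (B_tail (x - y))"
      by (subst nn_integral_cmult) (auto simp: emeasure_eq_measure B_tail_def ennreal_mult)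
    finally show "ennreal (B_tail (x - y)) = (\<integral>\<^sup>+\<omega>. ennreal (exp (\<alpha> * (x - y))) * (if B \<omega> > exp (x - y) then 1 else 0) \<partial>M)" ..
  qed
  also have "\<dots> = (\<integral>\<^sup>+\<omega>. \<integral>\<^sup>+y. ennreal (exp (\<alpha> * (x - y))) * (if B \<omega> > exp (x - y) then 1 else 0) \<partial>HH \<partial>M)"
    by (rule pair_sigma_finite.Fubini')
       (auto simp: pair_sigma_finite_def sigma_finite_measure_axioms W.H.sigma_finite_measure_axioms)
  also have "\<dots> = (\<integral>\<^sup>+\<omega>. ennreal (?\<phi> \<omega>) \<partial>M)"
  proof (rule nn_integral_cong)
    fix \<omega>
    show "(\<integral>\<^sup>+y. ennreal (exp (\<alpha> * (x - y))) * (if B \<omega> > exp (x - y) then 1 else 0) \<partial>HH) = ennreal (?\<phi> \<omega>)"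
    proof (cases "B \<omega> > 0")
      case False
      then have "\<not> B \<omega> > exp (x - y)" for y using exp_gt_zero[of "x - y"] by linarith
      then show ?thesis using False by simp
    next
      case True
      define b where "b = ln (B \<omega>)"
      have b: "B \<omega> = exp b" using True by (simp add: b_def)
      have "(\<integral>\<^sup>+y. ennreal (exp (\<alpha> * (x - y))) * (if B \<omega> > exp (x - y) then 1 else 0) \<partial>HH)
        = (\<integral>\<^sup>+y. ennreal (exp (\<alpha> * x) * (exp (- \<alpha> * y) * indicator {x - b<..} y)) \<partial>HH)"
        by (intro nn_integral_cong) (auto simp: b indicator_def algebra_simps simp flip: exp_add)
      also have "\<dots> = ennreal (\<integral>y. exp (\<alpha> * x) * (exp (- \<alpha> * y) * indicator {x - b<..} y) \<partial>HH)"
        by (intro nn_integral_eq_integral integrable_mult_right W.integrable_tail_mass) auto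
      also have "(\<integral>y. exp (\<alpha> * x) * (exp (- \<alpha> * y) * indicator {x - b<..} y) \<partial>HH) = exp (\<alpha> * x) * W.tail_mass (x - b)"
        by (simp add: W.tail_mass_def)
      also have "\<dots> = (exp (\<alpha> * b) * exp (\<alpha> * (x - b))) * W.tail_mass (x - b)"
        by (simp add: algebra_simps flip: exp_add)
      also have "\<dots> = ?\<phi> \<omega>"
        by (simp add: b exp_scale W.discounted_renewal_def)
      finally show ?thesis .
    qed
  qed
  finally have eq: "(\<integral>\<^sup>+\<omega>. ennreal (?\<phi> \<omega>) \<partial>M) = ennreal (\<integral>y. B_tail (x - y) \<partial>HH)" ..
  have nn: "?\<phi> \<omega> \<ge> 0" for \<omega> by (simp add: discounted_renewal_nonneg)
  show "integrable M ?\<phi>"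
    by (rule integrableI_nonneg) (auto simp: eq nn)
  have "(\<integral>\<omega>. ?\<phi> \<omega> \<partial>M) = enn2real (\<integral>\<^sup>+\<omega>. ennreal (?\<phi> \<omega>) \<partial>M)"
    by (rule integral_eq_nn_integral) (auto simp: nn)
  also have "\<dots> = (\<integral>y. B_tail (x - y) \<partial>HH)"
    unfolding eq by (rule enn2real_ennreal) (simp add: B_tail_pos less_imp_le)
  finally show "(\<integral>y. B_tail (x - y) \<partial>HH) = (\<integral>\<omega>. ?\<phi> \<omega> \<partial>M)" ..
qed

text \<open>Replacing the discounted mass by its limit turns exp (\<alpha> b) into exp (\<alpha>
  min(b, x)) / (\<alpha> \<open>drift\<close>), the clipped power of B. The exponential rate makes
  the total error a multiple of \<open>window\<close>.\<close>

lemma B_tail_convolution: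
  assumes r: "r > 0" and C: "C > 0"
    and rate: "\<And>s. \<bar>W.discounted_renewal s - W.discounted_limit s\<bar> \<le> C * exp (- r * \<bar>s\<bar>)"
  obtains D z0 where "D > 0"
    "\<And>x. x \<ge> z0 \<Longrightarrow> \<bar>(\<integral>y. B_tail (x - y) \<partial>HH) - clipped_moment x / (\<alpha> * W.drift)\<bar> \<le> D * (B_tail x + exp (- r * x))"
proof -
  obtain Cw z0 where Cw: "Cw > 0" "\<And>x. x \<ge> z0 \<Longrightarrow> window r x \<le> ennreal (Cw * (B_tail x + exp (- r * x)))"
    using window_bound[OF r] by metis
  have "\<bar>(\<integral>y. B_tail (x - y) \<partial>HH) - clipped_moment x / (\<alpha> * W.drift)\<bar> \<le> C * Cw * (B_tail x + exp (- r * x))" if x: "x \<ge> z0" for x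
  proof -
    let ?\<phi> = "\<lambda>\<omega>. if B \<omega> > 0 then B \<omega> powr \<alpha> * W.discounted_renewal (x - ln (B \<omega>)) else 0"
    let ?\<tau> = "\<lambda>\<omega>. min (max (B \<omega>) 0) (exp x) powr \<alpha> / (\<alpha> * W.drift)"
    have i: "integrable M ?\<phi>" "integrable M ?\<tau>"
      using B_tail_convolution_eq(1) integrable_clipped by auto
    have "(\<integral>y. B_tail (x - y) \<partial>HH) - clipped_moment x / (\<alpha> * W.drift) = (\<integral>\<omega>. ?\<phi> \<omega> - ?\<tau> \<omega> \<partial>M)"
      using i unfolding B_tail_convolution_eq(2) clipped_moment_def by simp
    then have "ennreal \<bar>(\<integral>y. B_tail (x - y) \<partial>HH) - clipped_moment x / (\<alpha> * W.drift)\<bar> \<le> (\<integral>\<^sup>+\<omega>. ennreal (norm (?\<phi> \<omega> - ?\<tau> \<omega>)) \<partial>M)"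
      using integral_norm_bound_ennreal[OF Bochner_Integration.integrable_diff[OF i]] by simp
    also have "\<dots> \<le> (\<integral>\<^sup>+\<omega>. ennreal C * (ennreal (B \<omega> powr \<alpha> * exp (- r * \<bar>x - ln (B \<omega>)\<bar>)) * indicator {0<..} (B \<omega>)) \<partial>M)"
    proof (rule nn_integral_mono)
      fix \<omega>
      show "ennreal (norm (?\<phi> \<omega> - ?\<tau> \<omega>)) \<le> ennreal C * (ennreal (B \<omega> powr \<alpha> * exp (- r * \<bar>x - ln (B \<omega>)\<bar>)) * indicator {0<..} (B \<omega>))"
      proof (cases "B \<omega> > 0")
        case False
        then have "max (B \<omega>) 0 = 0" by simp
        then have "?\<tau> \<omega> = 0" by (simp add: min_def)
        then show ?thesis using False by simp
      next
        case True
        define b where "b = ln (B \<omega>)"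
        have b: "B \<omega> = exp b" using True by (simp add: b_def)
        have "min (max (B \<omega>) 0) (exp x) = exp (min b x)" by (auto simp: b min_def max_def)
        then have "?\<tau> \<omega> = exp (\<alpha> * min b x) / (\<alpha> * W.drift)" by (simp add: exp_scale)
        also have "\<dots> = exp (\<alpha> * b) * W.discounted_limit (x - b)"
          by (simp add: W.discounted_limit_def min_def max_def algebra_simps flip: exp_add)
        finally have t: "?\<tau> \<omega> = exp (\<alpha> * b) * W.discounted_limit (x - b)" .
        have "norm (?\<phi> \<omega> - ?\<tau> \<omega>) = exp (\<alpha> * b) * \<bar>W.discounted_renewal (x - b) - W.discounted_limit (x - b)\<bar>"
          unfolding t by (simp add: b exp_scale abs_mult flip: right_diff_distrib)
        also have "\<dots> \<le> exp (\<alpha> * b) * (C * exp (- r * \<bar>x - b\<bar>))" by (intro mult_left_mono rate) auto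
        finally have "norm (?\<phi> \<omega> - ?\<tau> \<omega>) \<le> C * (B \<omega> powr \<alpha> * exp (- r * \<bar>x - ln (B \<omega>)\<bar>))"
          by (simp add: b exp_scale mult_ac)
        then have "ennreal (norm (?\<phi> \<omega> - ?\<tau> \<omega>)) \<le> ennreal (C * (B \<omega> powr \<alpha> * exp (- r * \<bar>x - ln (B \<omega>)\<bar>)))"
          by (rule ennreal_leI)
        also have "\<dots> = ennreal C * (ennreal (B \<omega> powr \<alpha> * exp (- r * \<bar>x - ln (B \<omega>)\<bar>)) * indicator {0<..} (B \<omega>))"
          using True C by (subst ennreal_mult) auto
        finally show ?thesis .
      qed
    qed
    also have "\<dots> = ennreal C * window r x" unfolding window_def by (rule nn_integral_cmult) measurable
    also have "\<dots> \<le> ennreal C * ennreal (Cw * (B_tail x + exp (- r * x)))" by (intro mult_left_mono Cw x) auto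
    also have "\<dots> = ennreal (C * Cw * (B_tail x + exp (- r * x)))"
      using C Cw(1) B_tail_pos[of x] by (simp add: mult.assoc flip: ennreal_mult)
    finally show ?thesis
      using C Cw(1) B_tail_pos[of x] by (simp add: ennreal_le_iff add_pos_pos less_imp_le)
  qed
  then show ?thesis using that[of "C * Cw" z0] C Cw(1) by simp
qed

text \<open>The \<alpha>-th power of min(B_+, exp x) is \<alpha> times the integral of t^(\<alpha> -
  1) over 0 < t < exp x with t < B; taking expectations under the integral produces L(t)/t.\<close>

lemma clipped_moment_eq: "clipped_moment x = \<alpha> * (LBINT t:{0<..<exp x}. (t powr \<alpha> * prob {\<omega> \<in> space M. B \<omega> > t}) / t)"
proof -
  have tm: "(\<lambda>t. prob {\<omega> \<in> space M. B \<omega> > t}) \<in> borel_measurable borel"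
  proof -
    have "mono (\<lambda>t. - prob {\<omega> \<in> space M. B \<omega> > t})"
      by (rule monoI) (auto intro!: finite_measure_mono)
    then have "(\<lambda>t. - prob {\<omega> \<in> space M. B \<omega> > t}) \<in> borel_measurable borel" by (rule borel_measurable_mono)
    then have "(\<lambda>t. - (- prob {\<omega> \<in> space M. B \<omega> > t})) \<in> borel_measurable borel" by (rule borel_measurable_uminus)
    then show ?thesis by simp
  qed
  note [measurable] = tm
  let ?h = "\<lambda>t. indicator {0<..<exp x} t *\<^sub>R ((t powr \<alpha> * prob {\<omega> \<in> space M. B \<omega> > t}) / t)"
  have "(\<integral>\<^sup>+t. ennreal (?h t) \<partial>lborel) = (\<integral>\<^sup>+t. \<integral>\<^sup>+\<omega>. ennreal (t powr (\<alpha> - 1)) * (if 0 < t \<and> t < exp x \<and> t < B \<omega> then 1 else 0) \<partial>M \<partial>lborel)"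
  proof (rule nn_integral_cong)
    fix t
    have "(\<integral>\<^sup>+\<omega>. ennreal (t powr (\<alpha> - 1)) * (if 0 < t \<and> t < exp x \<and> t < B \<omega> then 1 else 0) \<partial>M)
      = (\<integral>\<^sup>+\<omega>. (ennreal (t powr (\<alpha> - 1)) * indicator {0<..<exp x} t) * indicator {\<omega> \<in> space M. B \<omega> > t} \<omega> \<partial>M)"
      by (intro nn_integral_cong) (auto simp: indicator_def)
    also have "\<dots> = (ennreal (t powr (\<alpha> - 1)) * indicator {0<..<exp x} t) * ennreal (prob {\<omega> \<in> space M. B \<omega> > t})"
      by (subst nn_integral_cmult) (auto simp: emeasure_eq_measure)
    also have "\<dots> = ennreal (?h t)"
      by (auto simp: indicator_def powr_diff ennreal_mult[symmetric])
    finally show "ennreal (?h t) = (\<integral>\<^sup>+\<omega>. ennreal (t powr (\<alpha> - 1)) * (if 0 < t \<and> t < exp x \<and> t < B \<omega> then 1 else 0) \<partial>M)" ..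
  qed
  also have "\<dots> = (\<integral>\<^sup>+\<omega>. \<integral>\<^sup>+t. ennreal (t powr (\<alpha> - 1)) * (if 0 < t \<and> t < exp x \<and> t < B \<omega> then 1 else 0) \<partial>lborel \<partial>M)"
    by (rule pair_sigma_finite.Fubini')
       (auto simp: pair_sigma_finite_def sigma_finite_measure_axioms sigma_finite_lborel)
  also have "\<dots> = (\<integral>\<^sup>+\<omega>. ennreal (min (max (B \<omega>) 0) (exp x) powr \<alpha> / \<alpha>) \<partial>M)"
    using \<alpha>_pos by (subst powr_integral_below) auto
  also have "\<dots> = ennreal (\<integral>\<omega>. min (max (B \<omega>) 0) (exp x) powr \<alpha> / \<alpha> \<partial>M)"
    using integrable_clipped \<alpha>_pos by (intro nn_integral_eq_integral) auto
  also have "(\<integral>\<omega>. min (max (B \<omega>) 0) (exp x) powr \<alpha> / \<alpha> \<partial>M) = clipped_moment x / \<alpha>"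
    by (simp add: clipped_moment_def)
  finally have e: "(\<integral>\<^sup>+t. ennreal (?h t) \<partial>lborel) = ennreal (clipped_moment x / \<alpha>)" .
  have "(\<integral>t. ?h t \<partial>lborel) = enn2real (\<integral>\<^sup>+t. ennreal (?h t) \<partial>lborel)"
    by (rule integral_eq_nn_integral) (auto simp: indicator_def)
  also have "\<dots> = clipped_moment x / \<alpha>"
    unfolding e using \<alpha>_pos by (intro enn2real_ennreal) (simp add: clipped_moment_def)
  finally show ?thesis using \<alpha>_pos by (simp add: set_lebesgue_integral_def)
qed

end

section \<open>Comparison of the renewal measure with Lebesgue measure on windows\<close>

text \<open>For y in the window, the event V > exp (x - y) becomes y > x -
  \<open>clamp_ln K V\<close>. Nonpositive v is sent to the lower end -K, which corresponds to an
  empty interval.\<close>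

definition clamp_ln :: "real \<Rightarrow> real \<Rightarrow> real" where
  "clamp_ln K v = (if v > 0 then max (- K) (min K (ln v)) else - K)"

lemma clamp_ln_measurable [measurable]: "clamp_ln K \<in> borel_measurable borel"
  unfolding clamp_ln_def[abs_def] by measurable

lemma clamp_ln_bounds: "K \<ge> 0 \<Longrightarrow> - K \<le> clamp_ln K v \<and> clamp_ln K v \<le> K"
  by (auto simp: clamp_ln_def)

lemma less_clamp_ln: "- K \<le> w \<Longrightarrow> w < K \<Longrightarrow> w < clamp_ln K v \<longleftrightarrow> exp w < v"
proof (cases "v > 0")
  case True
  assume "- K \<le> w" "w < K"
  then have "w < clamp_ln K v \<longleftrightarrow> w < ln v" using True by (auto simp: clamp_ln_def)
  also have "\<dots> \<longleftrightarrow> exp w < exp (ln v)" unfolding exp_less_cancel_iff ..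
  finally show ?thesis using True by simp
next
  case False
  assume "- K \<le> w"
  then show ?thesis using False by (simp add: clamp_ln_def not_less order_trans[OF _ exp_ge_zero])
qed

context perpetuity_tail begin

lemma integral_exp_Ioc_HH:
  assumes "s \<le> t"
  shows "(\<integral>y. exp (- \<alpha> * y) * indicator {s<..t} y \<partial>HH) = W.tail_mass s - W.tail_mass t"
proof -
  have e: "exp (- \<alpha> * y) * indicator {s<..t} y = exp (- \<alpha> * y) * indicator {s<..} y - exp (- \<alpha> * y) * indicator {t<..} y" for y
    using assms by (auto simp: indicator_def)
  show ?thesis
    unfolding e W.tail_mass_def by (rule Bochner_Integration.integral_diff[OF W.integrable_tail_mass W.integrable_tail_mass])
qed

lemma integral_exp_Ioc_lborel:
  assumes "s \<le> t"
  shows "(\<integral>y. exp (- \<alpha> * y) * indicator {s<..t} y \<partial>lborel) = (exp (- \<alpha> * s) - exp (- \<alpha> * t)) / \<alpha>"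
proof -
  have "(\<integral>y. exp (- \<alpha> * y) * indicator {s<..t} y \<partial>lborel) = (\<integral>y. indicator {s..t} y *\<^sub>R exp (- \<alpha> * y) \<partial>lborel)"
    by (rule integral_cong_AE) (use AE_lborel_singleton[of s] in \<open>auto simp: indicator_def elim!: eventually_mono\<close>)
  also have "\<dots> = - exp (- \<alpha> * t) / \<alpha> - (- exp (- \<alpha> * s) / \<alpha>)"
    by (rule integral_FTC_Icc[OF assms])
       (use \<alpha>_pos in \<open>auto intro!: derivative_eq_intros continuous_intros simp flip: has_real_derivative_iff_has_vector_derivative\<close>)
  finally show ?thesis by (simp add: diff_divide_distrib)
qed

text \<open>Weighted masses of half-open intervals are differences of two discounted tails. Since K
  <= x, both end points are nonnegative, where the limit functional is constant; each contributes
  one error at distance at least x - K from 0, with weight at most exp (\<alpha> K).\<close>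

lemma interval_discrepancy:
  assumes rate: "\<And>s. \<bar>W.discounted_renewal s - W.discounted_limit s\<bar> \<le> C * exp (- r * \<bar>s\<bar>)"
    and r: "r > 0" and C: "C > 0" and K: "0 \<le> K" "K \<le> x" and c: "- K \<le> c" "c \<le> K"
  shows "\<bar>(\<integral>y. exp (\<alpha> * (x - y)) * indicator {x - c<..x + K} y \<partial>HH)
    - (\<integral>y. exp (\<alpha> * (x - y)) * indicator {x - c<..x + K} y \<partial>lborel) / W.drift\<bar> \<le> 2 * C * exp (\<alpha> * K) * exp (- r * (x - K))"
proof -
  have e: "exp (\<alpha> * (x - y)) * indicator {x - c<..x + K} y = exp (\<alpha> * x) * (exp (- \<alpha> * y) * indicator {x - c<..x + K} y)" for y
    by (simp add: algebra_simps flip: exp_add mult.assoc)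
  have le: "x - c \<le> x + K" using c by simp
  have dl: "W.discounted_limit s = 1 / (\<alpha> * W.drift)" if "s \<ge> 0" for s
    using that by (simp add: W.discounted_limit_def max_def)
  have ex: "exp (\<alpha> * x) = exp (\<alpha> * c) * exp (\<alpha> * (x - c))" "exp (\<alpha> * x) = exp (- \<alpha> * K) * exp (\<alpha> * (x + K))"
    by (simp_all add: algebra_simps flip: exp_add)
  have ex': "exp (\<alpha> * x) * exp (- \<alpha> * (x - c)) = exp (\<alpha> * c)" "exp (\<alpha> * x) * exp (- \<alpha> * (x + K)) = exp (- \<alpha> * K)"
    by (simp_all add: algebra_simps flip: exp_add)
  have a: "exp (\<alpha> * x) * W.tail_mass (x - c) = exp (\<alpha> * c) * W.discounted_renewal (x - c)"
    unfolding W.discounted_renewal_def by (subst ex(1)) simp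
  have b: "exp (\<alpha> * x) * W.tail_mass (x + K) = exp (- \<alpha> * K) * W.discounted_renewal (x + K)"
    unfolding W.discounted_renewal_def by (subst ex(2)) simp
  have 1: "(\<integral>y. exp (\<alpha> * (x - y)) * indicator {x - c<..x + K} y \<partial>HH) = exp (\<alpha> * c) * W.discounted_renewal (x - c) - exp (- \<alpha> * K) * W.discounted_renewal (x + K)"
    unfolding e integral_mult_right_zero integral_exp_Ioc_HH[OF le] right_diff_distrib[of "exp (\<alpha> * x)"] a b ..
  have 2: "(\<integral>y. exp (\<alpha> * (x - y)) * indicator {x - c<..x + K} y \<partial>lborel) / W.drift = exp (\<alpha> * c) * W.discounted_limit (x - c) - exp (- \<alpha> * K) * W.discounted_limit (x + K)"
    unfolding e integral_mult_right_zero integral_exp_Ioc_lborel[OF le] times_divide_eq_right right_diff_distrib[of "exp (\<alpha> * x)"] ex'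
    using K c \<alpha>_pos W.drift_pos by (simp add: dl diff_divide_distrib)
  have "\<bar>exp (\<alpha> * c) * (W.discounted_renewal (x - c) - W.discounted_limit (x - c))\<bar> \<le> exp (\<alpha> * K) * (C * exp (- r * (x - K)))"
  proof -
    have "\<alpha> * c \<le> \<alpha> * K" using c \<alpha>_pos by (intro mult_left_mono) auto
    moreover have "r * (x - K) \<le> r * \<bar>x - c\<bar>" using c r by (intro mult_left_mono) auto
    then have "C * exp (- r * \<bar>x - c\<bar>) \<le> C * exp (- r * (x - K))" using C by (intro mult_left_mono) auto
    from order_trans[OF rate this]
    have "\<bar>W.discounted_renewal (x - c) - W.discounted_limit (x - c)\<bar> \<le> C * exp (- r * (x - K))" .
    ultimately show ?thesis unfolding abs_mult by (intro mult_mono) auto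
  qed
  moreover have "\<bar>exp (- \<alpha> * K) * (W.discounted_renewal (x + K) - W.discounted_limit (x + K))\<bar> \<le> exp (\<alpha> * K) * (C * exp (- r * (x - K)))"
  proof -
    have "- \<alpha> * K \<le> \<alpha> * K" using K \<alpha>_pos by simp
    moreover have "r * (x - K) \<le> r * \<bar>x + K\<bar>" using K r by (intro mult_left_mono) auto
    then have "C * exp (- r * \<bar>x + K\<bar>) \<le> C * exp (- r * (x - K))" using C by (intro mult_left_mono) auto
    from order_trans[OF rate this]
    have "\<bar>W.discounted_renewal (x + K) - W.discounted_limit (x + K)\<bar> \<le> C * exp (- r * (x - K))" .
    ultimately show ?thesis unfolding abs_mult by (intro mult_mono) auto
  qed
  ultimately show ?thesis unfolding 1 2 by (simp add: algebra_simps)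
qed

text \<open>For fixed \<omega> the tail event restricted to the window is the indicator of an
  interval in y. Fubini thus reduces integrals of arbitrary, possibly discontinuous, tail functions
  to interval masses controlled uniformly in \<omega>.\<close>

lemma
  fixes \<nu> :: "real measure"
  assumes [measurable]: "V \<in> borel_measurable M" and sf: "sigma_finite_measure \<nu>" and [measurable_cong]: "sets \<nu> = sets borel"
    and fin: "\<And>a b. emeasure \<nu> {a<..b} < \<infinity>" and K: "K \<ge> 0"
  shows window_integrable: "integrable \<nu> (\<lambda>y. exp (\<alpha> * (x - y)) * prob {\<omega> \<in> space M. V \<omega> > exp (x - y)} * indicator {x - K<..x + K} y)"
    and window_integral: "(\<integral>y. exp (\<alpha> * (x - y)) * prob {\<omega> \<in> space M. V \<omega> > exp (x - y)} * indicator {x - K<..x + K} y \<partial>\<nu>)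
      = (\<integral>\<omega>. (\<integral>y. exp (\<alpha> * (x - y)) * indicator {x - clamp_ln K (V \<omega>)<..x + K} y \<partial>\<nu>) \<partial>M)"
    and window_inner_integrable: "integrable M (\<lambda>\<omega>. \<integral>y. exp (\<alpha> * (x - y)) * indicator {x - clamp_ln K (V \<omega>)<..x + K} y \<partial>\<nu>)"
proof -
  let ?f = "\<lambda>\<omega> y. exp (\<alpha> * (x - y)) * indicator {x - clamp_ln K (V \<omega>)<..x + K} y"
  let ?h = "\<lambda>y. exp (\<alpha> * K) * indicator {x - K<..x + K} y"
  interpret P: pair_sigma_finite M \<nu>
    by (intro pair_sigma_finite.intro sf sigma_finite_measure_axioms)
  have hi: "integrable \<nu> ?h"
    using fin[of "x - K" "x + K"] by (intro integrable_mult_right integrable_real_indicator) auto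
  have ex: "exp (\<alpha> * (x - y)) \<le> exp (\<alpha> * K)" if "y \<in> {x - K<..x + K}" for y
    using that \<alpha>_pos by (auto intro!: mult_left_mono)
  have "(\<lambda>(\<omega>, y). exp (\<alpha> * (x - y)) * (if x - clamp_ln K (V \<omega>) < y \<and> y \<le> x + K then 1 else 0)) \<in> borel_measurable (M \<Otimes>\<^sub>M \<nu>)"
    by measurable
  then have fm: "(\<lambda>(\<omega>, y). ?f \<omega> y) \<in> borel_measurable (M \<Otimes>\<^sub>M \<nu>)"
    by (simp add: indicator_def of_bool_def)
  have fb: "norm (?f \<omega> y) \<le> 1 * ?h y" for \<omega> y
    using clamp_ln_bounds[OF K, of "V \<omega>"] ex[of y] by (auto simp: indicator_def)
  have oi: "integrable M (\<lambda>\<omega>. 1::real)" by simp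
  note F = Fubini_product_bound[OF sigma_finite_measure_axioms sf fm oi hi fb]
  have inner: "(\<integral>\<omega>. ?f \<omega> y \<partial>M) = exp (\<alpha> * (x - y)) * prob {\<omega> \<in> space M. V \<omega> > exp (x - y)} * indicator {x - K<..x + K} y" for y
  proof (cases "y \<in> {x - K<..x + K}")
    case True
    then have "- K \<le> x - y" "x - y < K" by auto
    then have "x - clamp_ln K (V \<omega>) < y \<longleftrightarrow> V \<omega> > exp (x - y)" for \<omega>
      using less_clamp_ln[of K "x - y" "V \<omega>"] by linarith
    then have "(\<integral>\<omega>. ?f \<omega> y \<partial>M) = (\<integral>\<omega>. exp (\<alpha> * (x - y)) * of_bool (V \<omega> > exp (x - y)) \<partial>M)"
      using True by (intro Bochner_Integration.integral_cong) (auto simp: indicator_def)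
    also have "\<dots> = exp (\<alpha> * (x - y)) * prob {\<omega> \<in> space M. V \<omega> > exp (x - y)}"
      by (simp add: integral_of_bool)
    finally show ?thesis using True by simp
  next
    case False
    then have "?f \<omega> y = 0" for \<omega> using clamp_ln_bounds[OF K, of "V \<omega>"] by (auto simp: indicator_def)
    then show ?thesis using False by simp
  qed
  show "(\<integral>y. exp (\<alpha> * (x - y)) * prob {\<omega> \<in> space M. V \<omega> > exp (x - y)} * indicator {x - K<..x + K} y \<partial>\<nu>)
      = (\<integral>\<omega>. (\<integral>y. ?f \<omega> y \<partial>\<nu>) \<partial>M)"
    using F(2) unfolding inner .
  show "integrable M (\<lambda>\<omega>. \<integral>y. ?f \<omega> y \<partial>\<nu>)" using P.integrable_fst[OF F(1)] by simp
  show "integrable \<nu> (\<lambda>y. exp (\<alpha> * (x - y)) * prob {\<omega> \<in> space M. V \<omega> > exp (x - y)} * indicator {x - K<..x + K} y)"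
    using P.integrable_snd[OF F(1)] unfolding inner .
qed

lemma window_discrepancy:
  assumes V: "V \<in> borel_measurable M"
    and rate: "\<And>s. \<bar>W.discounted_renewal s - W.discounted_limit s\<bar> \<le> C * exp (- r * \<bar>s\<bar>)"
    and r: "r > 0" and C: "C > 0" and K: "0 \<le> K" "K \<le> x"
  defines "G \<equiv> (\<lambda>y. exp (\<alpha> * (x - y)) * prob {\<omega> \<in> space M. V \<omega> > exp (x - y)} * indicator {x - K<..x + K} y)"
  shows "\<bar>(\<integral>y. G y \<partial>HH) - (\<integral>y. G y \<partial>lborel) / W.drift\<bar> \<le> 2 * C * exp (\<alpha> * K) * exp (- r * (x - K))"
proof -
  let ?J = "\<lambda>\<nu> \<omega>. \<integral>y. exp (\<alpha> * (x - y)) * indicator {x - clamp_ln K (V \<omega>)<..x + K} y \<partial>\<nu>"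
  have HH: "sigma_finite_measure HH" "sets HH = sets borel" "\<And>a b. emeasure HH {a<..b} < \<infinity>"
    using W.H.sigma_finite_measure_axioms W.finite_H_Ioc by auto
  have lb: "sigma_finite_measure lborel" "sets lborel = sets (borel :: real measure)" "\<And>a b :: real. emeasure lborel {a<..b} < \<infinity>"
  proof -
    show "emeasure lborel {a<..b} < \<infinity>" for a b :: real by (cases "a \<le> b") auto
  qed (auto simp: sigma_finite_lborel)
  note i1 = window_inner_integrable[OF V HH K(1), of x] and i2 = window_inner_integrable[OF V lb K(1), of x]
  have eq: "(\<integral>y. G y \<partial>HH) - (\<integral>y. G y \<partial>lborel) / W.drift = (\<integral>\<omega>. ?J HH \<omega> - ?J lborel \<omega> / W.drift \<partial>M)"
    unfolding G_def window_integral[OF V HH K(1)] window_integral[OF V lb K(1)]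
      Bochner_Integration.integral_diff[OF i1 integrable_divide_zero[OF i2]] integral_divide_zero ..
  have "\<bar>(\<integral>y. G y \<partial>HH) - (\<integral>y. G y \<partial>lborel) / W.drift\<bar> \<le> (\<integral>\<omega>. \<bar>?J HH \<omega> - ?J lborel \<omega> / W.drift\<bar> \<partial>M)"
    unfolding eq by (rule integral_abs_bound)
  also have "\<dots> \<le> (\<integral>\<omega>. 2 * C * exp (\<alpha> * K) * exp (- r * (x - K)) \<partial>M)"
  proof (rule integral_mono)
    show "integrable M (\<lambda>\<omega>. \<bar>?J HH \<omega> - ?J lborel \<omega> / W.drift\<bar>)"
      by (rule integrable_abs[OF Bochner_Integration.integrable_diff[OF i1 integrable_divide_zero[OF i2]]])
    show "\<bar>?J HH \<omega> - ?J lborel \<omega> / W.drift\<bar> \<le> 2 * C * exp (\<alpha> * K) * exp (- r * (x - K))" for \<omega>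
      using interval_discrepancy[OF rate r C K] clamp_ln_bounds[OF K(1), of "V \<omega>"] by blast
  qed simp
  finally show ?thesis by (simp add: prob_space)
qed

section \<open>The increment outside a window\<close>

definition mean_abs_incr :: "real \<Rightarrow> real" where "mean_abs_incr z = exp (\<alpha> * z) * (\<integral>\<omega>. \<bar>incr z \<omega>\<bar> \<partial>M)"

lemma mean_abs_incr_measurable [measurable]: "mean_abs_incr \<in> borel_measurable borel"
proof -
  have "(\<lambda>(z, \<omega>). \<bar>incr z \<omega>\<bar>) \<in> borel_measurable (borel \<Otimes>\<^sub>M M)" by measurable
  then have "(\<lambda>z. \<integral>\<omega>. \<bar>incr z \<omega>\<bar> \<partial>M) \<in> borel_measurable borel"
    by (rule sigma_finite_measure.borel_measurable_lebesgue_integral[OF sigma_finite_measure_axioms])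
  then show ?thesis unfolding mean_abs_incr_def[abs_def] by (intro borel_measurable_times) simp
qed

lemma mean_abs_incr_nonneg: "mean_abs_incr z \<ge> 0"
  by (simp add: mean_abs_incr_def)

lemma abs_mean_incr_le: "\<bar>mean_incr z\<bar> \<le> mean_abs_incr z"
  unfolding mean_incr_def mean_abs_incr_def abs_mult abs_exp_cancel by (intro mult_left_mono integral_abs_bound) simp

lemma mean_abs_incr_le: "mean_abs_incr z \<le> 2 * exp (\<alpha> * z)"
proof -
  have "(\<integral>\<omega>. \<bar>incr z \<omega>\<bar> \<partial>M) \<le> (\<integral>\<omega>. 2 \<partial>M)"
    by (rule integral_mono) (auto simp: abs_incr_le integrable_incr)
  then show ?thesis by (simp add: mean_abs_incr_def prob_space)
qed

text \<open>D, c and z0 do not depend on K, which is what later allows K to be chosen large before x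
  tends to infinity. Half of the exponent \<epsilon> gives decay in K, the other half keeps the
  convolution bounded; the band around ln B is handled by \<open>near_B_convolution\<close>.\<close>

lemma mean_abs_incr_tail:
  fixes \<nu> :: "real measure"
  assumes sf: "sigma_finite_measure \<nu>" and sb [measurable_cong]: "sets \<nu> = sets borel"
    and unit: "\<And>a b. a \<le> b \<Longrightarrow> b \<le> a + 3 \<Longrightarrow> emeasure \<nu> {a<..b} \<le> ennreal (C' * ((b - a) + exp (- r * \<bar>a\<bar>)))"
    and r: "r > 0" and C': "C' \<ge> 0"
    and exp_abs: "\<And>\<epsilon>. \<epsilon> > 0 \<Longrightarrow> \<exists>C. \<forall>x. (\<integral>\<^sup>+y. ennreal (exp (- \<epsilon> * \<bar>x - y\<bar>)) \<partial>\<nu>) \<le> ennreal C"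
  shows "\<exists>D c z0. D > 0 \<and> c > 0 \<and> (\<forall>K\<ge>2. \<forall>x\<ge>z0. (\<integral>\<^sup>+y. ennreal (mean_abs_incr (x - y)) * indicator (- {-K..<K}) (x - y) \<partial>\<nu>)
      \<le> ennreal (D * (exp (- c * K) + B_tail x + exp (- r * x))))"
proof -
  obtain C \<epsilon> \<delta> where C: "C > 0" and \<epsilon>: "0 < \<epsilon>" and \<delta>: "0 < \<delta>" "\<delta> < \<alpha>"
    and bound: "\<And>z. exp (\<alpha> * z) * (\<integral>\<omega>. \<bar>incr z \<omega>\<bar> \<partial>M) \<le> C * exp (- \<epsilon> * \<bar>z\<bar>) + 2 * exp (\<alpha> * z) * near_B \<delta> z"
    using increment_bound by metis
  obtain Ce where Ce: "\<And>x. (\<integral>\<^sup>+y. ennreal (exp (- (\<epsilon> / 2) * \<bar>x - y\<bar>)) \<partial>\<nu>) \<le> ennreal Ce"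
    using exp_abs[of "\<epsilon> / 2"] \<epsilon> by auto
  obtain Cw z0 where Cw: "Cw > 0" "\<And>x. x \<ge> z0 \<Longrightarrow> window r x \<le> ennreal (Cw * (B_tail x + exp (- r * x)))"
    using window_bound[OF r] by metis
  have "0 < \<alpha> - \<delta> / 2" "\<alpha> - \<delta> / 2 < \<alpha>" using \<delta> by auto
  from moment_pos_finite[OF this] obtain m where m: "m \<ge> 0" "(\<integral>\<^sup>+\<omega>. ennreal (max (B \<omega>) 0 powr (\<alpha> - \<delta> / 2)) \<partial>M) = ennreal m"
    by (cases "\<integral>\<^sup>+\<omega>. ennreal (max (B \<omega>) 0 powr (\<alpha> - \<delta> / 2)) \<partial>M") auto
  \<comment> \<open>The slower of the two decay rates in K, from the exponential part and from the
    band around ln B.\<close>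
  define c where "c = min (\<epsilon> / 2) (\<delta> / 2)"
  have c: "c > 0" "c \<le> \<epsilon> / 2" "c \<le> \<delta> / 2" using \<epsilon> \<delta> by (auto simp: c_def)
  define E where "E = 2 * exp \<alpha> * C'"
  define D where "D = C * \<bar>Ce\<bar> + E * (3 * exp (\<delta> / 2)) * m + E * exp (2 * r) * Cw + 1"
  have E: "E \<ge> 0" using C' by (simp add: E_def)
  have D: "D > 0" using C E m Cw by (simp add: D_def add_nonneg_pos)
  have "(\<integral>\<^sup>+y. ennreal (mean_abs_incr (x - y)) * indicator (- {-K..<K}) (x - y) \<partial>\<nu>) \<le> ennreal (D * (exp (- c * K) + B_tail x + exp (- r * x)))"
    if K: "K \<ge> 2" and x: "x \<ge> z0" for K x
  proof -
    have nb: "near_B \<delta> z \<ge> 0" for z by (simp add: near_B_def)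
    have "(\<integral>\<^sup>+y. ennreal (mean_abs_incr (x - y)) * indicator (- {-K..<K}) (x - y) \<partial>\<nu>)
      \<le> (\<integral>\<^sup>+y. ennreal (C * exp (- (\<epsilon> / 2) * K)) * ennreal (exp (- (\<epsilon> / 2) * \<bar>x - y\<bar>))
        + ennreal (2 * exp (\<alpha> * (x - y)) * near_B \<delta> (x - y)) * indicator (- {-K..<K}) (x - y) \<partial>\<nu>)"
    proof (rule nn_integral_mono)
      fix y
      define z where "z = x - y"
      show "ennreal (mean_abs_incr (x - y)) * indicator (- {-K..<K}) (x - y) \<le> ennreal (C * exp (- (\<epsilon> / 2) * K)) * ennreal (exp (- (\<epsilon> / 2) * \<bar>x - y\<bar>))
        + ennreal (2 * exp (\<alpha> * (x - y)) * near_B \<delta> (x - y)) * indicator (- {-K..<K}) (x - y)"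
      proof (cases "x - y \<in> - {-K..<K}")
        case True
        then have "K \<le> \<bar>z\<bar>" by (auto simp: z_def)
        then have "\<epsilon> / 2 * K \<le> \<epsilon> / 2 * \<bar>z\<bar>" using \<epsilon> by (intro mult_left_mono) auto
        then have "exp (- \<epsilon> * \<bar>z\<bar>) \<le> exp (- (\<epsilon> / 2) * K) * exp (- (\<epsilon> / 2) * \<bar>z\<bar>)"
          by (simp add: field_simps flip: exp_add)
        then have "C * exp (- \<epsilon> * \<bar>z\<bar>) \<le> C * (exp (- (\<epsilon> / 2) * K) * exp (- (\<epsilon> / 2) * \<bar>z\<bar>))"
          using C by (intro mult_left_mono) auto
        then have "mean_abs_incr z \<le> C * (exp (- (\<epsilon> / 2) * K) * exp (- (\<epsilon> / 2) * \<bar>z\<bar>)) + 2 * exp (\<alpha> * z) * near_B \<delta> z"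
          using bound[of z] unfolding mean_abs_incr_def by linarith
        then have "ennreal (mean_abs_incr z) \<le> ennreal (C * (exp (- (\<epsilon> / 2) * K) * exp (- (\<epsilon> / 2) * \<bar>z\<bar>)) + 2 * exp (\<alpha> * z) * near_B \<delta> z)"
          by (rule ennreal_leI)
        also have "\<dots> = ennreal (C * exp (- (\<epsilon> / 2) * K)) * ennreal (exp (- (\<epsilon> / 2) * \<bar>z\<bar>)) + ennreal (2 * exp (\<alpha> * z) * near_B \<delta> z)"
          using C nb[of z] by (simp add: ennreal_plus ennreal_mult mult.assoc)
        finally show ?thesis using True by (simp add: z_def)
      qed simp
    qed
    also have "\<dots> = ennreal (C * exp (- (\<epsilon> / 2) * K)) * (\<integral>\<^sup>+y. ennreal (exp (- (\<epsilon> / 2) * \<bar>x - y\<bar>)) \<partial>\<nu>)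
        + (\<integral>\<^sup>+y. ennreal (2 * exp (\<alpha> * (x - y)) * near_B \<delta> (x - y)) * indicator (- {-K..<K}) (x - y) \<partial>\<nu>)"
      by (subst nn_integral_add) (simp_all add: nn_integral_cmult)
    also have "\<dots> \<le> ennreal (C * exp (- (\<epsilon> / 2) * K)) * ennreal Ce + ennreal E * (ennreal (3 * exp (- (\<delta> / 2) * (K - 1))) * ennreal m + ennreal (1 * exp (2 * r)) * window r x)"
      unfolding m(2)[symmetric] E_def
      by (intro add_mono mult_left_mono Ce near_B_convolution[OF sf sb r _ C' \<delta> K]) (use unit in auto)
    also have "\<dots> \<le> ennreal (C * exp (- c * K)) * ennreal \<bar>Ce\<bar> + ennreal E * (ennreal (3 * exp (\<delta> / 2) * exp (- c * K)) * ennreal m + ennreal (exp (2 * r)) * ennreal (Cw * (B_tail x + exp (- r * x))))"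
    proof -
      have cK: "c * K \<le> \<epsilon> / 2 * K" "c * K \<le> \<delta> / 2 * K" using c K by (intro mult_right_mono; simp)+
      have 1: "C * exp (- (\<epsilon> / 2) * K) \<le> C * exp (- c * K)"
        using C cK(1) by (intro mult_left_mono) auto
      have "exp (- (\<delta> / 2) * (K - 1)) = exp (\<delta> / 2) * exp (- (\<delta> / 2) * K)" unfolding exp_add[symmetric] by (simp add: field_simps)
      also have "\<dots> \<le> exp (\<delta> / 2) * exp (- c * K)" using cK(2) by (intro mult_left_mono) auto
      finally have 2: "3 * exp (- (\<delta> / 2) * (K - 1)) \<le> 3 * exp (\<delta> / 2) * exp (- c * K)" by simp
      show ?thesis
        unfolding mult_1_left by (intro add_mono mult_left_mono mult_right_mono mult_mono ennreal_leI 1 2 Cw x) auto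
    qed
    also have "\<dots> = ennreal (C * exp (- c * K) * \<bar>Ce\<bar> + E * (3 * exp (\<delta> / 2) * exp (- c * K) * m + exp (2 * r) * (Cw * (B_tail x + exp (- r * x)))))"
      using C E m Cw(1) B_tail_pos[of x] by (simp add: ennreal_plus ennreal_mult add_nonneg_nonneg less_imp_le del: ennreal_plus flip: ennreal_mult ennreal_plus)
    also have "\<dots> \<le> ennreal (D * (exp (- c * K) + B_tail x + exp (- r * x)))"
    proof (rule ennreal_leI)
      define p q where "p = exp (- c * K)" and "q = B_tail x + exp (- r * x)"
      have pq: "p \<ge> 0" "q \<ge> 0" using B_tail_pos[of x] by (auto simp: p_def q_def add_nonneg_nonneg less_imp_le)
      define a b where "a = C * \<bar>Ce\<bar> + E * (3 * exp (\<delta> / 2)) * m" and "b = E * exp (2 * r) * Cw"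
      have ab: "a \<ge> 0" "b \<ge> 0" using C E m Cw(1) by (auto simp: a_def b_def)
      have "C * p * \<bar>Ce\<bar> + E * (3 * exp (\<delta> / 2) * p * m + exp (2 * r) * (Cw * q)) = a * p + b * q"
        by (simp add: a_def b_def algebra_simps)
      also have "\<dots> \<le> (a + b + 1) * p + (a + b + 1) * q"
        using ab pq by (intro add_mono mult_right_mono) auto
      also have "\<dots> = D * (p + q)" by (simp add: D_def a_def b_def algebra_simps)
      finally show "C * exp (- c * K) * \<bar>Ce\<bar> + E * (3 * exp (\<delta> / 2) * exp (- c * K) * m + exp (2 * r) * (Cw * (B_tail x + exp (- r * x)))) \<le> D * (exp (- c * K) + B_tail x + exp (- r * x))"
        by (simp add: p_def q_def add.assoc)
    qed
    finally show ?thesis .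
  qed
  with D c(1) show ?thesis
    by (intro exI[of _ D] exI[of _ c] exI[of _ z0] conjI allI impI)
qed

text \<open>Lebesgue measure obeys the same interval bound as H, so the same estimate applies to it.
  Taking K = 2, r = 1 and x = \<open>z0\<close> makes the outside part finite, while inside the
  window the increment is bounded by a constant.\<close>

lemma mean_abs_incr_integrable: "integrable lborel mean_abs_incr"
  and mean_abs_incr_tail_lborel: "r > 0 \<Longrightarrow> \<exists>D c z0. D > 0 \<and> c > 0 \<and> (\<forall>K\<ge>2. \<forall>x\<ge>z0.
     (\<integral>\<^sup>+y. ennreal (mean_abs_incr (x - y)) * indicator (- {-K..<K}) (x - y) \<partial>lborel) \<le> ennreal (D * (exp (- c * K) + B_tail x + exp (- r * x))))"
proof -
  have unit: "emeasure lborel {a<..b} \<le> ennreal (1 * ((b - a) + exp (- r * \<bar>a\<bar>)))" if "a \<le> b" for a b r :: real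
    using that by (simp add: ennreal_leI)
  have tail: "\<exists>D c z0. D > 0 \<and> c > 0 \<and> (\<forall>K\<ge>2. \<forall>x\<ge>z0.
     (\<integral>\<^sup>+y. ennreal (mean_abs_incr (x - y)) * indicator (- {-K..<K}) (x - y) \<partial>lborel) \<le> ennreal (D * (exp (- c * K) + B_tail x + exp (- r * x))))"
    if r: "r > 0" for r
  proof -
    have ea: "\<exists>C. \<forall>x. (\<integral>\<^sup>+y. ennreal (exp (- \<epsilon> * \<bar>x - y\<bar>)) \<partial>lborel) \<le> ennreal C" if "\<epsilon> > 0" for \<epsilon>
      using nn_integral_exp_abs[OF that] by (metis order_refl)
    show ?thesis by (rule mean_abs_incr_tail[OF sigma_finite_lborel _ unit[of _ _ r] r zero_le_one ea]) auto
  qed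
  then show "r > 0 \<Longrightarrow> \<exists>D c z0. D > 0 \<and> c > 0 \<and> (\<forall>K\<ge>2. \<forall>x\<ge>z0.
     (\<integral>\<^sup>+y. ennreal (mean_abs_incr (x - y)) * indicator (- {-K..<K}) (x - y) \<partial>lborel) \<le> ennreal (D * (exp (- c * K) + B_tail x + exp (- r * x))))" .
  obtain D c z0 where D: "\<forall>K\<ge>2. \<forall>x\<ge>z0.
     (\<integral>\<^sup>+y. ennreal (mean_abs_incr (x - y)) * indicator (- {-K..<K}) (x - y) \<partial>lborel) \<le> ennreal (D * (exp (- c * K) + B_tail x + exp (- 1 * x)))"
    using tail[OF zero_less_one] by (elim exE conjE) (rule that)
  have "(\<integral>\<^sup>+z. ennreal (mean_abs_incr z) \<partial>lborel) = (\<integral>\<^sup>+y. ennreal (mean_abs_incr (z0 + -1 * y)) \<partial>lborel)"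
    by (subst nn_integral_real_affine[where c="-1" and t=z0]) auto
  also have "\<dots> \<le> (\<integral>\<^sup>+y. ennreal (mean_abs_incr (z0 - y)) * indicator (- {-2..<2}) (z0 - y) + ennreal (2 * exp (\<alpha> * 2)) * indicator {z0 - 2..z0 + 2} y \<partial>lborel)"
  proof (rule nn_integral_mono)
    fix y
    show "ennreal (mean_abs_incr (z0 + -1 * y)) \<le> ennreal (mean_abs_incr (z0 - y)) * indicator (- {-2..<2}) (z0 - y) + ennreal (2 * exp (\<alpha> * 2)) * indicator {z0 - 2..z0 + 2} y"
    proof (cases "z0 - y \<in> {-2..<2}")
      case True
      then have "mean_abs_incr (z0 - y) \<le> 2 * exp (\<alpha> * 2)"
        using \<alpha>_pos by (intro order_trans[OF mean_abs_incr_le]) auto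
      then show ?thesis using True by (auto simp: indicator_def intro: ennreal_leI)
    qed auto
  qed
  also have "\<dots> = (\<integral>\<^sup>+y. ennreal (mean_abs_incr (z0 - y)) * indicator (- {-2..<2}) (z0 - y) \<partial>lborel) + ennreal (2 * exp (\<alpha> * 2)) * 4"
    by (subst nn_integral_add) (simp_all add: nn_integral_cmult_indicator)
  also have "\<dots> < \<infinity>"
    using le_less_trans[OF D[rule_format, of 2 z0] ennreal_less_top] by (simp add: ennreal_mult_less_top)
  finally show "integrable lborel mean_abs_incr"
    by (intro integrableI_nonneg) (auto simp: mean_abs_incr_nonneg)
qed

lemma mean_abs_incr_tail_HH:
  obtains r C D c z0 where "r > 0" "C > 0" "D > 0" "c > 0"
    "\<And>s. \<bar>W.discounted_renewal s - W.discounted_limit s\<bar> \<le> C * exp (- r * \<bar>s\<bar>)"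
    "\<And>K x. K \<ge> 2 \<Longrightarrow> x \<ge> z0 \<Longrightarrow>
     (\<integral>\<^sup>+y. ennreal (mean_abs_incr (x - y)) * indicator (- {-K..<K}) (x - y) \<partial>HH) \<le> ennreal (D * (exp (- c * K) + B_tail x + exp (- r * x)))"
proof -
  obtain r C where r: "r > 0" and C: "C > 0" and rate: "\<And>s. \<bar>W.discounted_renewal s - W.discounted_limit s\<bar> \<le> C * exp (- r * \<bar>s\<bar>)"
    using W.discounted_renewal_rate by metis
  obtain C' where C': "C' > 0" "\<And>a b. a \<le> b \<Longrightarrow> b \<le> a + 3 \<Longrightarrow> measure HH {a<..b} \<le> C' * ((b - a) + exp (- r * \<bar>a\<bar>))"
    using W.measure_H_Ioc_bound[OF r C rate] by metis
  have unit: "emeasure HH {a<..b} \<le> ennreal (C' * ((b - a) + exp (- r * \<bar>a\<bar>)))" if "a \<le> b" "b \<le> a + 3" for a b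
    using C'(2)[OF that] W.finite_H_Ioc[of a b] by (subst emeasure_eq_ennreal_measure) (auto intro: ennreal_leI)
  have ea: "\<exists>C. \<forall>x. (\<integral>\<^sup>+y. ennreal (exp (- \<epsilon> * \<bar>x - y\<bar>)) \<partial>HH) \<le> ennreal C" if "\<epsilon> > 0" for \<epsilon>
    using W.nn_integral_exp_abs_H[OF that] by metis
  have "\<exists>D c z0. D > 0 \<and> c > 0 \<and> (\<forall>K\<ge>2. \<forall>x\<ge>z0.
     (\<integral>\<^sup>+y. ennreal (mean_abs_incr (x - y)) * indicator (- {-K..<K}) (x - y) \<partial>HH) \<le> ennreal (D * (exp (- c * K) + B_tail x + exp (- r * x))))"
    by (rule mean_abs_incr_tail[OF W.H.sigma_finite_measure_axioms _ unit r less_imp_le[OF C'(1)] ea]) auto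
  then obtain D c z0 where D: "D > 0" "c > 0" and bd: "\<forall>K\<ge>2. \<forall>x\<ge>z0.
     (\<integral>\<^sup>+y. ennreal (mean_abs_incr (x - y)) * indicator (- {-K..<K}) (x - y) \<partial>HH) \<le> ennreal (D * (exp (- c * K) + B_tail x + exp (- r * x)))"
    by (elim exE conjE) (rule that)
  show ?thesis by (rule that[OF r C D rate bd[rule_format]])
qed

lemma mean_incr_integrable: "integrable lborel mean_incr"
  by (rule Bochner_Integration.integrable_bound[OF mean_abs_incr_integrable]) (auto simp: abs_mean_incr_le mean_abs_incr_nonneg)

lemma
  shows mean_incr_integrable_reflect: "integrable lborel (\<lambda>y. mean_incr (x - y))"
    and mean_incr_integral_reflect: "(\<integral>y. mean_incr (x - y) \<partial>lborel) = (\<integral>z. mean_incr z \<partial>lborel)"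
proof -
  show "integrable lborel (\<lambda>y. mean_incr (x - y))"
    using lborel_integrable_real_affine[OF mean_incr_integrable, of "-1" x] by simp
  show "(\<integral>y. mean_incr (x - y) \<partial>lborel) = (\<integral>z. mean_incr z \<partial>lborel)"
    using lborel_integral_real_affine[of "-1" mean_incr x] by simp
qed

text \<open>The mean increment is a difference of the three tails of R, A R and B, and the interval
  estimate costs 2 C for each of them.\<close>

lemma mean_incr_window_discrepancy:
  assumes rate: "\<And>s. \<bar>W.discounted_renewal s - W.discounted_limit s\<bar> \<le> C * exp (- r * \<bar>s\<bar>)"
    and r: "r > 0" and C: "C > 0" and K: "0 \<le> K" "K \<le> x"
  shows "\<bar>(\<integral>y. mean_incr (x - y) * indicator {x - K<..x + K} y \<partial>HH) - (\<integral>y. mean_incr (x - y) * indicator {x - K<..x + K} y \<partial>lborel) / W.drift\<bar>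
    \<le> 6 * C * exp (\<alpha> * K) * exp (- r * (x - K))"
proof -
  define G where "G V y = exp (\<alpha> * (x - y)) * prob {\<omega> \<in> space M. V \<omega> > exp (x - y)} * indicator {x - K<..x + K} y" for V y
  have V: "R \<in> borel_measurable M" "(\<lambda>\<omega>. A \<omega> * R \<omega>) \<in> borel_measurable M" "B \<in> borel_measurable M" by measurable
  have eq: "mean_incr (x - y) * indicator {x - K<..x + K} y = G R y - G (\<lambda>\<omega>. A \<omega> * R \<omega>) y - G B y" for y
    unfolding mean_incr_eq R_tail_def AR_tail_def B_tail_def G_def by (simp only: left_diff_distrib)
  have HH: "sigma_finite_measure HH" "sets HH = sets borel" "\<And>a b. emeasure HH {a<..b} < \<infinity>"
    using W.H.sigma_finite_measure_axioms W.finite_H_Ioc by auto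
  have lb: "sigma_finite_measure lborel" "sets lborel = sets (borel :: real measure)" "\<And>a b :: real. emeasure lborel {a<..b} < \<infinity>"
  proof -
    show "emeasure lborel {a<..b} < \<infinity>" for a b :: real by (cases "a \<le> b") auto
  qed (auto simp: sigma_finite_lborel)
  have split: "(\<integral>y. mean_incr (x - y) * indicator {x - K<..x + K} y \<partial>\<nu>) = (\<integral>y. G R y \<partial>\<nu>) - (\<integral>y. G (\<lambda>\<omega>. A \<omega> * R \<omega>) y \<partial>\<nu>) - (\<integral>y. G B y \<partial>\<nu>)"
    if \<nu>: "sigma_finite_measure \<nu>" "sets \<nu> = sets borel" "\<And>a b. emeasure \<nu> {a<..b} < \<infinity>" for \<nu>
  proof -
    have i: "integrable \<nu> (G V)" if "V \<in> borel_measurable M" for V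
      using window_integrable[OF that \<nu> K(1)] unfolding G_def[abs_def] .
    show ?thesis unfolding eq
      by (simp only: Bochner_Integration.integral_diff Bochner_Integration.integrable_diff i[OF V(1)] i[OF V(2)] i[OF V(3)])
  qed
  have b: "\<bar>(\<integral>y. G V y \<partial>HH) - (\<integral>y. G V y \<partial>lborel) / W.drift\<bar> \<le> 2 * C * exp (\<alpha> * K) * exp (- r * (x - K))"
    if "V \<in> borel_measurable M" for V
    unfolding G_def by (rule window_discrepancy[OF that rate r C K])
  show ?thesis
    using b[OF V(1)] b[OF V(2)] b[OF V(3)] unfolding split[OF HH] split[OF lb] diff_divide_distrib by linarith
qed

text \<open>The half-open conventions match: x - y in [-K, K) is the same as y in (x - K, x + K]. So
  full integral minus window integral is exactly the outside part bounded before.\<close>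

lemma mean_incr_window_remainder:
  fixes \<nu> :: "real measure"
  assumes [measurable_cong]: "sets \<nu> = sets borel" and i: "integrable \<nu> (\<lambda>y. mean_incr (x - y))"
    and b: "(\<integral>\<^sup>+y. ennreal (mean_abs_incr (x - y)) * indicator (- {-K..<K}) (x - y) \<partial>\<nu>) \<le> ennreal T" and T: "T \<ge> 0"
  shows "\<bar>(\<integral>y. mean_incr (x - y) \<partial>\<nu>) - (\<integral>y. mean_incr (x - y) * indicator {x - K<..x + K} y \<partial>\<nu>)\<bar> \<le> T"
proof -
  have iw: "integrable \<nu> (\<lambda>y. mean_incr (x - y) * indicator {x - K<..x + K} y)"
    by (rule integrable_real_mult_indicator[OF _ i]) measurable
  have "ennreal \<bar>(\<integral>y. mean_incr (x - y) - mean_incr (x - y) * indicator {x - K<..x + K} y \<partial>\<nu>)\<bar> \<le> (\<integral>\<^sup>+y. ennreal (norm (mean_incr (x - y) - mean_incr (x - y) * indicator {x - K<..x + K} y)) \<partial>\<nu>)"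
    using integral_norm_bound_ennreal[OF Bochner_Integration.integrable_diff[OF i iw]] by simp
  also have "\<dots> \<le> (\<integral>\<^sup>+y. ennreal (mean_abs_incr (x - y)) * indicator (- {-K..<K}) (x - y) \<partial>\<nu>)"
    by (rule nn_integral_mono) (auto simp: indicator_def abs_mean_incr_le ennreal_leI)
  also note b
  finally have "\<bar>(\<integral>y. mean_incr (x - y) - mean_incr (x - y) * indicator {x - K<..x + K} y \<partial>\<nu>)\<bar> \<le> T"
    using T by (simp add: ennreal_le_iff)
  then show ?thesis by (simp only: Bochner_Integration.integral_diff[OF i iw])
qed

text \<open>Compare H with Lebesgue measure over the drift inside the window, and discard the
  outside for both measures. The coefficient D of the tail of B depends neither on K nor on e, so
  the remaining errors can be made small afterwards.\<close>

lemma mean_incr_renewal: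
  obtains D where "D \<ge> 0"
    "\<And>e. e > 0 \<Longrightarrow> \<forall>\<^sub>F x in at_top. \<bar>(\<integral>y. mean_incr (x - y) \<partial>HH) - (\<integral>z. mean_incr z \<partial>lborel) / W.drift\<bar> \<le> D * B_tail x + e"
proof -
  let ?d = "W.drift"
  note d = W.drift_pos
  obtain r C D1 c1 z1 where r: "r > 0" and C: "C > 0" and D1: "D1 > 0" "c1 > 0"
    and rate: "\<And>s. \<bar>W.discounted_renewal s - W.discounted_limit s\<bar> \<le> C * exp (- r * \<bar>s\<bar>)"
    and t1: "\<And>K x. K \<ge> 2 \<Longrightarrow> x \<ge> z1 \<Longrightarrow>
     (\<integral>\<^sup>+y. ennreal (mean_abs_incr (x - y)) * indicator (- {-K..<K}) (x - y) \<partial>HH) \<le> ennreal (D1 * (exp (- c1 * K) + B_tail x + exp (- r * x)))"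
    by (fact mean_abs_incr_tail_HH)
  obtain D2 c2 z2 where D2: "D2 > 0" "c2 > 0"
    and t2: "\<forall>K\<ge>2. \<forall>x\<ge>z2. (\<integral>\<^sup>+y. ennreal (mean_abs_incr (x - y)) * indicator (- {-K..<K}) (x - y) \<partial>lborel) \<le> ennreal (D2 * (exp (- c2 * K) + B_tail x + exp (- r * x)))"
    using mean_abs_incr_tail_lborel[OF r] by (elim exE conjE) (rule that)
  define D where "D = D1 + D2 / ?d"
  have D: "D \<ge> 0" using D1 D2 d by (simp add: D_def)
  have main: "\<bar>(\<integral>y. mean_incr (x - y) \<partial>HH) - (\<integral>z. mean_incr z \<partial>lborel) / ?d\<bar>
    \<le> D * B_tail x + (D1 * exp (- c1 * K) + D2 * exp (- c2 * K) / ?d) + (D * exp (- r * x) + 6 * C * exp (\<alpha> * K) * exp (- r * (x - K)))"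
    if K: "K \<ge> 2" and x: "x \<ge> K" "x \<ge> z1" "x \<ge> z2" for K x
  proof -
    let ?w = "\<lambda>\<nu>. \<integral>y. mean_incr (x - y) * indicator {x - K<..x + K} y \<partial>\<nu>"
    have p: "0 \<le> D1 * (exp (- c1 * K) + B_tail x + exp (- r * x))" "0 \<le> D2 * (exp (- c2 * K) + B_tail x + exp (- r * x))"
      using D1 D2 B_tail_pos[of x] by (auto intro!: mult_nonneg_nonneg add_nonneg_nonneg less_imp_le)
    have 1: "\<bar>(\<integral>y. mean_incr (x - y) \<partial>HH) - ?w HH\<bar> \<le> D1 * (exp (- c1 * K) + B_tail x + exp (- r * x))"
      by (rule mean_incr_window_remainder[OF _ integrable_mean_incr_HH t1[OF K x(2)] p(1)]) simp
    have "\<bar>(\<integral>y. mean_incr (x - y) \<partial>lborel) - ?w lborel\<bar> \<le> D2 * (exp (- c2 * K) + B_tail x + exp (- r * x))"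
      by (rule mean_incr_window_remainder[OF _ mean_incr_integrable_reflect t2[rule_format, OF K x(3)] p(2)]) simp
    then have "\<bar>(\<integral>z. mean_incr z \<partial>lborel) - ?w lborel\<bar> / ?d \<le> D2 * (exp (- c2 * K) + B_tail x + exp (- r * x)) / ?d"
      unfolding mean_incr_integral_reflect using d by (intro divide_right_mono) auto
    then have 2: "\<bar>(\<integral>z. mean_incr z \<partial>lborel) / ?d - ?w lborel / ?d\<bar> \<le> D2 * (exp (- c2 * K) + B_tail x + exp (- r * x)) / ?d"
      using d by (simp flip: diff_divide_distrib)
    have 3: "\<bar>?w HH - ?w lborel / ?d\<bar> \<le> 6 * C * exp (\<alpha> * K) * exp (- r * (x - K))"
      using K x by (intro mean_incr_window_discrepancy[OF rate r C]) auto
    have "\<bar>(\<integral>y. mean_incr (x - y) \<partial>HH) - (\<integral>z. mean_incr z \<partial>lborel) / ?d\<bar>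
      \<le> D1 * (exp (- c1 * K) + B_tail x + exp (- r * x)) + D2 * (exp (- c2 * K) + B_tail x + exp (- r * x)) / ?d + 6 * C * exp (\<alpha> * K) * exp (- r * (x - K))"
      using 1 2 3 by linarith
    also have "\<dots> = D * B_tail x + (D1 * exp (- c1 * K) + D2 * exp (- c2 * K) / ?d) + (D * exp (- r * x) + 6 * C * exp (\<alpha> * K) * exp (- r * (x - K)))"
      by (simp add: D_def ring_distribs add_divide_distrib)
    finally show ?thesis .
  qed
  have "\<forall>\<^sub>F x in at_top. \<bar>(\<integral>y. mean_incr (x - y) \<partial>HH) - (\<integral>z. mean_incr z \<partial>lborel) / ?d\<bar> \<le> D * B_tail x + e" if e: "e > 0" for e
  proof -
    have "((\<lambda>K. D1 * exp (- c1 * K) + D2 * exp (- c2 * K) / ?d) \<longlongrightarrow> 0) at_top"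
    proof (rule tendsto_add_zero)
      show "((\<lambda>K. D1 * exp (- c1 * K)) \<longlongrightarrow> 0) at_top" using D1 by real_asymp
      show "((\<lambda>K. D2 * exp (- c2 * K) / ?d) \<longlongrightarrow> 0) at_top"
        by (rule tendsto_divide_zero) (use D2 in real_asymp)
    qed
    then have "\<forall>\<^sub>F K in at_top. D1 * exp (- c1 * K) + D2 * exp (- c2 * K) / ?d < e / 2"
      using e by (intro order_tendstoD(2)) auto
    then have "\<forall>\<^sub>F K in at_top. D1 * exp (- c1 * K) + D2 * exp (- c2 * K) / ?d < e / 2 \<and> K \<ge> 2"
      using eventually_ge_at_top[of 2] by eventually_elim simp
    \<comment> \<open>K is fixed here, depending on e only. The discrepancy inside the window
      contains a factor growing exponentially in K and vanishes only as x tends to infinity with K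
      fixed.\<close>
    then obtain K where K: "D1 * exp (- c1 * K) + D2 * exp (- c2 * K) / ?d < e / 2" "K \<ge> 2"
      using eventually_happens'[OF trivial_limit_at_top_linorder] by blast
    have "((\<lambda>x. D * exp (- r * x) + 6 * C * exp (\<alpha> * K) * exp (- r * (x - K))) \<longlongrightarrow> 0) at_top"
      using r by real_asymp
    then have "\<forall>\<^sub>F x in at_top. D * exp (- r * x) + 6 * C * exp (\<alpha> * K) * exp (- r * (x - K)) < e / 2"
      using e by (intro order_tendstoD(2)) auto
    then show ?thesis
      using eventually_ge_at_top[of "max K (max z1 z2)"]
    proof eventually_elim
      case (elim x)
      then have "K \<le> x" "z1 \<le> x" "z2 \<le> x" by auto
      from main[OF K(2) this] elim(1) K(1) show ?case by linarith
    qed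
  qed
  then show ?thesis by (rule that[OF D])
qed

section \<open>The constant term\<close>

abbreviation "excess \<omega> \<equiv> max (A \<omega> * R \<omega> + B \<omega>) 0 powr \<alpha> - max (A \<omega> * R \<omega>) 0 powr \<alpha> - max (B \<omega>) 0 powr \<alpha>"

text \<open>E B_+^\<alpha> is infinite in the theorem, so integrability cannot be obtained term by
  term. It follows from absolute integrability of the increment over z and \<omega> jointly, whose
  integral over z alone is the difference of powers divided by \<alpha>.\<close>

lemma excess_integrable: "integrable M excess"
  and mean_incr_integral: "(\<integral>z. mean_incr z \<partial>lborel) = (\<integral>\<omega>. excess \<omega> \<partial>M) / \<alpha>"
proof -
  let ?F = "\<lambda>z \<omega>. exp (\<alpha> * z) * incr z \<omega>"
  interpret P: pair_sigma_finite lborel M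
    by (intro pair_sigma_finite.intro sigma_finite_lborel sigma_finite_measure_axioms)
  have Fm: "case_prod ?F \<in> borel_measurable (lborel \<Otimes>\<^sub>M M)"
  proof -
    have "(\<lambda>p. exp (\<alpha> * fst p) * (case p of (z, \<omega>) \<Rightarrow> incr z \<omega>)) \<in> borel_measurable (borel \<Otimes>\<^sub>M M)" by measurable
    then show ?thesis by (simp add: case_prod_beta')
  qed
  have Fi: "integrable (lborel \<Otimes>\<^sub>M M) (case_prod ?F)"
  proof (rule P.Fubini_integrable[OF Fm])
    show "integrable lborel (\<lambda>z. \<integral>\<omega>. norm (case_prod ?F (z, \<omega>)) \<partial>M)"
      using mean_abs_incr_integrable by (simp add: abs_mult mean_abs_incr_def[abs_def])
    show "AE z in lborel. integrable M (\<lambda>\<omega>. case_prod ?F (z, \<omega>))"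
      by (simp add: integrable_incr)
  qed
  have inner: "(\<integral>z. ?F z \<omega> \<partial>lborel) = excess \<omega> / \<alpha>" for \<omega>
  proof -
    have e: "?F z \<omega> = exp (\<alpha> * z) * of_bool (A \<omega> * R \<omega> + B \<omega> > exp z) - exp (\<alpha> * z) * of_bool (A \<omega> * R \<omega> > exp z) - exp (\<alpha> * z) * of_bool (B \<omega> > exp z)" for z
      by (simp add: incr_def right_diff_distrib)
    show ?thesis unfolding e
      by (simp only: Bochner_Integration.integral_diff Bochner_Integration.integrable_diff
          integrable_exp_below[OF \<alpha>_pos] integral_exp_below[OF \<alpha>_pos] diff_divide_distrib)
  qed
  have "integrable M (\<lambda>\<omega>. \<integral>z. ?F z \<omega> \<partial>lborel)"
    using P.integrable_snd[OF Fi] .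
  then have "integrable M (\<lambda>\<omega>. \<alpha> * (excess \<omega> / \<alpha>))" unfolding inner by (rule integrable_mult_right)
  then show "integrable M excess" using \<alpha>_pos by simp
  have "(\<integral>z. mean_incr z \<partial>lborel) = (\<integral>z. \<integral>\<omega>. ?F z \<omega> \<partial>M \<partial>lborel)"
    by (simp add: mean_incr_def)
  also have "\<dots> = (\<integral>\<omega>. \<integral>z. ?F z \<omega> \<partial>lborel \<partial>M)"
    by (rule P.Fubini_integral[OF Fi, symmetric])
  finally show "(\<integral>z. mean_incr z \<partial>lborel) = (\<integral>\<omega>. excess \<omega> \<partial>M) / \<alpha>"
    unfolding inner integral_divide_zero .
qed

lemma R_tail_expansion:
  obtains D where "D \<ge> 0"
    "\<And>e. e > 0 \<Longrightarrow> \<forall>\<^sub>F x in at_top. \<bar>R_tail x - clipped_moment x / (\<alpha> * W.drift) - (\<integral>\<omega>. excess \<omega> \<partial>M) / (\<alpha> * W.drift)\<bar> \<le> D * B_tail x + e"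
proof -
  obtain D1 where D1: "D1 \<ge> 0"
    "\<And>e. e > 0 \<Longrightarrow> \<forall>\<^sub>F x in at_top. \<bar>(\<integral>y. mean_incr (x - y) \<partial>HH) - (\<integral>z. mean_incr z \<partial>lborel) / W.drift\<bar> \<le> D1 * B_tail x + e"
    by (fact mean_incr_renewal)
  obtain r C where r: "r > 0" and C: "C > 0" and rate: "\<And>s. \<bar>W.discounted_renewal s - W.discounted_limit s\<bar> \<le> C * exp (- r * \<bar>s\<bar>)"
    using W.discounted_renewal_rate by metis
  obtain D2 z0 where D2: "D2 > 0"
    "\<And>x. x \<ge> z0 \<Longrightarrow> \<bar>(\<integral>y. B_tail (x - y) \<partial>HH) - clipped_moment x / (\<alpha> * W.drift)\<bar> \<le> D2 * (B_tail x + exp (- r * x))"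
    by (fact B_tail_convolution[OF r C rate])
  have "\<forall>\<^sub>F x in at_top. \<bar>R_tail x - clipped_moment x / (\<alpha> * W.drift) - (\<integral>\<omega>. excess \<omega> \<partial>M) / (\<alpha> * W.drift)\<bar> \<le> (D1 + D2) * B_tail x + e"
    if e: "e > 0" for e
  proof -
    have "((\<lambda>x. D2 * exp (- r * x)) \<longlongrightarrow> 0) at_top" using r by real_asymp
    then have "\<forall>\<^sub>F x in at_top. D2 * exp (- r * x) < e / 2"
      using e by (intro order_tendstoD(2)) auto
    moreover have "\<forall>\<^sub>F x in at_top. \<bar>(\<integral>y. mean_incr (x - y) \<partial>HH) - (\<integral>z. mean_incr z \<partial>lborel) / W.drift\<bar> \<le> D1 * B_tail x + e / 2"
      using e by (intro D1) auto
    ultimately show ?thesis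
      using eventually_ge_at_top[of z0]
    proof eventually_elim
      case (elim x)
      have "(\<integral>z. mean_incr z \<partial>lborel) / W.drift = (\<integral>\<omega>. excess \<omega> \<partial>M) / (\<alpha> * W.drift)"
        by (simp add: mean_incr_integral)
      moreover have "D2 * (B_tail x + exp (- r * x)) = D2 * B_tail x + D2 * exp (- r * x)" "(D1 + D2) * B_tail x = D1 * B_tail x + D2 * B_tail x"
        by (simp_all add: ring_distribs)
      ultimately show ?case using elim(1,2) D2(2)[OF elim(3)] R_tail_decomposition[of x] by linarith
    qed
  qed
  then show ?thesis using D1(1) D2(1) by (intro that[of "D1 + D2"]) auto
qed

end

section \<open>The expansion\<close>

text \<open>Z lives on its own probability space; this replaces its law by the image of the tilted
  measure on M, where moments of Z become moments of A.\<close>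

lemma tilted_law_eq:
  assumes [measurable]: "A \<in> borel_measurable M" and i: "integrable M (\<lambda>\<omega>. A \<omega> powr \<alpha>)"
    and N: "prob_space N" and [measurable]: "Z \<in> borel_measurable N"
    and law: "\<And>E. E \<in> sets borel \<Longrightarrow> measure N {z \<in> space N. Z z \<in> E} =
        (\<integral>\<omega>. A \<omega> powr \<alpha> * indicator {\<omega>. A \<omega> > 0 \<and> ln (A \<omega>) \<in> E} \<omega> \<partial>M)"
  shows "distr N borel Z = distr (density M (\<lambda>\<omega>. ennreal (A \<omega> powr \<alpha> * indicator {0<..} (A \<omega>)))) borel (\<lambda>\<omega>. ln (A \<omega>))"
proof (rule measure_eqI)
  interpret N: prob_space N by (rule N)
  fix E :: "real set" assume "E \<in> sets (distr N borel Z)"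
  then have E [measurable]: "E \<in> sets borel" by simp
  have iE: "integrable M (\<lambda>\<omega>. A \<omega> powr \<alpha> * indicator {\<omega>. A \<omega> > 0 \<and> ln (A \<omega>) \<in> E} \<omega>)"
  proof (rule Bochner_Integration.integrable_bound[OF i])
    have "(\<lambda>\<omega>. A \<omega> powr \<alpha> * (if A \<omega> > 0 \<and> ln (A \<omega>) \<in> E then 1 else 0)) \<in> borel_measurable M" by measurable
    then show "(\<lambda>\<omega>. A \<omega> powr \<alpha> * indicator {\<omega>. A \<omega> > 0 \<and> ln (A \<omega>) \<in> E} \<omega>) \<in> borel_measurable M"
      by (simp add: indicator_def of_bool_def)
  qed (auto simp: indicator_def)
  have "emeasure (distr N borel Z) E = emeasure N {z \<in> space N. Z z \<in> E}"
    by (subst emeasure_distr) (auto intro!: arg_cong[where f="emeasure N"])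
  also have "\<dots> = ennreal (\<integral>\<omega>. A \<omega> powr \<alpha> * indicator {\<omega>. A \<omega> > 0 \<and> ln (A \<omega>) \<in> E} \<omega> \<partial>M)"
    unfolding N.emeasure_eq_measure law[OF E] ..
  also have "\<dots> = (\<integral>\<^sup>+\<omega>. ennreal (A \<omega> powr \<alpha> * indicator {\<omega>. A \<omega> > 0 \<and> ln (A \<omega>) \<in> E} \<omega>) \<partial>M)"
    by (rule nn_integral_eq_integral[symmetric, OF iE]) auto
  also have "\<dots> = (\<integral>\<^sup>+\<omega>. ennreal (A \<omega> powr \<alpha> * indicator {0<..} (A \<omega>)) * indicator ((\<lambda>\<omega>. ln (A \<omega>)) -` E \<inter> space M) \<omega> \<partial>M)"
    by (intro nn_integral_cong) (auto simp: indicator_def)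
  also have "\<dots> = emeasure (distr (density M (\<lambda>\<omega>. ennreal (A \<omega> powr \<alpha> * indicator {0<..} (A \<omega>)))) borel (\<lambda>\<omega>. ln (A \<omega>))) E"
    by (simp add: emeasure_distr emeasure_density)
  finally show "emeasure (distr N borel Z) E = emeasure (distr (density M (\<lambda>\<omega>. ennreal (A \<omega> powr \<alpha> * indicator {0<..} (A \<omega>)))) borel (\<lambda>\<omega>. ln (A \<omega>))) E" .
qed simp

lemma nn_integral_tilted_law:
  assumes [measurable]: "A \<in> borel_measurable M" "h \<in> borel_measurable borel"
  shows "(\<integral>\<^sup>+z. h z \<partial>distr (density M (\<lambda>\<omega>. ennreal (A \<omega> powr \<alpha> * indicator {0<..} (A \<omega>)))) borel (\<lambda>\<omega>. ln (A \<omega>)))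
    = (\<integral>\<^sup>+\<omega>. ennreal (A \<omega> powr \<alpha>) * indicator {0<..} (A \<omega>) * h (ln (A \<omega>)) \<partial>M)"
proof -
  have "(\<integral>\<^sup>+z. h z \<partial>distr (density M (\<lambda>\<omega>. ennreal (A \<omega> powr \<alpha> * indicator {0<..} (A \<omega>)))) borel (\<lambda>\<omega>. ln (A \<omega>)))
    = (\<integral>\<^sup>+\<omega>. ennreal (A \<omega> powr \<alpha> * indicator {0<..} (A \<omega>)) * h (ln (A \<omega>)) \<partial>M)"
    by (simp add: nn_integral_distr nn_integral_density)
  then show ?thesis by (simp add: ennreal_mult ennreal_indicator)
qed

lemma integral_tilted_law:
  assumes [measurable]: "A \<in> borel_measurable M" and A: "AE \<omega> in M. A \<omega> \<ge> 0"
  shows "(\<integral>z. z \<partial>distr (density M (\<lambda>\<omega>. ennreal (A \<omega> powr \<alpha> * indicator {0<..} (A \<omega>)))) borel (\<lambda>\<omega>. ln (A \<omega>)))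
    = (\<integral>\<omega>. A \<omega> powr \<alpha> * ln (A \<omega>) \<partial>M)"
proof -
  have "(\<integral>z. z \<partial>distr (density M (\<lambda>\<omega>. ennreal (A \<omega> powr \<alpha> * indicator {0<..} (A \<omega>)))) borel (\<lambda>\<omega>. ln (A \<omega>)))
    = (\<integral>\<omega>. ln (A \<omega>) \<partial>density M (\<lambda>\<omega>. ennreal (A \<omega> powr \<alpha> * indicator {0<..} (A \<omega>))))"
    by (rule integral_distr) auto
  also have "\<dots> = (\<integral>\<omega>. (A \<omega> powr \<alpha> * indicator {0<..} (A \<omega>)) *\<^sub>R ln (A \<omega>) \<partial>M)"
    by (rule integral_density) auto
  \<comment> \<open>At A = 0 both integrands vanish because \<open>0 powr \<alpha>\<close> is 0;
    this is the convention 0^\<alpha> log 0 = 0.\<close>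
  also have "\<dots> = (\<integral>\<omega>. A \<omega> powr \<alpha> * ln (A \<omega>) \<partial>M)"
    by (rule integral_cong_AE) (measurable, use A in eventually_elim, auto simp: indicator_def)
  finally show ?thesis .
qed

text \<open>A finite limit superior lies below some natural number, which gives one power bound
  valid for all small h and uniformly in the location a.\<close>

lemma concentration_bound:
  fixes p :: "real \<Rightarrow> real \<Rightarrow> real"
  assumes "Limsup (at_right 0) (\<lambda>h. SUP a::real. ereal (h powr (- \<beta>) * p a h)) < \<infinity>"
  obtains C h0 where "C > 0" "h0 > 0" "\<And>h a. 0 < h \<Longrightarrow> h < h0 \<Longrightarrow> p a h \<le> C * h powr \<beta>"
proof -
  obtain n :: nat where n: "Limsup (at_right 0) (\<lambda>h. SUP a::real. ereal (h powr (- \<beta>) * p a h)) < ereal (real n)"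
    using assms less_PInf_Ex_of_nat by auto
  then have "\<forall>\<^sub>F h in at_right 0. (SUP a::real. ereal (h powr (- \<beta>) * p a h)) < ereal (real n)"
    by (rule Limsup_lessD)
  then obtain h0 where h0: "h0 > 0" "\<And>h. 0 < h \<Longrightarrow> h < h0 \<Longrightarrow> (SUP a::real. ereal (h powr (- \<beta>) * p a h)) < ereal (real n)"
    by (auto simp: eventually_at_right_field)
  \<comment> \<open>The natural number n may be 0; n + 1 guarantees a positive constant.\<close>
  have "p a h \<le> (real n + 1) * h powr \<beta>" if h: "0 < h" "h < h0" for h a
  proof -
    have "ereal (h powr (- \<beta>) * p a h) < ereal (real n)"
      by (rule le_less_trans[OF SUP_upper[OF UNIV_I] h0(2)[OF h]])
    then have "h powr \<beta> * (h powr (- \<beta>) * p a h) \<le> h powr \<beta> * (real n + 1)"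
      by (intro mult_left_mono) auto
    moreover have "h powr \<beta> * h powr (- \<beta>) = 1" using h by (simp flip: powr_add)
    ultimately show ?thesis by (simp add: mult.commute flip: mult.assoc)
  qed
  then show ?thesis using that[of "real n + 1" h0] h0(1) by simp
qed

theorem theorem4p4:
  fixes M :: "'a measure" and A B R :: "'a \<Rightarrow> real"
    and N :: "'b measure" and Z :: "'b \<Rightarrow> real"
    and \<alpha> \<beta> \<gamma> \<rho> :: real and L Lt :: "real \<Rightarrow> real"
  assumes M: "prob_space M"
    and AB: "A \<in> borel_measurable M" "B \<in> borel_measurable M"
    and alpha: "\<alpha> > 0"
    and A_nonneg: "AE \<omega> in M. A \<omega> \<ge> 0"
    and A_nonarith: "\<not> arithmetic_law (cond_log_law M A)"
    and A_alpha: "integrable M (\<lambda>\<omega>. A \<omega> powr \<alpha>)" "(\<integral>\<omega>. A \<omega> powr \<alpha> \<partial>M) = 1"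
    and rho_finite: "integrable M (\<lambda>\<omega>. A \<omega> powr \<alpha> * ln (A \<omega>))"
    and rho: "\<rho> = (\<integral>\<omega>. A \<omega> powr \<alpha> * ln (A \<omega>) \<partial>M)"
    and L: "L = (\<lambda>x. x powr \<alpha> * measure M {\<omega> \<in> space M. B \<omega> > x})"
    and L_sv: "slowly_varying L"
    and B_pos: "(\<integral>\<^sup>+\<omega>. ennreal (max (B \<omega>) 0 powr \<alpha>) \<partial>M) = \<infinity>"
    and B_neg: "\<And>\<epsilon>. 0 < \<epsilon> \<Longrightarrow> \<epsilon> < \<alpha> \<Longrightarrow>
        (\<integral>\<^sup>+\<omega>. ennreal (max (- B \<omega>) 0 powr (\<alpha> - \<epsilon>)) \<partial>M) < \<infinity>"
    and beta: "\<beta> > 0"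
    and A_conc: "Limsup (at_right 0) (\<lambda>h. SUP a::real. ereal (h powr (- \<beta>) *
        measure M {\<omega> \<in> space M. A \<omega> > 0 \<and> a < ln (A \<omega>) \<and> ln (A \<omega>) \<le> a + h})) < \<infinity>"
    and gamma: "\<gamma> > \<alpha> + \<alpha>\<^sup>2 / \<beta>" "integrable M (\<lambda>\<omega>. A \<omega> powr \<gamma>)"
    and Z: "prob_space N" "Z \<in> borel_measurable N"
    and Z_law: "\<And>E. E \<in> sets borel \<Longrightarrow> measure N {z \<in> space N. Z z \<in> E} =
        (\<integral>\<omega>. A \<omega> powr \<alpha> * indicator {\<omega>. A \<omega> > 0 \<and> ln (A \<omega>) \<in> E} \<omega> \<partial>M)"
    and Z_snl: "strongly_non_lattice (distr N borel Z)"
    and R: "perpetuity_solution M A B R"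
    and Lt: "Lt = (\<lambda>x. LBINT t:{0<..<x}. L t / t)"
  shows "integrable M (\<lambda>\<omega>. max (A \<omega> * R \<omega> + B \<omega>) 0 powr \<alpha>
            - max (A \<omega> * R \<omega>) 0 powr \<alpha> - max (B \<omega>) 0 powr \<alpha>) \<and>
         (\<exists>u v. u \<in> O[at_top](L) \<and> v \<in> o[at_top](\<lambda>_. 1 :: real) \<and>
           (\<forall>\<^sub>F x in at_top. x powr \<alpha> * measure M {\<omega> \<in> space M. R \<omega> > x} =
              Lt x / \<rho>
              + (\<integral>\<omega>. max (A \<omega> * R \<omega> + B \<omega>) 0 powr \<alpha>
                   - max (A \<omega> * R \<omega>) 0 powr \<alpha> - max (B \<omega>) 0 powr \<alpha> \<partial>M) / (\<alpha> * \<rho>)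
              + u x + v x))"
proof -
  define \<mu> where "\<mu> = distr N borel Z"
  define \<theta> where "\<theta> = \<gamma> - \<alpha>"
  interpret M: prob_space M by (rule M)
  note [measurable] = AB
  have \<theta>: "\<theta> > 0" using gamma(1) alpha beta by (simp add: \<theta>_def) (smt (verit) divide_nonneg_pos zero_le_power2)
  have \<mu>_eq: "\<mu> = distr (density M (\<lambda>\<omega>. ennreal (A \<omega> powr \<alpha> * indicator {0<..} (A \<omega>)))) borel (\<lambda>\<omega>. ln (A \<omega>))"
    unfolding \<mu>_def by (rule tilted_law_eq[OF AB(1) A_alpha(1) Z Z_law])
  have \<mu>_law: "(\<integral>\<^sup>+z. h z \<partial>\<mu>) = (\<integral>\<^sup>+\<omega>. ennreal (A \<omega> powr \<alpha>) * indicator {0<..} (A \<omega>) * h (ln (A \<omega>)) \<partial>M)"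
    if "h \<in> borel_measurable borel" for h
    unfolding \<mu>_eq by (rule nn_integral_tilted_law[OF AB(1) that])
  have neg: "(\<integral>\<^sup>+z. ennreal (exp (- \<alpha> * z)) \<partial>\<mu>) \<le> 1"
  proof -
    have "(\<integral>\<^sup>+z. ennreal (exp (- \<alpha> * z)) \<partial>\<mu>) = (\<integral>\<^sup>+\<omega>. ennreal (A \<omega> powr \<alpha>) * indicator {0<..} (A \<omega>) * ennreal (exp (- \<alpha> * ln (A \<omega>))) \<partial>M)"
      by (rule \<mu>_law) simp
    also have "\<dots> \<le> (\<integral>\<^sup>+\<omega>. 1 \<partial>M)"
      by (intro nn_integral_mono) (auto simp: indicator_def powr_def simp flip: ennreal_mult exp_add)
    finally show ?thesis by (simp add: M.emeasure_space_1)
  qed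
  have pos: "(\<integral>\<^sup>+z. ennreal (exp (\<theta> * z)) \<partial>\<mu>) < \<infinity>"
  proof -
    have "(\<integral>\<^sup>+z. ennreal (exp (\<theta> * z)) \<partial>\<mu>) = (\<integral>\<^sup>+\<omega>. ennreal (A \<omega> powr \<alpha>) * indicator {0<..} (A \<omega>) * ennreal (exp (\<theta> * ln (A \<omega>))) \<partial>M)"
      by (rule \<mu>_law) simp
    also have "\<dots> \<le> (\<integral>\<^sup>+\<omega>. ennreal (A \<omega> powr \<gamma>) \<partial>M)"
      by (intro nn_integral_mono) (auto simp: indicator_def powr_def \<theta>_def algebra_simps simp flip: ennreal_mult exp_add)
    also have "\<dots> < \<infinity>" using integrableD(2)[OF gamma(2)] by (simp add: less_top)
    finally show ?thesis .
  qed
  interpret W: tilted_walk \<mu> \<alpha> \<theta>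
  proof -
    interpret prob_space \<mu> unfolding \<mu>_def by (rule prob_space.prob_space_distr[OF Z])
    have s [measurable_cong]: "sets \<mu> = sets borel" by (simp add: \<mu>_def)
    have i: "integrable \<mu> (\<lambda>z. exp (- \<alpha> * z))"
      using neg by (intro integrableI_nonneg) (auto simp: le_less_trans[OF _ ennreal_one_less_top])
    have "ennreal (\<integral>z. exp (- \<alpha> * z) \<partial>\<mu>) \<le> 1"
      using neg nn_integral_eq_integral[OF i] by simp
    then have "(\<integral>z. exp (- \<alpha> * z) \<partial>\<mu>) \<le> 1" by (simp add: ennreal_le_1)
    moreover have "integrable \<mu> (\<lambda>z. exp (\<theta> * z))"
      using pos by (intro integrableI_nonneg) auto
    ultimately show "tilted_walk \<mu> \<alpha> \<theta>"
      using s i alpha \<theta> Z_snl by unfold_locales (auto simp: \<mu>_def)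
  qed
  have drift: "W.drift = \<rho>"
  proof -
    have "W.drift = (\<integral>z. z \<partial>\<mu>)" by (rule W.drift_def)
    then show ?thesis unfolding rho \<mu>_eq integral_tilted_law[OF AB(1) A_nonneg] .
  qed
  obtain Cb h0 where Cb: "Cb > 0" and h0: "h0 > 0"
    and conc: "\<And>h a. 0 < h \<Longrightarrow> h < h0 \<Longrightarrow> measure M {\<omega> \<in> space M. A \<omega> > 0 \<and> a < ln (A \<omega>) \<and> ln (A \<omega>) \<le> a + h} \<le> Cb * h powr \<beta>"
    by (fact concentration_bound[OF A_conc])
  interpret perpetuity_tail M A B R \<alpha> \<mu> \<theta> \<beta> Cb h0
  proof unfold_locales
    show "perpetuity_solution M A B R" by (rule R)
    show "slowly_varying (\<lambda>x. x powr \<alpha> * M.prob {\<omega> \<in> space M. x < B \<omega>})" using L_sv unfolding L .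
    show "(\<integral>\<^sup>+\<omega>. ennreal (\<bar>A \<omega>\<bar> powr (\<alpha> + \<theta>)) \<partial>M) < \<infinity>"
    proof -
      have "(\<integral>\<^sup>+\<omega>. ennreal (\<bar>A \<omega>\<bar> powr (\<alpha> + \<theta>)) \<partial>M) = (\<integral>\<^sup>+\<omega>. ennreal (A \<omega> powr \<gamma>) \<partial>M)"
        by (rule nn_integral_cong_AE) (use A_nonneg in eventually_elim, simp add: \<theta>_def)
      also have "\<dots> < \<infinity>" using integrableD(2)[OF gamma(2)] by (simp add: less_top)
      finally show ?thesis .
    qed
    show "(\<integral>\<^sup>+\<omega>. ennreal (max (- B \<omega>) 0 powr k) \<partial>M) < \<infinity>" if "0 < k" "k < \<alpha>" for k
      using B_neg[of "\<alpha> - k"] that by simp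
  qed (fact AB alpha A_nonneg \<mu>_law beta Cb h0 conc)+
  define err where "err x = x powr \<alpha> * measure M {\<omega> \<in> space M. R \<omega> > x} - Lt x / \<rho> - (\<integral>\<omega>. excess \<omega> \<partial>M) / (\<alpha> * \<rho>)" for x
  have Lx: "L x = B_tail (ln x)" if "x > 0" for x using B_tail_eq[OF that] by (simp add: L)
  have err_eq: "err x = R_tail (ln x) - clipped_moment (ln x) / (\<alpha> * W.drift) - (\<integral>\<omega>. excess \<omega> \<partial>M) / (\<alpha> * W.drift)" if x: "x > 0" for x
  proof -
    have "x powr \<alpha> * measure M {\<omega> \<in> space M. R \<omega> > x} = R_tail (ln x)"
      using x by (simp add: R_tail_def powr_def)
    moreover have "clipped_moment (ln x) = \<alpha> * Lt x"
      unfolding clipped_moment_eq Lt L using x by simp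
    ultimately show ?thesis using alpha by (simp add: err_def drift)
  qed
  obtain D where D: "D \<ge> 0"
    "\<And>e. e > 0 \<Longrightarrow> \<forall>\<^sub>F x in at_top. \<bar>R_tail x - clipped_moment x / (\<alpha> * W.drift) - (\<integral>\<omega>. excess \<omega> \<partial>M) / (\<alpha> * W.drift)\<bar> \<le> D * B_tail x + e"
    by (fact R_tail_expansion)
  have err_le: "\<forall>\<^sub>F x in at_top. \<bar>err x\<bar> \<le> D * L x + e \<and> L x \<ge> 0" if e: "e > 0" for e
    using eventually_compose_filterlim[OF D(2)[OF e] ln_at_top] eventually_gt_at_top[of 0]
    by eventually_elim (simp add: err_eq Lx B_tail_pos less_imp_le)
  \<comment> \<open>The estimate |\<open>err\<close>| <= D L + e holds eventually for each e, but
    the two remainders must be single functions. Clamping the error to [-D L, D L] gives the part of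
    order L; the overshoot is then eventually at most e for every e > 0.\<close>
  define u where "u x = max (- (D * L x)) (min (D * L x) (err x))" for x
  define v where "v x = err x - u x" for x
  have "u \<in> O(L)"
  proof (rule bigoI)
    show "\<forall>\<^sub>F x in at_top. norm (u x) \<le> D * norm (L x)"
      using err_le[OF zero_less_one]
    proof eventually_elim
      case (elim x)
      then have "D * L x \<ge> 0" using D(1) by simp
      then show ?case using elim by (auto simp: u_def)
    qed
  qed
  moreover have "v \<in> o(\<lambda>_. 1 :: real)"
  proof (rule landau_o.smallI)
    fix e :: real assume "e > 0"
    from err_le[OF this] show "\<forall>\<^sub>F x in at_top. norm (v x) \<le> e * norm (1 :: real)"
    proof eventually_elim
      case (elim x)
      then have "D * L x \<ge> 0" using D(1) by simp
      then show ?case using elim \<open>e > 0\<close> by (auto simp: v_def u_def max_def min_def)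
    qed
  qed
  moreover have "\<forall>\<^sub>F x in at_top. x powr \<alpha> * measure M {\<omega> \<in> space M. R \<omega> > x} = Lt x / \<rho> + (\<integral>\<omega>. excess \<omega> \<partial>M) / (\<alpha> * \<rho>) + u x + v x"
    by (rule always_eventually) (simp add: v_def err_def)
  ultimately show ?thesis using excess_integrable by blast
qed

end
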